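(* Let $\mu$ be a non-zero (complex) pluriharmonic measure on $\mathrm{b}D$. Then $\widehat\beta$ is a pseudo-image measure of $\mu$ under $\pi$. In addition, if $(\mu_\xi)_{\xi\in\widehat{\mathrm{b}D}}$ is a disintegration of $\mu$ relative to $\widehat\beta$, then the following hold: (a) for $\widehat\beta$-almost every $\xi\in\widehat{\mathrm{b}D}$ and for every $z\in\mathbb{D}_\xi$, $$(\mathcal{P}\mu)(z)=\int_{\mathrm{b}D}\frac{1-|z|^2}{|\zeta-z|^2}\,\mathrm{d}\mu_\xi(\zeta);$$ (b) if $\mu$ is holomorphic, then $\mu_\xi$ is holomorphic (in particular, absolutely continuous with respect to $\beta_\xi$) for $\widehat\beta$-almost every $\xi\in\widehat{\mathrm{b}D}$.
   Context: Setting. $D\subseteq\mathbb{C}^n$ is a bounded symmetric domain (a bounded connected open set such that for every $z\in D$ there is a holomorphic involution of $D$ having $z$ as an isolated fixed point) which is convex and circular ($\alpha z\in D$ for all $z\in D$ and $\alpha\in\mathbb{T}$). Here $\mathbb{D}$ is the open unit disc in $\mathbb{C}$ and $\mathbb{T}=\partial\mathbb{D}$, with normalized Haar measure $\beta_{\mathbb{T}}$. $\mathrm{b}D$ is the Silov boundary of $D$: the smallest closed subset of $\partial D$ such that $\sup_D|f|=\max_{\mathrm{b}D}|f|$ for every holomorphic $f$ on $D$ extending continuously to the closure $\overline{D}$. $K$ is the compact group of linear automorphisms of $D$; it acts transitively on $\mathrm{b}D$, and it is assumed that $K\subseteq U(n)$ and that $\mathrm{b}D$ is contained in the Euclidean unit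 sphere ($|\cdot|$ is the Euclidean norm on $\mathbb{C}^n$). $\beta$ is the unique $K$-invariant probability measure on $\mathrm{b}D$. Measures are complex Radon measures. Kernels. The Hardy space $H^2(D)$ is the space of holomorphic $f$ on $D$ with $\|f\|^2=\sup_{0\le\rho<1}\int_{\mathrm{b}D}|f(\rho\zeta)|^2\,\mathrm{d}\beta(\zeta)<\infty$; $\mathcal{C}$ is its reproducing kernel, which extends to a sesqui-holomorphic function on a neighbourhood of $D\times\overline{D}$. The Poisson–Szegő kernel is $\mathcal{P}(z,\zeta)=|\mathcal{C}(z,\zeta)|^2/\mathcal{C}(z,z)$ for $z\in D$, $\zeta\in\mathrm{b}D$, and $(\mathcal{P}\mu)(z)=\int_{\mathrm{b}D}\mathcal{P}(z,\zeta)\,\mathrm{d}\mu(\zeta)$. A measure $\mu$ on $\mathrm{b}D$ is pluriharmonic (resp. holomorphic) if the function $\mathcal{P}\mu$ is pluriharmonic, i.e. harmonic on the intersection of $D$ with every complex line (resp. holomorphic) on $D$. Quotient. $\widehat{\mathrm{b}D}$ is the quotient of $\mathrm{b}D$ by the action $(\alpha,\zeta)\mapsto\alpha\zeta$ of $\mathbb{T}$, $\pi\colon\mathrm{b}D\to\widehat{\mathrm{b}D}$ is the canonical projection, $\widehat\beta=\pi_*(\beta)$. For $\xi\in\widehat{\mathrm{b}D}$, $\mathbb{D}_\xi=\{w\zeta: w\in\mathbb{D},\ \zeta\in\pi^{-1}(\xi)\}$, and $\beta_\xi$ is the image of $\beta_{\mathbb{T}}$ under $\alpha\mapsto\alpha\zeta$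 (any $\zeta\in\pi^{-1}(\xi)$), viewed also as a measure on $\mathrm{b}D$. Fixing $\zeta\in\pi^{-1}(\xi)$, the map $w\mapsto w\zeta$ identifies $\mathbb{D}$ with $\mathbb{D}_\xi$ and $\mathbb{T}$ with $\pi^{-1}(\xi)$; a measure concentrated on $\pi^{-1}(\xi)$ is called holomorphic if, under this identification, its classical Poisson integral on $\mathbb{D}_\xi$ is holomorphic. Disintegration. For $X,Y$ locally compact spaces with countable base, complex Radon measures $\mu$ on $X$ and $\nu$ on $Y$, and a $\mu$-measurable $p\colon X\to Y$: $\nu$ is a pseudo-image measure (resp. weak pseudo-image measure) of $\mu$ under $p$ if a subset $N$ of $Y$ is $\nu$-negligible if and only if (resp. only if) $p^{-1}(N)$ is $\mu$-negligible. When $\nu$ is a weak pseudo-image measure, a disintegration of $\mu$ relative to $\nu$ is a family $(\mu_y)_{y\in Y}$ of complex Radon measures on $X$ such that: for $\nu$-almost every $y$, $\mu_y$ is concentrated on $p^{-1}(y)$; and for every $\mu$-integrable $f$, $f$ is $\mu_y$-integrable for $\nu$-almost every $y$, the map $y\mapsto\int_X f\,\mathrm{d}\mu_y$ is $\nu$-integrable, and $\int_X f\,\mathrm{d}\mu=\int_Y\int_X f\,\mathrm{d}\mu_y\,\mathrm{d}\nu(y)$. Here $X=\mathrm{b}D$, $Y=\widehat{\mathrm{b}D}$, $p=\pi$, $\nu=\widehat\beta$. *)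

theory Defs
  imports "HOL-Analysis.Analysis"
begin

section \<open>Functions of several complex variables\<close>

definition mholomorphic_on :: "(complex^'n \<Rightarrow> complex) \<Rightarrow> (complex^'n) set \<Rightarrow> bool" where
  "mholomorphic_on f D \<longleftrightarrow>
     (\<forall>z\<in>D. \<exists>f'. (f has_derivative f') (at z) \<and> (\<forall>c h. f' (c *s h) = c * f' h))"

definition sesquiholomorphic_on ::
  "(complex^'n \<Rightarrow> complex^'n \<Rightarrow> complex) \<Rightarrow> ((complex^'n) \<times> (complex^'n)) set \<Rightarrow> bool" where
  "sesquiholomorphic_on F U \<longleftrightarrow>
     (\<forall>p\<in>U. \<exists>A B. ((\<lambda>(z, w). F z w) has_derivative (\<lambda>(h, k). A h + B k)) (at p)
        \<and> (\<forall>c h. A (c *s h) = c * A h) \<and> (\<forall>c k. B (c *s k) = cnj c * B k))"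

text \<open>Harmonic: of class \<open>C\<^sup>2\<close> with vanishing Laplacian; \<open>u\<close> may be complex-valued.\<close>

definition harmonic_on :: "(complex \<Rightarrow> complex) \<Rightarrow> complex set \<Rightarrow> bool" where
  "harmonic_on u U \<longleftrightarrow>
     (\<exists>ux uy uxx uxy uyx uyy.
        continuous_on U uxx \<and> continuous_on U uxy \<and> continuous_on U uyx \<and> continuous_on U uyy \<and>
        (\<forall>w\<in>U. (u has_derivative (\<lambda>h. Re h *\<^sub>R ux w + Im h *\<^sub>R uy w)) (at w) \<and>
               (ux has_derivative (\<lambda>h. Re h *\<^sub>R uxx w + Im h *\<^sub>R uxy w)) (at w) \<and>
               (uy has_derivative (\<lambda>h. Re h *\<^sub>R uyx w + Im h *\<^sub>R uyy w)) (at w) \<and>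
               uxx w + uyy w = 0))"

definition pluriharmonic_on :: "(complex^'n \<Rightarrow> complex) \<Rightarrow> (complex^'n) set \<Rightarrow> bool" where
  "pluriharmonic_on f D \<longleftrightarrow>
     (\<forall>a v. v \<noteq> 0 \<longrightarrow> harmonic_on (\<lambda>w. f (a + w *s v)) {w. a + w *s v \<in> D})"


section \<open>Bounded symmetric domains\<close>

definition bounded_symmetric_domain :: "(complex^'n) set \<Rightarrow> bool" where
  "bounded_symmetric_domain D \<longleftrightarrow>
     open D \<and> connected D \<and> bounded D \<and> D \<noteq> {} \<and>
     (\<forall>z\<in>D. \<exists>s. (\<forall>i. mholomorphic_on (\<lambda>w. s w $ i) D) \<and> s ` D \<subseteq> D \<and> (\<forall>w\<in>D. s (s w) = w)
        \<and> z isolated_in {w\<in>D. s w = w})"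

definition circular :: "(complex^'n) set \<Rightarrow> bool" where
  "circular D \<longleftrightarrow> (\<forall>\<alpha> z. cmod \<alpha> = 1 \<longrightarrow> z \<in> D \<longrightarrow> \<alpha> *s z \<in> D)"

text \<open>The first formula says that \<open>\<bar>f\<bar>\<close> attains a maximum on \<open>B\<close>, equal to its supremum on \<open>D\<close>.\<close>

definition maximum_boundary :: "(complex^'n) set \<Rightarrow> (complex^'n) set \<Rightarrow> bool" where
  "maximum_boundary D B \<longleftrightarrow> closed B \<and> B \<subseteq> frontier D \<and>
     (\<forall>f. mholomorphic_on f D \<and> continuous_on (closure D) f \<longrightarrow>
        (\<exists>\<zeta>\<in>B. (\<forall>\<zeta>'\<in>B. cmod (f \<zeta>') \<le> cmod (f \<zeta>)) \<and> (SUP z\<in>D. cmod (f z)) = cmod (f \<zeta>)))"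

definition silov_boundary :: "(complex^'n) set \<Rightarrow> (complex^'n) set \<Rightarrow> bool" where
  "silov_boundary D B \<longleftrightarrow> maximum_boundary D B \<and> (\<forall>B'. maximum_boundary D B' \<longrightarrow> B \<subseteq> B')"

definition linear_automorphisms :: "(complex^'n) set \<Rightarrow> (complex^'n^'n) set" where
  "linear_automorphisms D = {A. invertible A \<and> (\<lambda>z. A *v z) ` D = D}"

definition unitary_matrix :: "complex^'n^'n \<Rightarrow> bool" where
  "unitary_matrix A \<longleftrightarrow> (\<chi> i j. cnj (A $ j $ i)) ** A = mat 1"

abbreviation borel_on :: "'a::topological_space set \<Rightarrow> 'a measure" where
  "borel_on S \<equiv> restrict_space borel S"

text \<open>Since the linear automorphism group acts transitively on the Silov boundary, there is exactly
  one measure with the following property.\<close>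

definition invariant_probability ::
  "(complex^'n) set \<Rightarrow> (complex^'n) set \<Rightarrow> (complex^'n) measure \<Rightarrow> bool" where
  "invariant_probability D bD \<beta> \<longleftrightarrow>
     space \<beta> = bD \<and> sets \<beta> = sets (borel_on bD) \<and> emeasure \<beta> bD = 1 \<and>
     (\<forall>A\<in>linear_automorphisms D. distr \<beta> \<beta> (\<lambda>\<zeta>. A *v \<zeta>) = \<beta>)"


section \<open>Complex measures\<close>

text \<open>On compact metrizable spaces (and on quotients of these by compact groups) complex Radon
  measures are the same as countably additive complex functions on the Borel sets. The values of
  \<open>\<mu>\<close> outside \<open>sets M\<close> are irrelevant.\<close>

definition complex_measure :: "'a measure \<Rightarrow> ('a set \<Rightarrow> complex) \<Rightarrow> bool" where
  "complex_measure M \<mu> \<longleftrightarrow> \<mu> {} = 0 \<and>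
     (\<forall>A::nat \<Rightarrow> 'a set. range A \<subseteq> sets M \<and> disjoint_family A \<longrightarrow> (\<lambda>i. \<mu> (A i)) sums \<mu> (\<Union>i. A i))"

definition variation :: "'a measure \<Rightarrow> ('a set \<Rightarrow> complex) \<Rightarrow> 'a measure" where
  "variation M \<mu> = measure_of (space M) (sets M)
     (\<lambda>E. SUP A\<in>{A::nat \<Rightarrow> 'a set. range A \<subseteq> sets M \<and> disjoint_family A \<and> (\<Union>i. A i) = E}.
        \<Sum>i. ennreal (cmod (\<mu> (A i))))"

text \<open>The unimodular density in the polar decomposition of \<open>\<mu>\<close> with respect to its variation. It
  exists, and is unique almost everywhere, by the Radon--Nikodym theorem.\<close>

definition polar_density :: "'a measure \<Rightarrow> ('a set \<Rightarrow> complex) \<Rightarrow> 'a \<Rightarrow> complex" where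
  "polar_density M \<mu> = (SOME h. h \<in> borel_measurable M \<and> (\<forall>x\<in>space M. cmod (h x) = 1) \<and>
     (\<forall>E\<in>sets M. \<mu> E = (LINT x:E|variation M \<mu>. h x)))"

text \<open>Completions are taken so that negligible means contained in a Borel null set, and so that
  every integrable function in the sense of Radon measures is covered.\<close>

definition cintegrable :: "'a measure \<Rightarrow> ('a set \<Rightarrow> complex) \<Rightarrow> ('a \<Rightarrow> complex) \<Rightarrow> bool" where
  "cintegrable M \<mu> f \<longleftrightarrow> integrable (completion (variation M \<mu>)) f"

definition cintegral :: "'a measure \<Rightarrow> ('a set \<Rightarrow> complex) \<Rightarrow> ('a \<Rightarrow> complex) \<Rightarrow> complex" where
  "cintegral M \<mu> f = (LINT x|completion (variation M \<mu>). f x * polar_density M \<mu> x)"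

definition cnegligible :: "'a measure \<Rightarrow> ('a set \<Rightarrow> complex) \<Rightarrow> 'a set \<Rightarrow> bool" where
  "cnegligible M \<mu> N \<longleftrightarrow> N \<in> null_sets (completion (variation M \<mu>))"

definition concentrated_on :: "'a measure \<Rightarrow> ('a set \<Rightarrow> complex) \<Rightarrow> 'a set \<Rightarrow> bool" where
  "concentrated_on M \<mu> S \<longleftrightarrow> cnegligible M \<mu> (space M - S)"


section \<open>Pseudo-image measures and disintegrations\<close>

text \<open>The base measure \<open>\<nu>\<close> is taken positive, which is the only case needed.\<close>

definition weak_pseudo_image ::
  "'a measure \<Rightarrow> ('a set \<Rightarrow> complex) \<Rightarrow> ('a \<Rightarrow> 'b) \<Rightarrow> 'b measure \<Rightarrow> bool" where
  "weak_pseudo_image M \<mu> p \<nu> \<longleftrightarrow> p \<in> measurable (completion (variation M \<mu>)) \<nu> \<and>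
     (\<forall>N\<subseteq>space \<nu>. N \<in> null_sets (completion \<nu>) \<longrightarrow> cnegligible M \<mu> (p -` N \<inter> space M))"

definition pseudo_image ::
  "'a measure \<Rightarrow> ('a set \<Rightarrow> complex) \<Rightarrow> ('a \<Rightarrow> 'b) \<Rightarrow> 'b measure \<Rightarrow> bool" where
  "pseudo_image M \<mu> p \<nu> \<longleftrightarrow> p \<in> measurable (completion (variation M \<mu>)) \<nu> \<and>
     (\<forall>N\<subseteq>space \<nu>. N \<in> null_sets (completion \<nu>) \<longleftrightarrow> cnegligible M \<mu> (p -` N \<inter> space M))"

definition disintegration ::
  "'a measure \<Rightarrow> ('a set \<Rightarrow> complex) \<Rightarrow> ('a \<Rightarrow> 'b) \<Rightarrow> 'b measure \<Rightarrow> ('b \<Rightarrow> 'a set \<Rightarrow> complex) \<Rightarrow> bool"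
  where
  "disintegration M \<mu> p \<nu> \<mu>y \<longleftrightarrow> weak_pseudo_image M \<mu> p \<nu> \<and>
     (\<forall>y\<in>space \<nu>. complex_measure M (\<mu>y y)) \<and>
     (AE y in \<nu>. concentrated_on M (\<mu>y y) (p -` {y})) \<and>
     (\<forall>f. cintegrable M \<mu> f \<longrightarrow>
        (AE y in \<nu>. cintegrable M (\<mu>y y) f) \<and>
        integrable (completion \<nu>) (\<lambda>y. cintegral M (\<mu>y y) f) \<and>
        cintegral M \<mu> f = (LINT y|completion \<nu>. cintegral M (\<mu>y y) f))"


section \<open>Hardy space and the Poisson--Szego kernel\<close>

definition hardy_sq :: "(complex^'n) measure \<Rightarrow> (complex^'n \<Rightarrow> complex) \<Rightarrow> ennreal" where
  "hardy_sq \<beta> f = (SUP \<rho>\<in>{0..<1::real}. \<integral>\<^sup>+\<zeta>. ennreal ((cmod (f (\<rho> *\<^sub>R \<zeta>)))\<^sup>2) \<partial>\<beta>)"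

definition hardy_space ::
  "(complex^'n) set \<Rightarrow> (complex^'n) measure \<Rightarrow> (complex^'n \<Rightarrow> complex) set" where
  "hardy_space D \<beta> = {f. mholomorphic_on f D \<and> hardy_sq \<beta> f < \<infinity>}"

text \<open>The scalar product (linear in the first variable) is recovered from the norm by polarization.\<close>

definition hardy_inner ::
  "(complex^'n) measure \<Rightarrow> (complex^'n \<Rightarrow> complex) \<Rightarrow> (complex^'n \<Rightarrow> complex) \<Rightarrow> complex" where
  "hardy_inner \<beta> f g =
     (\<Sum>k<4::nat. \<i> ^ k * complex_of_real (enn2real (hardy_sq \<beta> (\<lambda>z. f z + \<i> ^ k * g z)))) / 4"

text \<open>The first condition determines \<open>C\<close> on \<open>D \<times> D\<close>, and then the second one determines it on
  \<open>D \<times> closure D\<close> by continuity. Values elsewhere are never used.\<close>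

definition cauchy_szego_kernel ::
  "(complex^'n) set \<Rightarrow> (complex^'n) measure \<Rightarrow> (complex^'n \<Rightarrow> complex^'n \<Rightarrow> complex) \<Rightarrow> bool" where
  "cauchy_szego_kernel D \<beta> C \<longleftrightarrow>
     (\<forall>w\<in>D. (\<lambda>z. C z w) \<in> hardy_space D \<beta> \<and>
        (\<forall>f\<in>hardy_space D \<beta>. f w = hardy_inner \<beta> f (\<lambda>z. C z w))) \<and>
     (\<exists>U. open U \<and> D \<times> closure D \<subseteq> U \<and> sesquiholomorphic_on C U)"

definition poisson_szego ::
  "(complex^'n \<Rightarrow> complex^'n \<Rightarrow> complex) \<Rightarrow> complex^'n \<Rightarrow> complex^'n \<Rightarrow> complex" where
  "poisson_szego C z \<zeta> = complex_of_real ((cmod (C z \<zeta>))\<^sup>2) / C z z"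

definition poisson_integral ::
  "(complex^'n) set \<Rightarrow> (complex^'n \<Rightarrow> complex^'n \<Rightarrow> complex) \<Rightarrow> ((complex^'n) set \<Rightarrow> complex) \<Rightarrow>
   complex^'n \<Rightarrow> complex" where
  "poisson_integral bD C \<mu> z = cintegral (borel_on bD) \<mu> (poisson_szego C z)"

definition pluriharmonic_measure ::
  "(complex^'n) set \<Rightarrow> (complex^'n) set \<Rightarrow> (complex^'n \<Rightarrow> complex^'n \<Rightarrow> complex) \<Rightarrow>
   ((complex^'n) set \<Rightarrow> complex) \<Rightarrow> bool" where
  "pluriharmonic_measure D bD C \<mu> \<longleftrightarrow>
     complex_measure (borel_on bD) \<mu> \<and> pluriharmonic_on (poisson_integral bD C \<mu>) D"

definition holomorphic_measure ::
  "(complex^'n) set \<Rightarrow> (complex^'n) set \<Rightarrow> (complex^'n \<Rightarrow> complex^'n \<Rightarrow> complex) \<Rightarrow>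
   ((complex^'n) set \<Rightarrow> complex) \<Rightarrow> bool" where
  "holomorphic_measure D bD C \<mu> \<longleftrightarrow>
     complex_measure (borel_on bD) \<mu> \<and> mholomorphic_on (poisson_integral bD C \<mu>) D"


section \<open>The quotient of the Silov boundary by the circle group\<close>

text \<open>Points of the quotient are the orbits themselves, so that the fibre of the projection over
  \<open>\<xi>\<close> is \<open>\<xi>\<close>.\<close>

definition torbit :: "complex^'n \<Rightarrow> (complex^'n) set" where
  "torbit \<zeta> = {\<alpha> *s \<zeta> |\<alpha>. cmod \<alpha> = 1}"

text \<open>The generating sets are the open sets of the quotient topology.\<close>

definition quotient_borel :: "(complex^'n) set \<Rightarrow> (complex^'n) set measure" where
  "quotient_borel bD = sigma (torbit ` bD)
     {V. V \<subseteq> torbit ` bD \<and> openin (top_of_set bD) {\<zeta>\<in>bD. torbit \<zeta> \<in> V}}"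

definition quotient_measure ::
  "(complex^'n) set \<Rightarrow> (complex^'n) measure \<Rightarrow> (complex^'n) set measure" where
  "quotient_measure bD \<beta> = distr \<beta> (quotient_borel bD) torbit"

definition disc_over :: "(complex^'n) set \<Rightarrow> (complex^'n) set" where
  "disc_over \<xi> = {w *s \<zeta> |w \<zeta>. cmod w < 1 \<and> \<zeta> \<in> \<xi>}"

definition circle_haar :: "complex measure" where
  "circle_haar = distr (uniform_measure lborel {0..1}) (borel_on (sphere 0 1)) (\<lambda>t. cis (2 * pi * t))"

text \<open>The measure \<open>\<beta>\<^sub>\<xi>\<close>, where \<open>\<xi>\<close> is the orbit of \<open>\<zeta>\<close>.\<close>

definition orbit_haar :: "(complex^'n) set \<Rightarrow> complex^'n \<Rightarrow> (complex^'n) measure" where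
  "orbit_haar bD \<zeta> = distr circle_haar (borel_on bD) (\<lambda>\<alpha>. \<alpha> *s \<zeta>)"

definition disc_poisson :: "(complex set \<Rightarrow> complex) \<Rightarrow> complex \<Rightarrow> complex" where
  "disc_poisson \<nu> w = cintegral (borel_on (sphere 0 1)) \<nu>
     (\<lambda>\<alpha>. complex_of_real ((1 - (cmod w)\<^sup>2) / (cmod (\<alpha> - w))\<^sup>2))"

text \<open>A measure concentrated on the orbit \<open>\<xi>\<close> is transported to the circle by \<open>\<alpha> \<mapsto> \<alpha> \<zeta>\<close>; the
  choice of \<open>\<zeta> \<in> \<xi>\<close> does not matter.\<close>

definition fibre_holomorphic ::
  "(complex^'n) set \<Rightarrow> (complex^'n) set \<Rightarrow> ((complex^'n) set \<Rightarrow> complex) \<Rightarrow> bool" where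
  "fibre_holomorphic bD \<xi> \<nu> \<longleftrightarrow> concentrated_on (borel_on bD) \<nu> \<xi> \<and>
     (\<forall>\<zeta>\<in>\<xi>. disc_poisson (\<lambda>A. \<nu> ((\<lambda>\<alpha>. \<alpha> *s \<zeta>) ` A)) holomorphic_on ball 0 1)"

end

theory Submission
  imports Defs "HOL-Complex_Analysis.Complex_Analysis"
begin

text \<open>
  Let \<open>u\<close> be the Poisson--Szego integral of \<open>\<mu>\<close>. On each disc \<open>w \<mapsto> w \<zeta>\<close> the harmonic function \<open>u\<close> has
  Fourier coefficients \<open>c\<^sub>k(\<zeta>)\<close>, which are continuous and homogeneous in \<open>\<zeta>\<close>. Symmetry of the kernel
  and the approximate identity property show that \<open>\<mu>\<close> and \<open>c\<^sub>k \<beta>\<close> have the same integrals against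
  functions that are homogeneous of degree \<open>-k\<close>, also when these are restricted to a saturated set.
  Hence sets null for the image of \<open>\<beta>\<close> are null for that of \<open>\<mu>\<close>. Conversely, on a saturated \<open>\<mu>\<close>-null set
  all \<open>c\<^sub>k\<close> vanish almost everywhere; but pluriharmonicity makes \<open>c\<^sub>k\<close> or its conjugate a homogeneous
  element of the ball algebra, and if the zero set of such a function has positive measure then the
  product of enough of its translates under \<open>K\<close> is so small in mean square that it vanishes.
  Comparing homogeneous moments shows that almost every \<open>\<mu>\<^sub>\<xi>\<close> has the Fourier coefficients \<open>c\<^sub>k(\<zeta>)\<close>;
  this is (a), and (b) follows with the theorem of F. and M. Riesz.
\<close>

section \<open>Complex measures\<close>

text \<open>Homogeneous test functions are enough because their sums contain the real polynomials,
  so by Stone-Weierstrass a measure on \<open>bD\<close> whose homogeneous moments all vanish is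
  zero. The obstacle is the zero set of c_k: the modulus of c_k is constant on every orbit, so
  one-variable uniqueness theorems on slices say nothing about it. Translates help through a
  competition of two rates. If the zero set has measure m > 0, suitable N translates leave a common
  non-zero set of measure at most gamma^N with gamma = 1 - m/2, while the value of their product at
  radius r loses only the factor r^(kN), k being the degree; one picks r with r^(2k) > gamma and
  lets N grow in the L2 bound for point evaluations. On almost every fibre only countably many
  moments can be known simultaneously. Powers of the coordinates suffice, since every orbit avoids
  some coordinate hyperplane. A second care is due to completions: a negligible set of orbits must
  be enclosed in a Borel one before moments apply to it, and compactness of the circle makes this
  possible.\<close>

lemmas LINT_cong = Bochner_Integration.integral_cong[OF refl]

section \<open>The total variation of a complex measure\<close>

definition countable_partitions :: "'a measure \<Rightarrow> 'a set \<Rightarrow> (nat \<Rightarrow> 'a set) set" where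
  "countable_partitions M E = {A. range A \<subseteq> sets M \<and> disjoint_family A \<and> (\<Union>i. A i) = E}"

definition total_variation :: "'a measure \<Rightarrow> ('a set \<Rightarrow> complex) \<Rightarrow> 'a set \<Rightarrow> ennreal" where
  "total_variation M \<mu> E = (SUP A\<in>countable_partitions M E. \<Sum>i. ennreal (cmod (\<mu> (A i))))"

lemma variation_eq_measure_of: "variation M \<mu> = measure_of (space M) (sets M) (total_variation M \<mu>)"
  by (simp add: variation_def total_variation_def[abs_def] countable_partitions_def)

lemma space_variation [simp]: "space (variation M \<mu>) = space M"
  and sets_variation [simp, measurable_cong]: "sets (variation M \<mu>) = sets M"
  by (simp_all add: variation_eq_measure_of)

text \<open>Tonelli's theorem for the counting measure.\<close>

lemma ennreal_suminf_swap:
  fixes f :: "nat \<Rightarrow> nat \<Rightarrow> ennreal"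
  shows "(\<Sum>i. \<Sum>j. f i j) = (\<Sum>j. \<Sum>i. f i j)"
  using nn_integral_suminf[of "\<lambda>j i. f i j" "count_space UNIV"]
  by (simp add: nn_integral_count_space_nat)

lemma ennreal_norm_sums_le:
  fixes a :: "nat \<Rightarrow> complex"
  assumes "a sums s"
  shows "ennreal (norm s) \<le> (\<Sum>i. ennreal (norm (a i)))"
proof (cases "summable (\<lambda>i. norm (a i))")
  case True
  then have "norm s \<le> (\<Sum>i. norm (a i))"
    using summable_norm[OF True] assms by (simp add: sums_iff)
  then show ?thesis
    unfolding suminf_ennreal2[OF norm_ge_zero True] by (rule ennreal_leI)
next
  case False
  then have "(\<Sum>i. ennreal (norm (a i))) = top"
    using summable_suminf_not_top[OF norm_ge_zero, of a] by fastforce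
  then show ?thesis by simp
qed

text \<open>The pairing function flattens a sequence of partitions into one partition, which is what
  makes the total variation superadditive over countable unions.\<close>

lemma countable_partitions_union:
  assumes E: "disjoint_family E" and P: "\<And>i. P i \<in> countable_partitions M (E i)"
  shows "(\<lambda>k. case prod_decode k of (i, j) \<Rightarrow> P i j) \<in> countable_partitions M (\<Union>i. E i)"
    (is "?C \<in> _")
proof -
  have dj: "disjoint_family ?C"
    unfolding disjoint_family_on_def
  proof (intro ballI impI)
    fix k l :: nat assume "k \<noteq> l"
    obtain i j where k: "prod_decode k = (i, j)" by fastforce
    obtain i' j' where l: "prod_decode l = (i', j')" by fastforce
    have ne: "i \<noteq> i' \<or> j \<noteq> j'"
      using \<open>k \<noteq> l\<close> k l by (metis prod_decode_inverse)
    have sub: "P i j \<subseteq> E i" "P i' j' \<subseteq> E i'"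
      using P unfolding countable_partitions_def by auto
    show "?C k \<inter> ?C l = {}"
    proof (cases "i = i'")
      case True
      with ne P[of i] have "P i j \<inter> P i j' = {}"
        unfolding countable_partitions_def disjoint_family_on_def by auto
      then show ?thesis using True k l by simp
    next
      case False
      then have "E i \<inter> E i' = {}" using E unfolding disjoint_family_on_def by auto
      then show ?thesis using sub k l by auto
    qed
  qed
  have "(\<Union>k. ?C k) = (\<Union>i. \<Union>j. P i j)"
  proof
    show "(\<Union>k. ?C k) \<subseteq> (\<Union>i. \<Union>j. P i j)" by (auto split: prod.splits)
    show "(\<Union>i. \<Union>j. P i j) \<subseteq> (\<Union>k. ?C k)"
    proof clarsimp
      fix x i j assume "x \<in> P i j"
      then show "\<exists>k. x \<in> (case prod_decode k of (i, j) \<Rightarrow> P i j)"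
        by (intro exI[of _ "prod_encode (i, j)"]) simp
    qed
  qed
  also have "\<dots> = (\<Union>i. E i)" using P unfolding countable_partitions_def by auto
  finally have un: "(\<Union>k. ?C k) = (\<Union>i. E i)" .
  have "?C k \<in> sets M" for k
  proof -
    obtain i j where k: "prod_decode k = (i, j)" by fastforce
    have "P i j \<in> sets M" using P[of i] by (auto simp: countable_partitions_def)
    then show ?thesis by (simp add: k)
  qed
  then show ?thesis
    using dj un unfolding countable_partitions_def by blast
qed

lemma countable_partitions_trivial:
  assumes "E \<in> sets M"
  shows "(\<lambda>i. if i = 0 then E else {}) \<in> countable_partitions M E"
  using assms by (auto simp: countable_partitions_def disjoint_family_on_def)

lemma countable_partitions_Int:
  assumes P: "P \<in> countable_partitions M F" and A: "A \<in> sets M" "A \<subseteq> F"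
  shows "(\<lambda>j. P j \<inter> A) \<in> countable_partitions M A"
  unfolding countable_partitions_def
proof (intro CollectI conjI)
  show "range (\<lambda>j. P j \<inter> A) \<subseteq> sets M"
    using P A by (auto simp: countable_partitions_def)
  show "disjoint_family (\<lambda>j. P j \<inter> A)"
    using P unfolding countable_partitions_def disjoint_family_on_def by auto
  show "(\<Union>j. P j \<inter> A) = A"
    using P A unfolding countable_partitions_def by auto
qed

lemma complex_measure_sums:
  assumes "complex_measure M \<mu>" "range A \<subseteq> sets M" "disjoint_family A"
  shows "(\<lambda>i. \<mu> (A i)) sums \<mu> (\<Union>i. A i)"
  using assms unfolding complex_measure_def by blast

lemma complex_measure_empty: "complex_measure M \<mu> \<Longrightarrow> \<mu> {} = 0"
  unfolding complex_measure_def by (rule conjunct1)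

lemma total_variation_sup:
  assumes "A \<in> countable_partitions M E"
  shows "(\<Sum>i. ennreal (cmod (\<mu> (A i)))) \<le> total_variation M \<mu> E"
  unfolding total_variation_def using assms by (rule SUP_upper)

text \<open>Partitions of the pieces combine to a partition of the union, which gives one
  inequality; intersecting a partition of the union with the pieces gives the other one, by the
  triangle inequality for series.\<close>

lemma total_variation_countably_additive:
  assumes cm: "complex_measure M \<mu>"
  shows "countably_additive (sets M) (total_variation M \<mu>)"
proof (rule countably_additiveI)
  fix E :: "nat \<Rightarrow> 'a set"
  assume E: "range E \<subseteq> sets M" "disjoint_family E" "(\<Union>i. E i) \<in> sets M"
  let ?s = "\<lambda>A. \<Sum>i. ennreal (cmod (\<mu> (A i)))"
  \<comment> \<open>The suprema are written as limits of increasing sequences so that sum and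
    supremum can be exchanged; this covers infinite variations as well, before finiteness is
    known.\<close>
  have "\<exists>f. incseq f \<and> range f \<subseteq> ?s ` countable_partitions M (E i) \<and>
      total_variation M \<mu> (E i) = (SUP n. f n)" for i
    unfolding total_variation_def
  proof (rule ennreal_Sup_countable_SUP)
    have "E i \<in> sets M" using E by blast
    then show "?s ` countable_partitions M (E i) \<noteq> {}"
      using countable_partitions_trivial by fastforce
  qed
  then obtain f where "\<And>i. incseq (f i) \<and> range (f i) \<subseteq> ?s ` countable_partitions M (E i) \<and>
      total_variation M \<mu> (E i) = (SUP n. f i n)"
    by (metis (no_types, lifting))
  then have f: "\<And>i. incseq (f i)" "\<And>i n. f i n \<in> ?s ` countable_partitions M (E i)"
    "\<And>i. total_variation M \<mu> (E i) = (SUP n. f i n)" by blast+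
  have "(\<Sum>i. total_variation M \<mu> (E i)) = (SUP n. \<Sum>i. f i n)"
    unfolding f(3) by (rule ennreal_suminf_SUP_eq) (use f(1) in \<open>auto simp: incseq_def\<close>)
  also have "\<dots> \<le> total_variation M \<mu> (\<Union>i. E i)"
  proof (rule SUP_least)
    fix n
    have "\<forall>i. \<exists>P. P \<in> countable_partitions M (E i) \<and> f i n = ?s P"
      using f(2) by blast
    from choice[OF this] obtain P
      where P: "\<And>i. P i \<in> countable_partitions M (E i)" "\<And>i. f i n = ?s (P i)" by blast
    have "(\<Sum>i. f i n) = ?s (\<lambda>k. case prod_decode k of (i, j) \<Rightarrow> P i j)"
      unfolding P(2) case_prod_unfold
      by (rule suminf_ennreal_2dimen[symmetric, where f="\<lambda>p. ennreal (cmod (\<mu> (P (fst p) (snd p))))"]) simp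
    also have "\<dots> \<le> total_variation M \<mu> (\<Union>i. E i)"
      by (intro total_variation_sup countable_partitions_union E P)
    finally show "(\<Sum>i. f i n) \<le> total_variation M \<mu> (\<Union>i. E i)" .
  qed
  finally have le: "(\<Sum>i. total_variation M \<mu> (E i)) \<le> total_variation M \<mu> (\<Union>i. E i)" .
  have "total_variation M \<mu> (\<Union>i. E i) \<le> (\<Sum>i. total_variation M \<mu> (E i))"
    unfolding total_variation_def[of M \<mu> "\<Union>i. E i"]
  proof (rule SUP_least)
    fix P assume P: "P \<in> countable_partitions M (\<Union>i. E i)"
    have "?s P \<le> (\<Sum>j. \<Sum>i. ennreal (cmod (\<mu> (P j \<inter> E i))))"
    proof (rule suminf_le)
      fix j
      have "(\<lambda>i. \<mu> (P j \<inter> E i)) sums \<mu> (\<Union>i. P j \<inter> E i)"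
        using E P by (intro complex_measure_sums[OF cm])
          (auto simp: countable_partitions_def disjoint_family_on_def)
      moreover have "(\<Union>i. P j \<inter> E i) = P j"
        using P by (auto simp: countable_partitions_def)
      ultimately show "ennreal (cmod (\<mu> (P j))) \<le> (\<Sum>i. ennreal (cmod (\<mu> (P j \<inter> E i))))"
        using ennreal_norm_sums_le by fastforce
    qed auto
    also have "\<dots> = (\<Sum>i. \<Sum>j. ennreal (cmod (\<mu> (P j \<inter> E i))))"
      by (rule ennreal_suminf_swap)
    also have "\<dots> \<le> (\<Sum>i. total_variation M \<mu> (E i))"
    proof (intro suminf_le total_variation_sup)
      fix i show "(\<lambda>j. P j \<inter> E i) \<in> countable_partitions M (E i)"
        by (rule countable_partitions_Int[OF P]) (use E in blast)+
    qed auto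
    finally show "?s P \<le> (\<Sum>i. total_variation M \<mu> (E i))" .
  qed
  with le show "(\<Sum>i. total_variation M \<mu> (E i)) = total_variation M \<mu> (\<Union>i. E i)" by simp
qed

lemma total_variation_empty:
  assumes "complex_measure M \<mu>" shows "total_variation M \<mu> {} = 0"
proof -
  have *: "A i = {}" if "A \<in> countable_partitions M {}" for A i
    using that by (auto simp: countable_partitions_def)
  have "(\<Sum>i. ennreal (cmod (\<mu> (A i)))) \<le> 0" if "A \<in> countable_partitions M {}" for A
    by (simp add: *[OF that] complex_measure_empty[OF assms])
  then have "total_variation M \<mu> {} \<le> 0"
    unfolding total_variation_def by (rule SUP_least)
  then show ?thesis by simp
qed

lemma emeasure_variation:
  assumes "complex_measure M \<mu>" "E \<in> sets M"
  shows "emeasure (variation M \<mu>) E = total_variation M \<mu> E"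
  unfolding variation_eq_measure_of
  by (intro emeasure_measure_of_sigma total_variation_countably_additive[OF assms(1)] assms(2)
      sets.sigma_algebra_axioms) (simp add: positive_def total_variation_empty[OF assms(1)])

lemma norm_le_variation:
  assumes cm: "complex_measure M \<mu>" and E: "E \<in> sets M"
  shows "ennreal (cmod (\<mu> E)) \<le> emeasure (variation M \<mu>) E"
proof -
  have "ennreal (cmod (\<mu> E)) = (\<Sum>i. ennreal (cmod (\<mu> (if i = 0 then E else {}))))"
    by (subst suminf_finite[of "{0}"]) (simp_all add: complex_measure_empty[OF cm])
  also have "\<dots> \<le> emeasure (variation M \<mu>) E"
    unfolding emeasure_variation[OF assms]
    by (intro total_variation_sup countable_partitions_trivial E)
  finally show ?thesis .
qed

lemma complex_measure_Un:
  assumes cm: "complex_measure M \<mu>" and "A \<in> sets M" "B \<in> sets M" "A \<inter> B = {}"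
  shows "\<mu> (A \<union> B) = \<mu> A + \<mu> B"
proof -
  have "(\<lambda>n. \<mu> (binaryset A B n)) sums \<mu> (\<Union>i. binaryset A B i)"
    using assms by (intro complex_measure_sums[OF cm])
      (auto simp: range_binaryset_eq disjoint_family_on_def binaryset_def)
  moreover have "(\<lambda>n. \<mu> (binaryset A B n)) sums (\<mu> A + \<mu> B)"
    by (intro binaryset_sums complex_measure_empty[OF cm])
  ultimately show ?thesis
    using sums_unique2 by (fastforce simp: UN_binaryset_eq)
qed

lemma complex_measure_finite_UN:
  assumes cm: "complex_measure M \<mu>" and "finite I" and A: "\<And>i. i \<in> I \<Longrightarrow> A i \<in> sets M"
    and "disjoint_family_on A I"
  shows "\<mu> (\<Union>i\<in>I. A i) = (\<Sum>i\<in>I. \<mu> (A i))"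
  using assms(2-)
proof (induction I)
  case empty
  then show ?case using complex_measure_empty[OF cm] by simp
next
  case (insert x F)
  have d: "A x \<inter> (\<Union>i\<in>F. A i) = {}" "disjoint_family_on A F"
    using insert.prems(2) by (simp_all add: disjoint_family_on_insert[OF insert.hyps(2)])
  have sets: "(\<Union>i\<in>F. A i) \<in> sets M"
    by (rule sets.finite_UN[OF insert.hyps(1)]) (rule insert.prems(1)[OF insertI2])
  have "\<mu> (A x \<union> (\<Union>i\<in>F. A i)) = \<mu> (A x) + \<mu> (\<Union>i\<in>F. A i)"
    by (rule complex_measure_Un[OF cm insert.prems(1)[OF insertI1] sets d(1)])
  also have "\<mu> (\<Union>i\<in>F. A i) = (\<Sum>i\<in>F. \<mu> (A i))"
    by (rule insert.IH[OF insert.prems(1)[OF insertI2] d(2)])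
  finally show ?case using insert.hyps by simp
qed

text \<open>Since |z| \<le> |Re z| + |Im z|, the sum of the moduli is at most the sum of four
  one-signed partial sums. The largest of them carries a quarter, and no cancellation occurs in its
  real or imaginary part.\<close>

lemma exists_subset_norm_sum_ge:
  fixes f :: "'i \<Rightarrow> complex"
  assumes "finite I"
  shows "\<exists>S\<subseteq>I. (\<Sum>i\<in>I. cmod (f i)) \<le> 4 * cmod (\<Sum>i\<in>S. f i)"
proof -
  define a where "a = (\<Sum>i\<in>{i\<in>I. Re (f i) \<ge> 0}. Re (f i))"
  define b where "b = (\<Sum>i\<in>{i\<in>I. Re (f i) < 0}. - Re (f i))"
  define c where "c = (\<Sum>i\<in>{i\<in>I. Im (f i) \<ge> 0}. Im (f i))"
  define d where "d = (\<Sum>i\<in>{i\<in>I. Im (f i) < 0}. - Im (f i))"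
  have part: "(\<Sum>i\<in>I. g i) = (\<Sum>i\<in>{i\<in>I. P i}. g i) + (\<Sum>i\<in>{i\<in>I. \<not> P i}. g i)"
    for g :: "'i \<Rightarrow> real" and P
  proof -
    have "I = {i\<in>I. P i} \<union> {i\<in>I. \<not> P i}" by blast
    then show ?thesis
      using sum.union_disjoint[of "{i\<in>I. P i}" "{i\<in>I. \<not> P i}" g] assms by force
  qed
  have "(\<Sum>i\<in>I. cmod (f i)) \<le> (\<Sum>i\<in>I. \<bar>Re (f i)\<bar> + \<bar>Im (f i)\<bar>)"
    by (intro sum_mono cmod_le)
  also have "\<dots> = (\<Sum>i\<in>I. \<bar>Re (f i)\<bar>) + (\<Sum>i\<in>I. \<bar>Im (f i)\<bar>)"
    by (rule sum.distrib)
  also have "(\<Sum>i\<in>I. \<bar>Re (f i)\<bar>) = a + b"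
    unfolding a_def b_def part[of _ "\<lambda>i. Re (f i) \<ge> 0"] not_le
    by (intro arg_cong2[of _ _ _ _ "(+)"] sum.cong) auto
  also have "(\<Sum>i\<in>I. \<bar>Im (f i)\<bar>) = c + d"
    unfolding c_def d_def part[of _ "\<lambda>i. Im (f i) \<ge> 0"] not_le
    by (intro arg_cong2[of _ _ _ _ "(+)"] sum.cong) auto
  finally have "(\<Sum>i\<in>I. cmod (f i)) \<le> a + b + (c + d)" .
  moreover have "a \<le> cmod (\<Sum>i\<in>{i\<in>I. Re (f i) \<ge> 0}. f i)"
    unfolding a_def Re_sum[symmetric] by (rule complex_Re_le_cmod)
  moreover have "b \<le> cmod (\<Sum>i\<in>{i\<in>I. Re (f i) < 0}. f i)"
    unfolding b_def sum_negf Re_sum[symmetric] using abs_Re_le_cmod abs_le_D2 by blast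
  moreover have "c \<le> cmod (\<Sum>i\<in>{i\<in>I. Im (f i) \<ge> 0}. f i)"
    unfolding c_def Im_sum[symmetric] using abs_Im_le_cmod abs_le_D1 by blast
  moreover have "d \<le> cmod (\<Sum>i\<in>{i\<in>I. Im (f i) < 0}. f i)"
    unfolding d_def sum_negf Im_sum[symmetric] using abs_Im_le_cmod abs_le_D2 by blast
  ultimately consider "(\<Sum>i\<in>I. cmod (f i)) \<le> 4 * cmod (\<Sum>i\<in>{i\<in>I. Re (f i) \<ge> 0}. f i)"
    | "(\<Sum>i\<in>I. cmod (f i)) \<le> 4 * cmod (\<Sum>i\<in>{i\<in>I. Re (f i) < 0}. f i)"
    | "(\<Sum>i\<in>I. cmod (f i)) \<le> 4 * cmod (\<Sum>i\<in>{i\<in>I. Im (f i) \<ge> 0}. f i)"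
    | "(\<Sum>i\<in>I. cmod (f i)) \<le> 4 * cmod (\<Sum>i\<in>{i\<in>I. Im (f i) < 0}. f i)" by linarith
  then show ?thesis by cases (rule exI, rule conjI[rotated], assumption, blast)+
qed

text \<open>A set of infinite variation contains pieces of huge measure, but \<open>\<mu> E\<close>
  itself is fixed; so such a piece and its complement are both large, and one of the two keeps
  infinite variation while the other one is split off.\<close>

lemma total_variation_split:
  assumes cm: "complex_measure M \<mu>" and E: "E \<in> sets M" and top: "total_variation M \<mu> E = top"
  shows "\<exists>A\<in>sets M. A \<subseteq> E \<and> cmod (\<mu> A) > 1 \<and> total_variation M \<mu> (E - A) = top"
proof -
  \<comment> \<open>The factor 4 is the loss in \<open>exists_subset_norm_sum_ge\<close>; the
    surplus 2 over \<open>cmod (\<mu> E)\<close> leaves modulus above 1 for both \<open>A\<close>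
    and \<open>E - A\<close>.\<close>
  define t where "t = 4 * (2 + cmod (\<mu> E))"
  have t_nonneg: "0 \<le> t" by (simp add: t_def)
  have "ennreal t < total_variation M \<mu> E" using top by simp
  then obtain P where P: "P \<in> countable_partitions M E" "ennreal t < (\<Sum>i. ennreal (cmod (\<mu> (P i))))"
    unfolding total_variation_def less_SUP_iff by auto
  then obtain n where n: "ennreal t < (\<Sum>i<n. ennreal (cmod (\<mu> (P i))))"
    unfolding suminf_eq_SUP less_SUP_iff by auto
  have "t < (\<Sum>i<n. cmod (\<mu> (P i)))"
    using n ennreal_less_iff[of t] by (simp add: sum_ennreal t_nonneg)
  moreover obtain S where S: "S \<subseteq> {..<n}" "(\<Sum>i<n. cmod (\<mu> (P i))) \<le> 4 * cmod (\<Sum>i\<in>S. \<mu> (P i))"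
    using exists_subset_norm_sum_ge[of "{..<n}" "\<lambda>i. \<mu> (P i)"] by auto
  define A where "A = (\<Union>i\<in>S. P i)"
  have finS: "finite S" using S finite_subset by blast
  have A: "A \<in> sets M" "A \<subseteq> E"
    using P(1) sets.finite_UN[OF finS, of P M] unfolding A_def countable_partitions_def by blast+
  have "\<mu> A = (\<Sum>i\<in>S. \<mu> (P i))"
    unfolding A_def
  proof (rule complex_measure_finite_UN[OF cm finS])
    show "P i \<in> sets M" for i using P(1) by (auto simp: countable_partitions_def)
    show "disjoint_family_on P S"
      using P(1) disjoint_family_on_mono[of S UNIV P] by (simp add: countable_partitions_def)
  qed
  ultimately have big: "cmod (\<mu> A) > 2 + cmod (\<mu> E)" using S t_def by simp
  have "\<mu> E = \<mu> A + \<mu> (E - A)"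
    using complex_measure_Un[OF cm A(1) sets.Diff[OF E A(1)]] A(2) by (simp add: Un_absorb1)
  then have big2: "cmod (\<mu> (E - A)) > 1"
    using big norm_triangle_ineq2[of "\<mu> A" "\<mu> E"] by (simp add: norm_minus_commute)
  have "total_variation M \<mu> E = total_variation M \<mu> A + total_variation M \<mu> (E - A)"
    using plus_emeasure[of A "variation M \<mu>" "E - A"] A E sets.Diff[OF E A(1)]
    by (simp add: Un_absorb1 emeasure_variation[OF cm])
  then consider "total_variation M \<mu> (E - A) = top" | "total_variation M \<mu> A = top"
    using top by (metis ennreal_add_eq_top)
  then show ?thesis
  proof cases
    case 1
    have "cmod (\<mu> A) > 1" using big norm_ge_zero[of "\<mu> E"] by linarith
    then show ?thesis using A 1 by blast
  next
    case 2
    then show ?thesis using A E big2 double_diff[of A E E]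
      by (intro bexI[of _ "E - A"]) auto
  qed
qed

text \<open>Repeated splitting of a space of infinite variation would produce disjoint sets whose
  measures have modulus above 1, and these cannot form a convergent series.\<close>

lemma finite_measure_variation:
  assumes cm: "complex_measure M \<mu>"
  shows "finite_measure (variation M \<mu>)"
proof (rule finite_measureI, rule ccontr)
  assume "\<not> emeasure (variation M \<mu>) (space (variation M \<mu>)) \<noteq> \<infinity>"
  then have top: "total_variation M \<mu> (space M) = top"
    using emeasure_variation[OF cm, of "space M"] by simp
  define T where "T = {E \<in> sets M. total_variation M \<mu> E = top}"
  have "\<forall>E\<in>T. \<exists>A\<in>sets M. A \<subseteq> E \<and> cmod (\<mu> A) > 1 \<and> E - A \<in> T"
    using total_variation_split[OF cm] unfolding T_def by blast
  then obtain F where F: "\<And>E. E \<in> T \<Longrightarrow> F E \<in> sets M \<and> F E \<subseteq> E \<and> cmod (\<mu> (F E)) > 1 \<and> E - F E \<in> T"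
    by metis
  define E where "E = rec_nat (space M) (\<lambda>_ E. E - F E)"
  have E_simps: "E 0 = space M" "\<And>n. E (Suc n) = E n - F (E n)" by (auto simp: E_def)
  have ET: "E n \<in> T" for n
    by (induction n) (use F top in \<open>auto simp: E_simps T_def\<close>)
  have mono: "E n \<subseteq> E m" if "m \<le> n" for m n
    using that by (induction n rule: dec_induct) (auto simp: E_simps)
  have "disjoint_family (\<lambda>n. F (E n))"
    unfolding disjoint_family_on_def
  proof (intro ballI impI)
    fix m n :: nat assume "m \<noteq> n"
    have *: "F (E m) \<inter> F (E n) = {}" if "m < n" for m n
      using mono[of "Suc m" n] F[OF ET, of n] that unfolding E_simps by fastforce
    then show "F (E m) \<inter> F (E n) = {}" using \<open>m \<noteq> n\<close> by (metis inf_commute linorder_neqE_nat)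
  qed
  then have "(\<lambda>n. \<mu> (F (E n))) sums \<mu> (\<Union>n. F (E n))"
    using F[OF ET] by (intro complex_measure_sums[OF cm]) blast+
  then have "(\<lambda>n. \<mu> (F (E n))) \<longlonglongrightarrow> 0"
    by (meson sums_summable summable_LIMSEQ_zero)
  then have "eventually (\<lambda>n. cmod (\<mu> (F (E n))) < 1) sequentially"
    by (auto dest: tendstoD[where e=1])
  then obtain n where "cmod (\<mu> (F (E n))) < 1"
    using eventually_happens'[OF sequentially_bot] by blast
  then show False using F[OF ET, of n] by simp
qed

section \<open>Densities and the polar decomposition\<close>

text \<open>Adding the dominating measure \<open>V\<close> makes the signed measure positive, so
  that the Radon-Nikodym theorem for positive measures applies; the density of \<open>V\<close>, the
  constant 1, is subtracted at the end.\<close>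

lemma real_signed_measure_density:
  fixes s :: "'a set \<Rightarrow> real"
  assumes V: "finite_measure V"
    and sums: "\<And>A::nat \<Rightarrow> 'a set. range A \<subseteq> sets V \<Longrightarrow> disjoint_family A \<Longrightarrow> (\<lambda>i. s (A i)) sums s (\<Union>i. A i)"
    and le: "\<And>E. E \<in> sets V \<Longrightarrow> \<bar>s E\<bar> \<le> measure V E"
  shows "\<exists>g. integrable V g \<and> (\<forall>E\<in>sets V. s E = (LINT x:E|V. g x))"
proof -
  interpret V: finite_measure V by fact
  define \<nu> where "\<nu> = (\<lambda>E. ennreal (measure V E + s E))"
  define N where "N = measure_of (space V) (sets V) \<nu>"
  have setsN: "sets N = sets V" by (simp_all add: N_def)
  have nn: "0 \<le> measure V E + s E" if "E \<in> sets V" for E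
    using le[OF that] by linarith
  have N: "emeasure N E = \<nu> E" if E: "E \<in> sets V" for E
    unfolding N_def
  proof (rule emeasure_measure_of_sigma[OF sets.sigma_algebra_axioms _ _ E])
    show "positive (sets V) \<nu>"
      using le[of "{}"] by (simp add: positive_def \<nu>_def)
    show "countably_additive (sets V) \<nu>"
    proof (rule countably_additiveI)
      fix A :: "nat \<Rightarrow> 'a set"
      assume A: "range A \<subseteq> sets V" "disjoint_family A" "(\<Union>i. A i) \<in> sets V"
      have Ai: "A i \<in> sets V" for i using A(1) by blast
      have "(\<lambda>i. measure V (A i) + s (A i)) sums (measure V (\<Union>i. A i) + s (\<Union>i. A i))"
        by (intro sums_add V.finite_measure_UNION sums A(1,2))
      then have "(\<lambda>i. \<nu> (A i)) sums \<nu> (\<Union>i. A i)"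
        unfolding \<nu>_def using nn[OF Ai] nn[OF A(3)] by (subst sums_ennreal)
      then show "(\<Sum>i. \<nu> (A i)) = \<nu> (\<Union>i. A i)" by (rule sums_unique[symmetric])
    qed
  qed
  have "absolutely_continuous V N"
    unfolding absolutely_continuous_def
  proof
    fix E assume E: "E \<in> null_sets V"
    then have "E \<in> sets V" "measure V E = 0" by (auto simp: measure_def null_sets_def)
    then have "emeasure N E = 0" using N le[of E] by (simp add: \<nu>_def)
    with \<open>E \<in> sets V\<close> show "E \<in> null_sets N" by (simp add: null_sets_def setsN)
  qed
  from V.Radon_Nikodym[OF this setsN]
  obtain f where f: "f \<in> borel_measurable V" "density V f = N" by blast
  have fE: "(\<integral>\<^sup>+x\<in>E. f x \<partial>V) = ennreal (measure V E + s E)" if "E \<in> sets V" for E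
    using emeasure_density[OF f(1) that] N[OF that] by (simp add: f(2) \<nu>_def)
  have "(\<integral>\<^sup>+x. f x \<partial>V) = (\<integral>\<^sup>+x\<in>space V. f x \<partial>V)"
    by (intro nn_integral_cong) simp
  then have "(\<integral>\<^sup>+x. f x \<partial>V) \<noteq> \<infinity>" using fE[of "space V"] by simp
  then have fin: "AE x in V. f x \<noteq> \<infinity>" by (rule nn_integral_PInf_AE[OF f(1)])
  have intE: "set_integrable V E (\<lambda>x. enn2real (f x)) \<and>
      (LINT x:E|V. enn2real (f x)) = measure V E + s E" if E: "E \<in> sets V" for E
  proof -
    have eq: "(\<integral>\<^sup>+x. ennreal (indicator E x *\<^sub>R enn2real (f x)) \<partial>V) = ennreal (measure V E + s E)"
      unfolding fE[OF E, symmetric]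
      by (rule nn_integral_cong_AE, use fin in eventually_elim)
        (auto simp: indicator_def less_top split: if_splits)
    have "integrable V (\<lambda>x. indicator E x *\<^sub>R enn2real (f x))"
      using f(1) E eq by (intro integrableI_nonneg) auto
    moreover have "(LINT x|V. indicator E x *\<^sub>R enn2real (f x)) = measure V E + s E"
      using f(1) E eq nn[OF E] by (subst integral_eq_nn_integral) auto
    ultimately show ?thesis by (simp add: set_integrable_def set_lebesgue_integral_def)
  qed
  have "integrable V (\<lambda>x. indicator (space V) x *\<^sub>R enn2real (f x))"
    using intE[of "space V"] by (simp add: set_integrable_def)
  then have int: "integrable V (\<lambda>x. enn2real (f x))"
    by (subst (asm) Bochner_Integration.integrable_cong[OF refl, of _ _ "\<lambda>x. enn2real (f x)"]) auto
  show ?thesis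
  proof (intro exI[of _ "\<lambda>x. enn2real (f x) - 1"] conjI ballI)
    show "integrable V (\<lambda>x. enn2real (f x) - 1)" using int by simp
    fix E assume E: "E \<in> sets V"
    have "(LINT x:E|V. enn2real (f x) - 1) = (LINT x:E|V. enn2real (f x)) - (LINT x:E|V. 1)"
      using intE[OF E] V.integrable_const[of 1] integrable_mult_indicator[OF E, of "\<lambda>_. 1 :: real"]
      by (intro set_integral_diff) (simp_all add: set_integrable_def)
    also have "\<dots> = s E" using intE[OF E] E by (simp add: set_lebesgue_integral_def)
    finally show "s E = (LINT x:E|V. enn2real (f x) - 1)" by simp
  qed
qed

lemma complex_measure_density:
  assumes cm: "complex_measure M \<mu>"
  shows "\<exists>h. integrable (variation M \<mu>) h \<and> (\<forall>E\<in>sets M. \<mu> E = (LINT x:E|variation M \<mu>. h x))"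
proof -
  let ?V = "variation M \<mu>"
  interpret V: finite_measure ?V by (rule finite_measure_variation[OF cm])
  have le: "cmod (\<mu> E) \<le> measure ?V E" if "E \<in> sets M" for E
    using norm_le_variation[OF cm that] by (simp add: V.emeasure_eq_measure)
  have "\<exists>g. integrable ?V g \<and> (\<forall>E\<in>sets ?V. Re (\<mu> E) = (LINT x:E|?V. g x))"
  proof (rule real_signed_measure_density[OF V.finite_measure_axioms])
    show "(\<lambda>i. Re (\<mu> (A i))) sums Re (\<mu> (\<Union>i. A i))"
      if "range A \<subseteq> sets ?V" "disjoint_family A" for A :: "nat \<Rightarrow> 'a set"
      using complex_measure_sums[OF cm] that by (intro sums_Re) simp
    show "\<bar>Re (\<mu> E)\<bar> \<le> measure ?V E" if "E \<in> sets ?V" for E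
      using le[of E] that abs_Re_le_cmod[of "\<mu> E"] by simp
  qed
  then obtain g1 where g1: "integrable ?V g1" "\<And>E. E \<in> sets M \<Longrightarrow> Re (\<mu> E) = (LINT x:E|?V. g1 x)"
    by auto
  have "\<exists>g. integrable ?V g \<and> (\<forall>E\<in>sets ?V. Im (\<mu> E) = (LINT x:E|?V. g x))"
  proof (rule real_signed_measure_density[OF V.finite_measure_axioms])
    show "(\<lambda>i. Im (\<mu> (A i))) sums Im (\<mu> (\<Union>i. A i))"
      if "range A \<subseteq> sets ?V" "disjoint_family A" for A :: "nat \<Rightarrow> 'a set"
      using complex_measure_sums[OF cm] that by (intro sums_Im) simp
    show "\<bar>Im (\<mu> E)\<bar> \<le> measure ?V E" if "E \<in> sets ?V" for E
      using le[of E] that abs_Im_le_cmod[of "\<mu> E"] by simp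
  qed
  then obtain g2 where g2: "integrable ?V g2" "\<And>E. E \<in> sets M \<Longrightarrow> Im (\<mu> E) = (LINT x:E|?V. g2 x)"
    by auto
  let ?h = "\<lambda>x. complex_of_real (g1 x) + \<i> * complex_of_real (g2 x)"
  show ?thesis
  proof (intro exI[of _ ?h] conjI ballI)
    show int: "integrable ?V ?h" using g1(1) g2(1) by simp
    fix E assume E: "E \<in> sets M"
    have i1: "integrable ?V (\<lambda>x. indicator E x *\<^sub>R g1 x)" "integrable ?V (\<lambda>x. indicator E x *\<^sub>R g2 x)"
      using E by (intro integrable_mult_indicator g1(1) g2(1); simp)+
    have "(LINT x:E|?V. ?h x) = (LINT x|?V. complex_of_real (indicator E x *\<^sub>R g1 x)
        + \<i> * complex_of_real (indicator E x *\<^sub>R g2 x))"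
      unfolding set_lebesgue_integral_def
      by (intro Bochner_Integration.integral_cong) (auto simp: indicator_def)
    also have "\<dots> = complex_of_real (LINT x:E|?V. g1 x) + \<i> * complex_of_real (LINT x:E|?V. g2 x)"
      unfolding set_lebesgue_integral_def
      by (subst Bochner_Integration.integral_add)
        (intro integrable_of_real integrable_mult_right i1
          | simp only: integral_complex_of_real integral_mult_right_zero)+
    also have "\<dots> = \<mu> E" using g1(2)[OF E] g2(2)[OF E] by (simp add: complex_eq_iff)
    finally show "\<mu> E = (LINT x:E|?V. ?h x)" by simp
  qed
qed

text \<open>All averages of the density have modulus at most 1, hence so has the density almost
  everywhere. The definition of the variation as a supremum gives the reverse inequality after
  integration, and both together force modulus 1.\<close>

lemma polar_density_exists:
  assumes cm: "complex_measure M \<mu>"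
  shows "\<exists>h. h \<in> borel_measurable M \<and> (\<forall>x\<in>space M. cmod (h x) = 1) \<and>
     (\<forall>E\<in>sets M. \<mu> E = (LINT x:E|variation M \<mu>. h x))"
proof -
  let ?V = "variation M \<mu>"
  interpret V: finite_measure ?V by (rule finite_measure_variation[OF cm])
  obtain h where h: "integrable ?V h" "\<And>E. E \<in> sets M \<Longrightarrow> \<mu> E = (LINT x:E|?V. h x)"
    using complex_measure_density[OF cm] by blast
  have hm: "h \<in> borel_measurable M" using borel_measurable_integrable[OF h(1)] by simp
  have le: "cmod (\<mu> E) \<le> measure ?V E" if "E \<in> sets M" for E
    using norm_le_variation[OF cm that] by (simp add: V.emeasure_eq_measure)
  have le1: "AE x in ?V. h x \<in> cball 0 1"
  proof (rule V.averaging_theorem[OF h(1) closed_cball])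
    fix E assume E: "E \<in> sets ?V" "0 < measure ?V E"
    have "cmod (LINT x:E|?V. h x) \<le> measure ?V E" using le[of E] h(2)[of E] E(1) by simp
    then show "(1 / measure ?V E) *\<^sub>R (LINT x:E|?V. h x) \<in> cball 0 1"
      using E(2) by (simp add: divide_simps)
  qed
  \<comment> \<open>Every partition sum of \<open>\<mu>\<close> is bounded by the integral of |h|,
    so the total mass of the variation is bounded by it too.\<close>
  have "emeasure ?V (space M) \<le> emeasure (density ?V (\<lambda>x. ennreal (cmod (h x)))) (space M)"
    unfolding emeasure_variation[OF cm sets.top] total_variation_def
  proof (rule SUP_least)
    fix P assume P: "P \<in> countable_partitions M (space M)"
    then have Pi: "range P \<subseteq> sets M" "disjoint_family P" "(\<Union>i. P i) = space M"
      by (auto simp: countable_partitions_def)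
    have "(\<Sum>i. ennreal (cmod (\<mu> (P i)))) \<le> (\<Sum>i. emeasure (density ?V (\<lambda>x. ennreal (cmod (h x)))) (P i))"
    proof (intro suminf_le)
      fix i have Pi': "P i \<in> sets M" using Pi(1) by blast
      have "ennreal (cmod (\<mu> (P i))) \<le> (\<integral>\<^sup>+x. ennreal (norm (indicator (P i) x *\<^sub>R h x)) \<partial>?V)"
        unfolding h(2)[OF Pi'] set_lebesgue_integral_def
        by (rule integral_norm_bound_ennreal) (use Pi' h(1) in \<open>intro integrable_mult_indicator; simp\<close>)
      also have "\<dots> = emeasure (density ?V (\<lambda>x. ennreal (cmod (h x)))) (P i)"
        using Pi' hm by (subst emeasure_density) (auto intro!: nn_integral_cong simp: indicator_def)
      finally show "ennreal (cmod (\<mu> (P i))) \<le> emeasure (density ?V (\<lambda>x. ennreal (cmod (h x)))) (P i)" .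
    qed auto
    also have "\<dots> = emeasure (density ?V (\<lambda>x. ennreal (cmod (h x)))) (space M)"
      unfolding Pi(3)[symmetric] by (rule suminf_emeasure) (use Pi in simp_all)
    finally show "(\<Sum>i. ennreal (cmod (\<mu> (P i)))) \<le> emeasure (density ?V (\<lambda>x. ennreal (cmod (h x)))) (space M)" .
  qed
  also have "\<dots> = (\<integral>\<^sup>+x. ennreal (cmod (h x)) \<partial>?V)"
    using hm by (subst emeasure_density) (auto intro!: nn_integral_cong)
  also have "\<dots> = ennreal (LINT x|?V. cmod (h x))"
    using h(1) by (intro nn_integral_eq_integral) auto
  finally have "measure ?V (space M) \<le> (LINT x|?V. cmod (h x))"
    by (simp add: V.emeasure_eq_measure)
  then have "(LINT x|?V. 1 - cmod (h x)) \<le> 0"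
    using h(1) by (subst Bochner_Integration.integral_diff) auto
  moreover have nn: "AE x in ?V. 0 \<le> 1 - cmod (h x)" using le1 by eventually_elim simp
  ultimately have "(LINT x|?V. 1 - cmod (h x)) = 0"
    using integral_nonneg_AE[OF nn] by linarith
  then have "AE x in ?V. 1 - cmod (h x) = 0"
    using integral_nonneg_eq_0_iff_AE[OF _ nn] h(1) by simp
  \<comment> \<open>The modulus has to be 1 at every point of the space, so the density is replaced
    by 1 on the exceptional null set.\<close>
  then have eq: "AE x in ?V. (if cmod (h x) = 1 then h x else 1) = h x" by eventually_elim simp
  show ?thesis
  proof (intro exI[of _ "\<lambda>x. if cmod (h x) = 1 then h x else 1"] conjI ballI)
    show m: "(\<lambda>x. if cmod (h x) = 1 then h x else 1) \<in> borel_measurable M"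
      using hm by measurable
    fix E assume E: "E \<in> sets M"
    show "\<mu> E = (LINT x:E|?V. if cmod (h x) = 1 then h x else 1)"
      unfolding h(2)[OF E] set_lebesgue_integral_def
      by (rule integral_cong_AE) (use eq hm m E in \<open>auto elim!: eventually_mono\<close>)
  qed simp
qed

lemma polar_density:
  assumes "complex_measure M \<mu>"
  shows polar_density_measurable: "polar_density M \<mu> \<in> borel_measurable M"
    and norm_polar_density: "x \<in> space M \<Longrightarrow> cmod (polar_density M \<mu> x) = 1"
    and polar_density_integral: "E \<in> sets M \<Longrightarrow> \<mu> E = (LINT x:E|variation M \<mu>. polar_density M \<mu> x)"
  using someI_ex[OF polar_density_exists[OF assms]] unfolding polar_density_def[symmetric] by blast+

lemma integrable_polar_density:
  assumes "complex_measure M \<mu>"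
  shows "integrable (variation M \<mu>) (polar_density M \<mu>)"
proof -
  interpret V: finite_measure "variation M \<mu>" by (rule finite_measure_variation[OF assms])
  show ?thesis
    by (rule V.integrable_const_bound[of _ 1])
      (use polar_density[OF assms] in \<open>auto intro!: AE_I2\<close>)
qed

section \<open>Integration against complex measures\<close>

lemma integral_simple_mult_complex:
  fixes g :: "'a \<Rightarrow> complex"
  assumes s: "simple_function N s" and g: "integrable N g"
  shows "integrable N (\<lambda>x. s x * g x)"
    and "(LINT x|N. s x * g x) = (\<Sum>y\<in>s ` space N. y * (LINT x:(s -` {y} \<inter> space N)|N. g x))"
proof -
  let ?i = "\<lambda>y x. indicat_real (s -` {y} \<inter> space N) x *\<^sub>R g x"
  have fin: "finite (s ` space N)" and meas: "\<And>y. s -` {y} \<inter> space N \<in> sets N"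
    using simple_functionD[OF s] by auto
  have int: "integrable N (?i y)" for y by (intro integrable_mult_indicator meas g)
  have eq: "s x * g x = (\<Sum>y\<in>s ` space N. y * ?i y x)" if x: "x \<in> space N" for x
  proof -
    have "(\<Sum>y\<in>s ` space N. y * ?i y x) = (\<Sum>y\<in>{s x}. y * ?i y x)"
      by (rule sum.mono_neutral_right) (use fin x in \<open>auto simp: indicator_def\<close>)
    then show ?thesis using x by (simp add: indicator_def)
  qed
  have "integrable N (\<lambda>x. \<Sum>y\<in>s ` space N. y * ?i y x)"
    by (intro Bochner_Integration.integrable_sum integrable_mult_right int)
  then show "integrable N (\<lambda>x. s x * g x)"
    by (subst Bochner_Integration.integrable_cong[OF refl eq])
  have "(LINT x|N. s x * g x) = (LINT x|N. (\<Sum>y\<in>s ` space N. y * ?i y x))"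
    by (rule Bochner_Integration.integral_cong[OF refl eq])
  also have "\<dots> = (\<Sum>y\<in>s ` space N. y * (LINT x|N. ?i y x))"
    by (subst Bochner_Integration.integral_sum) (simp_all only: integrable_mult_right int integral_mult_right_zero)
  finally show "(LINT x|N. s x * g x) = (\<Sum>y\<in>s ` space N. y * (LINT x:(s -` {y} \<inter> space N)|N. g x))"
    by (simp add: set_lebesgue_integral_def)
qed

lemma integrable_bounded_mult:
  fixes g \<phi> :: "'a \<Rightarrow> complex"
  assumes g: "integrable N g" and \<phi>: "\<phi> \<in> borel_measurable N" "\<And>x. x \<in> space N \<Longrightarrow> cmod (\<phi> x) \<le> B"
  shows "integrable N (\<lambda>x. \<phi> x * g x)"
proof (rule Bochner_Integration.integrable_bound[of N "\<lambda>x. B * cmod (g x)"])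
  show "integrable N (\<lambda>x. B * cmod (g x))" using g by simp
  show "(\<lambda>x. \<phi> x * g x) \<in> borel_measurable N" using g \<phi>(1) by simp
  show "AE x in N. norm (\<phi> x * g x) \<le> norm (B * cmod (g x))"
  proof (rule AE_I2)
    fix x assume "x \<in> space N"
    from \<phi>(2)[OF this] have "cmod (\<phi> x) * cmod (g x) \<le> \<bar>B\<bar> * cmod (g x)"
      by (intro mult_right_mono) auto
    then show "norm (\<phi> x * g x) \<le> norm (B * cmod (g x))" by (simp add: norm_mult abs_mult)
  qed
qed

text \<open>One complex measure may be given by densities with respect to different positive
  measures; simple functions and dominated convergence carry equality on sets over to bounded
  functions. Thus \<open>cintegral\<close>, which is defined by the polar density, can be computed
  from any density.\<close>

lemma integral_eq_of_set_integral_eq: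
  fixes g1 g2 \<phi> :: "'a \<Rightarrow> complex"
  assumes sets: "sets N1 = sets N2" and g: "integrable N1 g1" "integrable N2 g2"
    and eq: "\<And>E. E \<in> sets N1 \<Longrightarrow> (LINT x:E|N1. g1 x) = (LINT x:E|N2. g2 x)"
    and \<phi>: "\<phi> \<in> borel_measurable N1" "\<And>x. x \<in> space N1 \<Longrightarrow> cmod (\<phi> x) \<le> B"
  shows "(LINT x|N1. \<phi> x * g1 x) = (LINT x|N2. \<phi> x * g2 x)"
proof -
  have space: "space N1 = space N2" using sets by (rule sets_eq_imp_space_eq)
  obtain s where s: "\<And>i. simple_function N1 (s i)"
    "\<And>x. x \<in> space N1 \<Longrightarrow> (\<lambda>i. s i x) \<longlonglongrightarrow> \<phi> x"
    "\<And>i x. x \<in> space N1 \<Longrightarrow> cmod (s i x) \<le> 2 * cmod (\<phi> x)"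
    using borel_measurable_implies_sequence_metric[OF \<phi>(1), of 0] unfolding dist_0_norm
    by (metis dist_0_norm dist_commute)
  have s2: "simple_function N2 (s i)" for i
    using s(1)[of i] sets space by (simp add: simple_function_def)
  have bd: "cmod (s i x) \<le> 2 * B" if "x \<in> space N1" for i x
    using s(3)[OF that, of i] \<phi>(2)[OF that] by linarith
  have lim: "(\<lambda>i. LINT x|N. s i x * g x) \<longlonglongrightarrow> (LINT x|N. \<phi> x * g x)"
    if N: "sets N = sets N1" and g: "integrable N g" and s': "\<And>i. simple_function N (s i)"
    for N and g :: "'a \<Rightarrow> complex"
  proof (rule integral_dominated_convergence[where w="\<lambda>x. 2 * B * cmod (g x)"])
    have sp: "space N = space N1" using N by (rule sets_eq_imp_space_eq)
    have "\<phi> \<in> borel_measurable N" using \<phi>(1) N by (simp cong: measurable_cong_sets)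
    then show "(\<lambda>x. \<phi> x * g x) \<in> borel_measurable N" using g by simp
    show "(\<lambda>x. s i x * g x) \<in> borel_measurable N" for i
      using borel_measurable_simple_function[OF s'[of i]] g by simp
    show "integrable N (\<lambda>x. 2 * B * cmod (g x))" using g by simp
    show "AE x in N. (\<lambda>i. s i x * g x) \<longlonglongrightarrow> \<phi> x * g x"
      by (rule AE_I2) (intro tendsto_mult s(2) tendsto_const, simp add: sp)
    show "AE x in N. norm (s i x * g x) \<le> 2 * B * cmod (g x)" for i
      by (rule AE_I2) (simp add: sp norm_mult mult_right_mono bd)
  qed
  have "(LINT x|N1. s i x * g1 x) = (LINT x|N2. s i x * g2 x)" for i
    unfolding integral_simple_mult_complex(2)[OF s(1) g(1)] integral_simple_mult_complex(2)[OF s2 g(2)]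
      space
    by (intro sum.cong refl arg_cong2[of _ _ _ _ "(*)"], unfold space[symmetric], rule eq)
      (use s(1)[of i] in \<open>auto dest: simple_functionD\<close>)
  moreover have "(\<lambda>i. LINT x|N1. s i x * g1 x) \<longlonglongrightarrow> (LINT x|N1. \<phi> x * g1 x)"
    by (rule lim[OF refl g(1) s(1)])
  moreover have "(\<lambda>i. LINT x|N2. s i x * g2 x) \<longlonglongrightarrow> (LINT x|N2. \<phi> x * g2 x)"
    by (rule lim[OF sets[symmetric] g(2) s2])
  ultimately show ?thesis using LIMSEQ_unique by simp
qed

lemma cintegral_polar:
  assumes cm: "complex_measure M \<mu>" and \<phi>: "\<phi> \<in> borel_measurable M"
  shows "cintegral M \<mu> \<phi> = (LINT x|variation M \<mu>. \<phi> x * polar_density M \<mu> x)"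
  unfolding cintegral_def
  by (rule integral_completion) (use \<phi> polar_density_measurable[OF cm] in simp)

lemma cintegral_eq_density:
  assumes cm: "complex_measure M \<mu>" and N: "sets N = sets M" "integrable N g"
    and \<mu>: "\<And>E. E \<in> sets M \<Longrightarrow> \<mu> E = (LINT x:E|N. g x)"
    and \<phi>: "\<phi> \<in> borel_measurable M" "\<And>x. x \<in> space M \<Longrightarrow> cmod (\<phi> x) \<le> B"
  shows "cintegral M \<mu> \<phi> = (LINT x|N. \<phi> x * g x)"
  unfolding cintegral_polar[OF cm \<phi>(1)]
proof (rule integral_eq_of_set_integral_eq[where B=B])
  show "sets (variation M \<mu>) = sets N" using N(1) by simp
  show "(LINT x:E|variation M \<mu>. polar_density M \<mu> x) = (LINT x:E|N. g x)"
    if "E \<in> sets (variation M \<mu>)" for E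
    using polar_density_integral[OF cm, of E] \<mu>[of E] that by simp
qed (use N(2) \<phi> integrable_polar_density[OF cm] in simp_all)

lemma cintegrable_bounded:
  assumes cm: "complex_measure M \<mu>"
    and \<phi>: "\<phi> \<in> borel_measurable M" "\<And>x. x \<in> space M \<Longrightarrow> cmod (\<phi> x) \<le> B"
  shows "cintegrable M \<mu> \<phi>"
proof -
  interpret V: finite_measure "variation M \<mu>" by (rule finite_measure_variation[OF cm])
  have "integrable (variation M \<mu>) \<phi>"
    by (rule V.integrable_const_bound[of _ B]) (use \<phi> in \<open>auto intro!: AE_I2\<close>)
  then show ?thesis
    unfolding cintegrable_def using \<phi>(1) by (subst integrable_completion) simp_all
qed

text \<open>For a fibre measure this permits replacing a function on \<open>bD\<close> by a simpler
  one with the same values on the fibre, for instance treating a function of the orbit as a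
  constant.\<close>

lemma cintegral_cong_concentrated:
  assumes "concentrated_on M \<mu> S" "complex_measure M \<mu>"
    and "\<phi> \<in> borel_measurable M" "\<psi> \<in> borel_measurable M"
    and eq: "\<And>x. x \<in> space M \<Longrightarrow> x \<in> S \<Longrightarrow> \<phi> x = \<psi> x"
  shows "cintegral M \<mu> \<phi> = cintegral M \<mu> \<psi>"
  unfolding cintegral_def
proof (rule integral_cong_AE)
  let ?V = "completion (variation M \<mu>)"
  show "(\<lambda>x. \<phi> x * polar_density M \<mu> x) \<in> borel_measurable ?V"
    "(\<lambda>x. \<psi> x * polar_density M \<mu> x) \<in> borel_measurable ?V"
    by (intro measurable_completion; use assms polar_density_measurable[OF assms(2)] in simp)+
  have "AE x in ?V. x \<notin> space M - S"
    using assms(1) unfolding concentrated_on_def cnegligible_def by (rule AE_not_in)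
  then show "AE x in ?V. \<phi> x * polar_density M \<mu> x = \<psi> x * polar_density M \<mu> x"
    by (rule AE_mp, intro AE_I2) (simp add: eq)
qed

lemma complex_measure_concentrated:
  assumes c: "concentrated_on M \<mu> S" and cm: "complex_measure M \<mu>"
    and E: "E \<in> sets M" "E \<inter> S = {}"
  shows "\<mu> E = 0"
proof -
  have "E \<subseteq> space M - S" using E sets.sets_into_space by blast
  then have "E \<in> null_sets (completion (variation M \<mu>))"
    using c unfolding concentrated_on_def cnegligible_def by (rule null_sets_completion_subset)
  then have "emeasure (variation M \<mu>) E = 0"
    using E(1) by (auto simp: null_sets_def)
  then have "ennreal (cmod (\<mu> E)) \<le> 0" using norm_le_variation[OF cm E(1)] by simp
  then show ?thesis by simp
qed

text \<open>Reduces negligibility and absolute continuity to values of \<open>\<mu>\<close> on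
  subsets, and these are accessible to moments.\<close>

lemma variation_null_iff:
  assumes cm: "complex_measure M \<mu>" and A: "A \<in> sets M"
  shows "emeasure (variation M \<mu>) A = 0 \<longleftrightarrow> (\<forall>E\<in>sets M. E \<subseteq> A \<longrightarrow> \<mu> E = 0)"
proof
  assume 0: "emeasure (variation M \<mu>) A = 0"
  show "\<forall>E\<in>sets M. E \<subseteq> A \<longrightarrow> \<mu> E = 0"
  proof (intro ballI impI)
    fix E assume E: "E \<in> sets M" "E \<subseteq> A"
    have "ennreal (cmod (\<mu> E)) \<le> emeasure (variation M \<mu>) E" by (rule norm_le_variation[OF cm E(1)])
    also have "\<dots> \<le> emeasure (variation M \<mu>) A" by (rule emeasure_mono) (use E A in simp_all)
    finally show "\<mu> E = 0" using 0 by simp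
  qed
next
  assume *: "\<forall>E\<in>sets M. E \<subseteq> A \<longrightarrow> \<mu> E = 0"
  have "total_variation M \<mu> A \<le> 0"
    unfolding total_variation_def
  proof (rule SUP_least)
    fix P assume P: "P \<in> countable_partitions M A"
    have "\<mu> (P i) = 0" for i
      using P * by (auto simp: countable_partitions_def)
    then show "(\<Sum>i. ennreal (cmod (\<mu> (P i)))) \<le> 0" by simp
  qed
  then show "emeasure (variation M \<mu>) A = 0" using emeasure_variation[OF cm A] by simp
qed

section \<open>Functions that are homogeneous under the circle action\<close>

text \<open>On the unit circle this is the integer power; inside the disc it is the harmonic extension.\<close>

definition hpow :: "int \<Rightarrow> complex \<Rightarrow> complex" where
  "hpow k w = (if 0 \<le> k then w ^ nat k else cnj w ^ nat (- k))"

lemma hpow_0 [simp]: "hpow 0 w = 1"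
  by (simp add: hpow_def)

lemma hpow_of_nat [simp]: "hpow (int n) w = w ^ n"
  by (simp add: hpow_def)

lemma hpow_1 [simp]: "hpow 1 w = w"
  by (simp add: hpow_def)

lemma hpow_uminus: "hpow (- k) w = cnj (hpow k w)"
  by (cases k rule: linorder_cases[of _ 0]) (simp_all add: hpow_def)

lemma hpow_mult: "hpow k (v * w) = hpow k v * hpow k w"
  by (simp add: hpow_def power_mult_distrib)

lemma norm_hpow: "norm (hpow k w) = norm w ^ nat \<bar>k\<bar>"
  by (simp add: hpow_def norm_power)

lemma hpow_of_real: "hpow k (of_real r) = of_real r ^ nat \<bar>k\<bar>"
  by (simp add: hpow_def)

lemma hpow_eq_powi: "cmod w = 1 \<Longrightarrow> hpow k w = w powi k"
  using complex_norm_square[of w] inverse_unique[of w "cnj w"]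
  by (auto simp: hpow_def power_int_def)

lemma hpow_add: "cmod w = 1 \<Longrightarrow> hpow (j + k) w = hpow j w * hpow k w"
  using power_int_add[of w j k] by (simp add: hpow_eq_powi) (metis norm_zero zero_neq_one)

lemma hpow_uminus_mult_self [simp]: "cmod w = 1 \<Longrightarrow> hpow (- k) w * hpow k w = 1"
  using hpow_add[of w "- k" k] by simp

lemma norm_hpow_unit [simp]: "cmod w = 1 \<Longrightarrow> cmod (hpow k w) = 1"
  by (simp add: norm_hpow)

lemma continuous_on_hpow [continuous_intros]:
  "continuous_on S f \<Longrightarrow> continuous_on S (\<lambda>x. hpow k (f x))"
  unfolding hpow_def by (cases "0 \<le> k") (auto intro!: continuous_intros)

lemma hpow_measurable [measurable]: "hpow k \<in> borel_measurable borel"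
  by (intro borel_measurable_continuous_onI continuous_intros)

definition circle_homogeneous :: "(complex^'n) set \<Rightarrow> int \<Rightarrow> (complex^'n \<Rightarrow> complex) \<Rightarrow> bool" where
  "circle_homogeneous S k \<phi> \<longleftrightarrow> continuous_on S \<phi> \<and>
     (\<forall>\<alpha> z. cmod \<alpha> = 1 \<longrightarrow> z \<in> S \<longrightarrow> \<phi> (\<alpha> *s z) = hpow k \<alpha> * \<phi> z)"

lemma circle_homogeneous_mult:
  assumes "circle_homogeneous S j \<phi>" "circle_homogeneous S k \<psi>"
  shows "circle_homogeneous S (j + k) (\<lambda>z. \<phi> z * \<psi> z)"
  using assms unfolding circle_homogeneous_def
  by (auto intro!: continuous_intros simp: hpow_add)

lemma circle_homogeneous_cnj:
  assumes "circle_homogeneous S k \<phi>"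
  shows "circle_homogeneous S (- k) (\<lambda>z. cnj (\<phi> z))"
  using assms unfolding circle_homogeneous_def
  by (auto intro!: continuous_intros simp: hpow_uminus)

text \<open>Closed under products as well, because degrees add on the unit circle; the sums thus
  form an algebra large enough to contain all real polynomials.\<close>

inductive homogeneous_sum :: "(complex^'n) set \<Rightarrow> (complex^'n \<Rightarrow> complex) \<Rightarrow> bool" for S where
  hom: "circle_homogeneous S k \<phi> \<Longrightarrow> homogeneous_sum S \<phi>"
| add: "homogeneous_sum S \<phi> \<Longrightarrow> homogeneous_sum S \<psi> \<Longrightarrow> homogeneous_sum S (\<lambda>z. \<phi> z + \<psi> z)"

lemma homogeneous_sum_mult:
  assumes "homogeneous_sum S \<phi>" "homogeneous_sum S \<psi>"
  shows "homogeneous_sum S (\<lambda>z. \<phi> z * \<psi> z)"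
  using assms(1)
proof induction
  case (hom k \<phi>)
  from assms(2) show ?case
  proof induction
    case (hom j \<psi>)
    show ?case by (rule homogeneous_sum.hom[OF circle_homogeneous_mult[OF \<open>circle_homogeneous S k \<phi>\<close> hom]])
  next
    case (add \<psi>1 \<psi>2)
    then show ?case
      using homogeneous_sum.add[of S "\<lambda>z. \<phi> z * \<psi>1 z" "\<lambda>z. \<phi> z * \<psi>2 z"] by (simp add: distrib_left)
  qed
next
  case (add \<phi>1 \<phi>2)
  then show ?case
    using homogeneous_sum.add[of S "\<lambda>z. \<phi>1 z * \<psi> z" "\<lambda>z. \<phi>2 z * \<psi> z"] by (simp add: distrib_right)
qed

lemma complex_scale_eq: "(\<alpha> *s z :: complex^'n) = Re \<alpha> *\<^sub>R z + Im \<alpha> *\<^sub>R (\<i> *s z)"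
  by (simp add: vec_eq_iff complex_eq_iff algebra_simps)

text \<open>A real-linear form is twice the real part of a complex-linear one, that is, a sum of
  terms of degrees 1 and -1.\<close>

lemma homogeneous_sum_linear:
  fixes f :: "complex^'n \<Rightarrow> real"
  assumes "bounded_linear f"
  shows "homogeneous_sum S (\<lambda>z. complex_of_real (f z))"
proof -
  interpret bounded_linear f by fact
  define A where "A = (\<lambda>z::complex^'n. (complex_of_real (f z) - \<i> * complex_of_real (f (\<i> *s z))) / 2)"
  have sc: "A (\<alpha> *s z) = \<alpha> * A z" for \<alpha> z
  proof -
    have 1: "f (\<alpha> *s z) = Re \<alpha> * f z + Im \<alpha> * f (\<i> *s z)"
      by (subst complex_scale_eq) (simp add: add scaleR)
    have "\<i> *s (\<alpha> *s z) = Re \<alpha> *\<^sub>R (\<i> *s z) - Im \<alpha> *\<^sub>R z"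
      by (simp add: vec_eq_iff complex_eq_iff algebra_simps)
    then have 2: "f (\<i> *s (\<alpha> *s z)) = Re \<alpha> * f (\<i> *s z) - Im \<alpha> * f z"
      by (simp add: diff scaleR)
    show ?thesis unfolding A_def 1 2 by (simp add: complex_eq_iff algebra_simps)
  qed
  have "continuous_on S (\<lambda>z. f (\<i> *s z))"
    unfolding vector_scalar_mult_def
    by (intro continuous_on[OF continuous_on_vec_lambda] continuous_intros)
  then have "continuous_on S A"
    unfolding A_def by (intro continuous_intros continuous_on[OF continuous_on_id]) auto
  then have hA: "circle_homogeneous S 1 A"
    by (simp add: circle_homogeneous_def sc)
  have "complex_of_real (f z) = A z + cnj (A z)" for z
    by (simp add: A_def complex_eq_iff)
  then show ?thesis
    using homogeneous_sum.add[OF homogeneous_sum.hom[OF hA] homogeneous_sum.hom[OF circle_homogeneous_cnj[OF hA]]]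
    by simp
qed

lemma homogeneous_sum_const: "homogeneous_sum S (\<lambda>_. c)"
  by (rule homogeneous_sum.hom[of _ 0]) (simp add: circle_homogeneous_def)

lemma homogeneous_sum_real_polynomial:
  fixes p :: "complex^'n \<Rightarrow> real"
  assumes "real_polynomial_function p"
  shows "homogeneous_sum S (\<lambda>z. complex_of_real (p z))"
  using assms
  by induction (auto intro: homogeneous_sum_linear homogeneous_sum_const homogeneous_sum.add
      homogeneous_sum_mult)

lemma homogeneous_sum_continuous: "homogeneous_sum S \<phi> \<Longrightarrow> continuous_on S \<phi>"
  by (induction rule: homogeneous_sum.induct) (auto simp: circle_homogeneous_def intro: continuous_intros)

section \<open>Uniqueness of measures\<close>

text \<open>Dynkin's argument. The whole space belongs to the generator because the step to
  complements compares total masses.\<close>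

lemma complex_measure_eqI:
  assumes cm: "complex_measure Q \<nu>1" "complex_measure Q \<nu>2"
    and Q: "sets Q = sigma_sets (space Q) G" "Int_stable G" "G \<subseteq> Pow (space Q)" "space Q \<in> G"
    and eq: "\<And>V. V \<in> G \<Longrightarrow> \<nu>1 V = \<nu>2 V" and V: "V \<in> sets Q"
  shows "\<nu>1 V = \<nu>2 V"
  using Q(2,3) V[unfolded Q(1)]
proof (induction rule: sigma_sets_induct_disjoint)
  case (basic A)
  then show ?case by (rule eq)
next
  case empty
  then show ?case using complex_measure_empty[OF cm(1)] complex_measure_empty[OF cm(2)] by simp
next
  case (compl A)
  have A: "A \<in> sets Q" using compl(1) Q(1) by simp
  then have "A \<union> (space Q - A) = space Q" using sets.sets_into_space by blast
  then have "\<nu> (space Q) = \<nu> A + \<nu> (space Q - A)" if "complex_measure Q \<nu>" for \<nu>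
    using complex_measure_Un[OF that A sets.Diff[OF sets.top A]] by simp
  from this[OF cm(1)] this[OF cm(2)] show ?case using compl(2) eq[OF Q(4)] by simp
next
  case (union A)
  have A: "range A \<subseteq> sets Q" using union(2) Q(1) by simp
  have "(\<lambda>i. \<nu>1 (A i)) sums \<nu>1 (\<Union>i. A i)" "(\<lambda>i. \<nu>2 (A i)) sums \<nu>2 (\<Union>i. A i)"
    by (rule complex_measure_sums[OF cm(1) A union(1)], rule complex_measure_sums[OF cm(2) A union(1)])
  then show ?case unfolding union(3) by (rule sums_unique2)
qed

text \<open>The image under \<open>p\<close> of the measure with density \<open>g\<close>. It is
  used with the identity, with the projection to orbits and with a coordinate along an
  orbit.\<close>

lemma set_integral_complex_measure:
  fixes g :: "'a \<Rightarrow> complex"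
  assumes g: "integrable N g" and p: "p \<in> measurable N Q"
  shows "complex_measure Q (\<lambda>V. LINT x:(p -` V \<inter> space N)|N. g x)"
  unfolding complex_measure_def
proof (intro conjI allI impI)
  show "(LINT x:(p -` {} \<inter> space N)|N. g x) = 0" by (simp add: set_lebesgue_integral_def)
  fix A :: "nat \<Rightarrow> 'b set" assume A: "range A \<subseteq> sets Q \<and> disjoint_family A"
  define B where "B = (\<lambda>i. p -` A i \<inter> space N)"
  have B: "B i \<in> sets N" for i
    unfolding B_def using A by (intro measurable_sets[OF p]) blast
  have disj: "disjoint_family B"
    using A unfolding B_def disjoint_family_on_def by blast
  have UN: "p -` (\<Union>i. A i) \<inter> space N = (\<Union>i. B i)" by (auto simp: B_def)
  have int: "integrable N (\<lambda>x. indicat_real (B i) x *\<^sub>R g x)" for i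
    by (rule integrable_mult_indicator[OF B g])
  have ptw: "(\<lambda>i. indicat_real (B i) x * c) sums (indicat_real (\<Union>i. B i) x * c)" for x c
  proof (cases "x \<in> (\<Union>i. B i)")
    case True
    then obtain j where j: "x \<in> B j" by blast
    have "x \<notin> B i" if "i \<noteq> j" for i
      using disj j that unfolding disjoint_family_on_def by blast
    then have "(\<lambda>i. indicat_real (B i) x * c) = (\<lambda>i. if i = j then c else 0)"
      using j by (auto simp: indicator_def)
    then show ?thesis using True sums_single[of j "\<lambda>_. c"] by simp
  next
    case False
    then have "(\<lambda>i. indicat_real (B i) x * c) = (\<lambda>i. 0)" by auto
    then show ?thesis using False by simp
  qed
  have s1: "(\<lambda>i. norm (indicat_real (B i) x *\<^sub>R g x)) sums (indicat_real (\<Union>i. B i) x * norm (g x))" for x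
    using ptw[of x "norm (g x)"] by simp
  have int': "integrable N (\<lambda>x. norm (indicat_real (B i) x *\<^sub>R g x))" for i
    by (rule integrable_norm[OF int])
  have s2: "summable (\<lambda>i. LINT x|N. norm (indicat_real (B i) x *\<^sub>R g x))"
  proof (rule bounded_imp_summable[where B="LINT x|N. norm (g x)"])
    fix n
    have "(\<Sum>i\<le>n. LINT x|N. norm (indicat_real (B i) x *\<^sub>R g x))
        = (LINT x|N. (\<Sum>i\<le>n. norm (indicat_real (B i) x *\<^sub>R g x)))"
      by (rule Bochner_Integration.integral_sum[symmetric]) (rule int')
    also have "\<dots> \<le> (LINT x|N. norm (g x))"
    proof (rule integral_mono)
      fix x
      have "(\<Sum>i\<in>{..n}. norm (indicat_real (B i) x *\<^sub>R g x)) \<le> (\<Sum>i. norm (indicat_real (B i) x *\<^sub>R g x))"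
        by (rule sum_le_suminf[OF sums_summable[OF s1]]) auto
      also have "\<dots> = indicat_real (\<Union>i. B i) x * norm (g x)" using s1 by (rule sums_unique[symmetric])
      also have "\<dots> \<le> norm (g x)" by (simp add: indicator_def)
      finally show "(\<Sum>i\<le>n. norm (indicat_real (B i) x *\<^sub>R g x)) \<le> norm (g x)" .
    qed (intro Bochner_Integration.integrable_sum int' integrable_norm g)+
    finally show "(\<Sum>i\<le>n. LINT x|N. norm (indicat_real (B i) x *\<^sub>R g x)) \<le> (LINT x|N. norm (g x))" .
  qed simp
  have "(\<Sum>i. indicat_real (B i) x *\<^sub>R g x) = indicat_real (\<Union>i. B i) x *\<^sub>R g x" for x
    using sums_unique[OF sums_scaleR_left[OF ptw[of x 1], of "g x"]] by simp
  then show "(\<lambda>i. LINT x:(p -` A i \<inter> space N)|N. g x) sums (LINT x:(p -` (\<Union>i. A i) \<inter> space N)|N. g x)"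
    using sums_integral[OF int AE_I2[OF sums_summable[OF s1]] s2]
    unfolding UN B_def[symmetric] set_lebesgue_integral_def by (simp add: B_def)
qed

lemma sets_borel_on:
  fixes S :: "'a::topological_space set"
  assumes "closed S"
  shows "sets (borel_on S) = sigma_sets S ((\<inter>) S ` {U. open U})"
proof -
  have "S \<in> sigma_sets UNIV {U::'a set. open U}"
    using assms borel_closed[of S] by (simp add: borel_def)
  from sigma_sets_Int[OF this] show ?thesis
    by (simp add: sets_restrict_space borel_def)
qed

text \<open>These approximants depend on distances only, so they inherit every isometric symmetry of
  \<open>S - U\<close>; the moments over saturated open sets rely on this. The set
  \<open>S - U\<close> must not be empty because \<open>infdist\<close> to the empty set is 0 by
  convention.\<close>

lemma indicator_open_approx:
  fixes S :: "'a::metric_space set"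
  assumes U: "open U" and x: "x \<in> S" and ne: "S - U \<noteq> {}"
  shows "(\<lambda>n. min 1 (real n * infdist x (S - U))) \<longlonglongrightarrow> indicator (S \<inter> U) x"
proof (cases "x \<in> U")
  case True
  have "x \<notin> closure (S - U)"
    using True U closure_minimal[of "S - U" "- U"] by auto
  then have "infdist x (S - U) > 0"
    using in_closure_iff_infdist_zero[OF ne, of x] infdist_nonneg[of x "S - U"] by auto
  then have "eventually (\<lambda>n. real n * infdist x (S - U) \<ge> 1) sequentially"
    by real_asymp
  then have "eventually (\<lambda>n. min 1 (real n * infdist x (S - U)) = indicator (S \<inter> U) x) sequentially"
    by eventually_elim (use True x in auto)
  then show ?thesis by (rule tendsto_eventually)
next
  case False
  then have "infdist x (S - U) = 0" using x by auto
  then show ?thesis using False by simp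
qed

lemma continuous_imp_borel_on:
  fixes \<phi> :: "'a::topological_space \<Rightarrow> 'b::topological_space"
  assumes "continuous_on S \<phi>" shows "\<phi> \<in> borel_measurable (borel_on S)"
  using assms by (rule borel_measurable_continuous_on_restrict)

lemma set_integral_open_limit:
  fixes g :: "'a::metric_space \<Rightarrow> complex"
  assumes g: "integrable N g" and N: "sets N = sets (borel_on S)"
    and U: "open U" and ne: "S - U \<noteq> {}"
  shows "(\<lambda>n. LINT x|N. of_real (min 1 (real n * infdist x (S - U))) * g x) \<longlonglongrightarrow> (LINT x:(S \<inter> U)|N. g x)"
proof -
  have sp: "space N = S" using sets_eq_imp_space_eq[OF N] by (simp add: space_restrict_space)
  let ?f = "\<lambda>n x. min 1 (real n * infdist x (S - U))"
  have cont: "continuous_on S (?f n)" for n by (intro continuous_intros)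
  have meas: "?f n \<in> borel_measurable N" for n
    using continuous_imp_borel_on[OF cont[of n]] N by (simp cong: measurable_cong_sets)
  have SU: "S \<inter> U \<in> sets N"
    using U by (simp add: N sets_restrict_space)
  show ?thesis
    unfolding set_lebesgue_integral_def scaleR_conv_of_real
  proof (rule integral_dominated_convergence[where w="\<lambda>x. cmod (g x)"])
    have gm: "g \<in> borel_measurable N" using g by simp
    show "(\<lambda>x. complex_of_real (indicator (S \<inter> U) x) * g x) \<in> borel_measurable N"
      using SU gm by measurable
    show "(\<lambda>x. complex_of_real (?f n x) * g x) \<in> borel_measurable N" for n
      using meas[of n] gm by simp
    show "integrable N (\<lambda>x. cmod (g x))" using g by simp
    show "AE x in N. (\<lambda>n. complex_of_real (?f n x) * g x) \<longlonglongrightarrow> complex_of_real (indicator (S \<inter> U) x) * g x"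
      by (intro AE_I2 tendsto_mult tendsto_of_real tendsto_const indicator_open_approx U ne)
        (simp add: sp)
    show "AE x in N. norm (complex_of_real (?f n x) * g x) \<le> cmod (g x)" for n
    proof (rule AE_I2)
      fix x
      have "0 \<le> ?f n x" "?f n x \<le> 1" by (simp_all add: infdist_nonneg)
      then have "\<bar>?f n x\<bar> * cmod (g x) \<le> 1 * cmod (g x)" by (intro mult_right_mono) simp_all
      then show "norm (complex_of_real (?f n x) * g x) \<le> cmod (g x)" by (simp only: norm_mult norm_of_real mult_1)
    qed
  qed
qed

text \<open>The vanishing of homogeneous moments passes to real polynomials by additivity, to
  continuous functions by uniform approximation, to relatively open sets by dominated convergence
  and to Borel sets by Dynkin's argument.\<close>

lemma homogeneous_moments_zero:
  fixes g :: "complex^'n \<Rightarrow> complex"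
  assumes S: "compact S" and N: "sets N = sets (borel_on S)" and g: "integrable N g"
    and zero: "\<And>k \<phi>. circle_homogeneous S k \<phi> \<Longrightarrow> (LINT x|N. \<phi> x * g x) = 0"
    and E: "E \<in> sets (borel_on S)"
  shows "(LINT x:E|N. g x) = 0"
proof -
  have sp: "space N = S" using sets_eq_imp_space_eq[OF N] by (simp add: space_restrict_space)
  have int: "integrable N (\<lambda>x. \<phi> x * g x)" if \<phi>: "continuous_on S \<phi>" for \<phi>
  proof -
    obtain B where "\<And>x. x \<in> S \<Longrightarrow> cmod (\<phi> x) \<le> B"
      using compact_imp_bounded[OF compact_continuous_image[OF \<phi> S]] unfolding bounded_iff by blast
    moreover have "\<phi> \<in> borel_measurable N"
      using continuous_imp_borel_on[OF \<phi>] N by (simp cong: measurable_cong_sets)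
    ultimately show ?thesis using integrable_bounded_mult[OF g] sp by blast
  qed
  have hs: "(LINT x|N. \<phi> x * g x) = 0" if "homogeneous_sum S \<phi>" for \<phi>
    using that
  proof induction
    case (add \<phi> \<psi>)
    then show ?case
      using int[OF homogeneous_sum_continuous[OF add(1)]] int[OF homogeneous_sum_continuous[OF add(2)]]
      by (simp add: distrib_right)
  qed (rule zero)
  have cont: "(LINT x|N. of_real (\<psi> x) * g x) = 0" if \<psi>: "continuous_on S \<psi>" for \<psi> :: "complex^'n \<Rightarrow> real"
  proof -
    have le: "cmod (LINT x|N. of_real (\<psi> x) * g x) \<le> e * (LINT x|N. cmod (g x))" if e: "e > 0" for e
    proof -
      obtain p where p: "real_polynomial_function p" "\<And>x. x \<in> S \<Longrightarrow> \<bar>\<psi> x - p x\<bar> < e"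
        using Stone_Weierstrass_real_polynomial_function[OF S \<psi> e] by blast
      have c: "continuous_on S (\<lambda>x. complex_of_real (\<psi> x))" "continuous_on S (\<lambda>x. complex_of_real (p x))"
        using \<psi> homogeneous_sum_continuous[OF homogeneous_sum_real_polynomial[OF p(1)]]
        by (auto intro: continuous_intros)
      have "(LINT x|N. of_real (\<psi> x) * g x) = (LINT x|N. of_real (\<psi> x) * g x - of_real (p x) * g x)"
        using hs[OF homogeneous_sum_real_polynomial[OF p(1)]] int[OF c(1)] int[OF c(2)] by simp
      also have "cmod \<dots> \<le> (LINT x|N. e * cmod (g x))"
      proof (rule Bochner_Integration.integral_norm_bound_integral)
        show "integrable N (\<lambda>x. of_real (\<psi> x) * g x - of_real (p x) * g x)"
          by (intro Bochner_Integration.integrable_diff int c)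
        show "integrable N (\<lambda>x. e * cmod (g x))" using g by simp
        fix x assume "x \<in> space N"
        then have "\<bar>\<psi> x - p x\<bar> \<le> e" using p(2)[of x] sp by simp
        then show "norm (of_real (\<psi> x) * g x - of_real (p x) * g x) \<le> e * cmod (g x)"
          by (simp add: left_diff_distrib[symmetric] norm_mult mult_right_mono flip: of_real_diff)
      qed
      finally show ?thesis by simp
    qed
    have "((\<lambda>e. e * (LINT x|N. cmod (g x))) \<longlongrightarrow> 0 * (LINT x|N. cmod (g x))) (at_right 0)"
      by (intro tendsto_intros)
    then have "cmod (LINT x|N. of_real (\<psi> x) * g x) \<le> 0 * (LINT x|N. cmod (g x))"
      by (rule tendsto_lowerbound) (auto simp: le eventually_at_right_less intro: eventually_mono[OF eventually_at_right_less])
    then show ?thesis by simp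
  qed
  have idm: "id \<in> measurable N (borel_on S)"
    using N by (simp add: measurable_cong_sets[OF N refl] measurable_ident_sets)
  have "(LINT x:(id -` E \<inter> space N)|N. g x) = 0"
  proof (rule complex_measure_eqI[OF set_integral_complex_measure[OF g idm], of "\<lambda>_. 0" "(\<inter>) S ` {U. open U}"])
    show "complex_measure (borel_on S) (\<lambda>_. 0)" by (simp add: complex_measure_def)
    show "sets (borel_on S) = sigma_sets (space (borel_on S)) ((\<inter>) S ` {U. open U})"
      using sets_borel_on[OF compact_imp_closed[OF S]] by (simp add: space_restrict_space)
    show "Int_stable ((\<inter>) S ` {U. open U})"
    proof (rule Int_stableI_image)
      fix U V :: "(complex^'n) set" assume "U \<in> {U. open U}" "V \<in> {U. open U}"
      then show "\<exists>k\<in>{U. open U}. S \<inter> U \<inter> (S \<inter> V) = S \<inter> k"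
        by (intro bexI[of _ "U \<inter> V"]) auto
    qed
    show "(\<inter>) S ` {U. open U} \<subseteq> Pow (space (borel_on S))" by (auto simp: space_restrict_space)
    show "space (borel_on S) \<in> (\<inter>) S ` {U. open U}"
      by (auto simp: space_restrict_space intro!: image_eqI[of _ _ UNIV])
    fix V assume "V \<in> (\<inter>) S ` {U. open U}"
    then obtain U where U: "open U" "V = S \<inter> U" by blast
    have "(LINT x:(S \<inter> U)|N. g x) = 0"
    proof (cases "S - U = {}")
      case True
      then have "S \<inter> U = S" by blast
      then have "(LINT x:(S \<inter> U)|N. g x) = (LINT x|N. of_real 1 * g x)"
        unfolding set_lebesgue_integral_def
        by (intro Bochner_Integration.integral_cong) (auto simp: sp)
      also have "\<dots> = 0" by (rule cont) (intro continuous_intros)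
      finally show ?thesis .
    next
      case False
      have "(LINT x|N. of_real (min 1 (real n * infdist x (S - U))) * g x) = 0" for n
        by (rule cont) (intro continuous_intros)
      then show ?thesis
        using LIMSEQ_unique[OF set_integral_open_limit[OF g N U(1) False]] by simp
    qed
    then show "(LINT x:(id -` V \<inter> space N)|N. g x) = 0"
      using U by (simp add: sp Int_commute Int_left_commute)
  qed (rule E)
  moreover have "id -` E \<inter> space N = E" using E N sets.sets_into_space[of E N] by auto
  ultimately show ?thesis by simp
qed

section \<open>Harmonic functions on the disc\<close>

text \<open>The second difference is symmetric in the two directions, so evaluating it in both
  orders compares the two mixed derivatives. Two applications of the one-variable mean value theorem
  locate the point.\<close>

lemma rectangle_mean_value:
  fixes u :: "complex \<Rightarrow> real"
  assumes s: "0 < s" "2 * s < r" and e: "cmod e1 = 1" "cmod e2 = 1"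
    and p: "\<And>z. z \<in> ball w r \<Longrightarrow> (\<exists>L. (u has_derivative L) (at z) \<and> L e1 = p z)"
    and q: "\<And>z. z \<in> ball w r \<Longrightarrow> (\<exists>L. (p has_derivative L) (at z) \<and> L e2 = q z)"
  shows "\<exists>z\<in>cball w (2 * s). u (w + s *\<^sub>R e1 + s *\<^sub>R e2) - u (w + s *\<^sub>R e1) - u (w + s *\<^sub>R e2) + u w
     = s\<^sup>2 * q z"
proof -
  have inb: "w + x *\<^sub>R e1 + y *\<^sub>R e2 \<in> cball w (2 * s)"
    if "0 \<le> x" "x \<le> s" "0 \<le> y" "y \<le> s" for x y
  proof -
    have "dist w (w + x *\<^sub>R e1 + y *\<^sub>R e2) = norm (x *\<^sub>R e1 + y *\<^sub>R e2)"
      by (metis add.assoc add_diff_cancel_left' dist_commute dist_norm)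
    then show ?thesis
      using norm_triangle_ineq[of "x *\<^sub>R e1" "y *\<^sub>R e2"] that e by simp
  qed
  have inb': "w + x *\<^sub>R e1 + y *\<^sub>R e2 \<in> ball w r"
    if "0 \<le> x" "x \<le> s" "0 \<le> y" "y \<le> s" for x y
    using inb[OF that] s by simp
  have chain: "((\<lambda>t. f (c + t *\<^sub>R d)) has_real_derivative L d) (at t)"
    if "(f has_derivative L) (at (c + t *\<^sub>R d))" for f :: "complex \<Rightarrow> real" and L c d t
  proof -
    have "((\<lambda>t. c + t *\<^sub>R d) has_derivative (\<lambda>h. h *\<^sub>R d)) (at t)"
      by (auto intro!: derivative_eq_intros)
    from has_derivative_compose[OF this that]
    have "((\<lambda>t. f (c + t *\<^sub>R d)) has_derivative (\<lambda>h. L (h *\<^sub>R d))) (at t)" .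
    moreover have "L (h *\<^sub>R d) = h * L d" for h
      using linear_scale[OF has_derivative_linear[OF that]] by simp
    ultimately show ?thesis by (simp add: has_field_derivative_def mult_commute_abs)
  qed
  define \<phi> where "\<phi> = (\<lambda>x. u (w + s *\<^sub>R e2 + x *\<^sub>R e1) - u (w + x *\<^sub>R e1))"
  have d\<phi>: "(\<phi> has_real_derivative (p (w + s *\<^sub>R e2 + x *\<^sub>R e1) - p (w + x *\<^sub>R e1))) (at x)"
    if x: "0 \<le> x" "x \<le> s" for x
  proof -
    obtain L1 where L1: "(u has_derivative L1) (at (w + s *\<^sub>R e2 + x *\<^sub>R e1))" "L1 e1 = p (w + s *\<^sub>R e2 + x *\<^sub>R e1)"
      using p[OF inb'[of x s]] x s by (auto simp: add.commute add.left_commute)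
    obtain L2 where L2: "(u has_derivative L2) (at (w + x *\<^sub>R e1))" "L2 e1 = p (w + x *\<^sub>R e1)"
      using p[OF inb'[of x 0]] x s by auto
    show ?thesis
      unfolding \<phi>_def using DERIV_diff[OF chain[OF L1(1)] chain[OF L2(1)]] L1(2) L2(2) by simp
  qed
  obtain x where x: "0 < x" "x < s" "\<phi> s - \<phi> 0 = (s - 0) * (p (w + s *\<^sub>R e2 + x *\<^sub>R e1) - p (w + x *\<^sub>R e1))"
    using MVT2[OF s(1), of \<phi> "\<lambda>x. p (w + s *\<^sub>R e2 + x *\<^sub>R e1) - p (w + x *\<^sub>R e1)"] d\<phi> by blast
  have dp: "((\<lambda>y. p ((w + x *\<^sub>R e1) + y *\<^sub>R e2)) has_real_derivative q (w + x *\<^sub>R e1 + y *\<^sub>R e2)) (at y)"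
    if y: "0 \<le> y" "y \<le> s" for y
  proof -
    obtain L where L: "(p has_derivative L) (at (w + x *\<^sub>R e1 + y *\<^sub>R e2))" "L e2 = q (w + x *\<^sub>R e1 + y *\<^sub>R e2)"
      using q[OF inb'[of x y]] x y by auto
    show ?thesis using chain[OF L(1)] L(2) by simp
  qed
  obtain y where y: "0 < y" "y < s"
    "p ((w + x *\<^sub>R e1) + s *\<^sub>R e2) - p ((w + x *\<^sub>R e1) + 0 *\<^sub>R e2) = (s - 0) * q (w + x *\<^sub>R e1 + y *\<^sub>R e2)"
    using MVT2[OF s(1), of "\<lambda>y. p ((w + x *\<^sub>R e1) + y *\<^sub>R e2)" "\<lambda>y. q (w + x *\<^sub>R e1 + y *\<^sub>R e2)"] dp
    by blast
  have "u (w + s *\<^sub>R e1 + s *\<^sub>R e2) - u (w + s *\<^sub>R e1) - u (w + s *\<^sub>R e2) + u w = \<phi> s - \<phi> 0"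
    by (simp add: \<phi>_def algebra_simps)
  also have "\<dots> = s\<^sup>2 * q (w + x *\<^sub>R e1 + y *\<^sub>R e2)"
    using x(3) y(3) by (simp add: algebra_simps power2_eq_square)
  finally show ?thesis using inb[of x y] x y by (intro bexI[of _ "w + x *\<^sub>R e1 + y *\<^sub>R e2"]) auto
qed

text \<open>Schwarz's theorem. The notion \<open>harmonic_on\<close> keeps \<open>uxy\<close> and
  \<open>uyx\<close> apart, and their equality is one of the two Cauchy-Riemann conditions for
  \<open>ux - \<i> * uy\<close>.\<close>

lemma mixed_derivatives_commute:
  fixes u :: "complex \<Rightarrow> real"
  assumes "open U" "w \<in> U"
    and d: "\<And>z. z \<in> U \<Longrightarrow> (u has_derivative (\<lambda>h. Re h * ux z + Im h * uy z)) (at z)"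
      "\<And>z. z \<in> U \<Longrightarrow> (ux has_derivative (\<lambda>h. Re h * uxx z + Im h * uxy z)) (at z)"
      "\<And>z. z \<in> U \<Longrightarrow> (uy has_derivative (\<lambda>h. Re h * uyx z + Im h * uyy z)) (at z)"
    and c: "continuous_on U uxy" "continuous_on U uyx"
  shows "uxy w = uyx w"
proof (rule ccontr)
  assume ne: "uxy w \<noteq> uyx w"
  define e where "e = \<bar>uxy w - uyx w\<bar> / 2"
  have e: "e > 0" using ne by (simp add: e_def)
  obtain r0 where r0: "r0 > 0" "ball w r0 \<subseteq> U" using assms(1,2) open_contains_ball by blast
  have "isCont uxy w" "isCont uyx w"
    using c assms(1,2) continuous_on_eq_continuous_at by blast+
  then obtain r1 r2 where r1: "r1 > 0" "\<And>z. dist z w < r1 \<Longrightarrow> dist (uxy z) (uxy w) < e"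
    and r2: "r2 > 0" "\<And>z. dist z w < r2 \<Longrightarrow> dist (uyx z) (uyx w) < e"
    using e unfolding continuous_at_eps_delta by (metis)
  define s where "s = min r0 (min r1 r2) / 4"
  have s: "s > 0" "2 * s < r0" "2 * s < r1" "2 * s < r2"
    using r0(1) r1(1) r2(1) by (auto simp: s_def)
  have inU: "z \<in> U" if "z \<in> ball w r0" for z using that r0 by blast
  obtain z1 where z1: "z1 \<in> cball w (2 * s)"
    "u (w + s *\<^sub>R 1 + s *\<^sub>R \<i>) - u (w + s *\<^sub>R 1) - u (w + s *\<^sub>R \<i>) + u w = s\<^sup>2 * uxy z1"
  proof -
    have "\<exists>z\<in>cball w (2 * s). u (w + s *\<^sub>R 1 + s *\<^sub>R \<i>) - u (w + s *\<^sub>R 1) - u (w + s *\<^sub>R \<i>) + u w = s\<^sup>2 * uxy z"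
      by (rule rectangle_mean_value[OF s(1,2), of 1 \<i> w u ux uxy])
        (use d(1,2)[OF inU] in \<open>fastforce+\<close>)
    then show thesis using that by blast
  qed
  obtain z2 where z2: "z2 \<in> cball w (2 * s)"
    "u (w + s *\<^sub>R \<i> + s *\<^sub>R 1) - u (w + s *\<^sub>R \<i>) - u (w + s *\<^sub>R 1) + u w = s\<^sup>2 * uyx z2"
  proof -
    have "\<exists>z\<in>cball w (2 * s). u (w + s *\<^sub>R \<i> + s *\<^sub>R 1) - u (w + s *\<^sub>R \<i>) - u (w + s *\<^sub>R 1) + u w = s\<^sup>2 * uyx z"
      by (rule rectangle_mean_value[OF s(1,2), of \<i> 1 w u uy uyx])
        (use d(1,3)[OF inU] in \<open>fastforce+\<close>)
    then show thesis using that by blast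
  qed
  have "s\<^sup>2 * uxy z1 = s\<^sup>2 * uyx z2"
    using z1(2) z2(2) by (simp add: algebra_simps)
  then have "uxy z1 = uyx z2" using s(1) by simp
  moreover have "dist z1 w < r1" "dist z2 w < r2"
    using z1(1) z2(1) s by (simp_all add: dist_commute)
  then have "dist (uxy z1) (uxy w) < e" "dist (uyx z2) (uyx w) < e"
    using r1(2) r2(2) by blast+
  ultimately show False by (simp add: e_def dist_real_def abs_if split: if_splits)
qed

lemma has_derivative_Re_Im:
  fixes f :: "complex \<Rightarrow> complex"
  assumes "(f has_derivative (\<lambda>h. Re h *\<^sub>R a + Im h *\<^sub>R b)) (at z)"
  shows "((\<lambda>z. Re (f z)) has_derivative (\<lambda>h. Re h * Re a + Im h * Re b)) (at z)"
    and "((\<lambda>z. Im (f z)) has_derivative (\<lambda>h. Re h * Im a + Im h * Im b)) (at z)"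
  using has_derivative_Re[OF assms] has_derivative_Im[OF assms] by simp_all

text \<open>The Wirtinger derivative \<open>(ux - \<i> * uy) / 2\<close> is holomorphic by the
  Laplace equation and has a primitive \<open>G\<close> on the disc; the remainder u - G has
  vanishing Wirtinger derivative, so its conjugate is holomorphic.\<close>

lemma harmonic_decomposition:
  assumes h: "harmonic_on u U" and sub: "ball 0 R \<subseteq> U"
  shows "\<exists>G H. G holomorphic_on ball 0 R \<and> H holomorphic_on ball 0 R \<and>
    (\<forall>w\<in>ball 0 R. u w = G w + cnj (H w))"
proof -
  let ?B = "ball (0::complex) R"
  obtain ux uy uxx uxy uyx uyy where
    c: "continuous_on U uxy" "continuous_on U uyx" and
    d: "\<And>w. w \<in> U \<Longrightarrow> (u has_derivative (\<lambda>h. Re h *\<^sub>R ux w + Im h *\<^sub>R uy w)) (at w)"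
      "\<And>w. w \<in> U \<Longrightarrow> (ux has_derivative (\<lambda>h. Re h *\<^sub>R uxx w + Im h *\<^sub>R uxy w)) (at w)"
      "\<And>w. w \<in> U \<Longrightarrow> (uy has_derivative (\<lambda>h. Re h *\<^sub>R uyx w + Im h *\<^sub>R uyy w)) (at w)" and
    lap: "\<And>w. w \<in> U \<Longrightarrow> uxx w + uyy w = 0"
    using h unfolding harmonic_on_def by blast
  have sym: "uxy w = uyx w" if w: "w \<in> ?B" for w
  proof (rule complex_eqI)
    have sub': "z \<in> ?B \<Longrightarrow> z \<in> U" for z using sub by blast
    show "Re (uxy w) = Re (uyx w)"
      by (rule mixed_derivatives_commute[OF open_ball w has_derivative_Re_Im(1)[OF d(1)[OF sub']]
            has_derivative_Re_Im(1)[OF d(2)[OF sub']] has_derivative_Re_Im(1)[OF d(3)[OF sub']]])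
        (auto intro!: continuous_intros continuous_on_subset[OF c(1) sub] continuous_on_subset[OF c(2) sub])
    show "Im (uxy w) = Im (uyx w)"
      by (rule mixed_derivatives_commute[OF open_ball w has_derivative_Re_Im(2)[OF d(1)[OF sub']]
            has_derivative_Re_Im(2)[OF d(2)[OF sub']] has_derivative_Re_Im(2)[OF d(3)[OF sub']]])
        (auto intro!: continuous_intros continuous_on_subset[OF c(1) sub] continuous_on_subset[OF c(2) sub])
  qed
  define g where "g = (\<lambda>w. (ux w - \<i> * uy w) * (1 / 2))"
  have dg: "(g has_field_derivative (uxx w - \<i> * uyx w) / 2) (at w)" if w: "w \<in> ?B" for w
  proof -
    have wU: "w \<in> U" using w sub by blast
    have "(g has_derivative (\<lambda>h. ((Re h *\<^sub>R uxx w + Im h *\<^sub>R uxy w) - \<i> * (Re h *\<^sub>R uyx w + Im h *\<^sub>R uyy w)) * (1 / 2))) (at w)"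
      unfolding g_def by (intro derivative_intros d[OF wU])
    moreover have "((Re h *\<^sub>R uxx w + Im h *\<^sub>R uxy w) - \<i> * (Re h *\<^sub>R uyx w + Im h *\<^sub>R uyy w)) * (1 / 2)
        = (uxx w - \<i> * uyx w) / 2 * h" for h
    proof -
      have "uyy w = - uxx w" using lap[OF wU] by (simp add: add_eq_0_iff)
      then show ?thesis by (simp add: sym[OF w] complex_eq_iff algebra_simps)
    qed
    ultimately have "(g has_derivative (\<lambda>h. (uxx w - \<i> * uyx w) / 2 * h)) (at w)"
      by (elim has_derivative_eq_rhs) (rule ext)
    then show ?thesis by (simp only: has_field_derivative_def)
  qed
  then have "g holomorphic_on ?B"
    unfolding holomorphic_on_open[OF open_ball] by blast
  then obtain G where G: "\<And>w. w \<in> ?B \<Longrightarrow> (G has_field_derivative g w) (at w within ?B)"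
    using holomorphic_convex_primitive'[OF convex_ball open_ball] by blast
  then have G': "(G has_field_derivative g w) (at w)" if "w \<in> ?B" for w
    using G[OF that] at_within_open[OF that open_ball] by simp
  define H where "H = (\<lambda>w. cnj (u w - G w))"
  have "(H has_field_derivative cnj ((ux w + \<i> * uy w) / 2)) (at w)" if w: "w \<in> ?B" for w
  proof -
    have wU: "w \<in> U" using w sub by blast
    have "(H has_derivative (\<lambda>h. cnj ((Re h *\<^sub>R ux w + Im h *\<^sub>R uy w) - g w * h))) (at w)"
      unfolding H_def
      by (intro derivative_intros d(1)[OF wU] G'[OF w, unfolded has_field_derivative_def])
    moreover have "cnj ((Re h *\<^sub>R ux w + Im h *\<^sub>R uy w) - g w * h) = cnj ((ux w + \<i> * uy w) / 2) * h" for h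
      by (simp add: g_def complex_eq_iff algebra_simps) (simp add: field_simps)
    ultimately have "(H has_derivative (\<lambda>h. cnj ((ux w + \<i> * uy w) / 2) * h)) (at w)"
      by (elim has_derivative_eq_rhs) (rule ext)
    then show ?thesis by (simp only: has_field_derivative_def)
  qed
  then have "H holomorphic_on ?B" unfolding holomorphic_on_open[OF open_ball] by blast
  moreover have "G holomorphic_on ?B" using G' unfolding holomorphic_on_open[OF open_ball] by blast
  moreover have "u w = G w + cnj (H w)" for w by (simp add: H_def)
  ultimately show ?thesis by blast
qed

section \<open>Integrals over the circle\<close>

text \<open>Extension by zero from a closed product is Borel, and on second countable spaces the
  Borel sets of the product are generated by products of Borel sets.\<close>

lemma continuous_imp_pair_measurable:
  fixes f :: "'a::second_countable_topology \<times> 'b::second_countable_topology \<Rightarrow> complex"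
  assumes cont: "continuous_on (A \<times> B) f" and cl: "closed A" "closed B"
    and M: "sets M = sets (borel_on A)" and N: "sets N = sets (borel_on B)"
  shows "f \<in> borel_measurable (M \<Otimes>\<^sub>M N)"
proof -
  have sp: "space M = A" "space N = B"
    using sets_eq_imp_space_eq[OF M] sets_eq_imp_space_eq[OF N] by (simp_all add: space_restrict_space)
  have "(\<lambda>x. indicator (A \<times> B) x *\<^sub>R f x) \<in> borel_measurable (borel \<Otimes>\<^sub>M borel)"
    unfolding borel_prod using cl
    by (intro borel_measurable_continuous_on_indicator cont) (simp add: borel_closed closed_Times)
  moreover have "(\<lambda>x. x) \<in> measurable (M \<Otimes>\<^sub>M N) (borel \<Otimes>\<^sub>M borel)"
  proof -
    have "(\<lambda>x. x) \<in> measurable M borel" "(\<lambda>x. x) \<in> measurable N borel"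
      by (simp_all add: measurable_cong_sets[OF M refl] measurable_cong_sets[OF N refl]
          measurable_restrict_space1)
    then have "(\<lambda>p. (fst p, snd p)) \<in> measurable (M \<Otimes>\<^sub>M N) (borel \<Otimes>\<^sub>M borel)"
      by (intro measurable_Pair) (auto intro: measurable_compose[OF measurable_fst] measurable_compose[OF measurable_snd])
    then show ?thesis by simp
  qed
  ultimately have "(\<lambda>x. indicator (A \<times> B) x *\<^sub>R f x) \<in> borel_measurable (M \<Otimes>\<^sub>M N)"
    by (rule measurable_compose[rotated])
  then show ?thesis
    by (rule measurable_cong[THEN iffD1, rotated]) (auto simp: space_pair_measure sp)
qed

text \<open>Fubini's theorem for a jointly continuous kernel times a merely measurable bounded
  function of the second variable; polar densities are of the latter kind.\<close>

lemma Fubini_continuous: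
  fixes f :: "'a::second_countable_topology \<Rightarrow> 'b::second_countable_topology \<Rightarrow> complex"
  assumes cont: "continuous_on (A \<times> B) (\<lambda>(x, y). f x y)"
    and cpt: "compact A" "compact B" "closed A" "closed B"
    and M: "sets M = sets (borel_on A)" "finite_measure M"
    and N: "sets N = sets (borel_on B)" "finite_measure N"
    and g: "g \<in> borel_measurable N" "\<And>y. y \<in> B \<Longrightarrow> cmod (g y) \<le> G"
  shows "(LINT x|M. LINT y|N. f x y * g y) = (LINT y|N. (LINT x|M. f x y) * g y)"
proof -
  interpret M: finite_measure M by fact
  interpret N: finite_measure N by fact
  interpret pair_sigma_finite M N ..
  interpret P: finite_measure "M \<Otimes>\<^sub>M N" by (rule finite_measure_pair_measure[OF N(2) M(2)])
  have sp: "space M = A" "space N = B"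
    using sets_eq_imp_space_eq[OF M(1)] sets_eq_imp_space_eq[OF N(1)] by (simp_all add: space_restrict_space)
  obtain K where K: "\<And>p. p \<in> A \<times> B \<Longrightarrow> cmod (case p of (x, y) \<Rightarrow> f x y) \<le> K"
    using compact_imp_bounded[OF compact_continuous_image[OF cont compact_Times[OF cpt(1,2)]]]
    unfolding bounded_iff by blast
  have fm: "(\<lambda>(x, y). f x y) \<in> borel_measurable (M \<Otimes>\<^sub>M N)"
    by (rule continuous_imp_pair_measurable[OF cont cpt(3,4) M(1) N(1)])
  have gm: "(\<lambda>p. g (snd p)) \<in> borel_measurable (M \<Otimes>\<^sub>M N)"
    by (rule measurable_compose[OF measurable_snd g(1)])
  have "integrable (M \<Otimes>\<^sub>M N) (\<lambda>(x, y). f x y * g y)"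
  proof (rule P.integrable_const_bound[of _ "K * G"])
    show "(\<lambda>(x, y). f x y * g y) \<in> borel_measurable (M \<Otimes>\<^sub>M N)"
      using borel_measurable_times[OF fm gm] by (simp add: case_prod_unfold)
    show "AE p in M \<Otimes>\<^sub>M N. norm (case p of (x, y) \<Rightarrow> f x y * g y) \<le> K * G"
    proof (rule AE_I2)
      fix p assume "p \<in> space (M \<Otimes>\<^sub>M N)"
      then obtain x y where p: "p = (x, y)" "x \<in> A" "y \<in> B" by (auto simp: space_pair_measure sp)
      have "cmod (f x y) * cmod (g y) \<le> K * G"
        using K[of "(x, y)"] g(2)[of y] p order_trans[OF norm_ge_zero[of "f x y"], of K]
        by (intro mult_mono) auto
      then show "norm (case p of (x, y) \<Rightarrow> f x y * g y) \<le> K * G" by (simp add: p norm_mult)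
    qed
  qed
  then have "(LINT y|N. LINT x|M. f x y * g y) = (LINT x|M. LINT y|N. f x y * g y)"
    by (rule Fubini_integral)
  then show ?thesis by simp
qed

lemma sets_circle_haar [simp, measurable_cong]: "sets circle_haar = sets (borel_on (sphere 0 1))"
  and space_circle_haar [simp]: "space circle_haar = sphere 0 1"
  by (simp_all add: circle_haar_def space_restrict_space)

lemma cis_measurable_circle: "(\<lambda>t. cis (2 * pi * t)) \<in> measurable borel (borel_on (sphere 0 1))"
  by (intro measurable_restrict_space2 borel_measurable_continuous_onI continuous_intros) auto

lemma emeasure_circle_haar: "emeasure circle_haar (sphere 0 1) = 1"
proof -
  have "emeasure circle_haar (sphere 0 1) = emeasure (uniform_measure lborel {0..1::real}) UNIV"
    unfolding circle_haar_def using cis_measurable_circle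
  proof (subst emeasure_distr)
    have "(\<lambda>t. cis (2 * pi * t)) -` sphere 0 1 = UNIV" by auto
    then show "emeasure (uniform_measure lborel {0..1}) ((\<lambda>t. cis (2 * pi * t)) -` sphere 0 1 \<inter>
        space (uniform_measure lborel {0..1})) = emeasure (uniform_measure lborel {0..1::real}) UNIV"
      by simp
  qed (auto simp: sets_restrict_space intro!: image_eqI[of _ _ UNIV] cong: measurable_cong_sets)
  then show ?thesis by simp
qed

interpretation circle: finite_measure circle_haar
  by (rule finite_measureI) (simp add: emeasure_circle_haar)

lemma measure_circle_haar [simp]: "measure circle_haar (sphere 0 1) = 1"
  by (simp add: measure_def emeasure_circle_haar)

lemma circle_haar_integral:
  fixes f :: "complex \<Rightarrow> complex"
  assumes f: "f \<in> borel_measurable (borel_on (sphere 0 1))"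
  shows "(LINT \<alpha>|circle_haar. f \<alpha>) = (LINT t|lborel. indicator {0..1} t *\<^sub>R f (cis (2 * pi * t)))"
proof -
  have cm: "(\<lambda>t. cis (2 * pi * t)) \<in> measurable (uniform_measure lborel {0..1}) (borel_on (sphere 0 1))"
    using cis_measurable_circle by (simp cong: measurable_cong_sets)
  have U: "uniform_measure lborel {0..1::real} = density lborel (\<lambda>t. ennreal (indicator {0..1} t))"
    unfolding uniform_measure_def by (intro density_cong) (auto simp: indicator_def)
  have "(LINT \<alpha>|circle_haar. f \<alpha>) = (LINT t|uniform_measure lborel {0..1}. f (cis (2 * pi * t)))"
    unfolding circle_haar_def by (rule integral_distr[OF cm f])
  also have "\<dots> = (LINT t|lborel. indicator {0..1} t *\<^sub>R f (cis (2 * pi * t)))"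
    unfolding U using measurable_compose[OF cis_measurable_circle f]
    by (intro integral_density) auto
  finally show ?thesis .
qed

lemma circle_continuous_measurable:
  fixes f :: "complex \<Rightarrow> 'b::topological_space"
  assumes "continuous_on (sphere 0 1) f"
  shows "f \<in> borel_measurable circle_haar"
  using continuous_imp_borel_on[OF assms] by (simp cong: measurable_cong_sets)

lemma circle_integrable:
  fixes f :: "complex \<Rightarrow> 'b::{banach, second_countable_topology}"
  assumes "continuous_on (sphere 0 1) f"
  shows "integrable circle_haar f"
proof -
  obtain B where "\<And>x. x \<in> sphere 0 1 \<Longrightarrow> norm (f x) \<le> B"
    using compact_imp_bounded[OF compact_continuous_image[OF assms compact_sphere]]
    unfolding bounded_iff by blast
  then show ?thesis
    by (intro circle.integrable_const_bound[of _ B] AE_I2 circle_continuous_measurable[OF assms]) auto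
qed

lemma circle_integral_hpow: "(LINT \<alpha>|circle_haar. hpow k \<alpha>) = (if k = 0 then 1 else 0)"
proof (cases "k = 0")
  case True
  then show ?thesis by simp
next
  case False
  have "(LINT \<alpha>|circle_haar. hpow k \<alpha>) = (LINT t|lborel. indicator {0..1} t *\<^sub>R hpow k (cis (2 * pi * t)))"
    by (rule circle_haar_integral) (intro continuous_imp_borel_on continuous_intros)
  also have "\<dots> = (LINT t|lborel. indicator {0..1} t *\<^sub>R cis (2 * pi * k * t))"
  proof -
    have "hpow k (cis x) = cis (k * x)" for x :: real
    proof (cases "0 \<le> k")
      case True
      then have "real (nat k) = real_of_int k" by simp
      then show ?thesis using True by (simp only: hpow_def Complex.DeMoivre if_True)
    next
      case False
      then have "real (nat (- k)) = - real_of_int k" by simp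
      then show ?thesis using False by (simp add: hpow_def Complex.DeMoivre cis_cnj)
    qed
    then show ?thesis by (simp add: mult_ac)
  qed
  also have "\<dots> = cis (2 * pi * k * 1) / (\<i> * (2 * pi * k)) - cis (2 * pi * k * 0) / (\<i> * (2 * pi * k))"
  proof (rule integral_FTC_atLeastAtMost)
    fix x :: real
    have "((\<lambda>t. exp (\<i> * (2 * pi * k * t)) / (\<i> * (2 * pi * k))) has_vector_derivative
        exp (\<i> * (2 * pi * k * x))) (at x within {0..1})"
    proof -
      have "((\<lambda>z. exp (\<i> * (2 * pi * k * z)) / (\<i> * (2 * pi * k))) has_field_derivative
        exp (\<i> * (2 * pi * k * z))) (at z)" for z :: complex
        using False by (auto intro!: derivative_eq_intros)
      from has_vector_derivative_real_field[OF this]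
      show ?thesis by simp
    qed
    then show "((\<lambda>t. cis (2 * pi * k * t) / (\<i> * (2 * pi * k))) has_vector_derivative
        cis (2 * pi * k * x)) (at x within {0..1})"
      by (simp add: cis_conv_exp mult_ac)
  qed (auto intro!: continuous_intros)
  also have "cis (2 * pi * k * 1) = 1"
    using cis_multiple_2pi[of "real_of_int k"] by simp
  finally show ?thesis using False by simp
qed

text \<open>Termwise integration when the coefficients are absolutely summable and the functions
  uniformly bounded; it serves power series, Poisson kernels and the exponential series.\<close>

lemma integral_bounded_suminf:
  fixes c :: "nat \<Rightarrow> complex"
  assumes N: "finite_measure N" and c: "summable (\<lambda>n. norm (c n))"
    and \<psi>: "\<And>n. \<psi> n \<in> borel_measurable N" "\<And>n x. x \<in> space N \<Longrightarrow> cmod (\<psi> n x) \<le> B"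
  shows "(LINT x|N. (\<Sum>n. c n * \<psi> n x)) = (\<Sum>n. c n * (LINT x|N. \<psi> n x))"
    and "integrable N (\<lambda>x. \<Sum>n. c n * \<psi> n x)"
proof -
  interpret N: finite_measure N by fact
  have i\<psi>: "integrable N (\<psi> n)" for n
    by (rule N.integrable_const_bound[of _ B]) (use \<psi> in \<open>auto intro!: AE_I2\<close>)
  have int: "integrable N (\<lambda>x. c n * \<psi> n x)" for n using i\<psi> by simp
  have bd: "norm (c n * \<psi> n x) \<le> norm (c n) * B" if "x \<in> space N" for n x
    using \<psi>(2)[OF that, of n] by (simp add: norm_mult mult_left_mono)
  have cB: "summable (\<lambda>n. norm (c n) * B)" using c by (rule summable_mult2)
  have s1: "AE x in N. summable (\<lambda>n. norm (c n * \<psi> n x))"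
    by (intro AE_I2 summable_comparison_test'[OF cB]) (use bd in auto)
  have s2: "summable (\<lambda>n. LINT x|N. norm (c n * \<psi> n x))"
  proof (rule summable_comparison_test'[OF summable_mult2[OF cB, of "measure N (space N)"]])
    fix n
    have "(LINT x|N. norm (c n * \<psi> n x)) \<le> (LINT x|N. norm (c n) * B)"
      by (intro integral_mono integrable_norm int) (use bd in auto)
    then show "norm (LINT x|N. norm (c n * \<psi> n x)) \<le> norm (c n) * B * measure N (space N)"
      by (simp add: mult_ac)
  qed
  show "(LINT x|N. (\<Sum>n. c n * \<psi> n x)) = (\<Sum>n. c n * (LINT x|N. \<psi> n x))"
    using integral_suminf[OF int s1 s2] by simp
  show "integrable N (\<lambda>x. \<Sum>n. c n * \<psi> n x)"
    by (rule integrable_suminf[OF int s1 s2])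
qed

lemma holomorphic_power_series_0:
  assumes "G holomorphic_on ball 0 R"
  shows "\<exists>a. \<forall>w\<in>ball 0 R. summable (\<lambda>n. norm (a n * w ^ n)) \<and> G w = (\<Sum>n. a n * w ^ n)"
proof (intro exI[of _ "\<lambda>n. (deriv ^^ n) G 0 / fact n"] ballI conjI)
  fix w :: complex assume w: "w \<in> ball 0 R"
  have sums: "(\<lambda>n. (deriv ^^ n) G 0 / fact n * v ^ n) sums G v" if "v \<in> ball 0 R" for v
    using holomorphic_power_series[OF assms that] by simp
  then show "G w = (\<Sum>n. (deriv ^^ n) G 0 / fact n * w ^ n)" using w by (simp add: sums_iff)
  obtain r where r: "norm w < r" "r < R" using w dense[of "norm w" R] by auto
  then have "complex_of_real r \<in> ball 0 R" using norm_ge_zero[of w] by (simp del: norm_ge_zero)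
  from sums_summable[OF sums[OF this]]
  show "summable (\<lambda>n. norm ((deriv ^^ n) G 0 / fact n * w ^ n))"
    by (rule powser_insidea) (use r norm_ge_zero[of w] in \<open>simp del: norm_ge_zero\<close>)
qed

text \<open>A two-sided series is stored as two ordinary ones. The second starts at degree -1, hence
  \<open>Suc n\<close>, so that the constant term occurs once.\<close>

definition harmonic_coeffs :: "(complex \<Rightarrow> complex) \<Rightarrow> real \<Rightarrow> (int \<Rightarrow> complex) \<Rightarrow> bool" where
  "harmonic_coeffs u R c \<longleftrightarrow> continuous_on (ball 0 R) u \<and> (\<forall>w\<in>ball 0 R.
     summable (\<lambda>n. norm (c (int n) * w ^ n)) \<and> summable (\<lambda>n. norm (c (- int (Suc n)) * cnj w ^ Suc n)) \<and>
     u w = (\<Sum>n. c (int n) * w ^ n) + (\<Sum>n. c (- int (Suc n)) * cnj w ^ Suc n))"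

lemma harmonic_coeffs_exist:
  assumes "harmonic_on u U" "ball 0 R \<subseteq> U"
  shows "\<exists>c. harmonic_coeffs u R c"
proof -
  obtain G H where GH: "G holomorphic_on ball 0 R" "H holomorphic_on ball 0 R"
    "\<And>w. w \<in> ball 0 R \<Longrightarrow> u w = G w + cnj (H w)"
    using harmonic_decomposition[OF assms] by blast
  obtain a where "\<forall>w\<in>ball 0 R. summable (\<lambda>n. norm (a n * w ^ n)) \<and> G w = (\<Sum>n. a n * w ^ n)"
    using holomorphic_power_series_0[OF GH(1)] ..
  note a = bspec[OF this]
  obtain b where "\<forall>w\<in>ball 0 R. summable (\<lambda>n. norm (b n * w ^ n)) \<and> H w = (\<Sum>n. b n * w ^ n)"
    using holomorphic_power_series_0[OF GH(2)] ..
  note b = bspec[OF this]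
  \<comment> \<open>The splitting into \<open>G\<close> and the conjugate of \<open>H\<close> is
    unique only up to constants, and both constant terms contribute to degree 0.\<close>
  define c where "c = (\<lambda>k::int. if k > 0 then a (nat k) else if k = 0 then a 0 + cnj (b 0) else cnj (b (nat (- k))))"
  have c_pos: "c (int (Suc n)) = a (Suc n)" and c_neg: "c (- int (Suc n)) = cnj (b (Suc n))" for n
    by (simp_all add: c_def nat_add_distrib)
  have c0: "c 0 = a 0 + cnj (b 0)" by (simp add: c_def)
  have "continuous_on (ball 0 R) (\<lambda>w. G w + cnj (H w))"
    using GH(1,2) by (intro continuous_intros holomorphic_on_imp_continuous_on)
  then have cont: "continuous_on (ball 0 R) u"
    by (subst continuous_on_cong[OF refl GH(3)])
  have "summable (\<lambda>n. norm (c (int n) * w ^ n)) \<and> summable (\<lambda>n. norm (c (- int (Suc n)) * cnj w ^ Suc n)) \<and>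
     u w = (\<Sum>n. c (int n) * w ^ n) + (\<Sum>n. c (- int (Suc n)) * cnj w ^ Suc n)" if w: "w \<in> ball 0 R" for w
  proof -
    have sa: "summable (\<lambda>n. norm (a n * w ^ n))" and sb: "summable (\<lambda>n. norm (b n * w ^ n))"
      using a[OF w] b[OF w] by auto
    have s1: "summable (\<lambda>n. norm (c (int n) * w ^ n))"
    proof (subst summable_Suc_iff[symmetric])
      show "summable (\<lambda>n. norm (c (int (Suc n)) * w ^ Suc n))"
        using sa unfolding c_pos by (subst (asm) summable_Suc_iff[symmetric])
    qed
    have s2: "summable (\<lambda>n. norm (c (- int (Suc n)) * cnj w ^ Suc n))"
    proof -
      have "summable (\<lambda>n. norm (b (Suc n) * w ^ Suc n))"
        using sb by (subst (asm) summable_Suc_iff[symmetric])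
      then show ?thesis unfolding c_neg by (simp add: norm_mult norm_power)
    qed
    have "(\<Sum>n. c (int n) * w ^ n) = c 0 + (\<Sum>n. c (int (Suc n)) * w ^ Suc n)"
      using suminf_split_head[OF summable_norm_cancel[OF s1]] by simp
    moreover have "(\<Sum>n. a n * w ^ n) = a 0 + (\<Sum>n. c (int (Suc n)) * w ^ Suc n)"
      unfolding c_pos using suminf_split_head[OF summable_norm_cancel[OF sa]] by simp
    moreover have "cnj (\<Sum>n. b n * w ^ n) = cnj (b 0) + (\<Sum>n. c (- int (Suc n)) * cnj w ^ Suc n)"
    proof -
      have "cnj (\<Sum>n. b n * w ^ n) = (\<Sum>n. cnj (b n * w ^ n))"
        by (rule bounded_linear.suminf[OF bounded_linear_cnj summable_norm_cancel[OF sb]])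
      also have "\<dots> = cnj (b 0) + (\<Sum>n. cnj (b (Suc n) * w ^ Suc n))"
        using suminf_split_head[of "\<lambda>n. cnj (b n * w ^ n)"]
          bounded_linear.summable[OF bounded_linear_cnj summable_norm_cancel[OF sb]] by simp
      finally show ?thesis unfolding c_neg by simp
    qed
    ultimately have "u w = (\<Sum>n. c (int n) * w ^ n) + (\<Sum>n. c (- int (Suc n)) * cnj w ^ Suc n)"
      using GH(3)[OF w] a[OF w] b[OF w] c0 by simp
    then show ?thesis using s1 s2 by blast
  qed
  then show ?thesis using cont unfolding harmonic_coeffs_def by blast
qed

lemma suminf_single:
  fixes f :: "nat \<Rightarrow> complex"
  assumes "\<And>n. n \<noteq> m \<Longrightarrow> f n = 0"
  shows "(\<Sum>n. f n) = f m"
  using suminf_finite[of "{m}" f] assms by auto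

text \<open>Orthogonality of characters leaves a single term. How the coefficient depends on the
  radius, namely through \<open>hpow k w\<close>, matters later: comparing two radii is what forces
  components to vanish.\<close>

lemma harmonic_coeffs_integral:
  assumes c: "harmonic_coeffs u R c" and w: "w \<in> ball 0 R"
  shows "(LINT \<alpha>|circle_haar. u (w * \<alpha>) * hpow (- k) \<alpha>) = hpow k w * c k"
proof -
  have wa: "w * \<alpha> \<in> ball 0 R" if "cmod \<alpha> = 1" for \<alpha> using w that by (simp add: norm_mult)
  have s1: "summable (\<lambda>n. norm (c (int n) * w ^ n))"
    and s2: "summable (\<lambda>n. norm (c (- int (Suc n)) * cnj w ^ Suc n))"
    using c w unfolding harmonic_coeffs_def by blast+
  let ?\<psi>1 = "\<lambda>n \<alpha>. hpow (int n) \<alpha> * hpow (- k) \<alpha>"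
  let ?\<psi>2 = "\<lambda>n \<alpha>. hpow (- int (Suc n)) \<alpha> * hpow (- k) \<alpha>"
  have c1: "?\<psi>1 n \<in> borel_measurable circle_haar" "?\<psi>2 n \<in> borel_measurable circle_haar" for n
    by (intro circle_continuous_measurable continuous_intros)+
  have c2: "cmod (?\<psi>1 n \<alpha>) \<le> 1" "cmod (?\<psi>2 n \<alpha>) \<le> 1" if "\<alpha> \<in> space circle_haar" for n \<alpha>
    using that by (simp_all only: space_circle_haar mem_sphere_0 norm_mult norm_hpow_unit mult_1 order_refl)
  note J = integral_bounded_suminf[OF circle.finite_measure_axioms]
  have i1: "(LINT \<alpha>|circle_haar. hpow j \<alpha> * hpow (- k) \<alpha>) = (if j = k then 1 else 0)" for j
  proof -
    have "(LINT \<alpha>|circle_haar. hpow j \<alpha> * hpow (- k) \<alpha>) = (LINT \<alpha>|circle_haar. hpow (j + - k) \<alpha>)"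
      by (intro LINT_cong, subst hpow_add) auto
    then show ?thesis by (simp add: circle_integral_hpow)
  qed
  have exp: "u (w * \<alpha>) * hpow (- k) \<alpha> = (\<Sum>n. (c (int n) * w ^ n) * ?\<psi>1 n \<alpha>)
      + (\<Sum>n. (c (- int (Suc n)) * cnj w ^ Suc n) * ?\<psi>2 n \<alpha>)" if \<alpha>: "cmod \<alpha> = 1" for \<alpha>
  proof -
    have t1: "summable (\<lambda>n. norm (c (int n) * (w * \<alpha>) ^ n))"
      and t2: "summable (\<lambda>n. norm (c (- int (Suc n)) * cnj (w * \<alpha>) ^ Suc n))"
      and u: "u (w * \<alpha>) = (\<Sum>n. c (int n) * (w * \<alpha>) ^ n) + (\<Sum>n. c (- int (Suc n)) * cnj (w * \<alpha>) ^ Suc n)"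
      using c wa[OF \<alpha>] unfolding harmonic_coeffs_def by blast+
    have "(\<Sum>n. c (int n) * (w * \<alpha>) ^ n) * hpow (- k) \<alpha> = (\<Sum>n. c (int n) * (w * \<alpha>) ^ n * hpow (- k) \<alpha>)"
      by (rule suminf_mult2[OF summable_norm_cancel[OF t1]])
    moreover have "(\<Sum>n. c (- int (Suc n)) * cnj (w * \<alpha>) ^ Suc n) * hpow (- k) \<alpha>
        = (\<Sum>n. c (- int (Suc n)) * cnj (w * \<alpha>) ^ Suc n * hpow (- k) \<alpha>)"
      by (rule suminf_mult2[OF summable_norm_cancel[OF t2]])
    moreover have "hpow (- int (Suc n)) \<alpha> = cnj \<alpha> ^ Suc n" for n
      unfolding hpow_uminus hpow_of_nat by simp
    ultimately show ?thesis
      unfolding u distrib_right by (simp add: power_mult_distrib mult_ac del: power_Suc of_nat_Suc)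
  qed
  have "(LINT \<alpha>|circle_haar. u (w * \<alpha>) * hpow (- k) \<alpha>)
      = (LINT \<alpha>|circle_haar. (\<Sum>n. (c (int n) * w ^ n) * ?\<psi>1 n \<alpha>)
      + (\<Sum>n. (c (- int (Suc n)) * cnj w ^ Suc n) * ?\<psi>2 n \<alpha>))"
    by (intro LINT_cong exp) simp
  also have "\<dots> = (LINT \<alpha>|circle_haar. (\<Sum>n. (c (int n) * w ^ n) * ?\<psi>1 n \<alpha>))
      + (LINT \<alpha>|circle_haar. (\<Sum>n. (c (- int (Suc n)) * cnj w ^ Suc n) * ?\<psi>2 n \<alpha>))"
    by (intro Bochner_Integration.integral_add J(2)[OF s1 c1(1) c2(1)] J(2)[OF s2 c1(2) c2(2)])
  also have "(LINT \<alpha>|circle_haar. (\<Sum>n. (c (int n) * w ^ n) * ?\<psi>1 n \<alpha>))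
      = (\<Sum>n. (c (int n) * w ^ n) * (if int n = k then 1 else 0))"
    unfolding i1[symmetric] by (rule J(1)[OF s1 c1(1) c2(1)])
  also have "(LINT \<alpha>|circle_haar. (\<Sum>n. (c (- int (Suc n)) * cnj w ^ Suc n) * ?\<psi>2 n \<alpha>))
      = (\<Sum>n. (c (- int (Suc n)) * cnj w ^ Suc n) * (if - int (Suc n) = k then 1 else 0))"
    unfolding i1[symmetric] by (rule J(1)[OF s2 c1(2) c2(2)])
  also have "(\<Sum>n. (c (int n) * w ^ n) * (if int n = k then 1 else 0))
      + (\<Sum>n. (c (- int (Suc n)) * cnj w ^ Suc n) * (if - int (Suc n) = k then 1 else 0)) = hpow k w * c k"
  proof (cases "0 \<le> k")
    case True
    have "(\<Sum>n. (c (int n) * w ^ n) * (if int n = k then 1 else 0)) = hpow k w * c k"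
      using True by (subst suminf_single[of "nat k"]) (auto simp: hpow_def)
    moreover have "(\<Sum>n. (c (- int (Suc n)) * cnj w ^ Suc n) * (if - int (Suc n) = k then 1 else 0)) = 0"
      using True by (subst suminf_single[of 0]) auto
    ultimately show ?thesis by simp
  next
    case False
    define m where "m = nat (- k) - 1"
    have m: "- int (Suc m) = k" "nat (- k) = Suc m" using False by (simp_all add: m_def)
    have "(\<Sum>n. (c (- int (Suc n)) * cnj w ^ Suc n) * (if - int (Suc n) = k then 1 else 0)) = hpow k w * c k"
      using False m by (subst suminf_single[of m]) (auto simp: hpow_def)
    moreover have "(\<Sum>n. (c (int n) * w ^ n) * (if int n = k then 1 else 0)) = 0"
      using False by (subst suminf_single[of 0]) auto
    ultimately show ?thesis by simp
  qed
  finally show ?thesis .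
qed

text \<open>By Parseval the mean square on the circle of radius r is the sum of |a_n|^2 r^(2n),
  which increases with r; radius 1 is reached by continuity up to the boundary.\<close>

lemma holomorphic_circle_mean_square_mono:
  assumes cont: "continuous_on (cball 0 1) g" and hol: "g holomorphic_on ball 0 1" and r: "0 \<le> r" "r \<le> 1"
  shows "(LINT \<alpha>|circle_haar. (cmod (g (of_real r * \<alpha>)))\<^sup>2) \<le> (LINT \<alpha>|circle_haar. (cmod (g \<alpha>))\<^sup>2)"
proof -
  obtain a where "\<forall>w\<in>ball 0 1. summable (\<lambda>n. norm (a n * w ^ n)) \<and> g w = (\<Sum>n. a n * w ^ n)"
    using holomorphic_power_series_0[OF hol] ..
  note a = bspec[OF this]
  define I where "I = (\<lambda>r::real. LINT \<alpha>|circle_haar. (cmod (g (of_real r * \<alpha>)))\<^sup>2)"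
  define S where "S = (\<lambda>N (r::real). \<Sum>n<N. (cmod (a n))\<^sup>2 * r ^ (2 * n))"
  have lim: "(\<lambda>N. S N r) \<longlonglongrightarrow> I r" if r: "0 \<le> r" "r < 1" for r
  proof -
    define s where "s = (\<lambda>N \<alpha>. \<Sum>n<N. (a n * of_real r ^ n) * \<alpha> ^ n)"
    have rb: "complex_of_real r \<in> ball 0 1" using r by simp
    have sr: "summable (\<lambda>n. norm (a n * of_real r ^ n))" using a[OF rb] by blast
    have conts: "continuous_on (sphere 0 1) (s N)" for N unfolding s_def by (intro continuous_intros)
    have ptw: "(\<lambda>N. s N \<alpha>) \<longlonglongrightarrow> g (of_real r * \<alpha>)" if \<alpha>: "cmod \<alpha> = 1" for \<alpha>
    proof -
      have "of_real r * \<alpha> \<in> ball 0 1" using r \<alpha> by (simp add: norm_mult)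
      from a[OF this] have "(\<lambda>n. a n * (of_real r * \<alpha>) ^ n) sums g (of_real r * \<alpha>)"
        by (metis summable_norm_cancel summable_sums)
      then show ?thesis unfolding sums_def s_def by (simp add: power_mult_distrib mult_ac)
    qed
    have bd: "cmod (s N \<alpha>) \<le> (\<Sum>n. norm (a n * of_real r ^ n))" if \<alpha>: "cmod \<alpha> = 1" for N \<alpha>
    proof -
      have "cmod (s N \<alpha>) \<le> (\<Sum>n<N. norm (a n * of_real r ^ n))"
        unfolding s_def by (rule sum_norm_le) (simp add: norm_mult norm_power \<alpha>)
      also have "\<dots> \<le> (\<Sum>n. norm (a n * of_real r ^ n))"
        by (rule sum_le_suminf[OF sr]) auto
      finally show ?thesis .
    qed
    have cg: "continuous_on (sphere 0 1) (\<lambda>\<alpha>. g (of_real r * \<alpha>))"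
      by (rule continuous_on_compose2[OF cont]) (use r in \<open>auto intro!: continuous_intros simp: norm_mult\<close>)
    have "(\<lambda>N. LINT \<alpha>|circle_haar. (cmod (s N \<alpha>))\<^sup>2) \<longlonglongrightarrow> I r"
      unfolding I_def
    proof (rule integral_dominated_convergence[where w="\<lambda>_. (\<Sum>n. norm (a n * of_real r ^ n))\<^sup>2"])
      show "AE \<alpha> in circle_haar. (\<lambda>N. (cmod (s N \<alpha>))\<^sup>2) \<longlonglongrightarrow> (cmod (g (of_real r * \<alpha>)))\<^sup>2"
        by (intro AE_I2 tendsto_intros ptw) simp
      show "AE \<alpha> in circle_haar. norm ((cmod (s N \<alpha>))\<^sup>2) \<le> (\<Sum>n. norm (a n * of_real r ^ n))\<^sup>2" for N
        by (intro AE_I2) (use bd in \<open>simp add: power_mono\<close>)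
    qed (auto intro!: circle_continuous_measurable continuous_intros cg conts)
    moreover have "(LINT \<alpha>|circle_haar. (cmod (s N \<alpha>))\<^sup>2) = S N r" for N
    proof -
      let ?b = "\<lambda>n. a n * of_real r ^ n"
      have sq: "complex_of_real ((cmod (s N \<alpha>))\<^sup>2) = (\<Sum>m<N. \<Sum>n<N. ?b m * cnj (?b n) * hpow (int m - int n) \<alpha>)"
        if \<alpha>: "cmod \<alpha> = 1" for \<alpha>
      proof -
        have "complex_of_real ((cmod (s N \<alpha>))\<^sup>2) = s N \<alpha> * cnj (s N \<alpha>)"
          by (rule complex_norm_square)
        also have "\<dots> = (\<Sum>m<N. \<Sum>n<N. (?b m * \<alpha> ^ m) * cnj (?b n * \<alpha> ^ n))"
          unfolding s_def cnj_sum by (rule sum_product)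
        also have "\<dots> = (\<Sum>m<N. \<Sum>n<N. ?b m * cnj (?b n) * hpow (int m - int n) \<alpha>)"
        proof (intro sum.cong refl)
          fix m n
          have "hpow (int m - int n) \<alpha> = \<alpha> ^ m * cnj (\<alpha> ^ n)"
            using hpow_add[OF \<alpha>, of "int m" "- int n"] by (simp add: hpow_uminus)
          then show "(?b m * \<alpha> ^ m) * cnj (?b n * \<alpha> ^ n) = ?b m * cnj (?b n) * hpow (int m - int n) \<alpha>"
            by (simp add: mult_ac)
        qed
        finally show ?thesis .
      qed
      have "complex_of_real (LINT \<alpha>|circle_haar. (cmod (s N \<alpha>))\<^sup>2)
          = (LINT \<alpha>|circle_haar. complex_of_real ((cmod (s N \<alpha>))\<^sup>2))"
        by (rule integral_complex_of_real[symmetric])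
      also have "\<dots> = (LINT \<alpha>|circle_haar. (\<Sum>m<N. \<Sum>n<N. ?b m * cnj (?b n) * hpow (int m - int n) \<alpha>))"
        by (intro LINT_cong sq) simp
      also have "\<dots> = (\<Sum>m<N. \<Sum>n<N. ?b m * cnj (?b n) * (LINT \<alpha>|circle_haar. hpow (int m - int n) \<alpha>))"
      proof -
        have i: "integrable circle_haar (\<lambda>\<alpha>. ?b m * cnj (?b n) * hpow (int m - int n) \<alpha>)" for m n
          by (intro circle_integrable continuous_intros)
        show ?thesis
          by (simp only: Bochner_Integration.integral_sum i Bochner_Integration.integrable_sum
              integral_mult_right_zero)
      qed
      also have "\<dots> = (\<Sum>m<N. \<Sum>n<N. if m = n then ?b m * cnj (?b n) else 0)"
        by (intro sum.cong refl) (simp add: circle_integral_hpow)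
      also have "\<dots> = (\<Sum>m<N. ?b m * cnj (?b m))" by simp
      also have "\<dots> = complex_of_real (S N r)"
        unfolding S_def of_real_sum
      proof (intro sum.cong refl)
        fix m
        have "(cmod (?b m))\<^sup>2 = (cmod (a m))\<^sup>2 * r ^ (2 * m)"
          using r(1) by (simp add: norm_mult norm_power power_mult_distrib power_even_eq)
        then show "?b m * cnj (?b m) = complex_of_real ((cmod (a m))\<^sup>2 * r ^ (2 * m))"
          by (metis complex_norm_square)
      qed
      finally show ?thesis using of_real_eq_iff by blast
    qed
    ultimately show ?thesis by simp
  qed
  have mono: "I r \<le> I r'" if "0 \<le> r" "r \<le> r'" "r' < 1" for r r'
  proof (rule LIMSEQ_le[OF lim lim])
    show "\<exists>N. \<forall>n\<ge>N. S n r \<le> S n r'"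
      unfolding S_def using that by (auto intro!: sum_mono mult_left_mono power_mono)
  qed (use that in auto)
  show ?thesis
  proof (cases "r = 1")
    case False
    then have r1: "r < 1" using r by simp
    define \<rho> where "\<rho> = (\<lambda>n::nat. 1 - (1 - r) / (real n + 1))"
    have \<rho>: "r \<le> \<rho> n" "\<rho> n < 1" for n
    proof -
      have "(1 - r) / (real n + 1) \<le> (1 - r) / 1" using r1 by (intro divide_left_mono) auto
      then show "r \<le> \<rho> n" by (simp add: \<rho>_def)
      show "\<rho> n < 1" using r1 by (simp add: \<rho>_def)
    qed
    have \<rho>lim: "\<rho> \<longlonglongrightarrow> 1" unfolding \<rho>_def by real_asymp
    obtain B where B: "\<And>x. x \<in> cball 0 1 \<Longrightarrow> cmod (g x) \<le> B"
      using compact_imp_bounded[OF compact_continuous_image[OF cont compact_cball]]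
      unfolding bounded_iff by blast
    have in1: "of_real (\<rho> n) * \<alpha> \<in> cball 0 1" if "cmod \<alpha> = 1" for n \<alpha>
      using \<rho>[of n] r that by (simp add: norm_mult)
    have "(\<lambda>n. I (\<rho> n)) \<longlonglongrightarrow> (LINT \<alpha>|circle_haar. (cmod (g \<alpha>))\<^sup>2)"
      unfolding I_def
    proof (rule integral_dominated_convergence[where w="\<lambda>_. B\<^sup>2"])
      show "AE \<alpha> in circle_haar. (\<lambda>n. (cmod (g (of_real (\<rho> n) * \<alpha>)))\<^sup>2) \<longlonglongrightarrow> (cmod (g \<alpha>))\<^sup>2"
      proof (rule AE_I2)
        fix \<alpha> assume "\<alpha> \<in> space circle_haar"
        then have \<alpha>: "cmod \<alpha> = 1" by simp
        have "(\<lambda>n. of_real (\<rho> n) * \<alpha>) \<longlonglongrightarrow> of_real 1 * \<alpha>" by (intro tendsto_intros \<rho>lim)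
        then have "(\<lambda>n. g (of_real (\<rho> n) * \<alpha>)) \<longlonglongrightarrow> g (of_real 1 * \<alpha>)"
          by (rule continuous_on_tendsto_compose[OF cont]) (use in1[OF \<alpha>] \<alpha> in \<open>simp_all add: always_eventually\<close>)
        then show "(\<lambda>n. (cmod (g (of_real (\<rho> n) * \<alpha>)))\<^sup>2) \<longlonglongrightarrow> (cmod (g \<alpha>))\<^sup>2"
          by (auto intro!: tendsto_intros)
      qed
      show "AE \<alpha> in circle_haar. norm ((cmod (g (of_real (\<rho> n) * \<alpha>)))\<^sup>2) \<le> B\<^sup>2" for n
        by (rule AE_I2) (use B[OF in1] in \<open>simp add: power_mono\<close>)
      show "(\<lambda>\<alpha>. (cmod (g (of_real (\<rho> n) * \<alpha>)))\<^sup>2) \<in> borel_measurable circle_haar" for n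
        by (intro circle_continuous_measurable continuous_intros continuous_on_compose2[OF cont])
          (use in1 in auto)
      show "(\<lambda>\<alpha>. (cmod (g \<alpha>))\<^sup>2) \<in> borel_measurable circle_haar"
        by (intro circle_continuous_measurable continuous_intros continuous_on_subset[OF cont]) auto
    qed simp
    moreover have "\<exists>N. \<forall>n\<ge>N. I r \<le> I (\<rho> n)" using mono[OF r(1) \<rho>(1) \<rho>(2)] by blast
    ultimately have "I r \<le> (LINT \<alpha>|circle_haar. (cmod (g \<alpha>))\<^sup>2)" by (rule LIMSEQ_le_const)
    then show ?thesis unfolding I_def .
  qed simp
qed

section \<open>The geometry of the domain\<close>

lemma linear_scale_complex: "linear (\<lambda>z::complex^'n. \<alpha> *s z)"
  by (rule linearI) (simp_all add: vec_eq_iff algebra_simps)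

lemma linear_matrix_complex: "linear (\<lambda>z::complex^'n. A *v z)" for A :: "complex^'n^'n"
  by (rule linearI)
    (simp_all add: vec_eq_iff matrix_vector_mult_def algebra_simps sum.distrib scaleR_sum_right)

lemma bounded_linear_matrix_complex: "bounded_linear (\<lambda>z::complex^'n. A *v z)" for A :: "complex^'n^'n"
  using linear_matrix_complex by (simp add: linear_conv_bounded_linear)

lemma bounded_linear_scale_complex: "bounded_linear (\<lambda>z::complex^'n. \<alpha> *s z)"
  using linear_scale_complex by (simp add: linear_conv_bounded_linear)

lemma bounded_linear_scale_left: "bounded_linear (\<lambda>h::complex. h *s v)" for v :: "complex^'n"
  by (subst linear_conv_bounded_linear[symmetric], rule linearI) (simp_all add: vec_eq_iff algebra_simps)

lemma matrix_vector_scale: "A *v (c *s z) = c *s (A *v z)" for A :: "complex^'n^'n"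
  by (simp add: vec_eq_iff matrix_vector_mult_def sum_distrib_left mult_ac)

lemma continuous_on_matrix [continuous_intros]:
  fixes A :: "complex^'n^'n"
  shows "continuous_on S f \<Longrightarrow> continuous_on S (\<lambda>x. A *v f x)"
  by (rule bounded_linear.continuous_on[OF bounded_linear_matrix_complex])

lemma continuous_on_scale [continuous_intros]:
  fixes f :: "'a::topological_space \<Rightarrow> complex" and g :: "'a \<Rightarrow> complex^'n"
  assumes "continuous_on S f" "continuous_on S g"
  shows "continuous_on S (\<lambda>x. f x *s g x)"
  unfolding vector_scalar_mult_def using assms
  by (intro continuous_on_vec_lambda continuous_intros)

lemma mat_scale: "mat \<alpha> *v z = \<alpha> *s z" for z :: "complex^'n"
  by (simp add: vec_eq_iff matrix_vector_mult_def mat_def if_distrib[of "\<lambda>x. x * _"] cong: if_cong)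

lemma norm_scale_complex: "norm (\<alpha> *s z) = cmod \<alpha> * norm z" for z :: "complex^'n"
  by (simp add: norm_vec_def norm_mult L2_set_right_distrib)

definition cinner :: "complex^'n \<Rightarrow> complex^'n \<Rightarrow> complex" where
  "cinner z w = (\<Sum>i\<in>UNIV. z $ i * cnj (w $ i))"

lemma cinner_self: "cinner z z = complex_of_real ((norm z)\<^sup>2)"
proof -
  have "(norm z)\<^sup>2 = (\<Sum>i\<in>UNIV. (cmod (z $ i))\<^sup>2)"
    by (simp add: norm_vec_def L2_set_def sum_nonneg)
  then have "complex_of_real ((norm z)\<^sup>2) = (\<Sum>i\<in>UNIV. complex_of_real ((cmod (z $ i))\<^sup>2))"
    by (simp only: of_real_sum)
  then show ?thesis unfolding cinner_def complex_norm_square by simp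
qed

lemma cinner_scale: "cinner (c *s z) w = c * cinner z w"
  by (simp add: cinner_def sum_distrib_left mult_ac)

lemma cinner_commute: "cinner w z = cnj (cinner z w)"
  by (simp add: cinner_def mult.commute)

lemma norm_diff_cinner: "(norm (z - w))\<^sup>2 = (norm z)\<^sup>2 + (norm w)\<^sup>2 - 2 * Re (cinner z w)"
proof -
  have "complex_of_real ((norm (z - w))\<^sup>2) = cinner (z - w) (z - w)" by (rule cinner_self[symmetric])
  also have "\<dots> = cinner z z + cinner w w - (cinner z w + cinner w z)"
    by (simp add: cinner_def algebra_simps sum.distrib sum_subtractf)
  also have "\<dots> = complex_of_real ((norm z)\<^sup>2 + (norm w)\<^sup>2 - 2 * Re (cinner z w))"
    unfolding cinner_self cinner_commute[of w z] by (simp add: complex_eq_iff)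
  finally show ?thesis using of_real_eq_iff by blast
qed

lemma continuous_on_cinner [continuous_intros]:
  "continuous_on S f \<Longrightarrow> continuous_on S (\<lambda>x. cinner (f x) w)"
  unfolding cinner_def by (intro continuous_intros)

lemma norm_unitary:
  fixes A :: "complex^'n^'n"
  assumes "unitary_matrix A"
  shows "norm (A *v z) = norm z"
proof -
  have A: "(\<Sum>i\<in>UNIV. cnj (A $ i $ j) * A $ i $ k) = (if j = k then 1 else 0)" for j k
    using assms by (simp add: unitary_matrix_def vec_eq_iff matrix_matrix_mult_def mat_def)
  have "cinner (A *v z) (A *v z) = (\<Sum>i\<in>UNIV. \<Sum>k\<in>UNIV. \<Sum>j\<in>UNIV. (A $ i $ k * z $ k) * cnj (A $ i $ j * z $ j))"
    by (simp only: cinner_def matrix_vector_mult_def vec_lambda_beta cnj_sum sum_product)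
  also have "\<dots> = (\<Sum>k\<in>UNIV. \<Sum>j\<in>UNIV. \<Sum>i\<in>UNIV. (A $ i $ k * z $ k) * cnj (A $ i $ j * z $ j))"
    by (subst sum.swap) (intro sum.cong refl sum.swap)
  also have "\<dots> = (\<Sum>k\<in>UNIV. \<Sum>j\<in>UNIV. z $ k * cnj (z $ j) * (\<Sum>i\<in>UNIV. cnj (A $ i $ j) * A $ i $ k))"
    by (simp add: sum_distrib_left mult_ac)
  also have "\<dots> = (\<Sum>k\<in>UNIV. z $ k * cnj (z $ k))"
    unfolding A by (simp add: if_distrib[of "\<lambda>x. _ * x"] cong: if_cong)
  also have "\<dots> = cinner z z" by (simp add: cinner_def)
  finally show ?thesis unfolding cinner_self by (simp only: of_real_eq_iff) simp
qed

section \<open>Holomorphic functions of several variables\<close>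

lemma mholomorphic_on_compose_matrix:
  fixes A :: "complex^'n^'n"
  assumes f: "mholomorphic_on f D" and A: "\<And>z. z \<in> D \<Longrightarrow> A *v z \<in> D"
  shows "mholomorphic_on (\<lambda>z. f (A *v z)) D"
  unfolding mholomorphic_on_def
proof
  fix z assume "z \<in> D"
  then obtain f' where f': "(f has_derivative f') (at (A *v z))" "\<And>c h. f' (c *s h) = c * f' h"
    using f A unfolding mholomorphic_on_def by blast
  have "((\<lambda>z. f (A *v z)) has_derivative (\<lambda>h. f' (A *v h))) (at z)"
    by (rule has_derivative_compose[OF bounded_linear_imp_has_derivative[OF bounded_linear_matrix_complex] f'(1)])
  then show "\<exists>f'. ((\<lambda>z. f (A *v z)) has_derivative f') (at z) \<and> (\<forall>c h. f' (c *s h) = c * f' h)"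
    using f'(2) by (intro exI[of _ "\<lambda>h. f' (A *v h)"]) (simp add: matrix_vector_scale)
qed

lemma mholomorphic_on_line:
  assumes f: "mholomorphic_on f D"
  shows "(\<lambda>w. f (a + w *s v)) holomorphic_on {w. a + w *s v \<in> D}"
proof -
  have "(\<lambda>w. f (a + w *s v)) field_differentiable (at w)" if "a + w *s v \<in> D" for w
  proof -
    have "\<exists>f'. (f has_derivative f') (at (a + w *s v)) \<and> (\<forall>c h. f' (c *s h) = c * f' h)"
      using f[unfolded mholomorphic_on_def] that by (rule bspec)
    then obtain f' where f': "(f has_derivative f') (at (a + w *s v))" "\<And>c h. f' (c *s h) = c * f' h"
      by blast
    have "bounded_linear (\<lambda>h::complex. h *s v)"
      by (subst linear_conv_bounded_linear[symmetric], rule linearI) (simp_all add: vec_eq_iff algebra_simps)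
    from has_derivative_add[OF has_derivative_const bounded_linear_imp_has_derivative[OF this]]
    have "((\<lambda>w. a + w *s v) has_derivative (\<lambda>h. h *s v)) (at w)" by simp
    from has_derivative_compose[OF this f'(1)]
    have "((\<lambda>w. f (a + w *s v)) has_derivative (\<lambda>h. h * f' v)) (at w)" by (simp add: f'(2))
    then have "((\<lambda>w. f (a + w *s v)) has_field_derivative f' v) (at w)"
      by (simp add: has_field_derivative_def mult_commute_abs)
    then show ?thesis by (auto simp: field_differentiable_def)
  qed
  then show ?thesis by (auto simp: holomorphic_on_def intro: field_differentiable_at_within)
qed

lemma mholomorphic_on_const: "mholomorphic_on (\<lambda>z. c) D"
  unfolding mholomorphic_on_def by (intro ballI exI[of _ "\<lambda>h. 0"]) simp

lemma mholomorphic_on_mult: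
  assumes f: "mholomorphic_on f D" and g: "mholomorphic_on g D"
  shows "mholomorphic_on (\<lambda>z. f z * g z) D"
  unfolding mholomorphic_on_def
proof
  fix z assume z: "z \<in> D"
  obtain f' where f': "(f has_derivative f') (at z)" "\<And>c h. f' (c *s h) = c * f' h"
    using f z unfolding mholomorphic_on_def by blast
  obtain g' where g': "(g has_derivative g') (at z)" "\<And>c h. g' (c *s h) = c * g' h"
    using g z unfolding mholomorphic_on_def by blast
  show "\<exists>f'. ((\<lambda>z. f z * g z) has_derivative f') (at z) \<and> (\<forall>c h. f' (c *s h) = c * f' h)"
    using has_derivative_mult[OF f'(1) g'(1)] f'(2) g'(2)
    by (intro exI[of _ "\<lambda>h. f z * g' h + f' h * g z"]) (simp add: algebra_simps)
qed

lemma mholomorphic_on_add: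
  assumes f: "mholomorphic_on f D" and g: "mholomorphic_on g D"
  shows "mholomorphic_on (\<lambda>z. f z + g z) D"
  unfolding mholomorphic_on_def
proof
  fix z assume z: "z \<in> D"
  obtain f' where f': "(f has_derivative f') (at z)" "\<And>c h. f' (c *s h) = c * f' h"
    using f z unfolding mholomorphic_on_def by blast
  obtain g' where g': "(g has_derivative g') (at z)" "\<And>c h. g' (c *s h) = c * g' h"
    using g z unfolding mholomorphic_on_def by blast
  show "\<exists>f'. ((\<lambda>z. f z + g z) has_derivative f') (at z) \<and> (\<forall>c h. f' (c *s h) = c * f' h)"
    using has_derivative_add[OF f'(1) g'(1)] f'(2) g'(2)
    by (intro exI[of _ "\<lambda>h. f' h + g' h"]) (simp add: algebra_simps)
qed

lemma mholomorphic_on_cinner: "mholomorphic_on (\<lambda>z. cinner z w) D"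
  unfolding mholomorphic_on_def
proof
  fix z
  have "linear (\<lambda>z. cinner z w)"
    by (rule linearI) (simp_all add: cinner_def algebra_simps sum.distrib scaleR_sum_right)
  then have "bounded_linear (\<lambda>z. cinner z w)" by (simp add: linear_conv_bounded_linear)
  from bounded_linear_imp_has_derivative[OF this]
  show "\<exists>f'. ((\<lambda>z. cinner z w) has_derivative f') (at z) \<and> (\<forall>c h. f' (c *s h) = c * f' h)"
    by (intro exI[of _ "\<lambda>h. cinner h w"]) (simp add: cinner_scale)
qed

lemma mholomorphic_on_cong:
  assumes "open D" "\<And>z. z \<in> D \<Longrightarrow> f z = g z" "mholomorphic_on f D"
  shows "mholomorphic_on g D"
  unfolding mholomorphic_on_def
proof
  fix z assume z: "z \<in> D"
  then obtain f' where f': "(f has_derivative f') (at z)" "\<And>c h. f' (c *s h) = c * f' h"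
    using assms(3) unfolding mholomorphic_on_def by blast
  have "(g has_derivative f') (at z)"
    by (rule has_derivative_transform_within_open[OF f'(1) assms(1) z assms(2)])
  then show "\<exists>f'. (g has_derivative f') (at z) \<and> (\<forall>c h. f' (c *s h) = c * f' h)"
    using f'(2) by blast
qed

section \<open>Dilations, automorphisms and the invariant measure of the domain\<close>

locale symmetric_domain =
  fixes D bD :: "(complex^'n) set"
    and \<beta> :: "(complex^'n) measure"
    and C :: "complex^'n \<Rightarrow> complex^'n \<Rightarrow> complex"
  assumes bsd: "bounded_symmetric_domain D" and convex_D: "convex D" and circular_D: "circular D"
    and silov: "silov_boundary D bD"
    and unitary: "\<And>A. A \<in> linear_automorphisms D \<Longrightarrow> unitary_matrix A"
    and transitive: "\<And>\<zeta> \<zeta>'. \<zeta> \<in> bD \<Longrightarrow> \<zeta>' \<in> bD \<Longrightarrow> \<exists>A\<in>linear_automorphisms D. A *v \<zeta> = \<zeta>'"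
    and bD_sphere: "bD \<subseteq> sphere 0 1"
    and invariant: "invariant_probability D bD \<beta>"
    and kernel: "cauchy_szego_kernel D \<beta> C"
begin

lemma open_D: "open D" and bounded_D: "bounded D" and D_nonempty: "D \<noteq> {}"
  using bsd by (auto simp: bounded_symmetric_domain_def)

lemma circular: "cmod \<alpha> = 1 \<Longrightarrow> z \<in> D \<Longrightarrow> \<alpha> *s z \<in> D"
  using circular_D by (auto simp: circular_def)

lemma zero_in_D: "0 \<in> D"
proof -
  obtain z where z: "z \<in> D" using D_nonempty by blast
  have "(- 1) *s z \<in> D" by (rule circular[OF _ z]) simp
  then have "(1/2) *\<^sub>R z + (1/2) *\<^sub>R ((- 1) *s z) \<in> D"
    using convexD[OF convex_D z, of _ "1/2" "1/2"] by fastforce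
  moreover have "(1/2) *\<^sub>R z + (1/2) *\<^sub>R ((- 1) *s z) = 0" by (simp add: vec_eq_iff)
  ultimately show ?thesis by metis
qed

text \<open>Convexity and the interior point 0 pull points of the closure strictly inside;
  circularity supplies the phase of \<open>w\<close>. In particular the open slice disc of a
  boundary point lies in \<open>D\<close>.\<close>

lemma scale_closure:
  assumes w: "cmod w < 1" and z: "z \<in> closure D"
  shows "w *s z \<in> D"
proof (cases "w = 0")
  case True
  then show ?thesis using zero_in_D by simp
next
  case False
  have "z - (1 - cmod w) *\<^sub>R (z - 0) \<in> interior D"
    by (rule mem_interior_closure_convex_shrink[OF convex_D _ z])
      (use w False zero_in_D open_D in \<open>auto simp: interior_open\<close>)
  then have "cmod w *\<^sub>R z \<in> D" using open_D by (simp add: interior_open algebra_simps)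
  then have "(w / cmod w) *s (cmod w *\<^sub>R z) \<in> D"
    by (rule circular[rotated]) (use False in \<open>simp add: norm_divide\<close>)
  moreover have "(w / cmod w) *s (cmod w *\<^sub>R z) = w *s z"
    using False by (simp add: vec_eq_iff scaleR_conv_of_real[where 'a=complex])
  ultimately show ?thesis by simp
qed

lemma scale_D: "cmod w \<le> 1 \<Longrightarrow> z \<in> D \<Longrightarrow> w *s z \<in> D"
  using scale_closure[of w z] circular[of w z] closure_subset[of D] by (cases "cmod w = 1") auto

lemma compact_closure_D: "compact (closure D)"
  using bounded_D by (simp add: compact_closure)

lemma bD_closure: "bD \<subseteq> closure D" and closed_bD: "closed bD"
  using silov by (auto simp: silov_boundary_def maximum_boundary_def frontier_def)

lemma compact_bD: "compact bD"
  using bD_closure closed_bD compact_closure_D by (metis compact_Int_closed inf.absorb2)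

lemma scale_bD: "cmod w < 1 \<Longrightarrow> z \<in> bD \<Longrightarrow> w *s z \<in> D"
  using scale_closure bD_closure by blast

lemma automorphism_D: "A \<in> linear_automorphisms D \<Longrightarrow> z \<in> D \<Longrightarrow> A *v z \<in> D"
  by (auto simp: linear_automorphisms_def)

lemma automorphism_inverse:
  assumes "A \<in> linear_automorphisms D"
  shows "\<exists>B\<in>linear_automorphisms D. (\<forall>z. B *v (A *v z) = z) \<and> (\<forall>z. A *v (B *v z) = z)"
proof -
  obtain B where B: "A ** B = mat 1" "B ** A = mat 1"
    using assms by (auto simp: linear_automorphisms_def invertible_def)
  have 1: "B *v (A *v z) = z" "A *v (B *v z) = z" for z
    using B by (simp_all add: matrix_vector_mul_assoc)
  have D: "(\<lambda>z. A *v z) ` D = D" using assms by (simp add: linear_automorphisms_def)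
  then have "(\<lambda>z. B *v z) ` D = (\<lambda>z. B *v z) ` ((\<lambda>z. A *v z) ` D)" by simp
  also have "\<dots> = D" by (simp add: image_image 1)
  finally have "B \<in> linear_automorphisms D"
    using B by (auto simp: linear_automorphisms_def invertible_def)
  then show ?thesis using 1 by blast
qed

lemma automorphism_closure:
  assumes "A \<in> linear_automorphisms D" "z \<in> closure D"
  shows "A *v z \<in> closure D"
  using closure_bounded_linear_image_subset[OF bounded_linear_matrix_complex[of A], of D]
    assms by (auto simp: linear_automorphisms_def)

lemma automorphism_frontier:
  assumes A: "A \<in> linear_automorphisms D" and z: "z \<in> frontier D"
  shows "A *v z \<in> frontier D"
proof -
  obtain B where B: "B \<in> linear_automorphisms D" "\<And>z. B *v (A *v z) = z"
    using automorphism_inverse[OF A] by blast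
  have "A *v z \<notin> D" using automorphism_D[OF B(1), of "A *v z"] B(2) z open_D
    by (auto simp: frontier_def interior_open)
  then show ?thesis
    using z automorphism_closure[OF A] open_D by (auto simp: frontier_def interior_open)
qed

text \<open>Composition with \<open>A\<close> preserves the algebra that defines the Silov boundary,
  so the image of \<open>bD\<close> is again a maximum boundary and contains \<open>bD\<close> by
  minimality.\<close>

lemma silov_subset_automorphism:
  assumes A: "A \<in> linear_automorphisms D"
  shows "bD \<subseteq> (\<lambda>z. A *v z) ` bD"
proof -
  have mb: "maximum_boundary D bD" and min: "\<And>B. maximum_boundary D B \<Longrightarrow> bD \<subseteq> B"
    using silov by (auto simp: silov_boundary_def)
  have "maximum_boundary D ((\<lambda>z. A *v z) ` bD)"
    unfolding maximum_boundary_def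
  proof (intro conjI allI impI)
    show "closed ((\<lambda>z. A *v z) ` bD)"
      by (intro compact_imp_closed compact_continuous_image compact_bD continuous_intros)
    show "(\<lambda>z. A *v z) ` bD \<subseteq> frontier D"
      using mb automorphism_frontier[OF A] unfolding maximum_boundary_def by blast
    fix f assume f: "mholomorphic_on f D \<and> continuous_on (closure D) f"
    let ?g = "\<lambda>z. f (A *v z)"
    have "mholomorphic_on ?g D"
      using f automorphism_D[OF A] by (intro mholomorphic_on_compose_matrix) auto
    moreover have "continuous_on (closure D) ?g"
      using f automorphism_closure[OF A] by (auto intro!: continuous_on_compose2[of "closure D" f] continuous_intros)
    ultimately obtain \<zeta> where \<zeta>: "\<zeta> \<in> bD" "\<And>\<zeta>'. \<zeta>' \<in> bD \<Longrightarrow> cmod (?g \<zeta>') \<le> cmod (?g \<zeta>)"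
      "(SUP z\<in>D. cmod (?g z)) = cmod (?g \<zeta>)"
      using mb unfolding maximum_boundary_def by blast
    have "(SUP z\<in>D. cmod (?g z)) = (SUP z\<in>(\<lambda>z. A *v z) ` D. cmod (f z))" by (simp add: image_image)
    also have "(\<lambda>z. A *v z) ` D = D" using A by (simp add: linear_automorphisms_def)
    finally show "\<exists>\<zeta>\<in>(\<lambda>z. A *v z) ` bD. (\<forall>\<zeta>'\<in>(\<lambda>z. A *v z) ` bD. cmod (f \<zeta>') \<le> cmod (f \<zeta>)) \<and>
        (SUP z\<in>D. cmod (f z)) = cmod (f \<zeta>)"
      using \<zeta> by (intro bexI[of _ "A *v \<zeta>"]) simp_all
  qed
  then show ?thesis by (rule min)
qed

lemma automorphism_bD:
  assumes A: "A \<in> linear_automorphisms D" and z: "z \<in> bD"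
  shows "A *v z \<in> bD"
proof -
  obtain B where B: "B \<in> linear_automorphisms D" "\<And>z. A *v (B *v z) = z"
    using automorphism_inverse[OF A] by blast
  from silov_subset_automorphism[OF B(1)] z obtain y where "y \<in> bD" "z = B *v y" by blast
  then show ?thesis using B(2) by simp
qed

text \<open>Embeds the circle into the group of linear automorphisms, so that invariance under the
  group includes invariance under rotations.\<close>

lemma scalar_automorphism:
  assumes "cmod \<alpha> = 1"
  shows "mat \<alpha> \<in> linear_automorphisms D"
proof -
  have ne: "\<alpha> \<noteq> 0" using assms by auto
  have "mat \<alpha> ** mat (1 / \<alpha>) = (mat 1 :: complex^'n^'n)" "mat (1 / \<alpha>) ** mat \<alpha> = (mat 1 :: complex^'n^'n)"
    using ne by (simp_all add: vec_eq_iff matrix_matrix_mult_def mat_def if_distrib[of "\<lambda>x. x * _"] cong: if_cong)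
  then have "invertible (mat \<alpha> :: complex^'n^'n)" by (auto simp: invertible_def)
  moreover have "(\<lambda>z. \<alpha> *s z) ` D = D"
  proof
    show "(\<lambda>z. \<alpha> *s z) ` D \<subseteq> D" using circular[OF assms] by blast
    show "D \<subseteq> (\<lambda>z. \<alpha> *s z) ` D"
    proof
      fix z assume "z \<in> D"
      then have "(1 / \<alpha>) *s z \<in> D" by (rule circular[rotated]) (simp add: norm_divide assms)
      then show "z \<in> (\<lambda>z. \<alpha> *s z) ` D"
        by (rule image_eqI[rotated]) (use ne in \<open>simp add: vec_eq_iff\<close>)
    qed
  qed
  ultimately show ?thesis by (simp add: linear_automorphisms_def mat_scale)
qed

lemma circular_bD: "cmod \<alpha> = 1 \<Longrightarrow> z \<in> bD \<Longrightarrow> \<alpha> *s z \<in> bD"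
  using automorphism_bD[OF scalar_automorphism, of \<alpha> z] by (simp add: mat_scale)

lemma sets_\<beta>: "sets \<beta> = sets (borel_on bD)" and space_\<beta>: "space \<beta> = bD" and emeasure_\<beta>: "emeasure \<beta> bD = 1"
  using invariant by (auto simp: invariant_probability_def)

lemma finite_\<beta>: "finite_measure \<beta>"
  by (rule finite_measureI) (simp add: space_\<beta> emeasure_\<beta>)

lemma measure_\<beta>: "measure \<beta> bD = 1"
  by (simp add: measure_def emeasure_\<beta>)

lemma bD_nonempty: "bD \<noteq> {}"
  using emeasure_\<beta> by auto

lemma continuous_\<beta>_measurable:
  fixes f :: "complex^'n \<Rightarrow> 'b::topological_space"
  shows "continuous_on bD f \<Longrightarrow> f \<in> borel_measurable \<beta>"
  using continuous_imp_borel_on[of bD f] by (simp add: measurable_cong_sets[OF sets_\<beta> refl])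

lemma continuous_bD_bounded:
  fixes f :: "complex^'n \<Rightarrow> 'b::real_normed_vector"
  assumes "continuous_on bD f"
  shows "\<exists>B. \<forall>\<zeta>\<in>bD. norm (f \<zeta>) \<le> B"
  using compact_imp_bounded[OF compact_continuous_image[OF assms compact_bD]]
  unfolding bounded_iff by blast

lemma bounded_\<beta>_integrable:
  fixes f :: "complex^'n \<Rightarrow> 'b::{banach, second_countable_topology}"
  assumes "f \<in> borel_measurable \<beta>" "\<And>\<zeta>. \<zeta> \<in> bD \<Longrightarrow> norm (f \<zeta>) \<le> B"
  shows "integrable \<beta> f"
  by (rule finite_measure.integrable_const_bound[OF finite_\<beta>, of _ B])
    (use assms in \<open>auto intro!: AE_I2 simp: space_\<beta>\<close>)

lemma continuous_\<beta>_integrable: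
  fixes f :: "complex^'n \<Rightarrow> 'b::{banach, second_countable_topology}"
  assumes "continuous_on bD f"
  shows "integrable \<beta> f"
  using continuous_bD_bounded[OF assms] bounded_\<beta>_integrable[OF continuous_\<beta>_measurable[OF assms]] by blast

lemma automorphism_measurable:
  assumes "A \<in> linear_automorphisms D"
  shows "(\<lambda>\<zeta>. A *v \<zeta>) \<in> measurable \<beta> \<beta>"
  unfolding measurable_cong_sets[OF sets_\<beta> sets_\<beta>]
  by (rule measurable_restrict_space2[OF _ continuous_imp_borel_on])
    (use automorphism_bD[OF assms] in \<open>auto simp: space_restrict_space intro!: continuous_intros\<close>)

lemma \<beta>_invariant:
  fixes f :: "complex^'n \<Rightarrow> 'b::{banach, second_countable_topology}"
  assumes A: "A \<in> linear_automorphisms D" and f: "f \<in> borel_measurable \<beta>"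
  shows "(LINT \<zeta>|\<beta>. f (A *v \<zeta>)) = (LINT \<zeta>|\<beta>. f \<zeta>)"
proof -
  have "distr \<beta> \<beta> (\<lambda>\<zeta>. A *v \<zeta>) = \<beta>"
    using invariant A by (auto simp: invariant_probability_def)
  then show ?thesis
    using integral_distr[OF automorphism_measurable[OF A] f] by simp
qed

lemma \<beta>_circle_invariant:
  fixes f :: "complex^'n \<Rightarrow> 'b::{banach, second_countable_topology}"
  assumes "cmod \<alpha> = 1" "f \<in> borel_measurable \<beta>"
  shows "(LINT \<zeta>|\<beta>. f (\<alpha> *s \<zeta>)) = (LINT \<zeta>|\<beta>. f \<zeta>)"
  using \<beta>_invariant[OF scalar_automorphism[OF assms(1)] assms(2)] by (simp add: mat_scale)

text \<open>Invariance under rotations combined with Fubini: integrating over \<open>bD\<close>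
  amounts to averaging along orbits before integrating. This is how one-variable facts on slices
  enter.\<close>

lemma \<beta>_circle_average:
  fixes f :: "complex^'n \<Rightarrow> complex"
  assumes f: "continuous_on bD f"
  shows "(LINT \<zeta>|\<beta>. f \<zeta>) = (LINT \<zeta>|\<beta>. LINT \<alpha>|circle_haar. f (\<alpha> *s \<zeta>))"
proof -
  have cont: "continuous_on (sphere 0 1 \<times> bD) (\<lambda>(\<alpha>, \<zeta>). f (\<alpha> *s \<zeta>))"
    unfolding case_prod_unfold
    by (rule continuous_on_compose2[OF f]) (auto intro!: continuous_intros circular_bD)
  have "(LINT \<alpha>|circle_haar. LINT \<zeta>|\<beta>. f (\<alpha> *s \<zeta>) * 1) = (LINT \<zeta>|\<beta>. (LINT \<alpha>|circle_haar. f (\<alpha> *s \<zeta>)) * 1)"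
    by (rule Fubini_continuous[OF cont _ compact_bD _ closed_bD sets_circle_haar
          circle.finite_measure_axioms sets_\<beta> finite_\<beta>, of _ 1]) auto
  moreover have "(LINT \<alpha>|circle_haar. LINT \<zeta>|\<beta>. f (\<alpha> *s \<zeta>)) = (LINT \<alpha>|circle_haar. LINT \<zeta>|\<beta>. f \<zeta>)"
    by (intro LINT_cong \<beta>_circle_invariant continuous_\<beta>_measurable f) auto
  ultimately show ?thesis by simp
qed

end

section \<open>The Hardy space and its reproducing kernel\<close>

lemma scaleR_eq_scale: "r *\<^sub>R z = complex_of_real r *s z" for z :: "complex^'n"
  by (simp add: vec_eq_iff scaleR_conv_of_real[where 'a=complex])

lemma sesquiholomorphic_continuous:
  assumes "sesquiholomorphic_on C U"
  shows "continuous_on U (\<lambda>(z, w). C z w)"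
proof (rule continuous_at_imp_continuous_on, rule ballI)
  fix p assume "p \<in> U"
  with assms have "\<exists>A B. ((\<lambda>(z, w). C z w) has_derivative (\<lambda>(h, k). A h + B k)) (at p)"
    unfolding sesquiholomorphic_on_def by blast
  then show "isCont (\<lambda>(z, w). C z w) p"
    using has_derivative_continuous by blast
qed

context symmetric_domain
begin

section \<open>The ball algebra inside the Hardy space\<close>

definition ball_algebra :: "(complex^'n \<Rightarrow> complex) \<Rightarrow> bool" where
  "ball_algebra F \<longleftrightarrow> mholomorphic_on F D \<and> continuous_on (closure D) F"

lemma ball_algebra_bD: "ball_algebra F \<Longrightarrow> continuous_on bD F"
  unfolding ball_algebra_def using bD_closure continuous_on_subset by blast

lemma ball_algebra_const: "ball_algebra (\<lambda>z. c)"
  by (simp add: ball_algebra_def mholomorphic_on_const)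

lemma ball_algebra_mult: "ball_algebra F \<Longrightarrow> ball_algebra G \<Longrightarrow> ball_algebra (\<lambda>z. F z * G z)"
  by (simp add: ball_algebra_def mholomorphic_on_mult continuous_on_mult)

lemma ball_algebra_add: "ball_algebra F \<Longrightarrow> ball_algebra G \<Longrightarrow> ball_algebra (\<lambda>z. F z + G z)"
  by (simp add: ball_algebra_def mholomorphic_on_add continuous_on_add)

lemma ball_algebra_cinner: "ball_algebra (\<lambda>z. cinner z w)"
  by (simp add: ball_algebra_def mholomorphic_on_cinner continuous_on_cinner)

lemma ball_algebra_compose:
  assumes "ball_algebra F" "A \<in> linear_automorphisms D"
  shows "ball_algebra (\<lambda>z. F (A *v z))"
  using assms automorphism_D[OF assms(2)] automorphism_closure[OF assms(2)]
  unfolding ball_algebra_def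
  by (auto intro!: mholomorphic_on_compose_matrix continuous_on_compose2[of "closure D" F] continuous_intros)

text \<open>The one-variable monotonicity on each slice, averaged over \<open>bD\<close>.\<close>

lemma ball_algebra_mean_square_mono:
  assumes F: "ball_algebra F" and \<rho>: "0 \<le> \<rho>" "\<rho> \<le> 1"
  shows "(LINT \<zeta>|\<beta>. (cmod (F (of_real \<rho> *s \<zeta>)))\<^sup>2) \<le> (LINT \<zeta>|\<beta>. (cmod (F \<zeta>))\<^sup>2)"
proof -
  have cl: "of_real \<rho> *s z \<in> closure D" if "z \<in> closure D" for z
    using scale_closure[of "of_real \<rho>" z] closure_subset[of D] \<rho> that by (cases "\<rho> = 1") auto
  have Fc: "continuous_on (closure D) F" using F by (simp add: ball_algebra_def)
  have c\<rho>: "continuous_on bD (\<lambda>\<zeta>. F (of_real \<rho> *s \<zeta>))"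
    by (rule continuous_on_compose2[OF Fc]) (use cl bD_closure in \<open>auto intro!: continuous_intros\<close>)
  have avg: "(LINT \<zeta>|\<beta>. (cmod (f \<zeta>))\<^sup>2) = (LINT \<zeta>|\<beta>. LINT \<alpha>|circle_haar. (cmod (f (\<alpha> *s \<zeta>)))\<^sup>2)"
    if f: "continuous_on bD f" for f
  proof -
    have "complex_of_real (LINT \<zeta>|\<beta>. (cmod (f \<zeta>))\<^sup>2) = (LINT \<zeta>|\<beta>. complex_of_real ((cmod (f \<zeta>))\<^sup>2))"
      by (rule integral_complex_of_real[symmetric])
    also have "\<dots> = (LINT \<zeta>|\<beta>. LINT \<alpha>|circle_haar. complex_of_real ((cmod (f (\<alpha> *s \<zeta>)))\<^sup>2))"
      by (rule \<beta>_circle_average) (intro continuous_intros f)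
    also have "\<dots> = complex_of_real (LINT \<zeta>|\<beta>. LINT \<alpha>|circle_haar. (cmod (f (\<alpha> *s \<zeta>)))\<^sup>2)"
      unfolding integral_complex_of_real ..
    finally show ?thesis using of_real_eq_iff by blast
  qed
  have int: "integrable \<beta> (\<lambda>\<zeta>. LINT \<alpha>|circle_haar. (cmod (f (\<alpha> *s \<zeta>)))\<^sup>2)" if f: "continuous_on bD f" for f
  proof -
    have cont: "continuous_on (bD \<times> sphere 0 1) (\<lambda>p. complex_of_real ((cmod (f (snd p *s fst p)))\<^sup>2))"
      by (intro continuous_intros continuous_on_compose2[OF f]) (auto intro: circular_bD)
    interpret pair_sigma_finite \<beta> circle_haar
      unfolding pair_sigma_finite_def
      using finite_\<beta> circle.sigma_finite_measure_axioms finite_measure.axioms(1) by blast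
    have m: "(\<lambda>p. complex_of_real ((cmod (f (snd p *s fst p)))\<^sup>2)) \<in> borel_measurable (\<beta> \<Otimes>\<^sub>M circle_haar)"
      by (rule continuous_imp_pair_measurable[OF cont closed_bD _ sets_\<beta> sets_circle_haar]) simp
    obtain B where B: "\<And>\<zeta>. \<zeta> \<in> bD \<Longrightarrow> cmod (f \<zeta>) \<le> B"
      using continuous_bD_bounded[OF f] by blast
    have "integrable (\<beta> \<Otimes>\<^sub>M circle_haar) (\<lambda>p. complex_of_real ((cmod (f (snd p *s fst p)))\<^sup>2))"
    proof (rule finite_measure.integrable_const_bound[OF finite_measure_pair_measure[OF circle.finite_measure_axioms finite_\<beta>] _ m, of "B\<^sup>2"])
      show "AE p in \<beta> \<Otimes>\<^sub>M circle_haar. norm (complex_of_real ((cmod (f (snd p *s fst p)))\<^sup>2)) \<le> B\<^sup>2"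
      proof (rule AE_I2)
        fix p assume "p \<in> space (\<beta> \<Otimes>\<^sub>M circle_haar)"
        then have "snd p *s fst p \<in> bD" by (auto simp: space_pair_measure space_\<beta> intro: circular_bD)
        then have "(cmod (f (snd p *s fst p)))\<^sup>2 \<le> B\<^sup>2" using B by (simp add: power_mono)
        then show "norm (complex_of_real ((cmod (f (snd p *s fst p)))\<^sup>2)) \<le> B\<^sup>2"
          by (simp only: norm_of_real) simp
      qed
    qed
    from integrable_Re[OF integrable_fst'[OF this]]
    show ?thesis by (simp only: snd_conv fst_conv integral_complex_of_real Re_complex_of_real)
  qed
  have slice: "(LINT \<alpha>|circle_haar. (cmod (F (of_real \<rho> *s (\<alpha> *s \<zeta>))))\<^sup>2) \<le> (LINT \<alpha>|circle_haar. (cmod (F (\<alpha> *s \<zeta>)))\<^sup>2)"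
    if \<zeta>: "\<zeta> \<in> bD" for \<zeta>
  proof -
    let ?g = "\<lambda>w. F (w *s \<zeta>)"
    have in_cl: "w *s \<zeta> \<in> closure D" if "cmod w \<le> 1" for w
      using scale_bD[of w \<zeta>] circular_bD[of w \<zeta>] \<zeta> that bD_closure closure_subset[of D]
      by (cases "cmod w = 1") auto
    have "continuous_on (cball 0 1) ?g"
      by (rule continuous_on_compose2[OF Fc]) (use in_cl in \<open>auto intro!: continuous_intros\<close>)
    moreover have "?g holomorphic_on ball 0 1"
      using mholomorphic_on_line[of F D 0 \<zeta>] F scale_bD[OF _ \<zeta>]
      unfolding ball_algebra_def by (auto elim!: holomorphic_on_subset)
    ultimately show ?thesis
      using holomorphic_circle_mean_square_mono[of ?g \<rho>] \<rho> by (simp add: vector_smult_assoc)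
  qed
  show ?thesis
    unfolding avg[OF c\<rho>] avg[OF ball_algebra_bD[OF F]]
    by (rule integral_mono[OF int[OF c\<rho>] int[OF ball_algebra_bD[OF F]] slice]) (simp add: space_\<beta>)
qed

text \<open>The mean squares are bounded by the one at radius 1 and converge to it, so their
  supremum is an integral over \<open>bD\<close>. The later computations with Hardy norms stay in
  the ball algebra, where this formula replaces boundary values of general Hardy functions.\<close>

lemma hardy_sq_ball_algebra:
  assumes F: "ball_algebra F" and eq: "\<And>z. z \<in> D \<Longrightarrow> f z = F z"
  shows "hardy_sq \<beta> f = ennreal (LINT \<zeta>|\<beta>. (cmod (F \<zeta>))\<^sup>2)"
proof -
  define J where "J = (\<lambda>\<rho>::real. LINT \<zeta>|\<beta>. (cmod (F (of_real \<rho> *s \<zeta>)))\<^sup>2)"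
  have Fc: "continuous_on (closure D) F" using F by (simp add: ball_algebra_def)
  have inD: "complex_of_real \<rho> *s \<zeta> \<in> D" if "\<rho> \<in> {0..<1}" "\<zeta> \<in> bD" for \<rho> \<zeta>
    using scale_bD[of "of_real \<rho>" \<zeta>] that by simp
  have c\<rho>: "continuous_on bD (\<lambda>\<zeta>. F (of_real \<rho> *s \<zeta>))" if "\<rho> \<in> {0..<1}" for \<rho> :: real
    by (rule continuous_on_compose2[OF Fc]) (use inD[OF that] closure_subset[of D] in \<open>auto intro!: continuous_intros\<close>)
  have eqJ: "(\<integral>\<^sup>+\<zeta>. ennreal ((cmod (f (\<rho> *\<^sub>R \<zeta>)))\<^sup>2) \<partial>\<beta>) = ennreal (J \<rho>)" if \<rho>: "\<rho> \<in> {0..<1}" for \<rho>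
  proof -
    have "(\<integral>\<^sup>+\<zeta>. ennreal ((cmod (f (\<rho> *\<^sub>R \<zeta>)))\<^sup>2) \<partial>\<beta>) = (\<integral>\<^sup>+\<zeta>. ennreal ((cmod (F (of_real \<rho> *s \<zeta>)))\<^sup>2) \<partial>\<beta>)"
      by (intro nn_integral_cong) (simp add: space_\<beta> scaleR_eq_scale eq inD[OF \<rho>])
    also have "\<dots> = ennreal (J \<rho>)"
      unfolding J_def by (intro nn_integral_eq_integral continuous_\<beta>_integrable continuous_intros c\<rho> \<rho>) simp
    finally show ?thesis .
  qed
  define \<rho> where "\<rho> = (\<lambda>n::nat. 1 - 1 / (real n + 1))"
  have \<rho>1: "\<rho> n \<in> {0..<1}" for n by (simp add: \<rho>_def)
  have \<rho>lim: "\<rho> \<longlonglongrightarrow> 1" unfolding \<rho>_def by real_asymp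
  obtain B where B: "\<And>x. x \<in> closure D \<Longrightarrow> cmod (F x) \<le> B"
    using compact_imp_bounded[OF compact_continuous_image[OF Fc compact_closure_D]]
    unfolding bounded_iff by blast
  have "(\<lambda>n. J (\<rho> n)) \<longlonglongrightarrow> (LINT \<zeta>|\<beta>. (cmod (F \<zeta>))\<^sup>2)"
    unfolding J_def
  proof (rule integral_dominated_convergence[where w="\<lambda>_. B\<^sup>2"])
    show "(\<lambda>\<zeta>. (cmod (F \<zeta>))\<^sup>2) \<in> borel_measurable \<beta>"
      "(\<lambda>\<zeta>. (cmod (F (of_real (\<rho> n) *s \<zeta>)))\<^sup>2) \<in> borel_measurable \<beta>" for n
      by (intro continuous_\<beta>_measurable continuous_intros c\<rho>[OF \<rho>1] ball_algebra_bD[OF F])+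
    show "integrable \<beta> (\<lambda>_. B\<^sup>2)"
      by (intro continuous_\<beta>_integrable continuous_intros)
    show "AE \<zeta> in \<beta>. (\<lambda>n. (cmod (F (of_real (\<rho> n) *s \<zeta>)))\<^sup>2) \<longlonglongrightarrow> (cmod (F \<zeta>))\<^sup>2"
    proof (rule AE_I2)
      fix \<zeta> assume "\<zeta> \<in> space \<beta>"
      then have \<zeta>: "\<zeta> \<in> bD" by (simp add: space_\<beta>)
      have "(\<lambda>n. \<rho> n *\<^sub>R \<zeta>) \<longlonglongrightarrow> 1 *\<^sub>R \<zeta>" by (intro tendsto_intros \<rho>lim)
      then have "(\<lambda>n. of_real (\<rho> n) *s \<zeta>) \<longlonglongrightarrow> \<zeta>" by (simp add: scaleR_eq_scale)
      then have "(\<lambda>n. F (of_real (\<rho> n) *s \<zeta>)) \<longlonglongrightarrow> F \<zeta>"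
        by (rule continuous_on_tendsto_compose[OF Fc])
          (use inD[OF \<rho>1 \<zeta>] \<zeta> bD_closure closure_subset[of D] in \<open>auto intro!: always_eventually\<close>)
      then show "(\<lambda>n. (cmod (F (of_real (\<rho> n) *s \<zeta>)))\<^sup>2) \<longlonglongrightarrow> (cmod (F \<zeta>))\<^sup>2"
        by (intro tendsto_intros)
    qed
    show "AE \<zeta> in \<beta>. norm ((cmod (F (of_real (\<rho> n) *s \<zeta>)))\<^sup>2) \<le> B\<^sup>2" for n
    proof (rule AE_I2)
      fix \<zeta> assume "\<zeta> \<in> space \<beta>"
      then have "of_real (\<rho> n) *s \<zeta> \<in> closure D"
        using inD[OF \<rho>1] closure_subset[of D] by (auto simp: space_\<beta>)
      then show "norm ((cmod (F (of_real (\<rho> n) *s \<zeta>)))\<^sup>2) \<le> B\<^sup>2" by (simp add: B power_mono)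
    qed
  qed
  then have lim: "(\<lambda>n. ennreal (J (\<rho> n))) \<longlonglongrightarrow> ennreal (LINT \<zeta>|\<beta>. (cmod (F \<zeta>))\<^sup>2)"
    by (rule tendsto_ennrealI)
  have "hardy_sq \<beta> f = (SUP \<rho>\<in>{0..<1}. ennreal (J \<rho>))"
    unfolding hardy_sq_def by (intro SUP_cong refl eqJ)
  also have "\<dots> = ennreal (LINT \<zeta>|\<beta>. (cmod (F \<zeta>))\<^sup>2)"
  proof (rule antisym)
    show "(SUP \<rho>\<in>{0..<1}. ennreal (J \<rho>)) \<le> ennreal (LINT \<zeta>|\<beta>. (cmod (F \<zeta>))\<^sup>2)"
      unfolding J_def by (intro SUP_least ennreal_leI ball_algebra_mean_square_mono[OF F]) auto
    have "ennreal (J (\<rho> n)) \<le> (SUP \<rho>\<in>{0..<1}. ennreal (J \<rho>))" for n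
      by (rule SUP_upper[OF \<rho>1])
    then show "ennreal (LINT \<zeta>|\<beta>. (cmod (F \<zeta>))\<^sup>2) \<le> (SUP \<rho>\<in>{0..<1}. ennreal (J \<rho>))"
      by (intro LIMSEQ_le_const2[OF lim]) blast
  qed
  finally show ?thesis .
qed

text \<open>The polarization identity, with each Hardy norm replaced by its boundary
  integral.\<close>

lemma hardy_inner_ball_algebra:
  assumes F: "ball_algebra F" "\<And>z. z \<in> D \<Longrightarrow> f z = F z"
    and G: "ball_algebra G" "\<And>z. z \<in> D \<Longrightarrow> g z = G z"
  shows "hardy_inner \<beta> f g = (LINT \<zeta>|\<beta>. F \<zeta> * cnj (G \<zeta>))"
proof -
  let ?H = "\<lambda>k \<zeta>. F \<zeta> + \<i> ^ k * G \<zeta>"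
  have H: "ball_algebra (?H k)" for k
    by (intro ball_algebra_add ball_algebra_mult ball_algebra_const F(1) G(1))
  have "enn2real (hardy_sq \<beta> (\<lambda>z. f z + \<i> ^ k * g z)) = (LINT \<zeta>|\<beta>. (cmod (?H k \<zeta>))\<^sup>2)" for k
    by (subst hardy_sq_ball_algebra[OF H]) (simp_all add: F(2) G(2))
  then have "hardy_inner \<beta> f g = (\<Sum>k<4::nat. \<i> ^ k * (LINT \<zeta>|\<beta>. complex_of_real ((cmod (?H k \<zeta>))\<^sup>2))) / 4"
    unfolding hardy_inner_def integral_complex_of_real by simp
  also have "\<dots> = (LINT \<zeta>|\<beta>. (\<Sum>k<4::nat. \<i> ^ k * complex_of_real ((cmod (?H k \<zeta>))\<^sup>2)) / 4)"
  proof -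
    have "integrable \<beta> (\<lambda>\<zeta>. \<i> ^ k * complex_of_real ((cmod (?H k \<zeta>))\<^sup>2))" for k
      by (intro continuous_\<beta>_integrable continuous_intros ball_algebra_bD F(1) G(1))
    then show ?thesis
      by (simp only: integral_divide_zero Bochner_Integration.integral_sum integral_mult_right_zero)
  qed
  also have "\<dots> = (LINT \<zeta>|\<beta>. F \<zeta> * cnj (G \<zeta>))"
  proof (intro LINT_cong)
    fix \<zeta>
    show "(\<Sum>k<4::nat. \<i> ^ k * complex_of_real ((cmod (?H k \<zeta>))\<^sup>2)) / 4 = F \<zeta> * cnj (G \<zeta>)"
      unfolding complex_norm_square
      by (simp add: eval_nat_numeral lessThan_Suc) (simp add: complex_eq_iff algebra_simps)
  qed
  finally show ?thesis .
qed

lemma kernel_hardy: "w \<in> D \<Longrightarrow> (\<lambda>z. C z w) \<in> hardy_space D \<beta>"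
  and kernel_reproducing: "w \<in> D \<Longrightarrow> f \<in> hardy_space D \<beta> \<Longrightarrow> f w = hardy_inner \<beta> f (\<lambda>z. C z w)"
  using kernel unfolding cauchy_szego_kernel_def by blast+

lemma hardy_inner_commute: "hardy_inner \<beta> g f = cnj (hardy_inner \<beta> f g)"
proof -
  have sc: "hardy_sq \<beta> (\<lambda>z. c * h z) = hardy_sq \<beta> h" if "cmod c = 1" for c h
    using that by (simp add: hardy_sq_def norm_mult)
  have 1: "hardy_sq \<beta> (\<lambda>z. g z + f z) = hardy_sq \<beta> (\<lambda>z. f z + g z)"
    by (simp add: add.commute)
  have 2: "hardy_sq \<beta> (\<lambda>z. g z + \<i> * f z) = hardy_sq \<beta> (\<lambda>z. f z - \<i> * g z)"
    using sc[of "\<i>" "\<lambda>z. f z - \<i> * g z"] by (simp add: algebra_simps)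
  have 3: "hardy_sq \<beta> (\<lambda>z. g z - f z) = hardy_sq \<beta> (\<lambda>z. f z - g z)"
    using sc[of "- 1" "\<lambda>z. f z - g z"] by (simp add: algebra_simps)
  have 4: "hardy_sq \<beta> (\<lambda>z. g z - \<i> * f z) = hardy_sq \<beta> (\<lambda>z. f z + \<i> * g z)"
    using sc[of "- \<i>" "\<lambda>z. f z + \<i> * g z"] by (simp add: algebra_simps)
  show ?thesis
    unfolding hardy_inner_def by (simp add: eval_nat_numeral lessThan_Suc 1 2 3 4)
qed

text \<open>By the reproducing property \<open>C z w\<close> is the scalar product of the kernel
  functions of \<open>w\<close> and \<open>z\<close>.\<close>

lemma kernel_hermitian:
  assumes "z \<in> D" "w \<in> D" shows "C z w = cnj (C w z)"
  using kernel_reproducing[OF assms(1) kernel_hardy[OF assms(2)]]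
    kernel_reproducing[OF assms(2) kernel_hardy[OF assms(1)]] hardy_inner_commute by metis

lemma kernel_sesquiholomorphic:
  "\<exists>U. open U \<and> D \<times> closure D \<subseteq> U \<and> sesquiholomorphic_on C U"
  using kernel by (simp add: cauchy_szego_kernel_def)

lemma kernel_continuous: "continuous_on (D \<times> closure D) (\<lambda>(z, w). C z w)"
  using kernel_sesquiholomorphic sesquiholomorphic_continuous continuous_on_subset by blast

lemma kernel_continuous_compose [continuous_intros]:
  assumes "continuous_on S f" "continuous_on S g" "f ` S \<subseteq> D" "g ` S \<subseteq> closure D"
  shows "continuous_on S (\<lambda>x. C (f x) (g x))"
  using continuous_on_compose2[OF kernel_continuous continuous_on_Pair[OF assms(1,2)]] assms(3,4)
  by (simp add: image_subset_iff)

text \<open>It is the second variable of the kernel that reaches the boundary; hermitian symmetry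
  shows that the conjugate is holomorphic in that variable inside \<open>D\<close>.\<close>

lemma kernel_ball_algebra:
  assumes w: "w \<in> D" shows "ball_algebra (\<lambda>z. cnj (C w z))"
  unfolding ball_algebra_def
proof
  have "mholomorphic_on (\<lambda>z. C z w) D" using kernel_hardy[OF w] by (simp add: hardy_space_def)
  then show "mholomorphic_on (\<lambda>z. cnj (C w z)) D"
    by (rule mholomorphic_on_cong[OF open_D, rotated]) (rule kernel_hermitian[OF _ w])
  show "continuous_on (closure D) (\<lambda>z. cnj (C w z))"
    using w by (intro continuous_intros) auto
qed

lemma ball_algebra_hardy: "ball_algebra F \<Longrightarrow> F \<in> hardy_space D \<beta>"
  using hardy_sq_ball_algebra[of F F] by (simp add: hardy_space_def ball_algebra_def)

lemma kernel_reproducing_boundary: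
  assumes F: "ball_algebra F" and w: "w \<in> D"
  shows "F w = (LINT \<zeta>|\<beta>. F \<zeta> * C w \<zeta>)"
proof -
  have "F w = hardy_inner \<beta> F (\<lambda>z. C z w)"
    by (rule kernel_reproducing[OF w ball_algebra_hardy[OF F]])
  also have "\<dots> = (LINT \<zeta>|\<beta>. F \<zeta> * cnj (cnj (C w \<zeta>)))"
    by (rule hardy_inner_ball_algebra[OF F refl kernel_ball_algebra[OF w] kernel_hermitian[OF _ w]])
  finally show ?thesis by simp
qed

lemma continuous_kernel_bD: "w \<in> D \<Longrightarrow> continuous_on bD (\<lambda>\<zeta>. C w \<zeta>)"
  by (intro continuous_intros) (use bD_closure in auto)

text \<open>The squared norm of the kernel function of \<open>w\<close>, hence \<open>C w w\<close>,
  but real by construction.\<close>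

definition kernel_diag :: "complex^'n \<Rightarrow> real" where
  "kernel_diag w = (LINT \<zeta>|\<beta>. (cmod (C w \<zeta>))\<^sup>2)"

text \<open>Reproducing the kernel function at its own point gives the first claim. For the second,
  the constant 1 is reproduced, so the integral of |C - 1|^2, which is nonnegative, equals
  \<open>kernel_diag w - 1\<close>. The bound makes the later divisions by
  \<open>kernel_diag\<close> legitimate.\<close>

lemma
  assumes w: "w \<in> D"
  shows kernel_diag: "C w w = complex_of_real (kernel_diag w)"
    and kernel_diag_ge_1: "1 \<le> kernel_diag w"
  unfolding kernel_diag_def
proof -
  have "cnj (C w w) = (LINT \<zeta>|\<beta>. cnj (C w \<zeta>) * C w \<zeta>)"
    by (rule kernel_reproducing_boundary[OF kernel_ball_algebra[OF w] w])
  also have "\<dots> = (LINT \<zeta>|\<beta>. complex_of_real ((cmod (C w \<zeta>))\<^sup>2))"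
    unfolding complex_norm_square by (simp add: mult.commute)
  also have "\<dots> = complex_of_real (LINT \<zeta>|\<beta>. (cmod (C w \<zeta>))\<^sup>2)" by (rule integral_complex_of_real)
  finally show "C w w = complex_of_real (LINT \<zeta>|\<beta>. (cmod (C w \<zeta>))\<^sup>2)"
    by (metis complex_cnj_cnj complex_cnj_complex_of_real)
  have i: "integrable \<beta> (\<lambda>\<zeta>. (cmod (C w \<zeta>))\<^sup>2)" "integrable \<beta> (\<lambda>\<zeta>. Re (C w \<zeta>))"
    by (intro continuous_\<beta>_integrable continuous_intros continuous_kernel_bD w)+
  have "1 = Re (LINT \<zeta>|\<beta>. C w \<zeta>)"
    using kernel_reproducing_boundary[OF ball_algebra_const[of 1] w] by simp
  also have "\<dots> = (LINT \<zeta>|\<beta>. Re (C w \<zeta>))"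
    by (intro integral_Re[symmetric] continuous_\<beta>_integrable continuous_kernel_bD w)
  finally have 1: "(LINT \<zeta>|\<beta>. Re (C w \<zeta>)) = 1" ..
  have "0 \<le> (LINT \<zeta>|\<beta>. (cmod (C w \<zeta> - 1))\<^sup>2)" by simp
  also have "\<dots> = (LINT \<zeta>|\<beta>. (cmod (C w \<zeta>))\<^sup>2 - 2 * Re (C w \<zeta>) + 1)"
    unfolding cmod_power2
    by (intro LINT_cong) (simp add: power2_eq_square algebra_simps)
  also have "\<dots> = (LINT \<zeta>|\<beta>. (cmod (C w \<zeta>))\<^sup>2) - 2 * 1 + 1"
    using i 1 finite_measure.integrable_const[OF finite_\<beta>, of "1::real"]
    by (simp add: measure_\<beta> space_\<beta>)
  finally show "1 \<le> (LINT \<zeta>|\<beta>. (cmod (C w \<zeta>))\<^sup>2)" by simp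
qed

text \<open>The Cauchy-Schwarz inequality, obtained from the nonnegativity of the squared distance
  between \<open>F\<close> and its projection onto the kernel function of \<open>w\<close>.\<close>

lemma hardy_point_evaluation:
  assumes F: "ball_algebra F" and w: "w \<in> D"
  shows "(cmod (F w))\<^sup>2 \<le> kernel_diag w * (LINT \<zeta>|\<beta>. (cmod (F \<zeta>))\<^sup>2)"
proof -
  let ?k = "kernel_diag w"
  have k: "?k \<ge> 1" by (rule kernel_diag_ge_1[OF w])
  have i: "integrable \<beta> (\<lambda>\<zeta>. (cmod (C w \<zeta>))\<^sup>2)" "integrable \<beta> (\<lambda>\<zeta>. (cmod (F \<zeta>))\<^sup>2)"
    "integrable \<beta> (\<lambda>\<zeta>. cnj (F w) * (F \<zeta> * C w \<zeta>))"
    by (intro continuous_\<beta>_integrable continuous_intros continuous_kernel_bD w ball_algebra_bD[OF F])+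
  have lin3: "(LINT x|\<beta>. f x - c * g x + d * h x) = (LINT x|\<beta>. f x) - c * (LINT x|\<beta>. g x) + d * (LINT x|\<beta>. h x)"
    if "integrable \<beta> f" "integrable \<beta> g" "integrable \<beta> h" for f g h :: "complex^'n \<Rightarrow> real" and c d
    using that by simp
  have "(LINT \<zeta>|\<beta>. Re (cnj (F w) * (F \<zeta> * C w \<zeta>))) = Re (LINT \<zeta>|\<beta>. cnj (F w) * (F \<zeta> * C w \<zeta>))"
    by (rule integral_Re[OF i(3)])
  also have "\<dots> = Re (cnj (F w) * F w)"
    using kernel_reproducing_boundary[OF F w] by simp
  also have "\<dots> = (cmod (F w))\<^sup>2" unfolding cmod_power2 by (simp add: power2_eq_square)
  finally have 1: "(LINT \<zeta>|\<beta>. Re (cnj (F w) * (F \<zeta> * C w \<zeta>))) = (cmod (F w))\<^sup>2" .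
  have "0 \<le> (LINT \<zeta>|\<beta>. (cmod (F \<zeta> - F w * cnj (C w \<zeta>) / of_real ?k))\<^sup>2)" by simp
  also have "\<dots> = (LINT \<zeta>|\<beta>. (cmod (F \<zeta>))\<^sup>2 - 2 / ?k * Re (cnj (F w) * (F \<zeta> * C w \<zeta>))
      + (cmod (F w))\<^sup>2 / ?k\<^sup>2 * (cmod (C w \<zeta>))\<^sup>2)"
  proof (intro LINT_cong)
    fix \<zeta>
    have "(cmod (a - b))\<^sup>2 = (cmod a)\<^sup>2 - 2 * Re (a * cnj b) + (cmod b)\<^sup>2" for a b :: complex
      unfolding cmod_power2 by (simp add: power2_eq_square algebra_simps)
    note * = this[of "F \<zeta>" "F w * cnj (C w \<zeta>) / of_real ?k"]
    have "F \<zeta> * cnj (F w * cnj (C w \<zeta>) / of_real ?k) = (cnj (F w) * (F \<zeta> * C w \<zeta>)) / of_real ?k"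
      by simp
    then have 1: "Re (F \<zeta> * cnj (F w * cnj (C w \<zeta>) / of_real ?k)) = Re (cnj (F w) * (F \<zeta> * C w \<zeta>)) / ?k"
      by (simp only: Re_divide_of_real)
    have 2: "(cmod (F w * cnj (C w \<zeta>) / of_real ?k))\<^sup>2 = (cmod (F w))\<^sup>2 / ?k\<^sup>2 * (cmod (C w \<zeta>))\<^sup>2"
      by (simp add: norm_mult norm_divide power_mult_distrib power_divide)
    show "(cmod (F \<zeta> - F w * cnj (C w \<zeta>) / of_real ?k))\<^sup>2 = (cmod (F \<zeta>))\<^sup>2
      - 2 / ?k * Re (cnj (F w) * (F \<zeta> * C w \<zeta>)) + (cmod (F w))\<^sup>2 / ?k\<^sup>2 * (cmod (C w \<zeta>))\<^sup>2"
      unfolding * 1 2 by simp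
  qed
  also have "\<dots> = (LINT \<zeta>|\<beta>. (cmod (F \<zeta>))\<^sup>2) - 2 / ?k * (cmod (F w))\<^sup>2 + (cmod (F w))\<^sup>2 / ?k\<^sup>2 * ?k"
    unfolding lin3[OF i(2) integrable_Re[OF i(3)] i(1)] 1 kernel_diag_def[symmetric] ..
  also have "\<dots> = (LINT \<zeta>|\<beta>. (cmod (F \<zeta>))\<^sup>2) - (cmod (F w))\<^sup>2 / ?k"
    using k by (simp add: power2_eq_square field_simps)
  finally show ?thesis using k by (simp add: field_simps)
qed

section \<open>The Poisson-Szego kernel\<close>

definition poisson :: "complex^'n \<Rightarrow> complex^'n \<Rightarrow> real" where
  "poisson w \<zeta> = (cmod (C w \<zeta>))\<^sup>2 / kernel_diag w"

lemma poisson_szego_eq: "w \<in> D \<Longrightarrow> poisson_szego C w \<zeta> = complex_of_real (poisson w \<zeta>)"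
  by (simp add: poisson_szego_def poisson_def kernel_diag)

lemma poisson_nonneg: "w \<in> D \<Longrightarrow> 0 \<le> poisson w \<zeta>"
  using kernel_diag_ge_1[of w] by (simp add: poisson_def)

lemma kernel_diag_continuous: "continuous_on D kernel_diag"
proof -
  have "continuous_on D (\<lambda>w. Re (C w w))"
    by (intro continuous_intros) (use closure_subset[of D] in auto)
  then show ?thesis by (subst continuous_on_cong[OF refl, of _ _ "\<lambda>w. Re (C w w)"]) (auto simp: kernel_diag)
qed

lemma poisson_continuous:
  assumes "continuous_on S f" "continuous_on S g" "f ` S \<subseteq> D" "g ` S \<subseteq> bD"
  shows "continuous_on S (\<lambda>x. poisson (f x) (g x))"
proof -
  have "kernel_diag (f x) \<noteq> 0" if "x \<in> S" for x
    using kernel_diag_ge_1[of "f x"] assms(3) that by force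
  then show ?thesis
    unfolding poisson_def using assms bD_closure
    by (intro continuous_intros continuous_on_compose2[OF kernel_diag_continuous]) auto
qed

text \<open>\<open>F\<close> is multiplied by the kernel function normalized to value 1 at
  \<open>w\<close>, and the product is reproduced at \<open>w\<close>; the integrand becomes
  \<open>F\<close> times the Poisson kernel.\<close>

lemma poisson_reproducing:
  assumes F: "ball_algebra F" and w: "w \<in> D"
  shows "F w = (LINT \<zeta>|\<beta>. F \<zeta> * complex_of_real (poisson w \<zeta>))"
proof -
  let ?k = "kernel_diag w"
  have k: "?k \<ge> 1" by (rule kernel_diag_ge_1[OF w])
  have "ball_algebra (\<lambda>z. F z * cnj (C w z) * (1 / of_real ?k))"
    by (intro ball_algebra_mult ball_algebra_const F kernel_ball_algebra w)
  from kernel_reproducing_boundary[OF this w]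
  have e1: "F w * cnj (C w w) * (1 / of_real ?k) = (LINT \<zeta>|\<beta>. F \<zeta> * cnj (C w \<zeta>) * (1 / of_real ?k) * C w \<zeta>)" .
  have e2: "F w * cnj (C w w) * (1 / of_real ?k) = F w" using k by (simp add: kernel_diag[OF w])
  have "F \<zeta> * cnj (C w \<zeta>) * (1 / of_real ?k) * C w \<zeta> = F \<zeta> * complex_of_real (poisson w \<zeta>)" for \<zeta>
    unfolding poisson_def of_real_divide complex_norm_square by (simp add: mult_ac)
  then show ?thesis using trans[OF e2[symmetric] e1] by (simp only:)
qed

lemma poisson_integral_1:
  assumes "w \<in> D" shows "(LINT \<zeta>|\<beta>. poisson w \<zeta>) = 1"
proof -
  have "1 = (LINT \<zeta>|\<beta>. 1 * complex_of_real (poisson w \<zeta>))"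
    by (rule poisson_reproducing[OF ball_algebra_const assms])
  also have "\<dots> = complex_of_real (LINT \<zeta>|\<beta>. poisson w \<zeta>)"
    unfolding mult_1 by (rule integral_complex_of_real)
  finally have "complex_of_real (LINT \<zeta>|\<beta>. poisson w \<zeta>) = complex_of_real 1" by (simp only: of_real_1)
  then show ?thesis by (simp only: of_real_eq_iff)
qed

text \<open>The sphere is strictly convex: \<open>1 - Re (cinner \<zeta> \<zeta>0)\<close> measures the distance to \<open>\<zeta>0\<close>,
  and it is the real part of a holomorphic function. This makes the kernel an approximate identity.\<close>

lemma poisson_concentrates:
  assumes \<zeta>0: "\<zeta>0 \<in> bD" and r: "0 \<le> r" "r < 1"
  shows "(LINT \<zeta>|\<beta>. (norm (\<zeta> - \<zeta>0))\<^sup>2 * poisson (of_real r *s \<zeta>0) \<zeta>) = 2 - 2 * r"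
proof -
  let ?w = "complex_of_real r *s \<zeta>0"
  have w: "?w \<in> D" by (rule scale_bD[OF _ \<zeta>0]) (use r in simp)
  have n1: "norm \<zeta> = 1" if "\<zeta> \<in> bD" for \<zeta> using bD_sphere that by auto
  have cp: "continuous_on bD (poisson ?w)"
    by (rule poisson_continuous) (use w in \<open>auto intro!: continuous_intros\<close>)
  have i: "integrable \<beta> (\<lambda>\<zeta>. cinner \<zeta> \<zeta>0 * complex_of_real (poisson ?w \<zeta>))" "integrable \<beta> (poisson ?w)"
    by (intro continuous_\<beta>_integrable continuous_intros cp)+
  have "(LINT \<zeta>|\<beta>. cinner \<zeta> \<zeta>0 * complex_of_real (poisson ?w \<zeta>)) = cinner ?w \<zeta>0"
    by (rule poisson_reproducing[OF ball_algebra_cinner w, symmetric])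
  also have "\<dots> = complex_of_real r" unfolding cinner_scale cinner_self by (simp add: n1[OF \<zeta>0])
  finally have 1: "(LINT \<zeta>|\<beta>. Re (cinner \<zeta> \<zeta>0 * complex_of_real (poisson ?w \<zeta>))) = r"
    using integral_Re[OF i(1)] by simp
  have "(LINT \<zeta>|\<beta>. (norm (\<zeta> - \<zeta>0))\<^sup>2 * poisson ?w \<zeta>)
      = (LINT \<zeta>|\<beta>. 2 * poisson ?w \<zeta> - 2 * Re (cinner \<zeta> \<zeta>0 * complex_of_real (poisson ?w \<zeta>)))"
    by (intro LINT_cong)
      (simp add: space_\<beta> norm_diff_cinner n1 \<zeta>0 algebra_simps)
  also have "\<dots> = 2 * 1 - 2 * r"
    using i(2) integrable_Re[OF i(1)] poisson_integral_1[OF w] 1 by simp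
  finally show ?thesis by simp
qed

section \<open>Invariance and symmetry of the kernels\<close>

text \<open>Both kernels reproduce the value at \<open>w\<close> on the ball algebra, because
  \<open>\<beta>\<close> is invariant; their difference is then orthogonal to itself, and point
  evaluations carry its vanishing from \<open>bD\<close> to \<open>D\<close>.\<close>

lemma kernel_automorphism:
  assumes A: "A \<in> linear_automorphisms D" and z: "z \<in> D" and w: "w \<in> D"
  shows "C (A *v w) (A *v z) = C w z"
proof -
  have Aw: "A *v w \<in> D" by (rule automorphism_D[OF A w])
  obtain B where B: "B \<in> linear_automorphisms D" "\<And>z. B *v (A *v z) = z"
    using automorphism_inverse[OF A] by blast
  define F where "F = (\<lambda>z. cnj (C (A *v w) (A *v z)) + - 1 * cnj (C w z))"
  have F: "ball_algebra F"
    unfolding F_def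
    by (intro ball_algebra_add ball_algebra_mult ball_algebra_const kernel_ball_algebra w
        ball_algebra_compose[OF kernel_ball_algebra[OF Aw] A])
  have cF: "continuous_on bD F" by (rule ball_algebra_bD[OF F])
  have cA: "continuous_on bD (\<lambda>\<zeta>. C (A *v w) (A *v \<zeta>))"
    by (intro continuous_intros) (use Aw automorphism_bD[OF A] bD_closure in auto)
  have "F w = (\<lambda>z. F (B *v z)) (A *v w)" using B(2) by simp
  also have "\<dots> = (LINT \<zeta>|\<beta>. F (B *v \<zeta>) * C (A *v w) \<zeta>)"
    by (rule kernel_reproducing_boundary[OF ball_algebra_compose[OF F B(1)] Aw])
  also have "\<dots> = (LINT \<zeta>|\<beta>. F (B *v (A *v \<zeta>)) * C (A *v w) (A *v \<zeta>))"
  proof (rule \<beta>_invariant[OF A, symmetric], rule continuous_\<beta>_measurable)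
    have "continuous_on bD (\<lambda>\<zeta>. F (B *v \<zeta>))"
    proof (rule continuous_on_compose2[OF cF])
      show "continuous_on bD (\<lambda>\<zeta>. B *v \<zeta>)" by (intro continuous_intros)
      show "(\<lambda>\<zeta>. B *v \<zeta>) ` bD \<subseteq> bD" using automorphism_bD[OF B(1)] by blast
    qed
    then show "continuous_on bD (\<lambda>\<zeta>. F (B *v \<zeta>) * C (A *v w) \<zeta>)"
      by (rule continuous_on_mult[OF _ continuous_kernel_bD[OF Aw]])
  qed
  finally have "F w = (LINT \<zeta>|\<beta>. F \<zeta> * C (A *v w) (A *v \<zeta>))" by (simp add: B(2))
  moreover have "F w = (LINT \<zeta>|\<beta>. F \<zeta> * C w \<zeta>)" by (rule kernel_reproducing_boundary[OF F w])
  ultimately have "(LINT \<zeta>|\<beta>. F \<zeta> * C (A *v w) (A *v \<zeta>)) - (LINT \<zeta>|\<beta>. F \<zeta> * C w \<zeta>) = 0" by simp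
  moreover have "integrable \<beta> (\<lambda>\<zeta>. F \<zeta> * C (A *v w) (A *v \<zeta>))" "integrable \<beta> (\<lambda>\<zeta>. F \<zeta> * C w \<zeta>)"
    by (intro continuous_\<beta>_integrable continuous_intros cF cA continuous_kernel_bD w)+
  ultimately have "(LINT \<zeta>|\<beta>. F \<zeta> * C (A *v w) (A *v \<zeta>) - F \<zeta> * C w \<zeta>) = 0" by simp
  moreover have "F \<zeta> * C (A *v w) (A *v \<zeta>) - F \<zeta> * C w \<zeta> = complex_of_real ((cmod (F \<zeta>))\<^sup>2)" for \<zeta>
    unfolding complex_norm_square by (simp add: F_def algebra_simps)
  ultimately have "complex_of_real (LINT \<zeta>|\<beta>. (cmod (F \<zeta>))\<^sup>2) = 0"
    unfolding integral_complex_of_real[symmetric] by simp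
  then have "(cmod (F z))\<^sup>2 \<le> 0"
    using hardy_point_evaluation[OF F z] by simp
  then show ?thesis by (simp add: F_def)
qed

text \<open>By transitivity on \<open>bD\<close> the diagonal depends on the radius only, so
  normalizations agree when Poisson kernels at two boundary points are compared.\<close>

lemma kernel_diag_bD:
  assumes "\<zeta> \<in> bD" "\<zeta>' \<in> bD" "cmod r < 1"
  shows "kernel_diag (r *s \<zeta>) = kernel_diag (r *s \<zeta>')"
proof -
  obtain A where A: "A \<in> linear_automorphisms D" "A *v \<zeta> = \<zeta>'" using transitive assms by blast
  have "r *s \<zeta> \<in> D" "r *s \<zeta>' \<in> D" using assms scale_bD by blast+
  then show ?thesis
    using kernel_automorphism[OF A(1), of "r *s \<zeta>" "r *s \<zeta>"] kernel_diag
    by (simp add: matrix_vector_scale A(2))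
qed

text \<open>The function \<open>\<tau> \<mapsto> C (exp \<tau> a) (exp (- cnj \<tau>) b)\<close> is holomorphic and, by circular invariance,
  constant on the imaginary axis; so dilations may be moved from one argument to the other.\<close>

lemma kernel_move_dilation:
  assumes \<zeta>: "\<zeta> \<in> bD" and \<zeta>': "\<zeta>' \<in> bD" and s: "0 < s" "s < 1"
  shows "C (of_real (s * s) *s \<zeta>) \<zeta>' = C (of_real s *s \<zeta>) (of_real s *s \<zeta>')"
proof -
  \<comment> \<open>With this choice the factor s has moved completely when Re \<tau> reaches
    -\<delta>: there the two arguments are s^2 \<zeta> and \<zeta>', up to a common
    rotation.\<close>
  define \<delta> where "\<delta> = - ln s"
  have \<delta>: "\<delta> > 0" "exp (- \<delta>) = s" using s by (simp_all add: \<delta>_def)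
  define a b where "a = complex_of_real s *s \<zeta>" and "b = complex_of_real s *s \<zeta>'"
  define S where "S = {\<tau>. \<bar>Re \<tau>\<bar> < \<delta>}"
  define g where "g = (\<lambda>\<tau>. C (exp \<tau> *s a) (exp (- cnj \<tau>) *s b))"
  have inD: "exp \<tau> *s a \<in> D" "exp (- cnj \<tau>) *s b \<in> D" if "\<tau> \<in> S" for \<tau>
  proof -
    have "exp (Re \<tau>) < exp \<delta>" "exp (- Re \<tau>) < exp \<delta>" using that by (auto simp: S_def)
    then have "exp (Re \<tau>) * s < 1" "exp (- Re \<tau>) * s < 1"
      using s unfolding \<delta>_def by (simp_all add: exp_minus field_simps)
    then have "cmod (exp \<tau> * of_real s) < 1" "cmod (exp (- cnj \<tau>) * of_real s) < 1"
      using s by (simp_all add: norm_mult)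
    then show "exp \<tau> *s a \<in> D" "exp (- cnj \<tau>) *s b \<in> D"
      using scale_bD[OF _ \<zeta>] scale_bD[OF _ \<zeta>'] unfolding a_def b_def vector_smult_assoc by blast+
  qed
  have openS: "open S"
    unfolding S_def by (intro open_Collect_less continuous_intros)
  have "S = {\<tau>. Re \<tau> < \<delta>} \<inter> {\<tau>. - \<delta> < Re \<tau>}" by (auto simp: S_def)
  then have connS: "connected S"
    by (auto intro!: convex_connected convex_Int convex_halfspace_Re_lt convex_halfspace_Re_gt)
  obtain U where U: "D \<times> closure D \<subseteq> U" "sesquiholomorphic_on C U"
    using kernel_sesquiholomorphic by blast
  have "(\<lambda>\<tau>. g \<tau> - C a b) holomorphic_on S"
    unfolding holomorphic_on_open[OF openS]
  proof
    fix \<tau> assume \<tau>: "\<tau> \<in> S"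
    have "(exp \<tau> *s a, exp (- cnj \<tau>) *s b) \<in> U"
      using inD[OF \<tau>] U(1) closure_subset[of D] by auto
    then obtain A B where AB: "((\<lambda>(z, w). C z w) has_derivative (\<lambda>(h, k). A h + B k)) (at (exp \<tau> *s a, exp (- cnj \<tau>) *s b))"
      "\<And>c h. A (c *s h) = c * A h" "\<And>c k. B (c *s k) = cnj c * B k"
      using U(2) unfolding sesquiholomorphic_on_def by blast
    have d1: "((\<lambda>\<tau>. exp \<tau> *s a) has_derivative (\<lambda>h. (exp \<tau> * h) *s a)) (at \<tau>)"
      by (rule has_derivative_compose[OF _ bounded_linear_imp_has_derivative[OF bounded_linear_scale_left]])
        (auto intro!: derivative_eq_intros simp: mult_ac)
    have e2: "((\<lambda>\<tau>. exp (- cnj \<tau>)) has_derivative (\<lambda>h. exp (- cnj \<tau>) * - cnj h)) (at \<tau>)"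
    proof -
      have "((\<lambda>\<tau>. - cnj \<tau>) has_derivative (\<lambda>h. - cnj h)) (at \<tau>)"
        by (intro derivative_intros)
      from has_derivative_compose[OF this, of exp "\<lambda>h. exp (- cnj \<tau>) * h"]
      show ?thesis using DERIV_exp[of "- cnj \<tau>"] by (simp add: has_field_derivative_def)
    qed
    have d2: "((\<lambda>\<tau>. exp (- cnj \<tau>) *s b) has_derivative (\<lambda>h. (exp (- cnj \<tau>) * - cnj h) *s b)) (at \<tau>)"
      by (rule has_derivative_compose[OF e2 bounded_linear_imp_has_derivative[OF bounded_linear_scale_left]])
    from has_derivative_compose[OF has_derivative_Pair[OF d1 d2] AB(1)]
    have "(g has_derivative (\<lambda>h. A ((exp \<tau> * h) *s a) + B ((exp (- cnj \<tau>) * - cnj h) *s b))) (at \<tau>)"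
      by (simp add: g_def)
    then have "(g has_derivative (\<lambda>h. (exp \<tau> * A a - cnj (exp (- cnj \<tau>)) * B b) * h)) (at \<tau>)"
      by (rule has_derivative_eq_rhs) (rule ext, simp only: AB(2,3), simp add: algebra_simps)
    then have "(g has_field_derivative (exp \<tau> * A a - cnj (exp (- cnj \<tau>)) * B b)) (at \<tau>)"
      by (simp only: has_field_derivative_def)
    then have "((\<lambda>\<tau>. g \<tau> - C a b) has_field_derivative (exp \<tau> * A a - cnj (exp (- cnj \<tau>)) * B b) - 0) (at \<tau>)"
      by (intro derivative_intros)
    then show "\<exists>f'. ((\<lambda>\<tau>. g \<tau> - C a b) has_field_derivative f') (at \<tau>)" by blast
  qed
  have axis: "g (\<i> * of_real t) - C a b = 0" for t :: real
  proof -
    have aD: "a \<in> D" "b \<in> D" using inD[of 0] \<delta>(1) by (simp_all add: S_def)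
    have "cmod (exp (\<i> * of_real t)) = 1" by simp
    from kernel_automorphism[OF scalar_automorphism[OF this] aD(2,1)]
    show ?thesis by (simp add: g_def mat_scale)
  qed
  have lp: "0 islimpt range (\<lambda>t::real. \<i> * of_real t)"
    unfolding islimpt_approachable
  proof (intro allI impI)
    fix e :: real assume "e > 0"
    then show "\<exists>x'\<in>range (\<lambda>t::real. \<i> * of_real t). x' \<noteq> 0 \<and> dist x' 0 < e"
      by (intro bexI[of _ "\<i> * of_real (e / 2)"] rangeI) (auto simp: norm_mult)
  qed
  have const: "g \<tau> = C a b" if "\<tau> \<in> S" for \<tau>
  proof -
    have "g \<tau> - C a b = 0"
      by (rule analytic_continuation[OF \<open>(\<lambda>\<tau>. g \<tau> - C a b) holomorphic_on S\<close> openS connS _ _ lp _ that])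
        (use \<delta>(1) axis in \<open>auto simp: S_def\<close>)
    then show ?thesis by simp
  qed
  \<comment> \<open>The edge of the strip is approached from inside. On the edge the second argument
    lies on \<open>bD\<close>, where holomorphy in \<tau> is replaced by continuity of the
    kernel.\<close>
  define x where "x = (\<lambda>n::nat. - \<delta> * (1 - 1 / (real n + 2)))"
  have xS: "complex_of_real (x n) \<in> S" for n
    using \<delta>(1) by (simp add: x_def S_def abs_mult)
  have xlim: "x \<longlonglongrightarrow> - \<delta>" unfolding x_def by real_asymp
  have l1: "(\<lambda>n. (exp (x n) * s) *\<^sub>R \<zeta>) \<longlonglongrightarrow> (exp (- \<delta>) * s) *\<^sub>R \<zeta>"
    by (intro tendsto_intros xlim)
  have l2: "(\<lambda>n. (exp (- x n) * s) *\<^sub>R \<zeta>') \<longlonglongrightarrow> (exp (- (- \<delta>)) * s) *\<^sub>R \<zeta>'"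
    by (intro tendsto_intros xlim)
  have e1: "(exp (- (- \<delta>)) * s) *\<^sub>R \<zeta>' = \<zeta>'" "(exp (- \<delta>) * s) *\<^sub>R \<zeta> = of_real (s * s) *s \<zeta>"
    using \<delta>(2) s by (simp_all add: \<delta>_def exp_minus scaleR_eq_scale)
  have e2: "(exp (x n) * s) *\<^sub>R \<zeta> = exp (complex_of_real (x n)) *s a"
    "(exp (- x n) * s) *\<^sub>R \<zeta>' = exp (- cnj (complex_of_real (x n))) *s b" for n
    by (simp_all add: a_def b_def scaleR_eq_scale vector_smult_assoc exp_of_real flip: of_real_minus)
  have "(\<lambda>n. (\<lambda>(z, w). C z w) ((exp (x n) * s) *\<^sub>R \<zeta>, (exp (- x n) * s) *\<^sub>R \<zeta>')) \<longlonglongrightarrow>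
      (\<lambda>(z, w). C z w) (of_real (s * s) *s \<zeta>, \<zeta>')"
  proof (rule continuous_on_tendsto_compose[OF kernel_continuous])
    show "(\<lambda>n. ((exp (x n) * s) *\<^sub>R \<zeta>, (exp (- x n) * s) *\<^sub>R \<zeta>')) \<longlonglongrightarrow> (of_real (s * s) *s \<zeta>, \<zeta>')"
      using tendsto_Pair[OF l1 l2] unfolding e1 .
    have "s * s < 1 * 1" using s by (intro mult_strict_mono) auto
    then show "(of_real (s * s) *s \<zeta>, \<zeta>') \<in> D \<times> closure D"
      using scale_bD[OF _ \<zeta>, of "of_real (s * s)"] \<zeta>' bD_closure s by (auto simp: norm_mult)
    show "\<forall>\<^sub>F n in sequentially. ((exp (x n) * s) *\<^sub>R \<zeta>, (exp (- x n) * s) *\<^sub>R \<zeta>') \<in> D \<times> closure D"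
      unfolding e2 using inD[OF xS] closure_subset[of D] by (intro always_eventually) auto
  qed
  moreover have "(\<lambda>(z, w). C z w) ((exp (x n) * s) *\<^sub>R \<zeta>, (exp (- x n) * s) *\<^sub>R \<zeta>') = C a b" for n
    using const[OF xS[of n]] unfolding e2 g_def by simp
  ultimately have "(\<lambda>n::nat. C a b) \<longlonglongrightarrow> C (of_real (s * s) *s \<zeta>) \<zeta>'" by simp
  then show ?thesis using LIMSEQ_unique[OF tendsto_const] unfolding a_def b_def by metis
qed

text \<open>With the dilation shared equally, sqrt r on either side, hermitian symmetry inside
  \<open>D\<close> applies; \<open>kernel_diag_bD\<close> matches the denominators.\<close>

lemma poisson_symmetric:
  assumes \<zeta>: "\<zeta> \<in> bD" and \<zeta>': "\<zeta>' \<in> bD" and r: "0 < r" "r < 1"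
  shows "poisson (of_real r *s \<zeta>) \<zeta>' = poisson (of_real r *s \<zeta>') \<zeta>"
proof -
  define s where "s = sqrt r"
  have s: "0 < s" "s < 1" "s * s = r" using r by (simp_all add: s_def)
  have D: "of_real s *s \<zeta> \<in> D" "of_real s *s \<zeta>' \<in> D"
    using scale_bD[OF _ \<zeta>, of "of_real s"] scale_bD[OF _ \<zeta>', of "of_real s"] s by simp_all
  have "C (of_real r *s \<zeta>) \<zeta>' = C (of_real s *s \<zeta>) (of_real s *s \<zeta>')"
    using kernel_move_dilation[OF \<zeta> \<zeta>' s(1,2)] s(3) by simp
  also have "\<dots> = cnj (C (of_real s *s \<zeta>') (of_real s *s \<zeta>))" by (rule kernel_hermitian[OF D])
  also have "\<dots> = cnj (C (of_real r *s \<zeta>') \<zeta>)"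
    using kernel_move_dilation[OF \<zeta>' \<zeta> s(1,2)] s(3) by simp
  finally have "cmod (C (of_real r *s \<zeta>) \<zeta>') = cmod (C (of_real r *s \<zeta>') \<zeta>)" by simp
  moreover have "kernel_diag (of_real r *s \<zeta>) = kernel_diag (of_real r *s \<zeta>')"
    by (rule kernel_diag_bD[OF \<zeta> \<zeta>']) (use r in simp)
  ultimately show ?thesis by (simp add: poisson_def)
qed

end

section \<open>Pluriharmonic measures and their Fourier components\<close>

lemma space_borel_on [simp]: "space (borel_on S) = S"
  by (simp add: space_restrict_space)

text \<open>A convergent sequence together with its limit is compact, so the kernel is bounded along
  it uniformly in the second variable, and dominated convergence applies.\<close>

lemma continuous_on_integral_parameter:
  fixes F :: "'a::euclidean_space \<Rightarrow> 'b::second_countable_topology \<Rightarrow> complex"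
  assumes cont: "continuous_on (S \<times> T) (\<lambda>(x, y). F x y)" and S: "open S" and T: "compact T"
    and N: "sets N = sets (borel_on T)" "finite_measure N"
    and g: "g \<in> borel_measurable N" "\<And>y. y \<in> T \<Longrightarrow> cmod (g y) \<le> G"
  shows "continuous_on S (\<lambda>x. LINT y|N. F x y * g y)"
proof (rule continuous_on_sequentiallyI)
  interpret N: finite_measure N by fact
  have sp: "space N = T" using sets_eq_imp_space_eq[OF N(1)] by (simp add: space_restrict_space)
  fix u :: "nat \<Rightarrow> 'a" and a
  assume u: "\<forall>n. u n \<in> S" "a \<in> S" "u \<longlonglongrightarrow> a"
  have "compact (insert a (range u))" using u(3) by (rule compact_sequence_with_limit)
  then have cpt: "compact (insert a (range u) \<times> T)" using T by (rule compact_Times)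
  have sub: "insert a (range u) \<times> T \<subseteq> S \<times> T" using u by auto
  obtain B where B: "\<And>p. p \<in> insert a (range u) \<times> T \<Longrightarrow> cmod (case p of (x, y) \<Rightarrow> F x y) \<le> B"
    using compact_imp_bounded[OF compact_continuous_image[OF continuous_on_subset[OF cont sub] cpt]]
    unfolding bounded_iff by blast
  have contx: "continuous_on T (F x)" if "x \<in> S" for x
  proof -
    have "continuous_on T (\<lambda>y. (x, y))" by (intro continuous_on_Pair continuous_on_const continuous_on_id)
    moreover have "continuous_on ((\<lambda>y. (x, y)) ` T) (\<lambda>(x, y). F x y)"
      by (rule continuous_on_subset[OF cont]) (use that in auto)
    ultimately have "continuous_on T ((\<lambda>(x, y). F x y) \<circ> (\<lambda>y. (x, y)))"
      by (rule continuous_on_compose)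
    then show ?thesis by (simp add: o_def)
  qed
  have meas: "(\<lambda>y. F x y * g y) \<in> borel_measurable N" if "x \<in> S" for x
    using continuous_imp_borel_on[OF contx[OF that]] g(1)
    by (simp add: measurable_cong_sets[OF N(1) refl])
  show "(\<lambda>n. LINT y|N. F (u n) y * g y) \<longlonglongrightarrow> (LINT y|N. F a y * g y)"
  proof (rule integral_dominated_convergence[where w="\<lambda>_. B * G"])
    show "AE y in N. (\<lambda>n. F (u n) y * g y) \<longlonglongrightarrow> F a y * g y"
    proof (rule AE_I2)
      fix y assume y: "y \<in> space N"
      have "(\<lambda>n. (\<lambda>(x, y). F x y) (u n, y)) \<longlonglongrightarrow> (\<lambda>(x, y). F x y) (a, y)"
        by (rule continuous_on_tendsto_compose[OF cont])
          (use u y sp in \<open>auto intro!: tendsto_intros always_eventually\<close>)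
      then show "(\<lambda>n. F (u n) y * g y) \<longlonglongrightarrow> F a y * g y" by (auto intro!: tendsto_intros)
    qed
    show "AE y in N. norm (F (u n) y * g y) \<le> B * G" for n
    proof (rule AE_I2)
      fix y assume "y \<in> space N"
      then have y: "y \<in> T" by (simp add: sp)
      have "cmod (F (u n) y) \<le> B" using B[of "(u n, y)"] y by auto
      moreover from this have "0 \<le> B" using norm_ge_zero order_trans by blast
      ultimately show "norm (F (u n) y * g y) \<le> B * G"
        unfolding norm_mult using g(2)[OF y] by (intro mult_mono) auto
    qed
  qed (use meas u in auto)
qed

lemma harmonic_coeffs_const: "harmonic_coeffs (\<lambda>w. c) R (\<lambda>k. if k = 0 then c else 0)" (is "harmonic_coeffs _ _ ?c")
  unfolding harmonic_coeffs_def
proof (intro conjI ballI)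
  fix w
  show "summable (\<lambda>n. norm (?c (int n) * w ^ n))"
    by (rule summable_finite[of "{0}"]) auto
  show "summable (\<lambda>n. norm (?c (- int (Suc n)) * cnj w ^ Suc n))"
    by (rule summable_finite[of "{}"]) auto
  have "(\<Sum>n. ?c (int n) * w ^ n) = c" by (subst suminf_single[of 0]) auto
  moreover have "(\<Sum>n. ?c (- int (Suc n)) * cnj w ^ Suc n) = 0" by (subst suminf_single[of 0]) auto
  ultimately show "c = (\<Sum>n. ?c (int n) * w ^ n) + (\<Sum>n. ?c (- int (Suc n)) * cnj w ^ Suc n)" by simp
qed simp

definition circle_component :: "(complex^'n \<Rightarrow> complex) \<Rightarrow> int \<Rightarrow> complex^'n \<Rightarrow> complex" where
  "circle_component f k z = (LINT \<alpha>|circle_haar. f (\<alpha> *s z) * hpow (- k) \<alpha>)"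

text \<open>Continued homogeneously to \<open>2 D\<close>, so that it makes sense on the boundary of \<open>D\<close>.\<close>

definition boundary_coeff :: "(complex^'n \<Rightarrow> complex) \<Rightarrow> int \<Rightarrow> complex^'n \<Rightarrow> complex" where
  "boundary_coeff f k z = 2 ^ nat \<bar>k\<bar> * circle_component f k ((1/2) *s z)"

context symmetric_domain
begin

lemma circle_component_continuous:
  assumes f: "continuous_on D f"
  shows "continuous_on D (circle_component f k)"
  unfolding circle_component_def
proof (rule continuous_on_integral_parameter[OF _ open_D compact_sphere sets_circle_haar circle.finite_measure_axioms, of _ _ 1])
  show "continuous_on (D \<times> sphere 0 1) (\<lambda>(z, \<alpha>). f (\<alpha> *s z))"
    unfolding case_prod_unfold
    by (rule continuous_on_compose2[OF f]) (auto intro!: continuous_intros circular)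
  show "hpow (- k) \<in> borel_measurable circle_haar"
    by (intro circle_continuous_measurable continuous_intros)
qed simp

lemma boundary_coeff_continuous:
  assumes f: "continuous_on D f"
  shows "continuous_on (closure D) (boundary_coeff f k)"
proof -
  have "(\<lambda>z. (1/2) *s z) ` closure D \<subseteq> D"
    using scale_closure[of "1/2"] by (auto simp: norm_divide)
  with circle_component_continuous[OF f] have "continuous_on (closure D) (\<lambda>z. circle_component f k ((1/2) *s z))"
    by (rule continuous_on_compose2[OF _ bounded_linear.continuous_on[OF bounded_linear_scale_complex continuous_on_id]])
  then show ?thesis unfolding boundary_coeff_def by (rule continuous_on_mult_left)
qed

text \<open>The radius 1/2 in \<open>boundary_coeff\<close> is arbitrary: on a slice the k-th
  component scales by \<open>hpow k w\<close>, so every positive radius below 1 yields the same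
  coefficient. Boundary points \<open>z\<close> are allowed since their open slice disc lies in
  \<open>D\<close>.\<close>

lemma slice_coeffs:
  assumes ph: "pluriharmonic_on f D" and z: "z \<in> closure D"
  shows "harmonic_coeffs (\<lambda>w. f (w *s z)) 1 (\<lambda>k. boundary_coeff f k z)"
    and "cmod w < 1 \<Longrightarrow> circle_component f k (w *s z) = hpow k w * boundary_coeff f k z"
proof -
  have "\<exists>c. harmonic_coeffs (\<lambda>w. f (w *s z)) 1 c"
  proof (cases "z = 0")
    \<comment> \<open>The degenerate slice is treated apart because \<open>pluriharmonic_on\<close>
      speaks of non-zero directions only.\<close>
    case True
    then show ?thesis using harmonic_coeffs_const by auto
  next
    case False
    then have "harmonic_on (\<lambda>w. f (0 + w *s z)) {w. 0 + w *s z \<in> D}"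
      using ph unfolding pluriharmonic_on_def by blast
    then have "harmonic_on (\<lambda>w. f (w *s z)) {w. w *s z \<in> D}" by simp
    then show ?thesis
      by (rule harmonic_coeffs_exist) (use scale_closure[OF _ z] in auto)
  qed
  then obtain c where c: "harmonic_coeffs (\<lambda>w. f (w *s z)) 1 c" by blast
  have comp: "circle_component f k (w *s z) = hpow k w * c k" if "cmod w < 1" for w k
    using harmonic_coeffs_integral[OF c, of w k] that
    by (simp add: circle_component_def vector_smult_assoc mult.commute)
  have "boundary_coeff f k z = c k" for k
    unfolding boundary_coeff_def using comp[of "1/2" k]
    by (simp add: hpow_def norm_divide power_divide)
  then have "(\<lambda>k. boundary_coeff f k z) = c" by (rule ext)
  then show "harmonic_coeffs (\<lambda>w. f (w *s z)) 1 (\<lambda>k. boundary_coeff f k z)"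
    and "cmod w < 1 \<Longrightarrow> circle_component f k (w *s z) = hpow k w * boundary_coeff f k z"
    using c comp[of w k] by (simp, metis)
qed

lemma boundary_coeff_scale:
  assumes ph: "pluriharmonic_on f D" and z: "z \<in> closure D" and w: "cmod w \<le> 1"
  shows "boundary_coeff f k (w *s z) = hpow k w * boundary_coeff f k z"
proof -
  have "boundary_coeff f k (w *s z) = 2 ^ nat \<bar>k\<bar> * circle_component f k ((1/2 * w) *s z)"
    by (simp add: boundary_coeff_def vector_smult_assoc)
  also have "circle_component f k ((1/2 * w) *s z) = hpow k (1/2 * w) * boundary_coeff f k z"
    by (rule slice_coeffs(2)[OF ph z]) (use w in \<open>simp add: norm_mult norm_divide\<close>)
  also have "hpow k (1/2 * w) = (1/2) ^ nat \<bar>k\<bar> * hpow k w"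
    unfolding hpow_mult using hpow_of_real[of k "1/2"] by simp
  finally show ?thesis by (simp add: power_divide)
qed

end

section \<open>Boundary behaviour of the Poisson-Szego integral\<close>

locale pluriharmonic_setting = symmetric_domain D bD \<beta> C
  for D bD :: "(complex^'n) set" and \<beta> :: "(complex^'n) measure" and C +
  fixes \<mu> :: "(complex^'n) set \<Rightarrow> complex"
  assumes \<mu>: "pluriharmonic_measure D bD C \<mu>"
begin

abbreviation m :: "(complex^'n) measure" where "m \<equiv> variation (borel_on bD) \<mu>"
abbreviation h :: "complex^'n \<Rightarrow> complex" where "h \<equiv> polar_density (borel_on bD) \<mu>"
abbreviation u :: "complex^'n \<Rightarrow> complex" where "u \<equiv> poisson_integral bD C \<mu>"
abbreviation coeff :: "int \<Rightarrow> complex^'n \<Rightarrow> complex" where "coeff \<equiv> boundary_coeff u"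

lemma cm: "complex_measure (borel_on bD) \<mu>" and pluriharmonic: "pluriharmonic_on u D"
  using \<mu> unfolding pluriharmonic_measure_def by blast+

lemma finite_m: "finite_measure m" by (rule finite_measure_variation[OF cm])

lemma h_measurable: "h \<in> borel_measurable m"
  using polar_density_measurable[OF cm] by simp

lemma norm_h: "\<zeta> \<in> bD \<Longrightarrow> cmod (h \<zeta>) = 1"
  using norm_polar_density[OF cm] by (simp add: space_restrict_space)

lemma integrable_h: "integrable m h" by (rule integrable_polar_density[OF cm])

lemma continuous_m_measurable:
  fixes f :: "complex^'n \<Rightarrow> 'b::topological_space"
  shows "continuous_on bD f \<Longrightarrow> f \<in> borel_measurable m"
  using continuous_imp_borel_on[of bD f] by simp

lemma u_eq: "z \<in> D \<Longrightarrow> u z = (LINT \<zeta>|m. complex_of_real (poisson z \<zeta>) * h \<zeta>)"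
proof -
  assume z: "z \<in> D"
  have "poisson_szego C z = (\<lambda>\<zeta>. complex_of_real (poisson z \<zeta>))"
    by (rule ext) (rule poisson_szego_eq[OF z])
  moreover have "(\<lambda>\<zeta>. complex_of_real (poisson z \<zeta>)) \<in> borel_measurable (borel_on bD)"
    by (intro continuous_imp_borel_on continuous_intros poisson_continuous) (use z in auto)
  ultimately show ?thesis
    unfolding poisson_integral_def by (simp only: cintegral_polar[OF cm])
qed

lemma u_continuous: "continuous_on D u"
proof -
  have "continuous_on D (\<lambda>z. LINT \<zeta>|m. complex_of_real (poisson z \<zeta>) * h \<zeta>)"
    by (rule continuous_on_integral_parameter[OF _ open_D compact_bD _ finite_m h_measurable, of _ 1])
      (auto simp: norm_h case_prod_unfold intro!: continuous_intros poisson_continuous)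
  then show ?thesis by (subst continuous_on_cong[OF refl u_eq])
qed

lemma coeff_homogeneous: "circle_homogeneous bD k (coeff k)"
  unfolding circle_homogeneous_def
proof (intro conjI allI impI)
  show "continuous_on bD (coeff k)"
    by (rule continuous_on_subset[OF boundary_coeff_continuous[OF u_continuous] bD_closure])
  fix \<alpha> z assume \<alpha>: "cmod \<alpha> = 1" and z: "z \<in> bD"
  show "coeff k (\<alpha> *s z) = hpow k \<alpha> * coeff k z"
    by (rule boundary_coeff_scale[OF pluriharmonic subsetD[OF bD_closure z]]) (simp add: \<alpha>)
qed

text \<open>Near \<open>\<zeta>0\<close> the function is almost constant; elsewhere its oscillation
  is at most a multiple of |\<zeta> - \<zeta>0|^2, and the Poisson mean of that square is 2 - 2
  r.\<close>

lemma poisson_approximate_identity: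
  fixes \<phi> :: "complex^'n \<Rightarrow> complex"
  assumes \<phi>: "continuous_on bD \<phi>" and \<zeta>0: "\<zeta>0 \<in> bD" and r: "\<And>n::nat. 0 < r n \<and> r n < 1" "r \<longlonglongrightarrow> 1"
  shows "(\<lambda>n. LINT \<zeta>|\<beta>. \<phi> \<zeta> * complex_of_real (poisson (of_real (r n) *s \<zeta>0) \<zeta>)) \<longlonglongrightarrow> \<phi> \<zeta>0"
proof (rule LIMSEQ_I)
  fix e :: real assume e: "e > 0"
  obtain B where B: "\<And>\<zeta>. \<zeta> \<in> bD \<Longrightarrow> cmod (\<phi> \<zeta>) \<le> B" using continuous_bD_bounded[OF \<phi>] by blast
  have B0: "0 \<le> B" using order_trans[OF norm_ge_zero B[OF \<zeta>0]] .
  obtain d where d: "d > 0" "\<And>\<zeta>. \<zeta> \<in> bD \<Longrightarrow> dist \<zeta> \<zeta>0 < d \<Longrightarrow> dist (\<phi> \<zeta>) (\<phi> \<zeta>0) < e / 2"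
    using \<phi>[unfolded continuous_on_iff] \<zeta>0 e by (metis half_gt_zero)
  \<comment> \<open>Outside the ball of radius d the squared distance is at least d^2, so
    \<open>K\<close> times it dominates the largest possible oscillation 2 B.\<close>
  define K where "K = 2 * B / d\<^sup>2"
  have K0: "0 \<le> K" using B0 by (simp add: K_def)
  have bound: "cmod (\<phi> \<zeta> - \<phi> \<zeta>0) \<le> e / 2 + K * (norm (\<zeta> - \<zeta>0))\<^sup>2" if \<zeta>: "\<zeta> \<in> bD" for \<zeta>
  proof (cases "dist \<zeta> \<zeta>0 < d")
    case True
    then show ?thesis using d(2)[OF \<zeta> True] K0 by (simp add: dist_norm add_increasing2)
  next
    case False
    then have "d\<^sup>2 \<le> (norm (\<zeta> - \<zeta>0))\<^sup>2" using d(1) by (intro power_mono) (auto simp: dist_norm)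
    then have "K * d\<^sup>2 \<le> K * (norm (\<zeta> - \<zeta>0))\<^sup>2" using K0 by (rule mult_left_mono)
    moreover have "K * d\<^sup>2 = 2 * B" using d(1) by (simp add: K_def)
    moreover have "cmod (\<phi> \<zeta> - \<phi> \<zeta>0) \<le> 2 * B"
      using norm_triangle_ineq4[of "\<phi> \<zeta>" "\<phi> \<zeta>0"] B[OF \<zeta>] B[OF \<zeta>0] by linarith
    ultimately show ?thesis using e by linarith
  qed
  have key: "cmod ((LINT \<zeta>|\<beta>. \<phi> \<zeta> * complex_of_real (poisson (of_real s *s \<zeta>0) \<zeta>)) - \<phi> \<zeta>0) \<le> e / 2 + K * (2 - 2 * s)"
    if s: "0 < s" "s < 1" for s :: real
  proof -
    let ?P = "poisson (of_real s *s \<zeta>0)"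
    have w: "of_real s *s \<zeta>0 \<in> D" by (rule scale_bD[OF _ \<zeta>0]) (use s in simp)
    have cP: "continuous_on bD ?P"
      by (rule poisson_continuous) (use w in \<open>auto intro!: continuous_intros\<close>)
    have i: "integrable \<beta> ?P" "integrable \<beta> (\<lambda>\<zeta>. (norm (\<zeta> - \<zeta>0))\<^sup>2 * ?P \<zeta>)"
      "integrable \<beta> (\<lambda>\<zeta>. \<phi> \<zeta> * complex_of_real (?P \<zeta>))" "integrable \<beta> (\<lambda>\<zeta>. \<phi> \<zeta>0 * complex_of_real (?P \<zeta>))"
      by (intro continuous_\<beta>_integrable continuous_intros cP \<phi>)+
    have "(LINT \<zeta>|\<beta>. \<phi> \<zeta>0 * complex_of_real (?P \<zeta>)) = \<phi> \<zeta>0"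
      using poisson_integral_1[OF w] by simp
    then have "(LINT \<zeta>|\<beta>. \<phi> \<zeta> * complex_of_real (?P \<zeta>)) - \<phi> \<zeta>0
        = (LINT \<zeta>|\<beta>. \<phi> \<zeta> * complex_of_real (?P \<zeta>)) - (LINT \<zeta>|\<beta>. \<phi> \<zeta>0 * complex_of_real (?P \<zeta>))" by simp
    also have "\<dots> = (LINT \<zeta>|\<beta>. \<phi> \<zeta> * complex_of_real (?P \<zeta>) - \<phi> \<zeta>0 * complex_of_real (?P \<zeta>))"
      by (rule Bochner_Integration.integral_diff[symmetric]) (rule i)+
    also have "cmod \<dots> \<le> (LINT \<zeta>|\<beta>. e / 2 * ?P \<zeta> + K * ((norm (\<zeta> - \<zeta>0))\<^sup>2 * ?P \<zeta>))"
    proof (rule Bochner_Integration.integral_norm_bound_integral)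
      fix \<zeta> assume "\<zeta> \<in> space \<beta>"
      then have \<zeta>: "\<zeta> \<in> bD" by (simp add: space_\<beta>)
      have "cmod (\<phi> \<zeta> - \<phi> \<zeta>0) * ?P \<zeta> \<le> (e / 2 + K * (norm (\<zeta> - \<zeta>0))\<^sup>2) * ?P \<zeta>"
        by (rule mult_right_mono[OF bound[OF \<zeta>] poisson_nonneg[OF w]])
      then show "norm (\<phi> \<zeta> * complex_of_real (?P \<zeta>) - \<phi> \<zeta>0 * complex_of_real (?P \<zeta>))
          \<le> e / 2 * ?P \<zeta> + K * ((norm (\<zeta> - \<zeta>0))\<^sup>2 * ?P \<zeta>)"
        using poisson_nonneg[OF w, of \<zeta>]
        by (simp add: left_diff_distrib[symmetric] norm_mult distrib_right mult.assoc)
    qed (use i in simp_all)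
    also have "\<dots> = e / 2 * 1 + K * (2 - 2 * s)"
    proof -
      have "(LINT \<zeta>|\<beta>. e / 2 * ?P \<zeta> + K * ((norm (\<zeta> - \<zeta>0))\<^sup>2 * ?P \<zeta>))
          = e / 2 * (LINT \<zeta>|\<beta>. ?P \<zeta>) + K * (LINT \<zeta>|\<beta>. (norm (\<zeta> - \<zeta>0))\<^sup>2 * ?P \<zeta>)"
        using i(1,2) by simp
      then show ?thesis
        unfolding poisson_integral_1[OF w] poisson_concentrates[OF \<zeta>0 less_imp_le[OF s(1)] s(2)] .
    qed
    finally show ?thesis by (simp only: mult_1_right)
  qed
  have "(\<lambda>n. K * (2 - 2 * r n)) \<longlonglongrightarrow> K * (2 - 2 * 1)" by (intro tendsto_intros r(2))
  from LIMSEQ_D[OF this, of "e / 2"] e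
  obtain n0 where n0: "\<And>n. n \<ge> n0 \<Longrightarrow> \<bar>K * (2 - 2 * r n)\<bar> < e / 2" by auto
  show "\<exists>n0. \<forall>n\<ge>n0. norm ((LINT \<zeta>|\<beta>. \<phi> \<zeta> * complex_of_real (poisson (of_real (r n) *s \<zeta>0) \<zeta>)) - \<phi> \<zeta>0) < e"
  proof (intro exI[of _ n0] allI impI)
    fix n assume "n0 \<le> n"
    then show "norm ((LINT \<zeta>|\<beta>. \<phi> \<zeta> * complex_of_real (poisson (of_real (r n) *s \<zeta>0) \<zeta>)) - \<phi> \<zeta>0) < e"
      using key[of "r n"] r(1)[of n] n0[of n] by linarith
  qed
qed

text \<open>Symmetry of the Poisson kernel moves the extension from \<open>\<mu>\<close> to
  \<open>\<phi>\<close>, where the approximate identity gives pointwise convergence with a uniform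
  bound.\<close>

lemma dilates_converge:
  fixes \<phi> :: "complex^'n \<Rightarrow> complex"
  assumes \<phi>: "continuous_on bD \<phi>" and r: "\<And>n::nat. 0 < r n \<and> r n < 1" "r \<longlonglongrightarrow> 1"
  shows "(\<lambda>n. LINT \<zeta>|\<beta>. \<phi> \<zeta> * u (of_real (r n) *s \<zeta>)) \<longlonglongrightarrow> (LINT \<zeta>|m. \<phi> \<zeta> * h \<zeta>)"
proof -
  obtain B where B: "\<And>\<zeta>. \<zeta> \<in> bD \<Longrightarrow> cmod (\<phi> \<zeta>) \<le> B" using continuous_bD_bounded[OF \<phi>] by blast
  define Q where "Q = (\<lambda>n \<zeta>'. LINT \<zeta>|\<beta>. \<phi> \<zeta> * complex_of_real (poisson (of_real (r n) *s \<zeta>') \<zeta>))"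
  have rD: "of_real (r n) *s \<zeta> \<in> D" if "\<zeta> \<in> bD" for n \<zeta>
    by (rule scale_bD[OF _ that]) (use r(1)[of n] in simp)
  have cP: "continuous_on bD (poisson (of_real (r n) *s \<zeta>))" if "\<zeta> \<in> bD" for n \<zeta>
    by (rule poisson_continuous) (use rD[OF that] in \<open>auto intro!: continuous_intros\<close>)
  have step: "(LINT \<zeta>|\<beta>. \<phi> \<zeta> * u (of_real (r n) *s \<zeta>)) = (LINT \<zeta>|m. Q n \<zeta> * h \<zeta>)" for n
  proof -
    let ?F = "\<lambda>\<zeta> \<zeta>'. \<phi> \<zeta> * complex_of_real (poisson (of_real (r n) *s \<zeta>) \<zeta>')"
    have cF: "continuous_on (bD \<times> bD) (\<lambda>(\<zeta>, \<zeta>'). ?F \<zeta> \<zeta>')"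
      unfolding case_prod_unfold
      by (intro continuous_intros poisson_continuous continuous_on_compose2[OF \<phi>]) (use rD in auto)
    have "(LINT \<zeta>|\<beta>. \<phi> \<zeta> * u (of_real (r n) *s \<zeta>)) = (LINT \<zeta>|\<beta>. LINT \<zeta>'|m. ?F \<zeta> \<zeta>' * h \<zeta>')"
      by (intro LINT_cong) (simp add: space_\<beta> u_eq rD mult.assoc)
    also have "\<dots> = (LINT \<zeta>'|m. (LINT \<zeta>|\<beta>. ?F \<zeta> \<zeta>') * h \<zeta>')"
      by (rule Fubini_continuous[OF cF compact_bD compact_bD closed_bD closed_bD sets_\<beta> finite_\<beta> _ finite_m h_measurable, of 1])
        (simp_all add: norm_h)
    also have "\<dots> = (LINT \<zeta>'|m. Q n \<zeta>' * h \<zeta>')"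
    proof (intro LINT_cong refl arg_cong2[of _ _ _ _ "(*)"])
      fix \<zeta>' assume "\<zeta>' \<in> space m"
      then have \<zeta>': "\<zeta>' \<in> bD" by simp
      show "(LINT \<zeta>|\<beta>. ?F \<zeta> \<zeta>') = Q n \<zeta>'"
        unfolding Q_def
        by (intro LINT_cong)
          (use poisson_symmetric[OF _ \<zeta>'] r(1)[of n] in \<open>simp add: space_\<beta>\<close>)
    qed
    finally show ?thesis .
  qed
  have Qbound: "cmod (Q n \<zeta>) \<le> B" if \<zeta>: "\<zeta> \<in> bD" for n \<zeta>
  proof -
    have "cmod (Q n \<zeta>) \<le> (LINT \<zeta>'|\<beta>. B * poisson (of_real (r n) *s \<zeta>) \<zeta>')"
      unfolding Q_def
    proof (rule Bochner_Integration.integral_norm_bound_integral)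
      show "integrable \<beta> (\<lambda>\<zeta>'. \<phi> \<zeta>' * complex_of_real (poisson (of_real (r n) *s \<zeta>) \<zeta>'))"
        "integrable \<beta> (\<lambda>\<zeta>'. B * poisson (of_real (r n) *s \<zeta>) \<zeta>')"
        by (intro continuous_\<beta>_integrable continuous_intros cP \<phi> \<zeta>)+
      show "norm (\<phi> \<zeta>' * complex_of_real (poisson (of_real (r n) *s \<zeta>) \<zeta>')) \<le> B * poisson (of_real (r n) *s \<zeta>) \<zeta>'"
        if "\<zeta>' \<in> space \<beta>" for \<zeta>'
        using B[of \<zeta>'] that poisson_nonneg[OF rD[OF \<zeta>], of n \<zeta>']
        by (simp add: norm_mult space_\<beta> mult_right_mono)
    qed
    also have "\<dots> = B" using poisson_integral_1[OF rD[OF \<zeta>]] by simp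
    finally show ?thesis .
  qed
  \<comment> \<open>\<open>Q n\<close> is continuous even on an open neighbourhood of
    \<open>bD\<close>, since dilation by \<open>r n\<close> < 1 maps such a neighbourhood into
    \<open>D\<close>.\<close>
  have Qm: "Q n \<in> borel_measurable m" for n
  proof (rule continuous_m_measurable)
    have op: "open {z. of_real (r n) *s z \<in> D}"
      using open_vimage[OF open_D, of "\<lambda>z. of_real (r n) *s z"]
      by (simp add: vimage_def continuous_intros)
    have "continuous_on {z. of_real (r n) *s z \<in> D}
        (\<lambda>\<zeta>'. LINT \<zeta>|\<beta>. complex_of_real (poisson (of_real (r n) *s \<zeta>') \<zeta>) * \<phi> \<zeta>)"
      by (rule continuous_on_integral_parameter[OF _ op compact_bD sets_\<beta> finite_\<beta> continuous_\<beta>_measurable[OF \<phi>] B])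
        (auto simp: case_prod_unfold intro!: continuous_intros poisson_continuous)
    then have "continuous_on {z. of_real (r n) *s z \<in> D} (Q n)" by (simp add: Q_def mult.commute)
    then show "continuous_on bD (Q n)" by (rule continuous_on_subset) (use rD in auto)
  qed
  have "(\<lambda>n. LINT \<zeta>|m. Q n \<zeta> * h \<zeta>) \<longlonglongrightarrow> (LINT \<zeta>|m. \<phi> \<zeta> * h \<zeta>)"
  proof (rule integral_dominated_convergence[where w="\<lambda>_. B"])
    show "(\<lambda>\<zeta>. \<phi> \<zeta> * h \<zeta>) \<in> borel_measurable m" "(\<lambda>\<zeta>. Q n \<zeta> * h \<zeta>) \<in> borel_measurable m" for n
      by (intro borel_measurable_times h_measurable Qm continuous_m_measurable \<phi>)+
    show "integrable m (\<lambda>_. B)" using finite_measure.integrable_const[OF finite_m] .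
    show "AE \<zeta> in m. (\<lambda>n. Q n \<zeta> * h \<zeta>) \<longlonglongrightarrow> \<phi> \<zeta> * h \<zeta>"
      unfolding Q_def by (intro AE_I2 tendsto_mult tendsto_const poisson_approximate_identity \<phi> r) simp
    show "AE \<zeta> in m. norm (Q n \<zeta> * h \<zeta>) \<le> B" for n
      by (rule AE_I2) (simp add: norm_mult norm_h Qbound)
  qed
  then show ?thesis unfolding step .
qed

text \<open>Averaging along orbits against a function of degree -k removes every component of
  \<open>u\<close> but the k-th. At radius \<open>r n\<close> that component is its boundary
  coefficient times the |k|-th power of \<open>r n\<close>, and this power tends to 1.\<close>

lemma homogeneous_moment:
  assumes \<phi>: "circle_homogeneous bD (- k) \<phi>"
  shows "(LINT \<zeta>|m. \<phi> \<zeta> * h \<zeta>) = (LINT \<zeta>|\<beta>. \<phi> \<zeta> * coeff k \<zeta>)"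
proof -
  define r where "r = (\<lambda>n::nat. 1 - 1 / (real n + 2))"
  have r: "0 < r n \<and> r n < 1" for n by (simp add: r_def)
  have rlim: "r \<longlonglongrightarrow> 1" unfolding r_def by real_asymp
  have c\<phi>: "continuous_on bD \<phi>" and h\<phi>: "\<And>\<alpha> \<zeta>. cmod \<alpha> = 1 \<Longrightarrow> \<zeta> \<in> bD \<Longrightarrow> \<phi> (\<alpha> *s \<zeta>) = hpow (- k) \<alpha> * \<phi> \<zeta>"
    using \<phi> by (auto simp: circle_homogeneous_def)
  have rD: "of_real (r n) *s \<zeta> \<in> D" if "\<zeta> \<in> bD" for n \<zeta>
    by (rule scale_bD[OF _ that]) (use r[of n] in simp)
  have eq: "(LINT \<zeta>|\<beta>. \<phi> \<zeta> * u (of_real (r n) *s \<zeta>)) = complex_of_real (r n) ^ nat \<bar>k\<bar> * (LINT \<zeta>|\<beta>. \<phi> \<zeta> * coeff k \<zeta>)" for n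
  proof -
    have "continuous_on bD (\<lambda>\<zeta>. \<phi> \<zeta> * u (of_real (r n) *s \<zeta>))"
      by (intro continuous_intros c\<phi> continuous_on_compose2[OF u_continuous]) (use rD in auto)
    from \<beta>_circle_average[OF this]
    have "(LINT \<zeta>|\<beta>. \<phi> \<zeta> * u (of_real (r n) *s \<zeta>)) =
      (LINT \<zeta>|\<beta>. LINT \<alpha>|circle_haar. \<phi> (\<alpha> *s \<zeta>) * u (of_real (r n) *s (\<alpha> *s \<zeta>)))" .
    also have "\<dots> = (LINT \<zeta>|\<beta>. complex_of_real (r n) ^ nat \<bar>k\<bar> * (\<phi> \<zeta> * coeff k \<zeta>))"
    proof (intro LINT_cong)
      fix \<zeta> assume "\<zeta> \<in> space \<beta>"
      then have \<zeta>: "\<zeta> \<in> bD" by (simp add: space_\<beta>)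
      have "(LINT \<alpha>|circle_haar. \<phi> (\<alpha> *s \<zeta>) * u (of_real (r n) *s (\<alpha> *s \<zeta>)))
          = (LINT \<alpha>|circle_haar. \<phi> \<zeta> * (u (\<alpha> *s (of_real (r n) *s \<zeta>)) * hpow (- k) \<alpha>))"
        by (intro LINT_cong)
          (simp add: h\<phi>[OF _ \<zeta>] vector_smult_assoc mult_ac)
      also have "\<dots> = \<phi> \<zeta> * circle_component u k (of_real (r n) *s \<zeta>)"
        by (simp add: circle_component_def)
      also have "\<dots> = \<phi> \<zeta> * (hpow k (of_real (r n)) * coeff k \<zeta>)"
        using slice_coeffs(2)[OF pluriharmonic, of \<zeta> "of_real (r n)" k] \<zeta> bD_closure r[of n] by auto
      finally show "(LINT \<alpha>|circle_haar. \<phi> (\<alpha> *s \<zeta>) * u (of_real (r n) *s (\<alpha> *s \<zeta>)))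
          = complex_of_real (r n) ^ nat \<bar>k\<bar> * (\<phi> \<zeta> * coeff k \<zeta>)"
        unfolding hpow_of_real by (simp add: mult_ac)
    qed
    finally show ?thesis by simp
  qed
  have "(\<lambda>n. complex_of_real (r n) ^ nat \<bar>k\<bar> * (LINT \<zeta>|\<beta>. \<phi> \<zeta> * coeff k \<zeta>))
      \<longlonglongrightarrow> of_real 1 ^ nat \<bar>k\<bar> * (LINT \<zeta>|\<beta>. \<phi> \<zeta> * coeff k \<zeta>)"
    by (intro tendsto_intros rlim)
  moreover have "(\<lambda>n. complex_of_real (r n) ^ nat \<bar>k\<bar> * (LINT \<zeta>|\<beta>. \<phi> \<zeta> * coeff k \<zeta>)) \<longlonglongrightarrow> (LINT \<zeta>|m. \<phi> \<zeta> * h \<zeta>)"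
    using dilates_converge[OF c\<phi> r rlim] unfolding eq .
  ultimately show ?thesis using LIMSEQ_unique by fastforce
qed

end

section \<open>The quotient by the circle\<close>

text \<open>Rotations are isometries that preserve \<open>S\<close>, so distances to
  \<open>S\<close> cannot increase; the inverse rotation gives the reverse inequality. Cut-off
  functions of saturated sets built from distances are therefore of degree 0.\<close>

lemma infdist_circular:
  fixes z :: "complex^'n"
  assumes \<alpha>: "cmod \<alpha> = 1" and S: "\<And>\<alpha> z. cmod \<alpha> = 1 \<Longrightarrow> z \<in> S \<Longrightarrow> \<alpha> *s z \<in> S"
  shows "infdist (\<alpha> *s z) S = infdist z S"
proof (cases "S = {}")
  case False
  have le: "infdist (\<alpha> *s z) S \<le> infdist z S" if "cmod \<alpha> = 1" for \<alpha> z
    unfolding infdist_notempty[OF False, of z]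
  proof (rule cINF_greatest[OF False])
    fix y assume "y \<in> S"
    then have "infdist (\<alpha> *s z) S \<le> dist (\<alpha> *s z) (\<alpha> *s y)" by (intro infdist_le S that)
    also have "\<dots> = dist z y"
      using norm_scale_complex[of \<alpha> "z - y"] that by (simp add: dist_norm vector_sub_rdistrib)
    finally show "infdist (\<alpha> *s z) S \<le> dist z y" .
  qed
  have "infdist z S = infdist ((1 / \<alpha>) *s (\<alpha> *s z)) S" using \<alpha> by (auto simp: vector_smult_assoc)
  also have "\<dots> \<le> infdist (\<alpha> *s z) S" by (rule le) (simp add: norm_divide \<alpha>)
  finally show ?thesis by (rule antisym[OF le[OF \<alpha>]])
qed (simp add: infdist_def)

lemma torbit_self: "\<zeta> \<in> torbit \<zeta>"
  unfolding torbit_def by (auto intro!: exI[of _ 1] simp: vec_eq_iff)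

lemma torbit_eq:
  assumes "z \<in> torbit \<zeta>" shows "torbit z = torbit \<zeta>"
proof -
  obtain \<alpha> where \<alpha>: "cmod \<alpha> = 1" "z = \<alpha> *s \<zeta>" using assms by (auto simp: torbit_def)
  have ne: "\<alpha> \<noteq> 0" using \<alpha>(1) by auto
  show ?thesis
  proof
    show "torbit z \<subseteq> torbit \<zeta>"
      unfolding torbit_def \<alpha>(2) using \<alpha>(1) by (auto simp: vector_smult_assoc norm_mult)
    show "torbit \<zeta> \<subseteq> torbit z"
    proof
      fix y assume "y \<in> torbit \<zeta>"
      then obtain \<gamma> where "cmod \<gamma> = 1" "y = \<gamma> *s \<zeta>" by (auto simp: torbit_def)
      then have "y = (\<gamma> / \<alpha>) *s z" "cmod (\<gamma> / \<alpha>) = 1"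
        using \<alpha> ne by (simp_all add: vector_smult_assoc norm_divide)
      then show "y \<in> torbit z" by (auto simp: torbit_def)
    qed
  qed
qed

lemma torbit_eq_iff: "torbit z = torbit \<zeta> \<longleftrightarrow> z \<in> torbit \<zeta>"
  using torbit_eq[of z \<zeta>] torbit_self[of z] by auto

lemma torbit_scale: "cmod \<alpha> = 1 \<Longrightarrow> torbit (\<alpha> *s \<zeta>) = torbit \<zeta>"
  by (rule torbit_eq) (auto simp: torbit_def)

definition quotient_open :: "(complex^'n) set \<Rightarrow> (complex^'n) set set set" where
  "quotient_open bD = {V. V \<subseteq> torbit ` bD \<and> openin (top_of_set bD) {\<zeta>\<in>bD. torbit \<zeta> \<in> V}}"

lemma space_quotient_borel [simp]: "space (quotient_borel bD) = torbit ` bD"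
  and sets_quotient_borel: "sets (quotient_borel bD) = sigma_sets (torbit ` bD) (quotient_open bD)"
proof -
  have "quotient_open bD \<subseteq> Pow (torbit ` bD)" by (auto simp: quotient_open_def)
  then show "space (quotient_borel bD) = torbit ` bD"
    and "sets (quotient_borel bD) = sigma_sets (torbit ` bD) (quotient_open bD)"
    unfolding quotient_borel_def quotient_open_def[symmetric]
    by (rule space_measure_of, rule sets_measure_of)
qed

lemma torbit_measurable: "torbit \<in> measurable (borel_on bD) (quotient_borel bD)"
  unfolding quotient_borel_def
proof (rule measurable_sigma_sets[OF sets_measure_of])
  show "{V. V \<subseteq> torbit ` bD \<and> openin (top_of_set bD) {\<zeta> \<in> bD. torbit \<zeta> \<in> V}} \<subseteq> Pow (torbit ` bD)"
    by auto
  then show "{V. V \<subseteq> torbit ` bD \<and> openin (top_of_set bD) {\<zeta> \<in> bD. torbit \<zeta> \<in> V}} \<subseteq> Pow (torbit ` bD)" .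
  show "torbit \<in> space (borel_on bD) \<rightarrow> torbit ` bD" by (auto simp: space_restrict_space)
  fix V assume "V \<in> {V. V \<subseteq> torbit ` bD \<and> openin (top_of_set bD) {\<zeta> \<in> bD. torbit \<zeta> \<in> V}}"
  then obtain U where U: "open U" "{\<zeta> \<in> bD. torbit \<zeta> \<in> V} = bD \<inter> U"
    by (auto simp: openin_open)
  have "torbit -` V \<inter> space (borel_on bD) = bD \<inter> U" using U(2) by (auto simp: space_restrict_space)
  then show "torbit -` V \<inter> space (borel_on bD) \<in> sets (borel_on bD)"
    using U(1) by (simp add: sets_restrict_space)
qed

context pluriharmonic_setting
begin

abbreviation Q :: "(complex^'n) set measure" where "Q \<equiv> quotient_borel bD"
abbreviation \<nu> :: "(complex^'n) set measure" where "\<nu> \<equiv> quotient_measure bD \<beta>"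

lemma torbit_\<beta>: "torbit \<in> measurable \<beta> Q"
  unfolding measurable_cong_sets[OF sets_\<beta> refl] by (rule torbit_measurable)

lemma torbit_m: "torbit \<in> measurable m Q"
  unfolding measurable_cong_sets[OF sets_variation refl] by (rule torbit_measurable)

text \<open>Both sides are complex measures on the quotient. For an open set of the quotient
  topology the indicator is a limit of invariant continuous cut-offs, and multiplication by these
  does not change the degree of \<open>\<phi>\<close>.\<close>

lemma homogeneous_moment_saturated:
  assumes \<phi>: "circle_homogeneous bD (- k) \<phi>" and N: "N \<in> sets Q"
  shows "(LINT \<zeta>:(torbit -` N \<inter> bD)|m. \<phi> \<zeta> * h \<zeta>) = (LINT \<zeta>:(torbit -` N \<inter> bD)|\<beta>. \<phi> \<zeta> * coeff k \<zeta>)"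
proof -
  have c\<phi>: "continuous_on bD \<phi>" using \<phi> by (simp add: circle_homogeneous_def)
  obtain B where B: "\<And>\<zeta>. \<zeta> \<in> bD \<Longrightarrow> cmod (\<phi> \<zeta>) \<le> B" using continuous_bD_bounded[OF c\<phi>] by blast
  have i1: "integrable m (\<lambda>\<zeta>. \<phi> \<zeta> * h \<zeta>)"
    by (rule integrable_bounded_mult[OF integrable_h continuous_m_measurable[OF c\<phi>] B]) simp
  have cc: "continuous_on bD (coeff k)" using coeff_homogeneous by (simp add: circle_homogeneous_def)
  have i2: "integrable \<beta> (\<lambda>\<zeta>. \<phi> \<zeta> * coeff k \<zeta>)"
    by (intro continuous_\<beta>_integrable continuous_intros c\<phi> cc)
  have "(LINT \<zeta>:(torbit -` N \<inter> space m)|m. \<phi> \<zeta> * h \<zeta>) = (LINT \<zeta>:(torbit -` N \<inter> space \<beta>)|\<beta>. \<phi> \<zeta> * coeff k \<zeta>)"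
  proof (rule complex_measure_eqI[OF set_integral_complex_measure[OF i1 torbit_m]
        set_integral_complex_measure[OF i2 torbit_\<beta>] _ _ _ _ _ N])
    show "sets Q = sigma_sets (space Q) (quotient_open bD)" by (simp add: sets_quotient_borel)
    show "Int_stable (quotient_open bD)"
    proof (rule Int_stableI)
      fix V W assume VW: "V \<in> quotient_open bD" "W \<in> quotient_open bD"
      have "{\<zeta> \<in> bD. torbit \<zeta> \<in> V \<inter> W} = {\<zeta> \<in> bD. torbit \<zeta> \<in> V} \<inter> {\<zeta> \<in> bD. torbit \<zeta> \<in> W}" by auto
      then show "V \<inter> W \<in> quotient_open bD"
        using VW openin_Int[of "top_of_set bD" "{\<zeta> \<in> bD. torbit \<zeta> \<in> V}" "{\<zeta> \<in> bD. torbit \<zeta> \<in> W}"]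
        unfolding quotient_open_def by (simp add: le_infI1)
    qed
    show "quotient_open bD \<subseteq> Pow (space Q)" by (auto simp: quotient_open_def)
    have "{\<zeta> \<in> bD. torbit \<zeta> \<in> torbit ` bD} = bD" by auto
    then show "space Q \<in> quotient_open bD" by (simp add: quotient_open_def)
    fix V assume "V \<in> quotient_open bD"
    then obtain U where U: "open U" "{\<zeta> \<in> bD. torbit \<zeta> \<in> V} = bD \<inter> U"
      by (auto simp: quotient_open_def openin_open)
    have eq: "torbit -` V \<inter> space m = bD \<inter> U" "torbit -` V \<inter> space \<beta> = bD \<inter> U"
      using U(2) by (auto simp: space_\<beta>)
    have circ: "\<alpha> *s z \<in> bD - U" if "cmod \<alpha> = 1" "z \<in> bD - U" for \<alpha> z
    proof -
      have "z \<notin> {\<zeta> \<in> bD. torbit \<zeta> \<in> V}" using that U(2) by blast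
      then have "\<alpha> *s z \<notin> {\<zeta> \<in> bD. torbit \<zeta> \<in> V}" using that torbit_scale[OF that(1), of z] by auto
      then show ?thesis using that circular_bD[of \<alpha> z] U(2) by auto
    qed
    show "(LINT \<zeta>:(torbit -` V \<inter> space m)|m. \<phi> \<zeta> * h \<zeta>) = (LINT \<zeta>:(torbit -` V \<inter> space \<beta>)|\<beta>. \<phi> \<zeta> * coeff k \<zeta>)"
      unfolding eq
    proof (cases "bD - U = {}")
      case True
      then have "bD \<inter> U = bD" by blast
      moreover have "(LINT \<zeta>:bD|m. \<phi> \<zeta> * h \<zeta>) = (LINT \<zeta>|m. \<phi> \<zeta> * h \<zeta>)"
        unfolding set_lebesgue_integral_def by (intro Bochner_Integration.integral_cong) auto
      moreover have "(LINT \<zeta>:bD|\<beta>. \<phi> \<zeta> * coeff k \<zeta>) = (LINT \<zeta>|\<beta>. \<phi> \<zeta> * coeff k \<zeta>)"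
        unfolding set_lebesgue_integral_def by (intro Bochner_Integration.integral_cong) (auto simp: space_\<beta>)
      ultimately show "(LINT \<zeta>:(bD \<inter> U)|m. \<phi> \<zeta> * h \<zeta>) = (LINT \<zeta>:(bD \<inter> U)|\<beta>. \<phi> \<zeta> * coeff k \<zeta>)"
        using homogeneous_moment[OF \<phi>] by simp
    next
      case False
      let ?\<psi> = "\<lambda>n \<zeta>. complex_of_real (min 1 (real n * infdist \<zeta> (bD - U)))"
      have "circle_homogeneous bD 0 (?\<psi> n)" for n
        unfolding circle_homogeneous_def using infdist_circular[OF _ circ]
        by (auto intro!: continuous_intros)
      from circle_homogeneous_mult[OF this \<phi>]
      have hom: "circle_homogeneous bD (- k) (\<lambda>\<zeta>. ?\<psi> n \<zeta> * \<phi> \<zeta>)" for n by simp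
      have "(LINT \<zeta>|m. ?\<psi> n \<zeta> * (\<phi> \<zeta> * h \<zeta>)) = (LINT \<zeta>|\<beta>. ?\<psi> n \<zeta> * (\<phi> \<zeta> * coeff k \<zeta>))" for n
        using homogeneous_moment[OF hom] by (simp add: mult.assoc)
      moreover have "(\<lambda>n. LINT \<zeta>|m. ?\<psi> n \<zeta> * (\<phi> \<zeta> * h \<zeta>)) \<longlonglongrightarrow> (LINT \<zeta>:(bD \<inter> U)|m. \<phi> \<zeta> * h \<zeta>)"
        by (rule set_integral_open_limit[OF i1 _ U(1) False]) simp
      moreover have "(\<lambda>n. LINT \<zeta>|\<beta>. ?\<psi> n \<zeta> * (\<phi> \<zeta> * coeff k \<zeta>)) \<longlonglongrightarrow> (LINT \<zeta>:(bD \<inter> U)|\<beta>. \<phi> \<zeta> * coeff k \<zeta>)"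
        by (rule set_integral_open_limit[OF i2 sets_\<beta> U(1) False])
      ultimately show "(LINT \<zeta>:(bD \<inter> U)|m. \<phi> \<zeta> * h \<zeta>) = (LINT \<zeta>:(bD \<inter> U)|\<beta>. \<phi> \<zeta> * coeff k \<zeta>)"
        using LIMSEQ_unique by simp
    qed
  qed
  then show ?thesis by (simp add: space_\<beta>)
qed

end

section \<open>Zero sets of homogeneous holomorphic functions\<close>

context symmetric_domain
begin

lemma automorphism_mult:
  assumes "A \<in> linear_automorphisms D" "B \<in> linear_automorphisms D"
  shows "A ** B \<in> linear_automorphisms D"
proof -
  have "(\<lambda>z. (A ** B) *v z) ` D = (\<lambda>z. A *v z) ` ((\<lambda>z. B *v z) ` D)"
    by (simp add: image_image matrix_vector_mul_assoc)
  also have "\<dots> = D" using assms by (simp add: linear_automorphisms_def)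
  finally show ?thesis using assms by (simp add: linear_automorphisms_def invertible_mult)
qed

lemma automorphism_dist:
  assumes "A \<in> linear_automorphisms D"
  shows "dist (A *v z) (A *v w) = dist z w"
  using norm_unitary[OF unitary[OF assms], of "z - w"]
  by (simp add: dist_norm matrix_vector_mult_diff_distrib)

text \<open>Lists rather than sets of matrices, so that composed averages keep the multiplicity of
  coinciding products.\<close>

definition translate_average :: "(complex^'n \<Rightarrow> real) \<Rightarrow> (complex^'n^'n) list \<Rightarrow> complex^'n \<Rightarrow> real" where
  "translate_average \<phi> As \<zeta> = (\<Sum>A\<leftarrow>As. \<phi> (A *v \<zeta>)) / real (length As)"

text \<open>Averaging over translates raises the minimum as long as the function oscillates: the region
  where it is large can be moved, by transitivity, over any point. Hence the supremum of the minima
  of the averages is the mean; no Haar measure on the automorphism group is needed.\<close>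

lemma translate_average_ge_mean:
  assumes \<phi>: "continuous_on bD \<phi>" and \<eta>: "\<eta> > 0"
  shows "\<exists>As. As \<noteq> [] \<and> set As \<subseteq> linear_automorphisms D \<and>
    (\<forall>\<zeta>\<in>bD. (LINT \<zeta>|\<beta>. \<phi> \<zeta>) - \<eta> \<le> translate_average \<phi> As \<zeta>)"
proof -
  define Av where "Av = {As. As \<noteq> [] \<and> set As \<subseteq> linear_automorphisms D}"
  obtain B where B: "\<And>\<zeta>. \<zeta> \<in> bD \<Longrightarrow> \<bar>\<phi> \<zeta>\<bar> \<le> B" using continuous_bD_bounded[OF \<phi>] by auto
  have "uniformly_continuous_on bD \<phi>" by (rule compact_uniformly_continuous[OF \<phi> compact_bD])
  moreover have "\<eta> / 2 > 0" using \<eta> by simp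
  ultimately have "\<exists>d>0. \<forall>x\<in>bD. \<forall>y\<in>bD. dist y x < d \<longrightarrow> dist (\<phi> y) (\<phi> x) < \<eta> / 2"
    unfolding uniformly_continuous_on_def by blast
  then obtain d where d: "d > 0" "\<And>x y. x \<in> bD \<Longrightarrow> y \<in> bD \<Longrightarrow> dist y x < d \<Longrightarrow> dist (\<phi> y) (\<phi> x) < \<eta> / 2"
    by blast
  have "\<exists>k. finite k \<and> k \<subseteq> bD \<and> bD \<subseteq> (\<Union>x\<in>k. ball x d)"
    using seq_compact_imp_totally_bounded[OF compact_imp_seq_compact[OF compact_bD]] d(1) by blast
  then obtain k where k: "finite k" "k \<subseteq> bD" "bD \<subseteq> (\<Union>x\<in>k. ball x d)" by (elim exE conjE)
  obtain cs where cs: "set cs = k" using finite_list[OF k(1)] by blast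
  have cs_ne: "cs \<noteq> []" using k bD_nonempty cs by auto
  define M where "M = real (length cs)"
  have M: "M > 0" using cs_ne by (simp add: M_def)
  define X where "X = {c. \<exists>As\<in>Av. \<forall>\<zeta>\<in>bD. c \<le> translate_average \<phi> As \<zeta>}"
  obtain \<zeta>1 where \<zeta>1: "\<zeta>1 \<in> bD" using bD_nonempty by blast
  have avg_le: "translate_average \<phi> As \<zeta> \<le> C" "c \<le> translate_average \<phi> As \<zeta>"
    if "As \<in> Av" "\<zeta> \<in> bD" "\<And>\<zeta>. \<zeta> \<in> bD \<Longrightarrow> c \<le> \<phi> \<zeta> \<and> \<phi> \<zeta> \<le> C" for As \<zeta> c C
  proof -
    have "(\<Sum>A\<leftarrow>As. \<phi> (A *v \<zeta>)) \<le> (\<Sum>A\<leftarrow>As. C)" "(\<Sum>A\<leftarrow>As. c) \<le> (\<Sum>A\<leftarrow>As. \<phi> (A *v \<zeta>))"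
      using that automorphism_bD by (auto intro!: sum_list_mono simp: Av_def)
    then show "translate_average \<phi> As \<zeta> \<le> C" "c \<le> translate_average \<phi> As \<zeta>"
      using that(1) by (simp_all add: translate_average_def Av_def sum_list_triv field_simps)
  qed
  have B': "- B \<le> \<phi> \<zeta> \<and> \<phi> \<zeta> \<le> B" if "\<zeta> \<in> bD" for \<zeta>
    using B[OF that] by linarith
  have bdd: "bdd_above X"
  proof (rule bdd_aboveI[of _ B])
    fix c assume "c \<in> X"
    then obtain As where "As \<in> Av" "c \<le> translate_average \<phi> As \<zeta>1" using \<zeta>1 by (auto simp: X_def)
    moreover have "translate_average \<phi> As \<zeta>1 \<le> B"
      by (rule avg_le(1)[OF \<open>As \<in> Av\<close> \<zeta>1 B'])
    ultimately show "c \<le> B" by linarith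
  qed
  have "mat 1 \<in> linear_automorphisms D" by (rule scalar_automorphism) simp
  then have one: "[mat 1] \<in> Av" by (simp add: Av_def)
  have "- B \<in> X"
    unfolding X_def using one avg_le(2)[OF one _ B'] by blast
  then have X_ne: "X \<noteq> {}" by blast
  \<comment> \<open>An improvement step will raise the lower bound by \<eta> / (2 M), so a start
    within \<eta> / (4 M) of the supremum leads to a contradiction.\<close>
  have "Sup X - \<eta> / (4 * M) < Sup X" using \<eta> M by simp
  then obtain c where c: "c \<in> X" "Sup X - \<eta> / (4 * M) < c"
    using less_cSup_iff[OF X_ne bdd] by blast
  then obtain As where As: "As \<in> Av" "\<And>\<zeta>. \<zeta> \<in> bD \<Longrightarrow> c \<le> translate_average \<phi> As \<zeta>"
    by (auto simp: X_def)
  let ?\<psi> = "translate_average \<phi> As"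
  have As_ne: "real (length As) > 0" and AsK: "\<And>A. A \<in> set As \<Longrightarrow> A \<in> linear_automorphisms D"
    using As(1) by (auto simp: Av_def)
  have \<psi>_close: "?\<psi> y \<ge> ?\<psi> x - \<eta> / 2" if "x \<in> bD" "y \<in> bD" "dist y x < d" for x y
  proof -
    have "(\<Sum>A\<leftarrow>As. \<phi> (A *v x) - \<eta> / 2) \<le> (\<Sum>A\<leftarrow>As. \<phi> (A *v y))"
    proof (rule sum_list_mono)
      fix A assume "A \<in> set As"
      then have A: "A \<in> linear_automorphisms D" by (rule AsK)
      have "dist (\<phi> (A *v y)) (\<phi> (A *v x)) < \<eta> / 2"
        by (rule d(2)) (use A automorphism_bD that automorphism_dist[OF A] in auto)
      then show "\<phi> (A *v x) - \<eta> / 2 \<le> \<phi> (A *v y)" unfolding dist_real_def by linarith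
    qed
    then have "(\<Sum>A\<leftarrow>As. \<phi> (A *v x)) - real (length As) * (\<eta> / 2) \<le> (\<Sum>A\<leftarrow>As. \<phi> (A *v y))"
      by (simp add: sum_list_subtractf sum_list_triv)
    from divide_right_mono[OF this, of "real (length As)"]
    show ?thesis using As_ne by (simp add: translate_average_def diff_divide_distrib)
  qed
  have upper: "?\<psi> \<zeta> < c + \<eta>" if \<zeta>: "\<zeta> \<in> bD" for \<zeta>
  proof (rule ccontr)
    assume "\<not> ?\<psi> \<zeta> < c + \<eta>"
    then have big: "?\<psi> \<zeta> \<ge> c + \<eta>" by simp
    have "\<forall>x\<in>k. \<exists>A\<in>linear_automorphisms D. A *v x = \<zeta>" using transitive k(2) \<zeta> by blast
    then obtain T where T: "\<And>x. x \<in> k \<Longrightarrow> T x \<in> linear_automorphisms D" "\<And>x. x \<in> k \<Longrightarrow> T x *v x = \<zeta>"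
      by metis
    \<comment> \<open>Every net point x is carried to \<zeta> by \<open>T x\<close>. A given y is
      d-close to some net point x0, so the x0-th average at y is at least c + \<eta> / 2, and the
      other ones are at least c; division by their number M gives the gain.\<close>
    define Bs where "Bs = concat (map (\<lambda>x. map (\<lambda>A. A ** T x) As) cs)"
    have len: "length Bs = length cs * length As"
      by (simp add: Bs_def length_concat o_def sum_list_triv)
    have "Bs \<noteq> []" using len cs_ne As_ne by (metis length_0_conv mult_eq_0_iff of_nat_0 less_irrefl)
    moreover have "set Bs \<subseteq> linear_automorphisms D"
      using T(1) AsK cs by (auto simp: Bs_def intro!: automorphism_mult)
    ultimately have Bs: "Bs \<in> Av" by (simp add: Av_def)
    have avgB: "translate_average \<phi> Bs y = (\<Sum>x\<leftarrow>cs. ?\<psi> (T x *v y)) / M" for y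
    proof -
      have "(\<Sum>A\<leftarrow>Bs. \<phi> (A *v y)) = (\<Sum>x\<leftarrow>cs. \<Sum>A\<leftarrow>As. \<phi> (A *v (T x *v y)))"
        unfolding Bs_def by (induction cs) (simp_all add: o_def matrix_vector_mul_assoc)
      also have "\<dots> = (\<Sum>x\<leftarrow>cs. real (length As) * ?\<psi> (T x *v y))"
        using As_ne by (simp add: translate_average_def)
      also have "\<dots> = real (length As) * (\<Sum>x\<leftarrow>cs. ?\<psi> (T x *v y))" by (rule sum_list_const_mult)
      finally show ?thesis using As_ne by (simp add: translate_average_def[of \<phi> Bs] len M_def)
    qed
    have "c + \<eta> / (2 * M) \<in> X"
      unfolding X_def
    proof (intro CollectI bexI[OF _ Bs] ballI)
      fix y assume y: "y \<in> bD"
      then obtain x0 where x0: "x0 \<in> k" "dist x0 y < d" using k(3) by auto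
      have Ty: "T x *v y \<in> bD" if "x \<in> k" for x using automorphism_bD[OF T(1)[OF that] y] .
      have 1: "?\<psi> (T x0 *v y) \<ge> c + \<eta> / 2"
      proof -
        have "dist (T x0 *v y) \<zeta> < d"
          using automorphism_dist[OF T(1)[OF x0(1)], of y x0] T(2)[OF x0(1)] x0(2) by (simp add: dist_commute)
        from \<psi>_close[OF \<zeta> Ty[OF x0(1)] this] show ?thesis using big by simp
      qed
      have "M * c + \<eta> / 2 \<le> (\<Sum>x\<leftarrow>cs. ?\<psi> (T x *v y))"
      proof -
        obtain xs ys where sp: "cs = xs @ x0 # ys" using x0(1) cs split_list by metis
        have ge: "(\<Sum>x\<leftarrow>zs. c) \<le> (\<Sum>x\<leftarrow>zs. ?\<psi> (T x *v y))" if "set zs \<subseteq> k" for zs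
          by (rule sum_list_mono) (use As(2) Ty that in blast)
        have "set xs \<subseteq> k" "set ys \<subseteq> k" using sp cs by auto
        from ge[OF this(1)] ge[OF this(2)] 1 show ?thesis
          unfolding M_def sp by (simp add: sum_list_triv algebra_simps)
      qed
      from divide_right_mono[OF this, of M] show "c + \<eta> / (2 * M) \<le> translate_average \<phi> Bs y"
        unfolding avgB using M by (simp add: add_divide_distrib)
    qed
    then have "c + \<eta> / (2 * M) \<le> Sup X" by (rule cSup_upper[OF _ bdd])
    moreover have "\<eta> / (4 * M) < \<eta> / (2 * M)" using \<eta> M by (simp add: divide_simps)
    ultimately show False using c(2) by linarith
  qed
  have c\<phi>A: "continuous_on bD (\<lambda>\<zeta>. \<phi> (A *v \<zeta>))" if "A \<in> linear_automorphisms D" for A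
    by (rule continuous_on_compose2[OF \<phi>]) (use automorphism_bD[OF that] in \<open>auto intro!: continuous_intros\<close>)
  have int_sum: "integrable \<beta> (\<lambda>\<zeta>. \<Sum>A\<leftarrow>Bs. \<phi> (A *v \<zeta>)) \<and>
      (LINT \<zeta>|\<beta>. (\<Sum>A\<leftarrow>Bs. \<phi> (A *v \<zeta>))) = real (length Bs) * (LINT \<zeta>|\<beta>. \<phi> \<zeta>)"
    if "set Bs \<subseteq> linear_automorphisms D" for Bs
    using that
  proof (induction Bs)
    case (Cons A Bs)
    have A: "A \<in> linear_automorphisms D" using Cons.prems by simp
    have IH: "integrable \<beta> (\<lambda>\<zeta>. \<Sum>A\<leftarrow>Bs. \<phi> (A *v \<zeta>))"
      "(LINT \<zeta>|\<beta>. (\<Sum>A\<leftarrow>Bs. \<phi> (A *v \<zeta>))) = real (length Bs) * (LINT \<zeta>|\<beta>. \<phi> \<zeta>)"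
      using Cons by simp_all
    have "integrable \<beta> (\<lambda>\<zeta>. \<phi> (A *v \<zeta>))" by (rule continuous_\<beta>_integrable[OF c\<phi>A[OF A]])
    moreover have "(LINT \<zeta>|\<beta>. \<phi> (A *v \<zeta>)) = (LINT \<zeta>|\<beta>. \<phi> \<zeta>)"
      by (rule \<beta>_invariant[OF A continuous_\<beta>_measurable[OF \<phi>]])
    ultimately show ?case using IH by (simp add: algebra_simps)
  qed simp
  have "set As \<subseteq> linear_automorphisms D" using As(1) by (simp add: Av_def)
  note ia = int_sum[OF this]
  have i\<psi>: "integrable \<beta> ?\<psi>" unfolding translate_average_def using ia by simp
  have "(LINT \<zeta>|\<beta>. \<phi> \<zeta>) = (LINT \<zeta>|\<beta>. ?\<psi> \<zeta>)"
    unfolding translate_average_def using ia As_ne by simp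
  also have "\<dots> \<le> (LINT \<zeta>|\<beta>. c + \<eta>)"
    by (rule integral_mono[OF i\<psi>]) (use upper finite_measure.integrable_const[OF finite_\<beta>] in \<open>auto simp: space_\<beta> less_imp_le\<close>)
  also have "\<dots> = c + \<eta>" by (simp add: space_\<beta> measure_\<beta>)
  finally have "(LINT \<zeta>|\<beta>. \<phi> \<zeta>) - \<eta> \<le> c" by simp
  then show ?thesis using As by (intro exI[of _ As]) (auto simp: Av_def intro: order_trans)
qed

lemma indicator_\<beta>_integrable: "A \<in> sets \<beta> \<Longrightarrow> integrable \<beta> (indicator A :: _ \<Rightarrow> real)"
  by (rule bounded_\<beta>_integrable[where B=1]) auto

text \<open>On average over the group, a translate of \<open>E\<close> meets \<open>A\<close> in the
  proportion \<open>measure \<beta> E\<close>. The factor 1/2 pays for two losses of a quarter each: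
  finite averages reach the mean only approximately, and the indicator of \<open>E\<close> is
  replaced by a continuous majorant.\<close>

lemma closed_subset_translate:
  assumes E: "closed E" "E \<subseteq> bD" and A: "A \<in> sets \<beta>"
  shows "\<exists>T\<in>linear_automorphisms D. measure \<beta> E / 2 * measure \<beta> A \<le> measure \<beta> {\<zeta>\<in>A. T *v \<zeta> \<in> E}"
proof (cases "measure \<beta> A = 0 \<or> measure \<beta> E = 0")
  case True
  have "mat 1 \<in> linear_automorphisms D" by (rule scalar_automorphism) simp
  with True show ?thesis by auto
next
  case False
  interpret finite_measure \<beta> by (rule finite_\<beta>)
  define c a where "c = measure \<beta> E" and "a = measure \<beta> A"
  have c: "c > 0" and a: "a > 0" using False by (simp_all add: c_def a_def zero_less_measure_iff)
  have Ene: "E \<noteq> {}" using c by (auto simp: c_def)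
  have Em: "E \<in> sets \<beta>"
    unfolding sets_\<beta> sets_restrict_space using E by (intro image_eqI[of _ _ E]) auto
  have AbD: "A \<subseteq> bD" using sets.sets_into_space[OF A] by (simp add: space_\<beta>)
  define \<phi> where "\<phi> = (\<lambda>(n::nat) \<zeta>. max 0 (1 - real n * infdist \<zeta> E))"
  have c\<phi>: "continuous_on bD (\<phi> n)" for n unfolding \<phi>_def by (intro continuous_intros)
  have \<phi>01: "0 \<le> \<phi> n \<zeta>" "\<phi> n \<zeta> \<le> 1" for n \<zeta> by (auto simp: \<phi>_def infdist_nonneg)
  have \<phi>E: "indicator E \<zeta> \<le> \<phi> n \<zeta>" for n \<zeta> by (auto simp: \<phi>_def indicator_def)
  have "(\<lambda>n. LINT \<zeta>|\<beta>. \<phi> n \<zeta>) \<longlonglongrightarrow> (LINT \<zeta>|\<beta>. indicator E \<zeta>)"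
  proof (rule integral_dominated_convergence[where w="\<lambda>_. 1"])
    show "AE \<zeta> in \<beta>. (\<lambda>n. \<phi> n \<zeta>) \<longlonglongrightarrow> indicator E \<zeta>"
    proof (rule AE_I2)
      fix \<zeta>
      show "(\<lambda>n. \<phi> n \<zeta>) \<longlonglongrightarrow> indicator E \<zeta>"
      proof (cases "\<zeta> \<in> E")
        case True
        then show ?thesis by (simp add: \<phi>_def)
      next
        case False
        then have "infdist \<zeta> E > 0"
          using in_closed_iff_infdist_zero[OF E(1) Ene, of \<zeta>] infdist_nonneg[of \<zeta> E] by auto
        then have "eventually (\<lambda>n. real n * infdist \<zeta> E \<ge> 1) sequentially" by real_asymp
        then have "eventually (\<lambda>n. \<phi> n \<zeta> = indicator E \<zeta>) sequentially"
          by eventually_elim (use False in \<open>simp add: \<phi>_def\<close>)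
        then show ?thesis by (rule tendsto_eventually)
      qed
    qed
  qed (use c\<phi> \<phi>01 Em in \<open>auto intro!: continuous_\<beta>_measurable\<close>)
  then have lim: "(\<lambda>n. LINT \<zeta>|\<beta>. \<phi> n \<zeta>) \<longlonglongrightarrow> c" using Em by (simp add: c_def)
  have "c * a / 4 > 0" using c a by simp
  from LIMSEQ_D[OF lim this] obtain n where n: "norm ((LINT \<zeta>|\<beta>. \<phi> n \<zeta>) - c) < c * a / 4" by blast
  let ?\<phi> = "\<phi> n"
  have i\<phi>: "integrable \<beta> ?\<phi>" by (rule continuous_\<beta>_integrable[OF c\<phi>])
  have iE: "integrable \<beta> (indicator E :: _ \<Rightarrow> real)"
    by (rule indicator_\<beta>_integrable[OF Em])
  have ge: "c \<le> (LINT \<zeta>|\<beta>. ?\<phi> \<zeta>)"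
    using integral_mono[OF iE i\<phi> \<phi>E] Em by (simp add: c_def)
  obtain Ts where Ts: "Ts \<noteq> []" "set Ts \<subseteq> linear_automorphisms D"
    "\<And>\<zeta>. \<zeta> \<in> bD \<Longrightarrow> (LINT \<zeta>|\<beta>. ?\<phi> \<zeta>) - c / 4 \<le> translate_average ?\<phi> Ts \<zeta>"
    using translate_average_ge_mean[OF c\<phi>[of n], of "c / 4"] c by (metis divide_pos_pos zero_less_numeral)
  have Ts_pos: "real (length Ts) > 0" using Ts(1) by simp
  have TsK: "\<And>T. T \<in> set Ts \<Longrightarrow> T \<in> linear_automorphisms D" using Ts(2) by blast
  have c\<phi>T: "continuous_on bD (\<lambda>\<zeta>. ?\<phi> (T *v \<zeta>))" if "T \<in> linear_automorphisms D" for T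
    by (rule continuous_on_compose2[OF c\<phi>]) (use automorphism_bD[OF that] in \<open>auto intro!: continuous_intros\<close>)
  have iT: "integrable \<beta> (\<lambda>\<zeta>. indicator A \<zeta> * ?\<phi> (T *v \<zeta>))" if "T \<in> linear_automorphisms D" for T
    using integrable_mult_indicator[OF A continuous_\<beta>_integrable[OF c\<phi>T[OF that]]] by simp
  have sum: "integrable \<beta> (\<lambda>\<zeta>. \<Sum>T\<leftarrow>Bs. indicator A \<zeta> * ?\<phi> (T *v \<zeta>)) \<and>
      (LINT \<zeta>|\<beta>. (\<Sum>T\<leftarrow>Bs. indicator A \<zeta> * ?\<phi> (T *v \<zeta>))) = (\<Sum>T\<leftarrow>Bs. LINT \<zeta>|\<beta>. indicator A \<zeta> * ?\<phi> (T *v \<zeta>))"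
    if "set Bs \<subseteq> linear_automorphisms D" for Bs
    using that
  proof (induction Bs)
    case (Cons T Bs)
    then show ?case using iT[of T] by simp
  qed simp
  have iA: "integrable \<beta> (indicator A :: _ \<Rightarrow> real)"
    by (rule indicator_\<beta>_integrable[OF A])
  have "real (length Ts) * ((c - c / 4) * a) = (LINT \<zeta>|\<beta>. real (length Ts) * ((c - c / 4) * indicator A \<zeta>))"
    using A by (simp add: a_def)
  also have "\<dots> \<le> (LINT \<zeta>|\<beta>. (\<Sum>T\<leftarrow>Ts. indicator A \<zeta> * ?\<phi> (T *v \<zeta>)))"
  proof (rule integral_mono)
    show "integrable \<beta> (\<lambda>\<zeta>. real (length Ts) * ((c - c / 4) * indicator A \<zeta>))"
      by (intro integrable_mult_right iA)
    show "integrable \<beta> (\<lambda>\<zeta>. \<Sum>T\<leftarrow>Ts. indicator A \<zeta> * ?\<phi> (T *v \<zeta>))" using sum[OF Ts(2)] by blast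
    fix \<zeta> assume "\<zeta> \<in> space \<beta>"
    then have "c - c / 4 \<le> translate_average ?\<phi> Ts \<zeta>" using Ts(3)[of \<zeta>] ge by (simp add: space_\<beta>)
    then have "real (length Ts) * (c - c / 4) \<le> (\<Sum>T\<leftarrow>Ts. ?\<phi> (T *v \<zeta>))"
      using Ts_pos by (simp add: translate_average_def field_simps)
    then show "real (length Ts) * ((c - c / 4) * indicator A \<zeta>) \<le> (\<Sum>T\<leftarrow>Ts. indicator A \<zeta> * ?\<phi> (T *v \<zeta>))"
      by (simp add: indicator_def)
  qed
  also have "\<dots> = (\<Sum>T\<leftarrow>Ts. LINT \<zeta>|\<beta>. indicator A \<zeta> * ?\<phi> (T *v \<zeta>))" using sum[OF Ts(2)] by blast
  finally have total: "real (length Ts) * ((c - c / 4) * a) \<le> (\<Sum>T\<leftarrow>Ts. LINT \<zeta>|\<beta>. indicator A \<zeta> * ?\<phi> (T *v \<zeta>))" .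
  have "\<exists>T\<in>set Ts. (c - c / 4) * a \<le> (LINT \<zeta>|\<beta>. indicator A \<zeta> * ?\<phi> (T *v \<zeta>))"
  proof (rule ccontr)
    assume "\<not> ?thesis"
    then have less: "\<And>T. T \<in> set Ts \<Longrightarrow> (LINT \<zeta>|\<beta>. indicator A \<zeta> * ?\<phi> (T *v \<zeta>)) < (c - c / 4) * a" by force
    have "(\<Sum>T\<leftarrow>Ts. LINT \<zeta>|\<beta>. indicator A \<zeta> * ?\<phi> (T *v \<zeta>)) < (\<Sum>T\<leftarrow>Ts. (c - c / 4) * a)"
      using Ts(1) less by (intro sum_list_strict_mono) auto
    then show False using total by (simp add: sum_list_triv)
  qed
  then obtain T where T: "T \<in> linear_automorphisms D"
    "(c - c / 4) * a \<le> (LINT \<zeta>|\<beta>. indicator A \<zeta> * ?\<phi> (T *v \<zeta>))"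
    using TsK by blast
  have TE: "{\<zeta>\<in>A. T *v \<zeta> \<in> E} \<in> sets \<beta>"
  proof -
    have "{\<zeta>\<in>A. T *v \<zeta> \<in> E} = ((\<lambda>\<zeta>. T *v \<zeta>) -` E \<inter> space \<beta>) \<inter> A" using AbD by (auto simp: space_\<beta>)
    then show ?thesis using measurable_sets[OF automorphism_measurable[OF T(1)] Em] A by simp
  qed
  have iEm: "(\<lambda>\<zeta>. indicator E \<zeta> :: real) \<in> borel_measurable \<beta>" using Em by simp
  have \<phi>m: "?\<phi> \<in> borel_measurable \<beta>" by (rule continuous_\<beta>_measurable[OF c\<phi>])
  have diffm: "(\<lambda>\<zeta>. ?\<phi> \<zeta> - indicator E \<zeta>) \<in> borel_measurable \<beta>" using iEm \<phi>m by simp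
  have iTE: "integrable \<beta> (\<lambda>\<zeta>. ?\<phi> (T *v \<zeta>) - indicator E (T *v \<zeta>))"
  proof (rule bounded_\<beta>_integrable[where B=1])
    show "(\<lambda>\<zeta>. ?\<phi> (T *v \<zeta>) - indicator E (T *v \<zeta>)) \<in> borel_measurable \<beta>"
      by (rule measurable_compose[OF automorphism_measurable[OF T(1)] diffm])
    show "norm (?\<phi> (T *v \<zeta>) - indicator E (T *v \<zeta>)) \<le> 1" for \<zeta>
      using \<phi>01[of n "T *v \<zeta>"] by (auto simp: indicator_def abs_le_iff)
  qed
  \<comment> \<open>The error of passing from \<open>?\<phi>\<close> back to the indicator of
    \<open>E\<close> is integrated over all of \<open>bD\<close>, where by invariance it does not
    depend on \<open>T\<close>.\<close>
  have "(LINT \<zeta>|\<beta>. indicator A \<zeta> * ?\<phi> (T *v \<zeta>))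
      \<le> (LINT \<zeta>|\<beta>. indicator {\<zeta>\<in>A. T *v \<zeta> \<in> E} \<zeta> + (?\<phi> (T *v \<zeta>) - indicator E (T *v \<zeta>)))"
  proof (rule integral_mono[OF iT[OF T(1)]])
    show "integrable \<beta> (\<lambda>\<zeta>. indicator {\<zeta>\<in>A. T *v \<zeta> \<in> E} \<zeta> + (?\<phi> (T *v \<zeta>) - indicator E (T *v \<zeta>)))"
      by (rule Bochner_Integration.integrable_add[OF indicator_\<beta>_integrable[OF TE] iTE])
    show "indicator A \<zeta> * ?\<phi> (T *v \<zeta>) \<le> indicator {\<zeta>\<in>A. T *v \<zeta> \<in> E} \<zeta> + (?\<phi> (T *v \<zeta>) - indicator E (T *v \<zeta>))" for \<zeta>
      using \<phi>01[of n "T *v \<zeta>"] \<phi>E[of "T *v \<zeta>" n] by (auto simp: indicator_def)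
  qed
  also have "\<dots> = measure \<beta> {\<zeta>\<in>A. T *v \<zeta> \<in> E} + (LINT \<zeta>|\<beta>. ?\<phi> (T *v \<zeta>) - indicator E (T *v \<zeta>))"
    using TE by (subst Bochner_Integration.integral_add[OF indicator_\<beta>_integrable[OF TE] iTE]) simp
  also have "(LINT \<zeta>|\<beta>. ?\<phi> (T *v \<zeta>) - indicator E (T *v \<zeta>)) = (LINT \<zeta>|\<beta>. ?\<phi> \<zeta> - indicator E \<zeta>)"
    by (rule \<beta>_invariant[OF T(1) diffm])
  also have "\<dots> = (LINT \<zeta>|\<beta>. ?\<phi> \<zeta>) - c" using i\<phi> iE Em by (simp add: c_def)
  finally have "(c - c / 4) * a \<le> measure \<beta> {\<zeta>\<in>A. T *v \<zeta> \<in> E} + ((LINT \<zeta>|\<beta>. ?\<phi> \<zeta>) - c)"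
    using T(2) by linarith
  moreover have "(LINT \<zeta>|\<beta>. ?\<phi> \<zeta>) - c < c * a / 4" using n unfolding real_norm_def by linarith
  ultimately have "c / 2 * a \<le> measure \<beta> {\<zeta>\<in>A. T *v \<zeta> \<in> E}" by (simp add: algebra_simps)
  then show ?thesis using T(1) by (auto simp: c_def a_def)
qed

section \<open>Products of translates\<close>

definition bD_zeros :: "(complex^'n \<Rightarrow> complex) \<Rightarrow> (complex^'n) set" where
  "bD_zeros p = {\<zeta>\<in>bD. p \<zeta> = 0}"

lemma closed_bD_zeros: "continuous_on bD p \<Longrightarrow> closed (bD_zeros p)"
  unfolding bD_zeros_def using continuous_closed_preimage[OF _ closed_bD closed_singleton, of p 0]
  by (simp add: vimage_def Int_def conj_commute)

text \<open>Each new translate is chosen to vanish on at least the proportion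
  \<open>measure \<beta> (bD_zeros p) / 2\<close> of the set where no earlier one vanishes, so this
  set shrinks geometrically.\<close>

lemma iterated_translates:
  assumes p: "continuous_on bD p"
  shows "\<exists>Ts. length Ts = N \<and> set Ts \<subseteq> linear_automorphisms D \<and>
    {\<zeta>\<in>bD. \<forall>T\<in>set Ts. p (T *v \<zeta>) \<noteq> 0} \<in> sets \<beta> \<and>
    measure \<beta> {\<zeta>\<in>bD. \<forall>T\<in>set Ts. p (T *v \<zeta>) \<noteq> 0} \<le> (1 - measure \<beta> (bD_zeros p) / 2) ^ N"
proof (induction N)
  case 0
  have "{\<zeta>\<in>bD. \<forall>T\<in>set []. p (T *v \<zeta>) \<noteq> 0} = space \<beta>" by (simp add: space_\<beta>)
  then show ?case
    by (intro exI[of _ "[]"]) (simp add: measure_\<beta> space_\<beta>[symmetric], simp add: space_\<beta> measure_\<beta>)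
next
  case (Suc N)
  interpret finite_measure \<beta> by (rule finite_\<beta>)
  let ?c = "measure \<beta> (bD_zeros p)"
  obtain Ts where Ts: "length Ts = N" "set Ts \<subseteq> linear_automorphisms D"
    "{\<zeta>\<in>bD. \<forall>T\<in>set Ts. p (T *v \<zeta>) \<noteq> 0} \<in> sets \<beta>"
    "measure \<beta> {\<zeta>\<in>bD. \<forall>T\<in>set Ts. p (T *v \<zeta>) \<noteq> 0} \<le> (1 - ?c / 2) ^ N"
    using Suc by blast
  define A where "A = {\<zeta>\<in>bD. \<forall>T\<in>set Ts. p (T *v \<zeta>) \<noteq> 0}"
  obtain T where T: "T \<in> linear_automorphisms D"
    "?c / 2 * measure \<beta> A \<le> measure \<beta> {\<zeta>\<in>A. T *v \<zeta> \<in> bD_zeros p}"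
    using closed_subset_translate[OF closed_bD_zeros[OF p], of A] Ts(3) unfolding A_def bD_zeros_def by blast
  have Zm: "bD_zeros p \<in> sets \<beta>"
    unfolding sets_\<beta> sets_restrict_space using closed_bD_zeros[OF p]
    by (intro image_eqI[of _ _ "bD_zeros p"]) (auto simp: bD_zeros_def)
  have Bm: "{\<zeta>\<in>A. T *v \<zeta> \<in> bD_zeros p} \<in> sets \<beta>"
  proof -
    have "{\<zeta>\<in>A. T *v \<zeta> \<in> bD_zeros p} = ((\<lambda>\<zeta>. T *v \<zeta>) -` bD_zeros p \<inter> space \<beta>) \<inter> A"
      by (auto simp: space_\<beta> A_def)
    then show ?thesis using measurable_sets[OF automorphism_measurable[OF T(1)] Zm] Ts(3) A_def by simp
  qed
  have eq: "{\<zeta>\<in>bD. \<forall>T'\<in>set (T # Ts). p (T' *v \<zeta>) \<noteq> 0} = A - {\<zeta>\<in>A. T *v \<zeta> \<in> bD_zeros p}"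
    using automorphism_bD[OF T(1)] by (auto simp: A_def bD_zeros_def)
  have "measure \<beta> (A - {\<zeta>\<in>A. T *v \<zeta> \<in> bD_zeros p}) = measure \<beta> A - measure \<beta> {\<zeta>\<in>A. T *v \<zeta> \<in> bD_zeros p}"
    by (rule finite_measure_Diff) (use Ts(3) Bm A_def in auto)
  also have "\<dots> \<le> (1 - ?c / 2) * measure \<beta> A" using T(2) by (simp add: algebra_simps)
  also have "\<dots> \<le> (1 - ?c / 2) * (1 - ?c / 2) ^ N"
  proof (rule mult_left_mono)
    show "measure \<beta> A \<le> (1 - ?c / 2) ^ N" using Ts(4) A_def by simp
    have "?c \<le> measure \<beta> (space \<beta>)" by (rule bounded_measure)
    then show "0 \<le> 1 - ?c / 2" by (simp add: space_\<beta> measure_\<beta>)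
  qed
  finally show ?case
    using Ts(1-3) T(1) Bm A_def by (intro exI[of _ "T # Ts"]) (simp only: eq, simp)
qed

text \<open>\<open>G\<close> vanishes near a point where \<open>F\<close> does not; the complex line
  from there to \<open>z\<close> meets the convex domain in a connected open set, where the identity
  theorem applies.\<close>

lemma ball_algebra_mult_zero:
  assumes F: "ball_algebra F" and G: "ball_algebra G" and zero: "\<And>z. z \<in> D \<Longrightarrow> F z * G z = 0"
    and z1: "z1 \<in> D" "F z1 \<noteq> 0" and z: "z \<in> D"
  shows "G z = 0"
proof -
  have "continuous_on D F" using F closure_subset continuous_on_subset unfolding ball_algebra_def by blast
  then have "isCont F z1" using z1(1) open_D continuous_on_eq_continuous_at by blast
  then obtain e0 where e0: "e0 > 0" "\<And>y. dist z1 y < e0 \<Longrightarrow> F y \<noteq> 0"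
    using continuous_at_avoid[of z1 F 0] z1(2) by blast
  obtain e1 where e1: "e1 > 0" "ball z1 e1 \<subseteq> D" using open_D z1(1) open_contains_ball by blast
  define S where "S = {w. z1 + w *s (z - z1) \<in> D}"
  have contl: "continuous_on T (\<lambda>w. z1 + w *s (z - z1))" for T
    by (intro continuous_intros bounded_linear.continuous_on[OF bounded_linear_scale_left])
  have openS: "open S"
    using continuous_open_preimage[OF contl[of UNIV] open_UNIV open_D] by (simp add: S_def vimage_def)
  have "convex S"
  proof (rule convexI)
    fix x y u v assume xy: "x \<in> S" "y \<in> S" and uv: "0 \<le> (u::real)" "0 \<le> v" "u + v = 1"
    have "z1 + (u *\<^sub>R x + v *\<^sub>R y) *s (z - z1) = u *\<^sub>R (z1 + x *s (z - z1)) + v *\<^sub>R (z1 + y *s (z - z1))"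
    proof -
      have "z1 = u *\<^sub>R z1 + v *\<^sub>R z1" using uv by (simp add: scaleR_left_distrib[symmetric])
      moreover have "(u *\<^sub>R x + v *\<^sub>R y) *s (z - z1) = u *\<^sub>R (x *s (z - z1)) + v *\<^sub>R (y *s (z - z1))"
        by (simp add: vec_eq_iff algebra_simps)
      ultimately show ?thesis by (simp add: scaleR_right_distrib)
    qed
    then show "u *\<^sub>R x + v *\<^sub>R y \<in> S"
      using convexD[OF convex_D] xy uv unfolding S_def by simp
  qed
  have 0: "((\<lambda>w. z1 + w *s (z - z1)) \<longlongrightarrow> z1 + 0 *s (z - z1)) (at 0)"
    using contl[of UNIV] unfolding continuous_on_def by (drule_tac bspec[where x=0]) auto
  have "eventually (\<lambda>w. dist (z1 + w *s (z - z1)) (z1 + 0 *s (z - z1)) < min e0 e1) (at 0)"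
    using tendstoD[OF 0, of "min e0 e1"] e0(1) e1(1) by simp
  then obtain d where d: "d > 0" "\<And>w. w \<noteq> 0 \<Longrightarrow> dist w 0 < d \<Longrightarrow> dist (z1 + w *s (z - z1)) z1 < min e0 e1"
    unfolding eventually_at by auto
  have near: "G (z1 + w *s (z - z1)) = 0" if "w \<in> ball 0 d" for w
  proof -
    have "dist z1 (z1 + w *s (z - z1)) < min e0 e1"
      using d(2)[of w] that e0(1) e1(1) by (cases "w = 0") (auto simp: dist_commute)
    then have "F (z1 + w *s (z - z1)) \<noteq> 0" "z1 + w *s (z - z1) \<in> D" using e0(2) e1(2) by auto
    then show ?thesis using zero by (metis mult_eq_0_iff)
  qed
  have sub: "ball 0 d \<subseteq> S"
  proof
    fix w assume w: "w \<in> ball (0::complex) d"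
    have "dist z1 (z1 + w *s (z - z1)) < min e0 e1"
      using d(2)[of w] w e0(1) e1(1) by (cases "w = 0") (auto simp: dist_commute)
    then show "w \<in> S" using e1(2) by (auto simp: S_def)
  qed
  have "G (z1 + 1 *s (z - z1)) = 0"
    by (rule analytic_continuation_open[OF open_ball openS _ convex_connected[OF \<open>convex S\<close>] sub,
          of "\<lambda>w. G (z1 + w *s (z - z1))" "\<lambda>_. 0" 1])
      (use d(1) near G z mholomorphic_on_line[of G D z1 "z - z1"] in \<open>auto simp: S_def ball_algebra_def\<close>)
  then show ?thesis by simp
qed

text \<open>The product q of N translates is compared with itself. Let S be the maximum of |q|^2 on
  \<open>bD\<close>. At r times a maximum point homogeneity preserves the fraction r^(2kN) of S, but
  the point evaluation bound allows at most \<kappa> S \<gamma>^N. For large N only S = 0 is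
  possible; then q, hence one of its factors, hence \<open>p\<close> vanishes on
  \<open>D\<close>.\<close>

lemma homogeneous_zero_set:
  assumes p: "ball_algebra p" and hom: "\<And>w z. cmod w \<le> 1 \<Longrightarrow> z \<in> closure D \<Longrightarrow> p (w *s z) = w ^ k * p z"
    and nz: "\<zeta>0 \<in> bD" "p \<zeta>0 \<noteq> 0"
  shows "measure \<beta> (bD_zeros p) = 0"
proof (rule ccontr)
  assume ne: "measure \<beta> (bD_zeros p) \<noteq> 0"
  interpret finite_measure \<beta> by (rule finite_\<beta>)
  define \<gamma> where "\<gamma> = 1 - measure \<beta> (bD_zeros p) / 2"
  have "measure \<beta> (bD_zeros p) \<le> measure \<beta> (space \<beta>)" by (rule bounded_measure)
  then have \<gamma>: "0 < \<gamma>" "\<gamma> < 1" using ne by (simp_all add: \<gamma>_def space_\<beta> measure_\<beta> zero_less_measure_iff)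
  have "((\<lambda>r::real. r ^ (2 * k)) \<longlongrightarrow> 1 ^ (2 * k)) (at_left 1)" by (intro tendsto_intros)
  then have "eventually (\<lambda>r::real. \<gamma> < r ^ (2 * k)) (at_left 1)"
    using \<gamma>(2) by (intro order_tendstoD(1)) auto
  moreover have "eventually (\<lambda>r::real. 0 < r \<and> r < 1) (at_left 1)"
    by (rule eventually_at_leftI[of 0]) auto
  ultimately have "eventually (\<lambda>r::real. \<gamma> < r ^ (2 * k) \<and> 0 < r \<and> r < 1) (at_left 1)"
    by (rule eventually_conj)
  then obtain r :: real where r: "\<gamma> < r ^ (2 * k)" "0 < r" "r < 1"
    using eventually_happens'[of "at_left (1::real)"] trivial_limit_at_left_real[of "1::real"] by blast
  \<comment> \<open>\<open>\<kappa>\<close> has to be fixed before N, whereas the maximum point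
    depends on N; \<open>kernel_diag_bD\<close> makes the choice of the boundary point
    immaterial.\<close>
  define \<kappa> where "\<kappa> = kernel_diag (of_real r *s \<zeta>0)"
  define \<theta> where "\<theta> = \<gamma> / r ^ (2 * k)"
  have \<theta>: "0 \<le> \<theta>" "\<theta> < 1" using \<gamma> r by (simp_all add: \<theta>_def)
  have "(\<lambda>N. \<kappa> * \<theta> ^ N) \<longlonglongrightarrow> \<kappa> * 0"
    using \<theta> by (intro tendsto_intros LIMSEQ_realpow_zero)
  from LIMSEQ_D[OF this, of 1] obtain N where N: "\<bar>\<kappa> * \<theta> ^ N\<bar> < 1" by auto
  have cp: "continuous_on bD p" by (rule ball_algebra_bD[OF p])
  obtain Ts where Ts: "length Ts = N" "set Ts \<subseteq> linear_automorphisms D"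
    "{\<zeta>\<in>bD. \<forall>T\<in>set Ts. p (T *v \<zeta>) \<noteq> 0} \<in> sets \<beta>"
    "measure \<beta> {\<zeta>\<in>bD. \<forall>T\<in>set Ts. p (T *v \<zeta>) \<noteq> 0} \<le> \<gamma> ^ N"
    using iterated_translates[OF cp, of N] unfolding \<gamma>_def by blast
  define A where "A = {\<zeta>\<in>bD. \<forall>T\<in>set Ts. p (T *v \<zeta>) \<noteq> 0}"
  define prod where "prod = (\<lambda>(Ts :: (complex^'n^'n) list) z. \<Prod>T\<leftarrow>Ts. p (T *v z))"
  have prod_alg: "ball_algebra (prod Bs)" if "set Bs \<subseteq> linear_automorphisms D" for Bs
    using that
  proof (induction Bs)
    case Nil
    then show ?case using ball_algebra_const[of 1] by (simp add: prod_def)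
  next
    case (Cons T Bs)
    then have "ball_algebra (\<lambda>z. p (T *v z) * prod Bs z)"
      by (intro ball_algebra_mult ball_algebra_compose[OF p]) auto
    then show ?case by (simp add: prod_def)
  qed
  let ?q = "prod Ts"
  have q: "ball_algebra ?q" by (rule prod_alg[OF Ts(2)])
  have q_hom: "?q (of_real r *s \<zeta>) = (of_real r ^ k) ^ N * ?q \<zeta>" if \<zeta>: "\<zeta> \<in> bD" for \<zeta>
  proof -
    have "prod Bs (of_real r *s \<zeta>) = (of_real r ^ k) ^ length Bs * prod Bs \<zeta>"
      if "set Bs \<subseteq> linear_automorphisms D" for Bs
      using that
    proof (induction Bs)
      case (Cons T Bs)
      have "T *v \<zeta> \<in> closure D" using Cons.prems automorphism_bD[OF _ \<zeta>] bD_closure by auto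
      then have "p (T *v (of_real r *s \<zeta>)) = of_real r ^ k * p (T *v \<zeta>)"
        unfolding matrix_vector_scale using r by (intro hom) auto
      then show ?case using Cons by (simp add: prod_def)
    qed (simp add: prod_def)
    from this[OF Ts(2)] show ?thesis using Ts(1) by simp
  qed
  have cq: "continuous_on bD (\<lambda>\<zeta>. cmod (?q \<zeta>))"
    using ball_algebra_bD[OF q] by (intro continuous_intros)
  obtain \<zeta>1 where \<zeta>1: "\<zeta>1 \<in> bD" "\<And>\<zeta>. \<zeta> \<in> bD \<Longrightarrow> cmod (?q \<zeta>) \<le> cmod (?q \<zeta>1)"
    using continuous_attains_sup[OF compact_bD bD_nonempty cq] by blast
  define S where "S = (cmod (?q \<zeta>1))\<^sup>2"
  have S0: "0 \<le> S" by (simp add: S_def)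
  have q0: "?q \<zeta> = 0" if "\<zeta> \<in> bD" "\<zeta> \<notin> A" for \<zeta>
    using that by (auto simp: A_def prod_def prod_list_zero_iff)
  have "(LINT \<zeta>|\<beta>. (cmod (?q \<zeta>))\<^sup>2) \<le> (LINT \<zeta>|\<beta>. S * indicator A \<zeta>)"
  proof (rule integral_mono)
    show "integrable \<beta> (\<lambda>\<zeta>. (cmod (?q \<zeta>))\<^sup>2)"
      by (intro continuous_\<beta>_integrable continuous_intros ball_algebra_bD[OF q])
    have "integrable \<beta> (indicator A :: _ \<Rightarrow> real)"
      by (rule indicator_\<beta>_integrable) (use Ts(3) in \<open>simp add: A_def\<close>)
    then show "integrable \<beta> (\<lambda>\<zeta>. S * indicator A \<zeta>)" by simp
    fix \<zeta> assume "\<zeta> \<in> space \<beta>"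
    then show "(cmod (?q \<zeta>))\<^sup>2 \<le> S * indicator A \<zeta>"
      using \<zeta>1(2)[of \<zeta>] q0[of \<zeta>] by (cases "\<zeta> \<in> A") (simp_all add: space_\<beta> S_def power_mono)
  qed
  also have "\<dots> = S * measure \<beta> A" using Ts(3) by (simp add: A_def)
  also have "\<dots> \<le> S * \<gamma> ^ N" using Ts(4) S0 by (intro mult_left_mono) (simp_all add: A_def)
  finally have int_le: "(LINT \<zeta>|\<beta>. (cmod (?q \<zeta>))\<^sup>2) \<le> S * \<gamma> ^ N" .
  have rD: "of_real r *s \<zeta>1 \<in> D" by (rule scale_bD[OF _ \<zeta>1(1)]) (use r in simp)
  have \<kappa>1: "\<kappa> = kernel_diag (of_real r *s \<zeta>1)"
    unfolding \<kappa>_def by (rule kernel_diag_bD[OF nz(1) \<zeta>1(1)]) (use r in simp)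
  have "(cmod (?q (of_real r *s \<zeta>1)))\<^sup>2 = (r ^ (2 * k)) ^ N * S"
    unfolding q_hom[OF \<zeta>1(1)] S_def using r(2)
    by (simp add: norm_mult norm_power power_mult_distrib power_mult[symmetric] mult_ac)
  moreover have "(cmod (?q (of_real r *s \<zeta>1)))\<^sup>2 \<le> \<kappa> * (LINT \<zeta>|\<beta>. (cmod (?q \<zeta>))\<^sup>2)"
    unfolding \<kappa>1 by (rule hardy_point_evaluation[OF q rD])
  moreover have "\<kappa> * (LINT \<zeta>|\<beta>. (cmod (?q \<zeta>))\<^sup>2) \<le> \<kappa> * (S * \<gamma> ^ N)"
    using int_le kernel_diag_ge_1[OF rD] by (intro mult_left_mono) (simp_all add: \<kappa>1)
  ultimately have "(r ^ (2 * k)) ^ N * S \<le> \<kappa> * (S * \<gamma> ^ N)" by linarith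
  also have "\<kappa> * (S * \<gamma> ^ N) = (r ^ (2 * k)) ^ N * (\<kappa> * \<theta> ^ N * S)"
    unfolding \<theta>_def using r(2) by (simp add: power_divide)
  finally have "S \<le> \<kappa> * \<theta> ^ N * S" using r(2) by simp
  then have "(1 - \<kappa> * \<theta> ^ N) * S \<le> 0" by (simp add: algebra_simps)
  moreover have "1 - \<kappa> * \<theta> ^ N > 0" using N by linarith
  ultimately have "S = 0" using S0 by (simp add: mult_le_0_iff)
  then have "(LINT \<zeta>|\<beta>. (cmod (?q \<zeta>))\<^sup>2) \<le> 0" using int_le by simp
  then have "(cmod (?q z))\<^sup>2 \<le> 0" if "z \<in> D" for z
    using hardy_point_evaluation[OF q that] kernel_diag_ge_1[OF that]
    by (meson dual_order.trans mult_nonneg_nonpos order_trans zero_le_one)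
  then have qD: "?q z = 0" if "z \<in> D" for z using that by simp
  \<comment> \<open>By \<open>ball_algebra_mult_zero\<close> there are no zero divisors, so a
    vanishing product has a factor that vanishes identically.\<close>
  have "(\<forall>z\<in>D. prod Bs z = 0) \<Longrightarrow> \<exists>T\<in>set Bs. \<forall>z\<in>D. p (T *v z) = 0" if "set Bs \<subseteq> linear_automorphisms D" for Bs
    using that
  proof (induction Bs)
    case Nil
    then show ?case using zero_in_D by (auto simp: prod_def)
  next
    case (Cons T Bs)
    show ?case
    proof (cases "\<forall>z\<in>D. p (T *v z) = 0")
      case False
      then obtain z1 where z1: "z1 \<in> D" "p (T *v z1) \<noteq> 0" by blast
      have "prod Bs z = 0" if "z \<in> D" for z
        by (rule ball_algebra_mult_zero[OF ball_algebra_compose[OF p, of T] prod_alg[of Bs] _ z1 that])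
          (use Cons.prems in \<open>auto simp: prod_def\<close>)
      then show ?thesis using Cons by auto
    qed auto
  qed
  from this[OF Ts(2)] qD obtain T where T: "T \<in> linear_automorphisms D" "\<And>z. z \<in> D \<Longrightarrow> p (T *v z) = 0"
    using Ts(2) by blast
  obtain B where B: "B \<in> linear_automorphisms D" "\<And>z. T *v (B *v z) = z"
    using automorphism_inverse[OF T(1)] by blast
  have pD: "p z = 0" if "z \<in> D" for z using T(2)[OF automorphism_D[OF B(1) that]] B(2) by simp
  have "p ((1/2) *s \<zeta>0) = (1/2) ^ k * p \<zeta>0"
    by (rule hom) (use nz(1) bD_closure in \<open>auto simp: norm_divide\<close>)
  moreover have "(1/2) *s \<zeta>0 \<in> D" by (rule scale_bD[OF _ nz(1)]) (simp add: norm_divide)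
  ultimately show False using pD nz(2) by simp
qed

end

section \<open>The Poisson kernel of the disc\<close>

abbreviation disc_kernel :: "complex \<Rightarrow> complex \<Rightarrow> complex" where
  "disc_kernel t \<tau> \<equiv> complex_of_real ((1 - (cmod t)\<^sup>2) / (cmod (\<tau> - t))\<^sup>2)"

text \<open>With z = \<open>t * cnj \<tau>\<close> both series are geometric; their sums are 1 / (1
  - z) and cnj z / (1 - cnj z).\<close>

lemma poisson_kernel_series:
  assumes \<tau>: "cmod \<tau> = 1" and t: "cmod t < 1"
  shows "disc_kernel t \<tau>
    = (\<Sum>n. t ^ n * hpow (- int n) \<tau>) + (\<Sum>n. cnj t ^ Suc n * hpow (int (Suc n)) \<tau>)"
proof -
  define z where "z = t * cnj \<tau>"
  have z: "cmod z < 1" using t \<tau> by (simp add: z_def norm_mult)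
  have \<tau>2: "\<tau> * cnj \<tau> = 1" using complex_norm_square[of \<tau>] \<tau> by simp
  have "(\<lambda>n. z ^ n) sums (1 / (1 - z))" by (rule geometric_sums[OF z])
  moreover have "z ^ n = t ^ n * hpow (- int n) \<tau>" for n
    by (simp add: z_def power_mult_distrib hpow_uminus)
  ultimately have 1: "(\<Sum>n. t ^ n * hpow (- int n) \<tau>) = 1 / (1 - z)" by (simp add: sums_iff)
  have "(\<lambda>n. cnj z * cnj z ^ n) sums (cnj z * (1 / (1 - cnj z)))"
    by (intro sums_mult geometric_sums) (simp add: z)
  moreover have "cnj z * cnj z ^ n = cnj t ^ Suc n * hpow (int (Suc n)) \<tau>" for n
    unfolding hpow_of_nat by (simp add: z_def power_mult_distrib)
  ultimately have 2: "(\<Sum>n. cnj t ^ Suc n * hpow (int (Suc n)) \<tau>) = cnj z / (1 - cnj z)"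
    by (simp add: sums_iff)
  have ne: "1 - z \<noteq> 0" "1 - cnj z \<noteq> 0"
    using z complex_mod_cnj[of z] norm_one[where 'a=complex] by (metis eq_iff_diff_eq_0 less_irrefl)+
  have "\<tau> - t = \<tau> * (1 - z)" using \<tau>2 by (simp add: z_def algebra_simps)
  then have "cmod (\<tau> - t) = cmod (1 - z)" using \<tau> by (simp add: norm_mult)
  moreover have "cmod t = cmod z" using \<tau> by (simp add: z_def norm_mult)
  ultimately have "disc_kernel t \<tau>
      = (1 - complex_of_real ((cmod z)\<^sup>2)) / complex_of_real ((cmod (1 - z))\<^sup>2)" by simp
  also have "\<dots> = (1 - z * cnj z) / ((1 - z) * (1 - cnj z))"
    unfolding complex_norm_square by simp
  also have "\<dots> = 1 / (1 - z) + cnj z / (1 - cnj z)"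
    using ne by (simp add: divide_simps) (simp add: algebra_simps)
  finally show ?thesis unfolding 1 2 .
qed

text \<open>Formulated for a unimodular function on an arbitrary finite measure space, since the
  same expansion is used on the circle itself and on \<open>bD\<close> with a coordinate along one
  orbit.\<close>

lemma poisson_kernel_integral:
  assumes N: "finite_measure N" and v: "v \<in> borel_measurable N" "\<And>x. x \<in> space N \<Longrightarrow> cmod (v x) \<le> B"
    and e: "e \<in> borel_measurable N" "\<And>x. x \<in> space N \<Longrightarrow> cmod (e x) = 1" and t: "cmod t < 1"
  shows "(LINT x|N. disc_kernel t (e x) * v x)
    = (\<Sum>n. t ^ n * (LINT x|N. hpow (- int n) (e x) * v x))
    + (\<Sum>n. cnj t ^ Suc n * (LINT x|N. hpow (int (Suc n)) (e x) * v x))"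
proof -
  have c: "summable (\<lambda>n. norm (t ^ n))" "summable (\<lambda>n. norm (cnj t ^ Suc n))"
  proof -
    have g: "summable (\<lambda>n. norm t ^ n)" using t by (intro summable_geometric) simp
    then show "summable (\<lambda>n. norm (t ^ n))" by (simp only: norm_power)
    show "summable (\<lambda>n. norm (cnj t ^ Suc n))"
      using summable_mult[OF g, of "norm t"] by (simp add: norm_mult norm_power)
  qed
  have \<psi>: "(\<lambda>x. hpow k (e x) * v x) \<in> borel_measurable N" for k
    by (intro borel_measurable_times v(1) measurable_compose[OF e(1) hpow_measurable])
  have bd: "cmod (hpow k (e x) * v x) \<le> B" if "x \<in> space N" for k x
    using v(2)[OF that] e(2)[OF that] by (simp add: norm_mult)
  have "(LINT x|N. disc_kernel t (e x) * v x)
      = (LINT x|N. (\<Sum>n. t ^ n * (hpow (- int n) (e x) * v x)) + (\<Sum>n. cnj t ^ Suc n * (hpow (int (Suc n)) (e x) * v x)))"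
  proof (intro LINT_cong)
    fix x assume x: "x \<in> space N"
    have s: "summable (\<lambda>n. t ^ n * hpow (- int n) (e x))" "summable (\<lambda>n. cnj t ^ Suc n * hpow (int (Suc n)) (e x))"
      by (rule summable_norm_cancel, use c in \<open>simp only: norm_mult norm_hpow_unit[OF e(2)[OF x]] mult_1_right\<close>)+
    show "disc_kernel t (e x) * v x
        = (\<Sum>n. t ^ n * (hpow (- int n) (e x) * v x)) + (\<Sum>n. cnj t ^ Suc n * (hpow (int (Suc n)) (e x) * v x))"
      unfolding poisson_kernel_series[OF e(2)[OF x] t] distrib_right mult.assoc[symmetric]
      by (simp only: suminf_mult2[OF s(1), of "v x"] suminf_mult2[OF s(2), of "v x"])
  qed
  also have "\<dots> = (LINT x|N. (\<Sum>n. t ^ n * (hpow (- int n) (e x) * v x)))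
      + (LINT x|N. (\<Sum>n. cnj t ^ Suc n * (hpow (int (Suc n)) (e x) * v x)))"
    by (intro Bochner_Integration.integral_add integral_bounded_suminf(2)[OF N, where B = B] c \<psi> bd)
  also have "(LINT x|N. (\<Sum>n. t ^ n * (hpow (- int n) (e x) * v x)))
      = (\<Sum>n. t ^ n * (LINT x|N. hpow (- int n) (e x) * v x))"
    by (rule integral_bounded_suminf(1)[OF N c(1) \<psi> bd])
  also have "(LINT x|N. (\<Sum>n. cnj t ^ Suc n * (hpow (int (Suc n)) (e x) * v x)))
      = (\<Sum>n. cnj t ^ Suc n * (LINT x|N. hpow (int (Suc n)) (e x) * v x))"
    by (rule integral_bounded_suminf(1)[OF N c(2) \<psi> bd])
  finally show ?thesis .
qed

lemma harmonic_coeffs_Poisson: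
  assumes c: "harmonic_coeffs u R c" and R: "1 < R" and t: "cmod t < 1"
  shows "u t = (LINT \<tau>|circle_haar. u \<tau> * disc_kernel t \<tau>)"
proof -
  have cu: "continuous_on (sphere 0 1) u"
    using c R unfolding harmonic_coeffs_def by (elim conjE continuous_on_subset) auto
  obtain B where B: "\<And>x. x \<in> sphere 0 1 \<Longrightarrow> cmod (u x) \<le> B"
    using compact_imp_bounded[OF compact_continuous_image[OF cu compact_sphere]] unfolding bounded_iff by blast
  have k: "(LINT \<tau>|circle_haar. hpow (- k) \<tau> * u \<tau>) = c k" for k
    using harmonic_coeffs_integral[OF c, of 1 k] R by (simp add: hpow_def mult.commute)
  have "(LINT \<tau>|circle_haar. disc_kernel t \<tau> * u \<tau>)
    = (\<Sum>n. t ^ n * (LINT \<tau>|circle_haar. hpow (- int n) \<tau> * u \<tau>))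
    + (\<Sum>n. cnj t ^ Suc n * (LINT \<tau>|circle_haar. hpow (int (Suc n)) \<tau> * u \<tau>))"
    by (rule poisson_kernel_integral[OF circle.finite_measure_axioms circle_continuous_measurable[OF cu] _ circle_continuous_measurable[OF continuous_on_id] _ t, of B])
      (use B in auto)
  also have "\<dots> = (\<Sum>n. c (int n) * t ^ n) + (\<Sum>n. c (- int (Suc n)) * cnj t ^ Suc n)"
    using k[of "- int (Suc _)"] k by (simp only: minus_minus mult.commute)
  also have "\<dots> = u t" using c R t unfolding harmonic_coeffs_def by simp
  finally show ?thesis by (simp add: mult.commute)
qed

section \<open>Holomorphy of the Fourier components\<close>

text \<open>Osgood's lemma: the Cauchy estimates along lines are uniform in the direction, hence give
  Frechet differentiability once the derivative is additive.\<close>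

lemma mholomorphic_on_if_lines:
  fixes F :: "complex^'n \<Rightarrow> complex"
  assumes D: "open D" and cont: "continuous_on D F"
    and lines: "\<And>a v. a \<in> D \<Longrightarrow> (\<lambda>w. F (a + w *s v)) field_differentiable (at 0)"
  shows "mholomorphic_on F D"
proof -
  have fd: "(\<lambda>w. F (a + w *s v)) field_differentiable (at w0)" if h: "a + w0 *s v \<in> D" for a v w0
  proof -
    obtain d where d: "((\<lambda>w. F ((a + w0 *s v) + w *s v)) has_field_derivative d) (at 0)"
      using lines[OF h, of v] unfolding field_differentiable_def ..
    have "((\<lambda>w. w - w0) has_field_derivative 1) (at w0)" by (auto intro!: derivative_eq_intros)
    from DERIV_chain2[of "\<lambda>w. F ((a + w0 *s v) + w *s v)" d "\<lambda>w. w - w0" w0 1 UNIV] d this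
    have "((\<lambda>w. F ((a + w0 *s v) + (w - w0) *s v)) has_field_derivative d) (at w0)" by simp
    moreover have "(a + w0 *s v) + (w - w0) *s v = a + w *s v" for w
      by (simp add: vec_eq_iff algebra_simps)
    ultimately show ?thesis by (auto simp: field_differentiable_def)
  qed
  define \<delta> where "\<delta> = (\<lambda>a v. deriv (\<lambda>w. F (a + w *s v)) 0)"
  have \<delta>_deriv: "((\<lambda>w. F (a + w *s v)) has_field_derivative \<delta> a v) (at 0)" if "a \<in> D" for a v
    unfolding \<delta>_def using fd[of a 0 v] that by (simp add: DERIV_deriv_iff_field_differentiable)
  have \<delta>_scale: "\<delta> a (c *s v) = c * \<delta> a v" if "a \<in> D" for a c v
  proof -
    have "((\<lambda>w. w * c) has_field_derivative c) (at 0)" by (auto intro!: derivative_eq_intros)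
    from DERIV_chain2[of "\<lambda>w. F (a + w *s v)" "\<delta> a v" "\<lambda>w. w * c" 0 c UNIV] \<delta>_deriv[OF that, of v] this
    have "((\<lambda>w. F (a + (w * c) *s v)) has_field_derivative \<delta> a v * c) (at 0)" by simp
    then have "((\<lambda>w. F (a + w *s (c *s v))) has_field_derivative \<delta> a v * c) (at 0)"
      by (simp add: vector_smult_assoc)
    from DERIV_unique[OF \<delta>_deriv[OF that, of "c *s v"] this] show ?thesis by (simp add: mult.commute)
  qed
  show ?thesis
    unfolding mholomorphic_on_def
  proof
    fix a assume a: "a \<in> D"
    obtain r where r: "r > 0" "cball a (4 * r) \<subseteq> D"
    proof -
      obtain e where "e > 0" "cball a e \<subseteq> D" using D a open_contains_cball by blast
      then show thesis using that[of "e / 4"] by simp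
    qed
    have "compact (F ` cball a (4 * r))"
      by (intro compact_continuous_image continuous_on_subset[OF cont r(2)] compact_cball)
    then obtain M where M: "M > 0" "\<And>z. z \<in> cball a (4 * r) \<Longrightarrow> cmod (F z) < M"
      using compact_imp_bounded bounded_pos_less by (metis imageI)
    \<comment> \<open>The radii are nested: centres b within r of a and steps of norm at most 3 r
      stay in the ball of radius 4 r, where |F| < M. Cauchy's estimate on discs of radius r about
      points of modulus below 2 r then bounds the second derivative by 2 M / r^2, uniformly in b and
      v.\<close>
    have taylor: "cmod (F (b + w *s v) - F b - w * \<delta> b v) \<le> 2 * M / r\<^sup>2 * (cmod w)\<^sup>2"
      if b: "b \<in> cball a r" and v: "norm v \<le> 1" and w: "cmod w \<le> r" for b v w
    proof -
      let ?g = "\<lambda>w. F (b + w *s v)"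
      have inb: "b + w *s v \<in> cball a (4 * r)" if "cmod w \<le> 3 * r" for w
      proof -
        have "norm (w *s v) \<le> 3 * r * 1" unfolding norm_scale_complex by (intro mult_mono that v) (use r in auto)
        then show ?thesis using b norm_triangle_ineq4[of "a - b" "w *s v"] by (simp add: dist_norm algebra_simps)
      qed
      have hol: "?g holomorphic_on ball 0 (3 * r)"
        unfolding holomorphic_on_def
      proof
        fix w0 :: complex assume "w0 \<in> ball 0 (3 * r)"
        then have "cmod w0 \<le> 3 * r" by simp
        then have "b + w0 *s v \<in> D" by (rule subsetD[OF r(2) inb])
        then show "?g field_differentiable (at w0 within ball 0 (3 * r))"
          by (rule field_differentiable_at_within[OF fd])
      qed
      have deriv2: "cmod ((deriv ^^ 2) ?g z) \<le> 2 * M / r\<^sup>2" if z: "z \<in> ball 0 (2 * r)" for z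
      proof -
        have sub: "cball z r \<subseteq> ball 0 (3 * r)"
        proof
          fix x assume "x \<in> cball z r"
          then show "x \<in> ball 0 (3 * r)" using z norm_triangle_ineq[of z "x - z"] by (simp add: dist_norm norm_minus_commute)
        qed
        have h: "?g holomorphic_on cball z r" by (rule holomorphic_on_subset[OF hol sub])
        have "cmod ((deriv ^^ 2) ?g z) \<le> fact 2 * M / r ^ 2"
        proof (rule Cauchy_higher_deriv_bound[of ?g z r 0 M 2])
          show "?g holomorphic_on ball z r" by (rule holomorphic_on_subset[OF h ball_subset_cball])
          show "continuous_on (cball z r) ?g" by (rule holomorphic_on_imp_continuous_on[OF h])
          show "?g x \<in> ball 0 M" if "x \<in> ball z r" for x
          proof -
            have "x \<in> ball 0 (3 * r)" using that sub ball_subset_cball by blast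
            then show ?thesis using M(2)[OF inb[of x]] by simp
          qed
        qed (use r in auto)
        then show ?thesis by (simp add: fact_numeral)
      qed
      have "cmod ((deriv ^^ 0) ?g w - (\<Sum>i\<le>1. (deriv ^^ i) ?g 0 * (w - 0) ^ i / fact i))
          \<le> 2 * M / r\<^sup>2 * cmod (w - 0) ^ Suc 1 / fact 1"
      proof (rule complex_Taylor[of "ball 0 (2 * r)" 1 "\<lambda>i. (deriv ^^ i) ?g"])
        fix i and x :: complex assume x: "x \<in> ball 0 (2 * r)"
        have "(deriv ^^ i) ?g holomorphic_on ball 0 (3 * r)"
          by (rule holomorphic_higher_deriv[OF hol open_ball])
        then have "((deriv ^^ i) ?g has_field_derivative deriv ((deriv ^^ i) ?g) x) (at x)"
          by (rule holomorphic_derivI[OF _ open_ball]) (use x r in auto)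
        then show "((deriv ^^ i) ?g has_field_derivative (deriv ^^ Suc i) ?g x) (at x within ball 0 (2 * r))"
          by (simp add: has_field_derivative_at_within)
      next
        fix x :: complex assume "x \<in> ball 0 (2 * r)"
        then show "cmod ((deriv ^^ Suc 1) ?g x) \<le> 2 * M / r\<^sup>2"
          using deriv2[of x] by (simp add: numeral_2_eq_2)
      qed (use w r in auto)
      then show ?thesis by (simp add: \<delta>_def power2_eq_square mult.commute diff_diff_eq)
    qed
    define K where "K = 2 * M / r\<^sup>2"
    have K0: "K \<ge> 0" using M(1) by (simp add: K_def)
    have fre: "cmod (F (b + v) - F b - \<delta> b v) \<le> K * (norm v)\<^sup>2"
      if b: "b \<in> cball a r" and v: "norm v \<le> r" for b v
    proof (cases "v = 0")
      case True
      have "b \<in> D" using b r by auto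
      then show ?thesis using \<delta>_scale[of b 0 v] True by simp
    next
      case False
      define e where "e = (1 / complex_of_real (norm v)) *s v"
      have e: "norm e \<le> 1" "complex_of_real (norm v) *s e = v"
        using False by (simp_all add: e_def norm_scale_complex norm_divide vector_smult_assoc)
      have "b \<in> D" using b r by auto
      then have "complex_of_real (norm v) * \<delta> b e = \<delta> b v" using \<delta>_scale[of b "of_real (norm v)" e] e(2) by simp
      then show ?thesis using taylor[OF b e(1), of "of_real (norm v)"] v e(2) by (simp add: K_def)
    qed
    \<comment> \<open>The increment along u + v is compared with the one along v followed by the one
      along u from the shifted base point \<open>B w\<close>. This involves \<delta> at
      \<open>B w\<close>, whose continuity in the base point is not yet known; a difference quotient
      of fixed step s reduces it to continuity of \<open>F\<close>. The limit w to 0 is therefore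
      taken before the limit s to 0.\<close>
    have add: "\<delta> a (u + v) = \<delta> a u + \<delta> a v" for u v
    proof -
      define L where "L = 1 + norm u + norm v"
      have L: "L > 0" "norm u \<le> L" "norm v \<le> L" "norm (u + v) \<le> L"
        using norm_triangle_ineq[of u v] norm_ge_zero[of u] norm_ge_zero[of v] unfolding L_def by linarith+
      let ?X = "\<delta> a (u + v) - \<delta> a u - \<delta> a v"
      have small: "norm (complex_of_real s *s x) \<le> r" if "0 < s" "s \<le> r / L" "norm x \<le> L" for s x
      proof -
        have "norm (complex_of_real s *s x) \<le> (r / L) * L"
          unfolding norm_scale_complex using that r(1) L(1) by (intro mult_mono) auto
        then show ?thesis using L(1) by simp
      qed
      have est: "cmod (F (b + of_real s *s x) - F b - of_real s * \<delta> b x) \<le> K * (s * L)\<^sup>2"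
        if "b \<in> cball a r" "0 < s" "s \<le> r / L" "norm x \<le> L" for b s x
      proof -
        have "b \<in> D" using that(1) r by auto
        then have "cmod (F (b + of_real s *s x) - F b - of_real s * \<delta> b x) \<le> K * (norm (complex_of_real s *s x))\<^sup>2"
          using fre[OF that(1) small[OF that(2-4)]] by (simp add: \<delta>_scale)
        also have "\<dots> \<le> K * (s * L)\<^sup>2"
          unfolding norm_scale_complex using that K0 by (intro mult_left_mono power_mono mult_mono) auto
        finally show ?thesis .
      qed
      have bound: "cmod ?X \<le> 2 * K * L\<^sup>2 * s" if s: "0 < s" "s \<le> r / L" for s
      proof -
        define B where "B = (\<lambda>w::real. a + of_real w *s v)"
        define Y where "Y = (\<lambda>w. (F (B w + of_real s *s u) - F (B w)) - (F (a + of_real s *s u) - F a))"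
        have step: "cmod ?X \<le> 3 * K * L\<^sup>2 * w + cmod (Y w) / s + 2 * K * L\<^sup>2 * s"
          if w: "0 < w" "w \<le> r / L" for w
        proof -
          let ?P = "\<delta> a (u + v) - \<delta> (B w) u - \<delta> a v" and ?R = "\<delta> (B w) u - \<delta> a u"
          have Bw: "B w \<in> cball a r" using small[OF w, of v] L by (simp add: B_def dist_norm)
          have e1: "cmod (F (B w + of_real w *s u) - F (B w) - of_real w * \<delta> (B w) u) \<le> K * (w * L)\<^sup>2"
            by (rule est[OF Bw w L(2)])
          have e2: "cmod (F (B w) - F a - of_real w * \<delta> a v) \<le> K * (w * L)\<^sup>2"
            unfolding B_def by (rule est[OF _ w L(3)]) (use r in auto)
          have e3: "cmod (F (a + of_real w *s (u + v)) - F a - of_real w * \<delta> a (u + v)) \<le> K * (w * L)\<^sup>2"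
            by (rule est[OF _ w L(4)]) (use r in auto)
          have e4: "cmod (F (B w + of_real s *s u) - F (B w) - of_real s * \<delta> (B w) u) \<le> K * (s * L)\<^sup>2"
            by (rule est[OF Bw s L(2)])
          have e5: "cmod (F (a + of_real s *s u) - F a - of_real s * \<delta> a u) \<le> K * (s * L)\<^sup>2"
            by (rule est[OF _ s L(2)]) (use r in auto)
          have pt: "B w + of_real w *s u = a + of_real w *s (u + v)"
            by (simp add: B_def vec_eq_iff algebra_simps)
          have "of_real w * ?P =
              (F (B w + of_real w *s u) - F (B w) - of_real w * \<delta> (B w) u)
              + (F (B w) - F a - of_real w * \<delta> a v)
              - (F (a + of_real w *s (u + v)) - F a - of_real w * \<delta> a (u + v))"
            unfolding pt by (simp add: algebra_simps)
          then have "cmod (of_real w * ?P) \<le> K * (w * L)\<^sup>2 + K * (w * L)\<^sup>2 + K * (w * L)\<^sup>2"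
            using e1 e2 e3 norm_triangle_ineq4 norm_triangle_ineq by (smt (verit, best))
          then have "w * cmod ?P \<le> w * (3 * K * L\<^sup>2 * w)"
          proof -
            assume *: "cmod (of_real w * ?P) \<le> K * (w * L)\<^sup>2 + K * (w * L)\<^sup>2 + K * (w * L)\<^sup>2"
            have "cmod (of_real w * ?P) = w * cmod ?P"
              using w(1) unfolding norm_mult by simp
            moreover have "K * (w * L)\<^sup>2 + K * (w * L)\<^sup>2 + K * (w * L)\<^sup>2 = w * (3 * K * L\<^sup>2 * w)"
              by (simp add: power2_eq_square)
            ultimately show ?thesis using * by (simp only:)
          qed
          then have A1: "cmod ?P \<le> 3 * K * L\<^sup>2 * w"
            using w(1) by simp
          have "of_real s * ?R = Y w
              - (F (B w + of_real s *s u) - F (B w) - of_real s * \<delta> (B w) u)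
              + (F (a + of_real s *s u) - F a - of_real s * \<delta> a u)"
            by (simp add: Y_def algebra_simps)
          then have "cmod (of_real s * ?R) \<le> cmod (Y w) + K * (s * L)\<^sup>2 + K * (s * L)\<^sup>2"
            using e4 e5 norm_triangle_ineq4 norm_triangle_ineq by (smt (verit, best))
          then have "s * cmod ?R \<le> s * (cmod (Y w) / s + 2 * K * L\<^sup>2 * s)"
          proof -
            assume *: "cmod (of_real s * ?R) \<le> cmod (Y w) + K * (s * L)\<^sup>2 + K * (s * L)\<^sup>2"
            have "cmod (of_real s * ?R) = s * cmod ?R"
              using s(1) unfolding norm_mult by simp
            moreover have "cmod (Y w) + K * (s * L)\<^sup>2 + K * (s * L)\<^sup>2 = s * (cmod (Y w) / s + 2 * K * L\<^sup>2 * s)"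
              using s(1) by (simp add: power2_eq_square distrib_left)
            ultimately show ?thesis using * by (simp only:)
          qed
          then have A2: "cmod ?R \<le> cmod (Y w) / s + 2 * K * L\<^sup>2 * s"
            using s(1) by (simp only: mult_le_cancel_left_pos)
          have "?X = ?P + ?R" by simp
          then have "cmod ?X \<le> cmod ?P + cmod ?R"
            using norm_triangle_ineq by metis
          then show ?thesis using A1 A2 by linarith
        qed
        have tendF: "((\<lambda>w. F (a + of_real w *s v + x)) \<longlongrightarrow> F (a + x)) (at_right 0)" if x: "a + x \<in> D" for x
        proof -
          have "isCont F (a + x)" using cont D x continuous_on_eq_continuous_at by blast
          moreover have "((\<lambda>w::real. a + w *\<^sub>R v + x) \<longlongrightarrow> a + 0 *\<^sub>R v + x) (at_right 0)" by (intro tendsto_intros)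
          then have "((\<lambda>w::real. a + of_real w *s v + x) \<longlongrightarrow> a + x) (at_right 0)" by (simp add: scaleR_eq_scale)
          ultimately show ?thesis by (rule isCont_tendsto_compose)
        qed
        have "a + of_real s *s u \<in> D"
          using small[OF s L(2)] r by (auto intro!: subsetD[OF r(2)] simp: dist_norm)
        then have "(Y \<longlongrightarrow> (F (a + of_real s *s u) - F a) - (F (a + of_real s *s u) - F a)) (at_right 0)"
          unfolding Y_def B_def using tendF[of "of_real s *s u"] tendF[of 0] a
          by (intro tendsto_intros) simp_all
        then have "((\<lambda>w. 3 * K * L\<^sup>2 * w + cmod (Y w) / s + 2 * K * L\<^sup>2 * s) \<longlongrightarrow> 3 * K * L\<^sup>2 * 0 + cmod 0 / s + 2 * K * L\<^sup>2 * s) (at_right 0)"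
          using s(1) by (intro tendsto_intros) simp_all
        moreover have "eventually (\<lambda>w. cmod ?X \<le> 3 * K * L\<^sup>2 * w + cmod (Y w) / s + 2 * K * L\<^sup>2 * s) (at_right 0)"
          by (rule eventually_at_rightI[of 0 "r / L"]) (use step r L in auto)
        ultimately have "cmod ?X \<le> 3 * K * L\<^sup>2 * 0 + cmod 0 / s + 2 * K * L\<^sup>2 * s"
          by (rule tendsto_lowerbound) simp
        then show ?thesis by simp
      qed
      have "((\<lambda>s. 2 * K * L\<^sup>2 * s) \<longlongrightarrow> 2 * K * L\<^sup>2 * 0) (at_right 0)" by (intro tendsto_intros)
      moreover have "eventually (\<lambda>s. cmod ?X \<le> 2 * K * L\<^sup>2 * s) (at_right 0)"
        by (rule eventually_at_rightI[of 0 "r / L"]) (use bound r L in auto)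
      ultimately have "cmod ?X \<le> 2 * K * L\<^sup>2 * 0" by (rule tendsto_lowerbound) simp
      then show ?thesis by (simp add: algebra_simps)
    qed
    have "linear (\<delta> a)"
      by (rule linearI) (simp_all add: add scaleR_eq_scale \<delta>_scale[OF a] scaleR_conv_of_real[where 'a=complex])
    then have bl: "bounded_linear (\<delta> a)" by (simp add: linear_conv_bounded_linear)
    have "(F has_derivative \<delta> a) (at a)"
      unfolding has_derivative_at
    proof (intro conjI bl)
      show "(\<lambda>v. norm (F (a + v) - F a - \<delta> a v) / norm v) \<midarrow>0\<rightarrow> 0"
      proof (rule Lim_null_comparison)
        show "eventually (\<lambda>v. norm (norm (F (a + v) - F a - \<delta> a v) / norm v) \<le> K * norm v) (at 0)"
        proof (rule eventually_at[THEN iffD2], intro exI[of _ r] conjI ballI impI r(1))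
          fix v :: "complex^'n" assume v: "v \<noteq> 0 \<and> dist v 0 < r"
          have "cmod (F (a + v) - F a - \<delta> a v) \<le> K * (norm v)\<^sup>2"
            by (rule fre) (use v r in auto)
          then show "norm (norm (F (a + v) - F a - \<delta> a v) / norm v) \<le> K * norm v"
            using v by (simp add: divide_simps power2_eq_square mult.assoc)
        qed
        have "((\<lambda>v::complex^'n. K * norm v) \<longlongrightarrow> K * norm (0::complex^'n)) (at 0)" by (intro tendsto_intros)
        then show "((\<lambda>v::complex^'n. K * norm v) \<longlongrightarrow> 0) (at 0)" by simp
      qed
    qed
    then show "\<exists>f'. (F has_derivative f') (at a) \<and> (\<forall>c h. f' (c *s h) = c * f' h)"
      using \<delta>_scale[OF a] by blast
  qed
qed

section \<open>Fourier components on bidiscs\<close>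

context symmetric_domain
begin

lemma line_coeffs:
  assumes ph: "pluriharmonic_on f D" and R: "\<And>t. cmod t < R \<Longrightarrow> a + t *s b \<in> D"
  shows "\<exists>c. harmonic_coeffs (\<lambda>t. f (a + t *s b)) R c"
proof (cases "b = 0")
  case True
  then show ?thesis using harmonic_coeffs_const by auto
next
  case False
  then have "harmonic_on (\<lambda>w. f (a + w *s b)) {w. a + w *s b \<in> D}"
    using ph unfolding pluriharmonic_on_def by blast
  then show ?thesis by (rule harmonic_coeffs_exist) (use R in auto)
qed

text \<open>Some multiple x a with x > 1 still lies in \<open>D\<close>. A point of the bidisc is a
  convex combination of a point of the disc through x a, with weight q = R / x, and of a small
  multiple of \<open>v\<close> near 0.\<close>

lemma exists_bidisc:
  assumes a: "a \<in> D"
  shows "\<exists>e>0. \<exists>R>1. \<forall>s t. cmod s < R \<longrightarrow> cmod t < R \<longrightarrow> s *s a + t *s (of_real e *s v) \<in> D"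
proof -
  have "((\<lambda>x::real. x *\<^sub>R a) \<longlongrightarrow> 1 *\<^sub>R a) (at_right 1)" by (intro tendsto_intros)
  then have "eventually (\<lambda>x::real. x *\<^sub>R a \<in> D) (at_right 1)"
    by (rule topological_tendstoD) (use a open_D in auto)
  moreover have "eventually (\<lambda>x::real. 1 < x) (at_right 1)" by (rule eventually_at_right_less)
  ultimately have "eventually (\<lambda>x::real. x *\<^sub>R a \<in> D \<and> 1 < x) (at_right 1)" by (rule eventually_conj)
  then obtain x :: real where x: "x *\<^sub>R a \<in> D" "1 < x"
    using eventually_happens'[of "at_right (1::real)"] trivial_limit_at_right_real[of "1::real"] by blast
  obtain d where d: "d > 0" "ball 0 d \<subseteq> D" using open_D zero_in_D open_contains_ball by blast
  define R where "R = (1 + x) / 2"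
  define q where "q = R / x"
  have R: "1 < R" "R < x" and q: "0 < q" "q < 1" using x(2) by (simp_all add: R_def q_def)
  \<comment> \<open>Keeps R e |v| / (1 - q) below the radius d of a ball about 0 in
    \<open>D\<close>; the 1 added to the norm covers v = 0.\<close>
  define e where "e = (1 - q) * d / (R * (norm v + 1))"
  have e: "e > 0" using q R d(1) by (simp add: e_def add_nonneg_pos)
  have "s *s a + t *s (of_real e *s v) \<in> D" if s: "cmod s < R" and t: "cmod t < R" for s t
  proof -
    have 1: "(s / of_real R) *s (x *\<^sub>R a) \<in> D"
      by (rule scale_D[OF _ x(1)]) (use s R in \<open>simp add: norm_divide\<close>)
    have "norm ((t * of_real (e / (1 - q))) *s v) < d"
    proof -
      have "0 \<le> e / (1 - q)" using e q by simp
      then have "norm ((t * of_real (e / (1 - q))) *s v) = cmod t * (e / (1 - q)) * norm v"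
        by (simp only: norm_scale_complex norm_mult norm_of_real abs_of_nonneg)
      also have "\<dots> \<le> R * (e / (1 - q)) * norm v"
        using t e q by (intro mult_right_mono) auto
      also have "R * (e / (1 - q)) = d / (norm v + 1)" using q R by (simp add: e_def)
      also have "d / (norm v + 1) * norm v = d * (norm v / (norm v + 1))" by simp
      also have "\<dots> < d * 1" using d(1) by (intro mult_strict_left_mono) (simp_all add: divide_less_eq add_nonneg_pos)
      finally show ?thesis by simp
    qed
    then have 2: "(t * of_real (e / (1 - q))) *s v \<in> D" using d(2) by auto
    have "q *\<^sub>R ((s / of_real R) *s (x *\<^sub>R a)) + (1 - q) *\<^sub>R ((t * of_real (e / (1 - q))) *s v) \<in> D"
      by (rule convexD[OF convex_D 1 2]) (use q in auto)
    moreover have "q *\<^sub>R ((s / of_real R) *s (x *\<^sub>R a)) = s *s a"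
      using x(2) R by (simp add: q_def vec_eq_iff scaleR_conv_of_real[where 'a=complex])
    moreover have "(1 - q) *\<^sub>R ((t * of_real (e / (1 - q))) *s v) = t *s (of_real e *s v)"
      using q by (simp add: vec_eq_iff scaleR_conv_of_real[where 'a=complex])
    ultimately show ?thesis by simp
  qed
  then show ?thesis using e R by blast
qed

text \<open>The torus integral is homogeneous of degree \<open>\<bar>n\<bar> + \<bar>k - n\<bar>\<close> by harmonicity in each variable,
  and of degree \<open>\<bar>k\<bar>\<close> by harmonicity along lines through the origin.\<close>

lemma component_coeff_zero:
  assumes f: "continuous_on D f" and ph: "pluriharmonic_on f D" and R: "1 < R"
    and bidisc: "\<And>s t. cmod s < R \<Longrightarrow> cmod t < R \<Longrightarrow> s *s a + t *s b \<in> D" and n: "n < 0"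
  shows "(LINT \<tau>|circle_haar. circle_component f (int k) (a + \<tau> *s b) * hpow (- n) \<tau>) = 0"
proof -
  \<comment> \<open>The bidegree (j, n) in \<alpha> and \<tau> has total degree j + n = k under
    simultaneous rotation.\<close>
  let ?j = "int k - n"
  let ?A = "\<lambda>(x::real) \<alpha> \<tau>. f ((of_real x * \<alpha>) *s a + (of_real x * \<tau>) *s b)"
  let ?B = "\<lambda>(x::real) \<alpha> \<tau>. f (\<alpha> *s a + (of_real x * \<tau>) *s b)"
  let ?C = "\<lambda>(x::real) \<alpha> \<tau>. f ((of_real x * \<alpha>) *s (a + \<tau> *s b))"
  have Rb: "cmod (of_real x * y) < R" if "0 \<le> x" "x \<le> 1" "cmod y = 1" for x :: real and y :: complex
    using that R by (simp add: norm_mult)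
  define J where "J = (LINT \<tau>|circle_haar. circle_component f (int k) (a + \<tau> *s b) * hpow (- n) \<tau>)"
  define I where "I = (\<lambda>x::real. LINT \<alpha>|circle_haar. LINT \<tau>|circle_haar.
    ?A x \<alpha> \<tau> * hpow (- ?j) \<alpha> * hpow (- n) \<tau>)"
  have shift: "(LINT \<tau>|circle_haar. f (c + (w * \<tau>) *s b') * hpow (- i) \<tau>) = hpow i w * (LINT \<tau>|circle_haar. f (c + \<tau> *s b') * hpow (- i) \<tau>)"
    if h: "\<And>t. cmod t < R \<Longrightarrow> c + t *s b' \<in> D" and w: "cmod w \<le> 1" for c b' w i
  proof -
    obtain cc where cc: "harmonic_coeffs (\<lambda>t. f (c + t *s b')) R cc" using line_coeffs[OF ph h] ..
    show ?thesis
      using harmonic_coeffs_integral[OF cc, of w i] harmonic_coeffs_integral[OF cc, of 1 i] w R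
      by (simp add: hpow_def)
  qed
  have cont: "continuous_on (sphere 0 1 \<times> sphere 0 1)
      (\<lambda>(\<alpha>, \<tau>). ?A x \<alpha> \<tau> * hpow (- i) \<alpha>)" if "0 \<le> x" "x \<le> 1" for x i
    unfolding case_prod_unfold
    by (intro continuous_intros continuous_on_compose2[OF f]) (use Rb[OF that] in \<open>auto intro!: bidisc\<close>)
  have hm: "hpow i \<in> borel_measurable circle_haar" for i
    by (intro circle_continuous_measurable continuous_intros)
  have swap: "(LINT \<alpha>|circle_haar. LINT \<tau>|circle_haar. (?A x \<alpha> \<tau> * hpow (- i) \<alpha>) * hpow (- l) \<tau>)
      = (LINT \<tau>|circle_haar. (LINT \<alpha>|circle_haar. ?A x \<alpha> \<tau> * hpow (- i) \<alpha>) * hpow (- l) \<tau>)"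
    if "0 \<le> x" "x \<le> 1" for x i l
    by (rule Fubini_continuous[where G = 1, OF cont[OF that] compact_sphere compact_sphere _ _ sets_circle_haar
          circle.finite_measure_axioms sets_circle_haar circle.finite_measure_axioms hm]) auto
  \<comment> \<open>The two variables are shrunk by x one at a time, the other one being held fixed
    on its circle; each contributes its own power of x.\<close>
  have I1: "I x = hpow n (of_real x) * hpow ?j (of_real x) * I 1" if x: "0 \<le> x" "x \<le> 1" for x
  proof -
    have "I x = (LINT \<tau>|circle_haar. (LINT \<alpha>|circle_haar. ?A x \<alpha> \<tau> * hpow (- ?j) \<alpha>) * hpow (- n) \<tau>)"
      unfolding I_def by (rule swap[OF x])
    also have "\<dots> = (LINT \<tau>|circle_haar. (hpow ?j (of_real x) * (LINT \<alpha>|circle_haar. ?B x \<alpha> \<tau> * hpow (- ?j) \<alpha>)) * hpow (- n) \<tau>)"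
    proof (intro LINT_cong refl arg_cong2[of _ _ _ _ "(*)"])
      fix \<tau> assume "\<tau> \<in> space circle_haar"
      then have \<tau>: "cmod \<tau> = 1" by simp
      obtain cc where cc: "harmonic_coeffs (\<lambda>t. f ((of_real x * \<tau>) *s b + t *s a)) R cc"
        using line_coeffs[OF ph, of R "(of_real x * \<tau>) *s b" a] bidisc Rb[OF x \<tau>] by (auto simp: add.commute)
      show "(LINT \<alpha>|circle_haar. ?A x \<alpha> \<tau> * hpow (- ?j) \<alpha>)
          = hpow ?j (of_real x) * (LINT \<alpha>|circle_haar. ?B x \<alpha> \<tau> * hpow (- ?j) \<alpha>)"
        using harmonic_coeffs_integral[OF cc, of "of_real x" ?j] harmonic_coeffs_integral[OF cc, of 1 ?j] x R
        by (simp add: hpow_def[of _ 1] add.commute)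
    qed
    also have "\<dots> = hpow ?j (of_real x) * (LINT \<tau>|circle_haar. (LINT \<alpha>|circle_haar. ?B x \<alpha> \<tau> * hpow (- ?j) \<alpha>) * hpow (- n) \<tau>)"
      by (simp only: mult.assoc integral_mult_right_zero)
    also have "(LINT \<tau>|circle_haar. (LINT \<alpha>|circle_haar. ?B x \<alpha> \<tau> * hpow (- ?j) \<alpha>) * hpow (- n) \<tau>)
        = (LINT \<alpha>|circle_haar. LINT \<tau>|circle_haar. (?B x \<alpha> \<tau> * hpow (- ?j) \<alpha>) * hpow (- n) \<tau>)"
    proof (rule Fubini_continuous[where G = 1, symmetric, OF _ compact_sphere compact_sphere _ _ sets_circle_haar
          circle.finite_measure_axioms sets_circle_haar circle.finite_measure_axioms hm])
      show "continuous_on (sphere 0 1 \<times> sphere 0 1) (\<lambda>(\<alpha>, \<tau>). ?B x \<alpha> \<tau> * hpow (- ?j) \<alpha>)"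
        unfolding case_prod_unfold
        by (intro continuous_intros continuous_on_compose2[OF f]) (use Rb[OF x] R in \<open>auto intro!: bidisc\<close>)
    qed auto
    also have "\<dots> = (LINT \<alpha>|circle_haar. hpow n (of_real x) * (LINT \<tau>|circle_haar. f (\<alpha> *s a + \<tau> *s b) * hpow (- ?j) \<alpha> * hpow (- n) \<tau>))"
    proof (intro LINT_cong)
      fix \<alpha> assume "\<alpha> \<in> space circle_haar"
      then have \<alpha>: "cmod \<alpha> = 1" by simp
      have sh: "(LINT \<tau>|circle_haar. ?B x \<alpha> \<tau> * hpow (- n) \<tau>)
          = hpow n (of_real x) * (LINT \<tau>|circle_haar. f (\<alpha> *s a + \<tau> *s b) * hpow (- n) \<tau>)"
        by (rule shift) (use bidisc \<alpha> R x in auto)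
      have "(LINT \<tau>|circle_haar. ?B x \<alpha> \<tau> * hpow (- ?j) \<alpha> * hpow (- n) \<tau>)
          = (LINT \<tau>|circle_haar. hpow (- ?j) \<alpha> * (?B x \<alpha> \<tau> * hpow (- n) \<tau>))"
        by (simp only: mult_ac)
      also have "\<dots> = hpow n (of_real x) * (LINT \<tau>|circle_haar. hpow (- ?j) \<alpha> * (f (\<alpha> *s a + \<tau> *s b) * hpow (- n) \<tau>))"
        unfolding integral_mult_right_zero sh by (simp only: mult_ac)
      finally show "(LINT \<tau>|circle_haar. ?B x \<alpha> \<tau> * hpow (- ?j) \<alpha> * hpow (- n) \<tau>)
          = hpow n (of_real x) * (LINT \<tau>|circle_haar. f (\<alpha> *s a + \<tau> *s b) * hpow (- ?j) \<alpha> * hpow (- n) \<tau>)"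
        by (simp only: mult_ac)
    qed
    also have "\<dots> = hpow n (of_real x) * I 1" by (simp add: I_def)
    finally show ?thesis by (simp only: mult_ac)
  qed
  \<comment> \<open>Replacing \<tau> by \<alpha> \<tau>, which is \<open>shift\<close> with the
    unimodular factor \<alpha>, brings the point to the form x \<alpha> (a + \<tau> b), so that x
    acts along a line through the origin.\<close>
  have I2: "I x = of_real x ^ k * J" if x: "0 < x" "x \<le> 1" for x
  proof -
    have x0: "0 \<le> x" using x by simp
    have "I x = (LINT \<alpha>|circle_haar. LINT \<tau>|circle_haar. (?C x \<alpha> \<tau> * hpow (- int k) \<alpha>) * hpow (- n) \<tau>)"
      unfolding I_def
    proof (rule LINT_cong)
      fix \<alpha> assume "\<alpha> \<in> space circle_haar"
      then have \<alpha>: "cmod \<alpha> = 1" by simp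
      have inD: "(of_real x * \<alpha>) *s a + t *s (of_real x *s b) \<in> D" if "cmod t < R" for t
      proof -
        have "cmod (t * of_real x) < R" using that x R by (simp add: norm_mult) (meson mult_left_le norm_ge_zero order_le_less_trans)
        from bidisc[OF Rb[OF x0 x(2) \<alpha>] this] show ?thesis by (simp add: vector_smult_assoc)
      qed
      have "(LINT \<tau>|circle_haar. f ((of_real x * \<alpha>) *s a + (\<alpha> * \<tau>) *s (of_real x *s b)) * hpow (- n) \<tau>)
          = hpow n \<alpha> * (LINT \<tau>|circle_haar. f ((of_real x * \<alpha>) *s a + \<tau> *s (of_real x *s b)) * hpow (- n) \<tau>)"
        by (rule shift[OF inD]) (use \<alpha> in auto)
      then have "hpow (- n) \<alpha> * (LINT \<tau>|circle_haar. f ((of_real x * \<alpha>) *s a + (\<alpha> * \<tau>) *s (of_real x *s b)) * hpow (- n) \<tau>)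
          = (hpow (- n) \<alpha> * hpow n \<alpha>) * (LINT \<tau>|circle_haar. f ((of_real x * \<alpha>) *s a + \<tau> *s (of_real x *s b)) * hpow (- n) \<tau>)"
        by (simp only: mult.assoc)
      also have "\<dots> = (LINT \<tau>|circle_haar. ?A x \<alpha> \<tau> * hpow (- n) \<tau>)"
        unfolding hpow_uminus_mult_self[OF \<alpha>] by (simp add: vector_smult_assoc mult.commute)
      finally have sh: "(LINT \<tau>|circle_haar. ?A x \<alpha> \<tau> * hpow (- n) \<tau>)
          = hpow (- n) \<alpha> * (LINT \<tau>|circle_haar. ?C x \<alpha> \<tau> * hpow (- n) \<tau>)"
        by (simp add: vector_add_ldistrib vector_smult_assoc mult_ac)
      have "(LINT \<tau>|circle_haar. ?A x \<alpha> \<tau> * hpow (- ?j) \<alpha> * hpow (- n) \<tau>)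
          = (LINT \<tau>|circle_haar. hpow (- ?j) \<alpha> * (?A x \<alpha> \<tau> * hpow (- n) \<tau>))"
        by (simp only: mult_ac)
      also have "\<dots> = (hpow (- ?j) \<alpha> * hpow (- n) \<alpha>) * (LINT \<tau>|circle_haar. ?C x \<alpha> \<tau> * hpow (- n) \<tau>)"
        unfolding integral_mult_right_zero sh by (simp only: mult_ac)
      also have "hpow (- ?j) \<alpha> * hpow (- n) \<alpha> = hpow (- int k) \<alpha>"
        using hpow_add[OF \<alpha>, of "- ?j" "- n"] by simp
      also have "hpow (- int k) \<alpha> * (LINT \<tau>|circle_haar. ?C x \<alpha> \<tau> * hpow (- n) \<tau>)
          = (LINT \<tau>|circle_haar. hpow (- int k) \<alpha> * (?C x \<alpha> \<tau> * hpow (- n) \<tau>))"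
        by (rule integral_mult_right_zero[symmetric])
      finally show "(LINT \<tau>|circle_haar. ?A x \<alpha> \<tau> * hpow (- ?j) \<alpha> * hpow (- n) \<tau>)
          = (LINT \<tau>|circle_haar. (?C x \<alpha> \<tau> * hpow (- int k) \<alpha>) * hpow (- n) \<tau>)"
        by (simp only: mult_ac)
    qed
    also have "\<dots> = (LINT \<tau>|circle_haar. (LINT \<alpha>|circle_haar. ?C x \<alpha> \<tau> * hpow (- int k) \<alpha>) * hpow (- n) \<tau>)"
    proof (rule Fubini_continuous[where G = 1, OF _ compact_sphere compact_sphere _ _ sets_circle_haar
          circle.finite_measure_axioms sets_circle_haar circle.finite_measure_axioms hm])
      have "(of_real x * \<alpha>) *s (a + \<tau> *s b) \<in> D" if "cmod \<alpha> = 1" "cmod \<tau> = 1" for \<alpha> \<tau>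
        using bidisc[OF Rb[OF x0 x(2) that(1)], of "of_real x * \<alpha> * \<tau>"] Rb[OF x0 x(2), of "\<alpha> * \<tau>"] that
        by (simp add: vector_add_ldistrib vector_smult_assoc norm_mult mult.assoc)
      then show "continuous_on (sphere 0 1 \<times> sphere 0 1) (\<lambda>(\<alpha>, \<tau>). ?C x \<alpha> \<tau> * hpow (- int k) \<alpha>)"
        unfolding case_prod_unfold
        by (intro continuous_intros continuous_on_compose2[OF f]) auto
    qed auto
    also have "\<dots> = (LINT \<tau>|circle_haar. of_real x ^ k * (circle_component f (int k) (a + \<tau> *s b) * hpow (- n) \<tau>))"
    proof (intro LINT_cong)
      fix \<tau> assume "\<tau> \<in> space circle_haar"
      then have \<tau>: "cmod \<tau> = 1" by simp
      have "1 *s a + \<tau> *s b \<in> D" using bidisc[of 1 \<tau>] R \<tau> by simp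
      then have z: "a + \<tau> *s b \<in> D" by simp
      have inD: "0 + t *s (a + \<tau> *s b) \<in> D" if "cmod t < R" for t
        using bidisc[of t "t * \<tau>"] that \<tau> by (simp add: vector_add_ldistrib vector_smult_assoc norm_mult)
      have "(LINT \<alpha>|circle_haar. f (0 + (of_real x * \<alpha>) *s (a + \<tau> *s b)) * hpow (- int k) \<alpha>)
          = hpow (int k) (of_real x) * (LINT \<alpha>|circle_haar. f (0 + \<alpha> *s (a + \<tau> *s b)) * hpow (- int k) \<alpha>)"
        by (rule shift[OF inD]) (use x in auto)
      then show "(LINT \<alpha>|circle_haar. ?C x \<alpha> \<tau> * hpow (- int k) \<alpha>) * hpow (- n) \<tau>
          = of_real x ^ k * (circle_component f (int k) (a + \<tau> *s b) * hpow (- n) \<tau>)"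
        by (simp add: circle_component_def)
    qed
    also have "\<dots> = of_real x ^ k * J" by (simp add: J_def)
    finally show ?thesis .
  qed
  have J1: "I 1 = J" using I2[of 1] by simp
  have "hpow n (of_real (1/2)) * hpow ?j (of_real (1/2)) * J = of_real (1/2) ^ k * J"
    using I1[of "1/2"] I2[of "1/2"] J1 by auto
  moreover have "hpow n (of_real (1/2)) * hpow ?j (of_real (1/2)) = (of_real (1/2)) ^ (k + 2 * nat (- n))"
  proof -
    have "nat \<bar>n\<bar> + nat \<bar>?j\<bar> = k + 2 * nat (- n)" using n by simp
    then show ?thesis unfolding hpow_of_real by (metis power_add)
  qed
  ultimately have "complex_of_real (1/2) ^ k * ((complex_of_real (1/2)) ^ (2 * nat (- n)) * J) = of_real (1/2) ^ k * J"
    by (simp only: power_add mult.assoc)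
  \<comment> \<open>For n < 0 the exponents |n| + |k - n| and k differ by 2 |n|, so the integral
    equals a proper fraction of itself.\<close>
  then have e: "complex_of_real (1/2) ^ (2 * nat (- n)) * J = J" by (subst (asm) mult_left_cancel) simp_all
  have "cmod (complex_of_real (1/2) ^ (2 * nat (- n))) < 1"
    unfolding norm_power using n by (intro power_less_one_iff[THEN iffD2]) auto
  then have "complex_of_real (1/2) ^ (2 * nat (- n)) \<noteq> 1" by auto
  then show ?thesis using e unfolding J_def by simp
qed

text \<open>Along a complex line through \<open>a\<close> the component is an average of harmonic
  functions, hence the Poisson integral of its values on a circle; with the coefficients of negative
  degree gone, a power series remains. The line parameter is rescaled by \<open>e\<close> so that
  the unit circle fits into the bidisc.\<close>

lemma circle_component_mholomorphic:
  assumes f: "continuous_on D f" and ph: "pluriharmonic_on f D"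
  shows "mholomorphic_on (circle_component f (int k)) D"
proof (rule mholomorphic_on_if_lines[OF open_D circle_component_continuous[OF f]])
  fix a v assume a: "a \<in> D"
  let ?p = "circle_component f (int k)"
  obtain e R where eR: "e > 0" "R > 1"
    "\<And>s t. cmod s < R \<Longrightarrow> cmod t < R \<Longrightarrow> s *s a + t *s (of_real e *s v) \<in> D"
    using exists_bidisc[OF a, of v] by blast
  define b where "b = complex_of_real e *s v"
  have inD: "s *s a + t *s b \<in> D" if "cmod s < R" "cmod t < R" for s t
    using eR(3)[OF that] by (simp add: b_def)
  have inD1: "a + t *s b \<in> D" if "cmod t < R" for t using inD[of 1 t] that eR(2) by simp
  define G where "G = (\<lambda>t. ?p (a + t *s b))"
  have cG: "continuous_on (sphere 0 1) G"
    unfolding G_def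
    by (rule continuous_on_compose2[OF circle_component_continuous[OF f]])
      (use inD1 eR(2) in \<open>auto intro!: continuous_intros\<close>)
  obtain B where B: "\<And>x. x \<in> sphere 0 1 \<Longrightarrow> cmod (G x) \<le> B"
    using compact_imp_bounded[OF compact_continuous_image[OF cG compact_sphere]] unfolding bounded_iff by blast
  define J where "J = (\<lambda>n. LINT \<tau>|circle_haar. hpow (- int n) \<tau> * G \<tau>)"
  have neg: "(LINT \<tau>|circle_haar. hpow (int (Suc n)) \<tau> * G \<tau>) = 0" for n
    using component_coeff_zero[OF f ph eR(2) inD, of "- int (Suc n)" k]
    unfolding G_def minus_minus by (simp add: mult.commute)
  have G: "G t = (\<Sum>n. t ^ n * J n)" if t: "cmod t < 1" for t
  proof -
    let ?K = "\<lambda>\<tau>. disc_kernel t \<tau>"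
    have ne: "\<tau> - t \<noteq> 0" if "cmod \<tau> = 1" for \<tau> using that t by auto
    have cK: "continuous_on (sphere 0 1) ?K" using ne by (intro continuous_intros) auto
    obtain B' where B': "\<And>x. x \<in> sphere 0 1 \<Longrightarrow> cmod (?K x) \<le> B'"
      using compact_imp_bounded[OF compact_continuous_image[OF cK compact_sphere]] unfolding bounded_iff by blast
    have inD2: "\<alpha> *s (a + \<tau> *s b) \<in> D" if "cmod \<alpha> = 1" "cmod \<tau> = 1" for \<alpha> \<tau>
      by (rule circular[OF that(1) inD1]) (use that eR(2) in simp)
    have cF: "continuous_on (sphere 0 1 \<times> sphere 0 1) (\<lambda>(\<alpha>, \<tau>). f (\<alpha> *s (a + \<tau> *s b)) * hpow (- int k) \<alpha>)"
      unfolding case_prod_unfold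
      by (intro continuous_intros continuous_on_compose2[OF f]) (use inD2 in auto)
    have "G t = (LINT \<alpha>|circle_haar. LINT \<tau>|circle_haar. (f (\<alpha> *s (a + \<tau> *s b)) * hpow (- int k) \<alpha>) * ?K \<tau>)"
      unfolding G_def circle_component_def
    proof (intro LINT_cong)
      fix \<alpha> assume "\<alpha> \<in> space circle_haar"
      then have \<alpha>: "cmod \<alpha> = 1" by simp
      obtain c where c: "harmonic_coeffs (\<lambda>t. f (\<alpha> *s a + t *s (\<alpha> *s b))) R c"
        using line_coeffs[OF ph, of R "\<alpha> *s a" "\<alpha> *s b"] inD[of \<alpha> "_ * \<alpha>"] \<alpha> eR(2)
        by (auto simp: vector_smult_assoc norm_mult)
      have e: "\<alpha> *s a + t *s (\<alpha> *s b) = \<alpha> *s (a + t *s b)" for t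
        by (simp add: vector_add_ldistrib vector_smult_assoc mult.commute)
      have "f (\<alpha> *s (a + t *s b)) * hpow (- int k) \<alpha>
          = (LINT \<tau>|circle_haar. f (\<alpha> *s (a + \<tau> *s b)) * ?K \<tau>) * hpow (- int k) \<alpha>"
        using harmonic_coeffs_Poisson[OF c eR(2) t] unfolding e by simp
      also have "\<dots> = (LINT \<tau>|circle_haar. (f (\<alpha> *s (a + \<tau> *s b)) * ?K \<tau>) * hpow (- int k) \<alpha>)"
        by (rule integral_mult_left_zero[symmetric])
      finally show "f (\<alpha> *s (a + t *s b)) * hpow (- int k) \<alpha>
          = (LINT \<tau>|circle_haar. (f (\<alpha> *s (a + \<tau> *s b)) * hpow (- int k) \<alpha>) * ?K \<tau>)"
        by (simp only: mult_ac)
    qed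
    also have "\<dots> = (LINT \<tau>|circle_haar. (LINT \<alpha>|circle_haar. f (\<alpha> *s (a + \<tau> *s b)) * hpow (- int k) \<alpha>) * ?K \<tau>)"
      by (rule Fubini_continuous[where G = B', OF cF compact_sphere compact_sphere _ _ sets_circle_haar
            circle.finite_measure_axioms sets_circle_haar circle.finite_measure_axioms circle_continuous_measurable[OF cK]])
        (use B' in auto)
    also have "\<dots> = (LINT \<tau>|circle_haar. ?K \<tau> * G \<tau>)"
      unfolding G_def circle_component_def by (simp only: mult.commute)
    also have "\<dots> = (\<Sum>n. t ^ n * (LINT \<tau>|circle_haar. hpow (- int n) \<tau> * G \<tau>))
        + (\<Sum>n. cnj t ^ Suc n * (LINT \<tau>|circle_haar. hpow (int (Suc n)) \<tau> * G \<tau>))"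
      by (rule poisson_kernel_integral[OF circle.finite_measure_axioms circle_continuous_measurable[OF cG] _ circle_continuous_measurable[OF continuous_on_id] _ t, of B])
        (use B in auto)
    finally show ?thesis unfolding neg by (simp add: J_def)
  qed
  have "cmod (J n) \<le> B" for n
  proof -
    have "cmod (J n) \<le> (LINT \<tau>|circle_haar. B)"
      unfolding J_def
    proof (rule Bochner_Integration.integral_norm_bound_integral)
      show "integrable circle_haar (\<lambda>\<tau>. hpow (- int n) \<tau> * G \<tau>)"
        by (intro circle_integrable continuous_intros cG)
    qed (use B in \<open>auto simp: norm_mult\<close>)
    then show ?thesis by simp
  qed
  then have "summable (\<lambda>n. t ^ n * J n)" if "cmod t < 1" for t
    by (intro summable_comparison_test'[OF summable_mult2[OF summable_geometric[of "cmod t"]], of 0 _ B])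
      (use that in \<open>auto simp: norm_mult norm_power intro!: mult_left_mono\<close>)
  then have "(\<lambda>n. J n * (t - 0) ^ n) sums G t" if "t \<in> ball 0 1" for t
    using that G[of t] by (simp add: sums_iff mult.commute)
  then have holG: "G holomorphic_on ball 0 1" by (rule power_series_holomorphic)
  have "(\<lambda>w. G (w / of_real e)) field_differentiable (at 0)"
  proof -
    have "G field_differentiable (at (0 / of_real e))"
      by (rule holomorphic_on_imp_differentiable_at[OF holG open_ball]) simp
    moreover have "(\<lambda>w. w / complex_of_real e) field_differentiable (at 0)"
      using eR(1) by (intro derivative_intros) auto
    ultimately have "(G \<circ> (\<lambda>w. w / of_real e)) field_differentiable (at 0)"
      by (intro field_differentiable_compose)
    then show ?thesis by (simp add: o_def)
  qed
  moreover have "G (w / of_real e) = ?p (a + w *s v)" for w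
    using eR(1) by (simp add: G_def b_def vector_smult_assoc)
  ultimately show "(\<lambda>w. ?p (a + w *s v)) field_differentiable (at 0)"
    by simp
qed

lemma boundary_coeff_ball_algebra:
  assumes f: "continuous_on D f" and ph: "pluriharmonic_on f D"
  shows "ball_algebra (boundary_coeff f (int k))"
  unfolding ball_algebra_def
proof
  have "mholomorphic_on (\<lambda>z. circle_component f (int k) (mat (1/2) *v z)) D"
    by (rule mholomorphic_on_compose_matrix[OF circle_component_mholomorphic[OF f ph]])
      (auto simp: mat_scale norm_divide intro!: scale_D)
  from mholomorphic_on_mult[OF mholomorphic_on_const this, of "2 ^ k"]
  show "mholomorphic_on (boundary_coeff f (int k)) D"
    by (simp add: boundary_coeff_def[abs_def] mat_scale)
  show "continuous_on (closure D) (boundary_coeff f (int k))"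
    by (rule boundary_coeff_continuous[OF f])
qed

lemma boundary_coeff_nat_zeros:
  assumes f: "continuous_on D f" and ph: "pluriharmonic_on f D"
    and nz: "\<zeta>0 \<in> bD" "boundary_coeff f (int k) \<zeta>0 \<noteq> 0"
  shows "measure \<beta> (bD_zeros (boundary_coeff f (int k))) = 0"
  by (rule homogeneous_zero_set[OF boundary_coeff_ball_algebra[OF f ph] _ nz, of k])
    (simp add: boundary_coeff_scale[OF ph])

lemma pluriharmonic_on_cnj:
  assumes "pluriharmonic_on f D"
  shows "pluriharmonic_on (\<lambda>z. cnj (f z)) D"
  unfolding pluriharmonic_on_def
proof (intro allI impI)
  fix a v :: "complex^'n" assume "v \<noteq> 0"
  then have "harmonic_on (\<lambda>w. f (a + w *s v)) {w. a + w *s v \<in> D}" (is "harmonic_on ?f ?U")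
    using assms by (simp add: pluriharmonic_on_def)
  then obtain ux uy uxx uxy uyx uyy where u:
    "continuous_on ?U uxx" "continuous_on ?U uxy" "continuous_on ?U uyx" "continuous_on ?U uyy"
    "\<And>w. w \<in> ?U \<Longrightarrow> (?f has_derivative (\<lambda>h. Re h *\<^sub>R ux w + Im h *\<^sub>R uy w)) (at w)"
    "\<And>w. w \<in> ?U \<Longrightarrow> (ux has_derivative (\<lambda>h. Re h *\<^sub>R uxx w + Im h *\<^sub>R uxy w)) (at w)"
    "\<And>w. w \<in> ?U \<Longrightarrow> (uy has_derivative (\<lambda>h. Re h *\<^sub>R uyx w + Im h *\<^sub>R uyy w)) (at w)"
    "\<And>w. w \<in> ?U \<Longrightarrow> uxx w + uyy w = 0"
    unfolding harmonic_on_def by blast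
  have d: "((\<lambda>w. cnj (g w)) has_derivative (\<lambda>h. Re h *\<^sub>R cnj p + Im h *\<^sub>R cnj q)) (at w)"
    if "(g has_derivative (\<lambda>h. Re h *\<^sub>R p + Im h *\<^sub>R q)) (at w)" for g p q w
    using has_derivative_cnj[OF that] by simp
  have lap: "cnj (uxx w) + cnj (uyy w) = 0" if "w \<in> ?U" for w
    using u(8)[OF that] by (metis complex_cnj_add complex_cnj_zero)
  show "harmonic_on (\<lambda>w. cnj (f (a + w *s v))) ?U"
    unfolding harmonic_on_def
    by (rule exI[of _ "\<lambda>w. cnj (ux w)"], rule exI[of _ "\<lambda>w. cnj (uy w)"], rule exI[of _ "\<lambda>w. cnj (uxx w)"],
        rule exI[of _ "\<lambda>w. cnj (uxy w)"], rule exI[of _ "\<lambda>w. cnj (uyx w)"], rule exI[of _ "\<lambda>w. cnj (uyy w)"])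
      (intro conjI ballI d u(5-7) lap continuous_intros u(1-4))
qed

text \<open>A coefficient of negative degree is the conjugate of a coefficient of positive degree of
  the conjugate function, which is again pluriharmonic.\<close>

lemma boundary_coeff_zeros:
  assumes f: "continuous_on D f" and ph: "pluriharmonic_on f D"
    and nz: "\<zeta>0 \<in> bD" "boundary_coeff f k \<zeta>0 \<noteq> 0"
  shows "measure \<beta> (bD_zeros (boundary_coeff f k)) = 0"
proof (cases "0 \<le> k")
  case True
  then obtain n where "k = int n" by (metis nonneg_int_cases)
  then show ?thesis using boundary_coeff_nat_zeros[OF f ph] nz by blast
next
  case False
  define n where "n = nat (- k)"
  have k: "k = - int n" using False by (simp add: n_def)
  have cc: "boundary_coeff (\<lambda>z. cnj (f z)) (int n) z = cnj (boundary_coeff f k z)" for z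
  proof -
    have "circle_component (\<lambda>z. cnj (f z)) (int n) y = cnj (circle_component f k y)" for y
    proof -
      have "(\<lambda>\<alpha>. cnj (f (\<alpha> *s y)) * hpow (- int n) \<alpha>) = (\<lambda>\<alpha>. cnj (f (\<alpha> *s y) * hpow (int n) \<alpha>))"
        by (simp add: hpow_uminus)
      then show ?thesis unfolding circle_component_def k minus_minus by (simp only: Bochner_Integration.integral_cnj)
    qed
    then show ?thesis by (simp add: boundary_coeff_def k)
  qed
  have "measure \<beta> (bD_zeros (boundary_coeff (\<lambda>z. cnj (f z)) (int n))) = 0"
    by (rule boundary_coeff_nat_zeros[OF _ pluriharmonic_on_cnj[OF ph] nz(1)])
      (use f nz(2) in \<open>auto intro: continuous_intros simp: cc\<close>)
  then show ?thesis by (simp add: bD_zeros_def cc)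
qed

end

section \<open>The pseudo-image property\<close>

lemma set_integral_null_set:
  fixes f :: "'a \<Rightarrow> 'b::{banach, second_countable_topology}"
  assumes "A \<in> null_sets M" shows "(LINT x:A|M. f x) = 0"
  unfolding set_lebesgue_integral_def
  by (rule integral_eq_zero_AE) (use AE_not_in[OF assms] in \<open>auto elim!: eventually_mono\<close>)

context pluriharmonic_setting
begin

lemma sets_\<nu> [simp, measurable_cong]: "sets \<nu> = sets Q"
  and space_\<nu> [simp]: "space \<nu> = torbit ` bD"
  by (simp_all add: quotient_measure_def)

lemma emeasure_\<nu>: "N \<in> sets Q \<Longrightarrow> emeasure \<nu> N = emeasure \<beta> (torbit -` N \<inter> bD)"
  unfolding quotient_measure_def by (subst emeasure_distr[OF torbit_\<beta>]) (simp_all add: space_\<beta>)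

lemma saturated_sets: "N \<in> sets Q \<Longrightarrow> torbit -` N \<inter> bD \<in> sets (borel_on bD)"
  using measurable_sets[OF torbit_measurable, of N bD] by simp

lemma torbit_subset_bD: "\<zeta> \<in> bD \<Longrightarrow> torbit \<zeta> \<subseteq> bD"
  unfolding torbit_def using circular_bD by blast

lemma saturated_null_imp:
  assumes N: "N \<in> null_sets \<nu>"
  shows "torbit -` N \<inter> bD \<in> null_sets m"
proof -
  let ?V = "torbit -` N \<inter> bD"
  have NQ: "N \<in> sets Q" using null_setsD2[OF N] by simp
  have V: "?V \<in> sets (borel_on bD)" by (rule saturated_sets[OF NQ])
  have V0: "?V \<in> null_sets \<beta>" using null_setsD1[OF N] emeasure_\<nu>[OF NQ] V by (simp add: null_sets_def sets_\<beta>)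
  \<comment> \<open>The density is cut down to \<open>?V\<close>, so that vanishing moments yield
    the vanishing of \<open>\<mu>\<close> on every Borel subset of \<open>?V\<close>.\<close>
  let ?g = "\<lambda>x. indicator ?V x *\<^sub>R h x"
  have ig: "integrable m ?g" by (rule integrable_mult_indicator) (use V integrable_h in simp_all)
  have zero: "(LINT x|m. \<phi> x * ?g x) = 0" if \<phi>: "circle_homogeneous bD k \<phi>" for k \<phi>
  proof -
    have "(LINT x|m. \<phi> x * ?g x) = (LINT x:?V|m. \<phi> x * h x)"
      unfolding set_lebesgue_integral_def by (simp only: mult_scaleR_right)
    also have "\<dots> = (LINT x:?V|\<beta>. \<phi> x * coeff (- k) x)"
      by (rule homogeneous_moment_saturated[OF _ NQ]) (use \<phi> in simp)
    also have "\<dots> = 0" by (rule set_integral_null_set[OF V0])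
    finally show ?thesis .
  qed
  have "\<mu> E = 0" if E: "E \<in> sets (borel_on bD)" "E \<subseteq> ?V" for E
  proof -
    have "\<mu> E = (LINT x:E|m. h x)" by (rule polar_density_integral[OF cm E(1)])
    also have "\<dots> = (LINT x:E|m. ?g x)"
      unfolding set_lebesgue_integral_def
      by (intro LINT_cong) (use E(2) in \<open>auto simp: indicator_def\<close>)
    also have "\<dots> = 0"
      by (rule homogeneous_moments_zero[OF compact_bD _ ig zero E(1)]) simp_all
    finally show ?thesis .
  qed
  then have "emeasure m ?V = 0" using variation_null_iff[OF cm V] by blast
  then show ?thesis using V by (simp add: null_sets_def)
qed

text \<open>The orbits that leave \<open>U\<close> sweep out the image of the circle times
  \<open>bD - U\<close>, which is compact; so the orbits contained in \<open>U\<close> form a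
  relatively open saturated set.\<close>

lemma saturated_interior_open:
  assumes U: "open U"
  shows "torbit ` {\<zeta>\<in>bD. torbit \<zeta> \<subseteq> U} \<in> sets Q"
proof -
  let ?V = "{\<zeta>\<in>bD. torbit \<zeta> \<subseteq> U}"
  let ?K = "(\<lambda>(\<alpha>, \<zeta>). \<alpha> *s \<zeta>) ` (sphere 0 1 \<times> (bD - U))"
  have "compact (bD - U)" using compact_bD U by (rule compact_diff)
  then have "compact ?K"
    by (intro compact_continuous_image compact_Times compact_sphere)
      (auto simp: case_prod_unfold intro!: continuous_intros)
  then have K: "closed ?K" by (rule compact_imp_closed)
  have V: "?V = bD \<inter> (- ?K)"
  proof (intro set_eqI iffI)
    fix z assume z: "z \<in> ?V"
    have "z \<notin> ?K"
    proof
      assume "z \<in> ?K"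
      then obtain \<alpha> \<zeta> where \<alpha>: "cmod \<alpha> = 1" "\<zeta> \<in> bD" "\<zeta> \<notin> U" "z = \<alpha> *s \<zeta>" by auto
      have "torbit z = torbit \<zeta>" using torbit_scale[OF \<alpha>(1)] \<alpha>(4) by simp
      then show False using z torbit_self[of \<zeta>] \<alpha>(3) by auto
    qed
    then show "z \<in> bD \<inter> (- ?K)" using z by blast
  next
    fix z assume z: "z \<in> bD \<inter> (- ?K)"
    have "y \<in> U" if y: "y \<in> torbit z" for y
    proof (rule ccontr)
      assume yU: "y \<notin> U"
      have "y \<in> bD" using torbit_subset_bD z y by blast
      have "z \<in> torbit y" using torbit_eq[OF y] torbit_self[of z] by simp
      then obtain \<alpha> where "cmod \<alpha> = 1" "z = \<alpha> *s y" unfolding torbit_def by blast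
      then have "z \<in> ?K" using \<open>y \<in> bD\<close> yU by (intro image_eqI[of _ _ "(\<alpha>, y)"]) auto
      then show False using z by blast
    qed
    then show "z \<in> ?V" using z by blast
  qed
  have "{\<zeta>\<in>bD. torbit \<zeta> \<in> torbit ` ?V} = ?V"
    by (auto simp: torbit_eq_iff)
  moreover have "openin (top_of_set bD) ?V"
    unfolding V by (rule openin_open_Int) (rule open_Compl[OF K])
  ultimately have "torbit ` ?V \<in> quotient_open bD"
    unfolding quotient_open_def by auto
  then show ?thesis unfolding sets_quotient_borel by (rule sigma_sets.Basic)
qed

lemma null_open_cover:
  assumes B: "B \<in> null_sets m" and e: "e > 0"
  shows "\<exists>U. open U \<and> B \<subseteq> U \<and> emeasure m (U \<inter> bD) < ennreal e"
proof -
  define M where "M = distr m borel (\<lambda>x. x)"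
  have ident: "(\<lambda>x. x) \<in> measurable m borel" by (rule continuous_m_measurable) simp
  have eM: "emeasure M U = emeasure m (U \<inter> bD)" if "U \<in> sets borel" for U
    unfolding M_def using that by (subst emeasure_distr[OF ident]) simp_all
  have Bb: "B \<in> sets borel" "B \<subseteq> bD"
    using null_setsD2[OF B] sets.sets_into_space[OF null_setsD2[OF B]] closed_bD
    by (auto simp: sets_restrict_space)
  have fin: "emeasure M (space M) \<noteq> \<infinity>"
    using finite_measure.emeasure_finite[OF finite_m] by (simp add: M_def emeasure_distr[OF ident])
  have "emeasure M B = 0" using eM[OF Bb(1)] Bb(2) null_setsD1[OF B] by (simp add: Int_absorb2)
  then have "(INF U\<in>{U. B \<subseteq> U \<and> open U}. emeasure M U) < ennreal e"
    using outer_regular[of M B] fin Bb(1) e by (simp add: M_def)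
  then obtain U where "B \<subseteq> U" "open U" "emeasure M U < ennreal e" unfolding INF_less_iff by blast
  then show ?thesis using eM[of U] by auto
qed

text \<open>A negligible saturated set lies in a Borel null set that need not be saturated. Passing
  to the orbits contained in open neighbourhoods of small measure restores saturation and keeps
  measurability.\<close>

lemma saturated_null_cover:
  assumes N: "N \<subseteq> torbit ` bD" and null: "torbit -` N \<inter> bD \<in> null_sets (completion m)"
  shows "\<exists>N'\<in>sets Q. N \<subseteq> N' \<and> torbit -` N' \<inter> bD \<in> null_sets m"
proof -
  obtain B where B: "B \<in> null_sets m" "torbit -` N \<inter> bD \<subseteq> B"
    using null unfolding null_sets_completion_iff2 by blast
  have "\<forall>j. \<exists>U. open U \<and> B \<subseteq> U \<and> emeasure m (U \<inter> bD) < ennreal (1 / real (Suc j))"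
    by (intro allI null_open_cover[OF B(1)]) simp
  then obtain U where U: "\<And>j. open (U j)" "\<And>j. B \<subseteq> U j"
    "\<And>j. emeasure m (U j \<inter> bD) < ennreal (1 / real (Suc j))"
    by metis
  define N' where "N' = (\<Inter>j. torbit ` {\<zeta>\<in>bD. torbit \<zeta> \<subseteq> U j})"
  have N'Q: "N' \<in> sets Q"
    unfolding N'_def by (rule sets.countable_INT) (use saturated_interior_open[OF U(1)] in auto)
  have "N \<subseteq> N'"
  proof
    fix \<xi> assume \<xi>: "\<xi> \<in> N"
    then obtain \<zeta> where \<zeta>: "\<zeta> \<in> bD" "\<xi> = torbit \<zeta>" using N by blast
    have "torbit \<zeta> \<subseteq> B"
    proof
      fix z assume z: "z \<in> torbit \<zeta>"
      have "torbit z \<in> N" using torbit_eq[OF z] \<xi> \<zeta>(2) by simp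
      moreover have "z \<in> bD" using torbit_subset_bD[OF \<zeta>(1)] z by blast
      ultimately show "z \<in> B" using B(2) by blast
    qed
    then have "torbit \<zeta> \<subseteq> U j" for j using U(2) by blast
    then show "\<xi> \<in> N'" unfolding N'_def \<zeta>(2) using \<zeta>(1) by blast
  qed
  moreover have "emeasure m (torbit -` N' \<inter> bD) \<le> 0"
  proof (rule ennreal_le_epsilon)
    fix e :: real assume e: "0 < e"
    obtain j where j: "1 / real (Suc j) < e" using nat_approx_posE[OF e] by auto
    have "torbit -` N' \<inter> bD \<subseteq> U j \<inter> bD"
    proof
      fix z assume z: "z \<in> torbit -` N' \<inter> bD"
      then have "torbit z \<in> torbit ` {\<zeta>\<in>bD. torbit \<zeta> \<subseteq> U j}" by (simp add: N'_def)
      then have "torbit z \<subseteq> U j" by auto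
      then show "z \<in> U j \<inter> bD" using z torbit_self by blast
    qed
    then have "emeasure m (torbit -` N' \<inter> bD) \<le> emeasure m (U j \<inter> bD)"
      by (rule emeasure_mono) (use U(1)[of j] in \<open>auto simp: sets_restrict_space\<close>)
    also have "\<dots> \<le> ennreal (1 / real (Suc j))" using U(3)[of j] by (rule less_imp_le)
    also have "\<dots> \<le> ennreal e" using j by (intro ennreal_leI) simp
    finally show "emeasure m (torbit -` N' \<inter> bD) \<le> 0 + ennreal e" by simp
  qed
  ultimately show ?thesis using N'Q saturated_sets[OF N'Q] by (auto simp: null_sets_def)
qed

text \<open>Otherwise all homogeneous moments of \<open>\<mu>\<close> would vanish.\<close>

lemma exists_coeff_nonzero:
  assumes "\<exists>E\<in>sets (borel_on bD). \<mu> E \<noteq> 0"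
  shows "\<exists>k. \<exists>\<zeta>\<in>bD. coeff k \<zeta> \<noteq> 0"
proof (rule ccontr)
  assume "\<not> ?thesis"
  then have c0: "coeff k \<zeta> = 0" if "\<zeta> \<in> bD" for k \<zeta> using that by blast
  have zero: "(LINT x|m. \<phi> x * h x) = 0" if \<phi>: "circle_homogeneous bD k \<phi>" for k \<phi>
  proof -
    have "(LINT x|m. \<phi> x * h x) = (LINT x|\<beta>. \<phi> x * coeff (- k) x)"
      by (rule homogeneous_moment) (use \<phi> in simp)
    also have "\<dots> = (LINT x|\<beta>. 0)"
      by (intro LINT_cong) (simp add: c0 space_\<beta>)
    finally show ?thesis by simp
  qed
  have "\<mu> E = 0" if E: "E \<in> sets (borel_on bD)" for E
  proof -
    have "\<mu> E = (LINT x:E|m. h x)" by (rule polar_density_integral[OF cm E])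
    also have "\<dots> = 0" by (rule homogeneous_moments_zero[OF compact_bD _ integrable_h zero E]) simp_all
    finally show ?thesis .
  qed
  then show False using assms by blast
qed

text \<open>With the conjugate of \<open>coeff k\<close> as test function, the moment over the
  saturated set is the \<open>\<beta>\<close>-integral of |c_k|^2; it vanishes because the set is
  null for the variation of \<open>\<mu>\<close>. So c_k vanishes almost everywhere on the set,
  while the zero set of a non-zero c_k is null.\<close>

lemma saturated_null_conv:
  assumes nz: "\<exists>E\<in>sets (borel_on bD). \<mu> E \<noteq> 0" and N: "N \<in> sets Q" and null: "torbit -` N \<inter> bD \<in> null_sets m"
  shows "N \<in> null_sets \<nu>"
proof -
  let ?V = "torbit -` N \<inter> bD"
  obtain k \<zeta>0 where k: "\<zeta>0 \<in> bD" "coeff k \<zeta>0 \<noteq> 0" using exists_coeff_nonzero[OF nz] by blast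
  have V: "?V \<in> sets \<beta>" unfolding sets_\<beta> by (rule saturated_sets[OF N])
  have ch: "continuous_on bD (coeff k)" using coeff_homogeneous by (simp add: circle_homogeneous_def)
  have i: "integrable \<beta> (\<lambda>\<zeta>. indicator ?V \<zeta> *\<^sub>R (cmod (coeff k \<zeta>))\<^sup>2)"
    by (intro integrable_mult_indicator V continuous_\<beta>_integrable continuous_intros ch)
  have sq: "cnj (coeff k \<zeta>) * coeff k \<zeta> = complex_of_real ((cmod (coeff k \<zeta>))\<^sup>2)" for \<zeta>
    by (simp only: complex_norm_square mult.commute)
  have "complex_of_real (LINT \<zeta>|\<beta>. indicator ?V \<zeta> *\<^sub>R (cmod (coeff k \<zeta>))\<^sup>2)
      = (LINT \<zeta>|\<beta>. complex_of_real (indicator ?V \<zeta> *\<^sub>R (cmod (coeff k \<zeta>))\<^sup>2))"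
    by (rule integral_complex_of_real[symmetric])
  also have "\<dots> = (LINT \<zeta>:?V|\<beta>. cnj (coeff k \<zeta>) * coeff k \<zeta>)"
    unfolding set_lebesgue_integral_def sq
    by (intro LINT_cong) (simp add: scaleR_conv_of_real[where 'a=complex])
  also have "\<dots> = (LINT \<zeta>:?V|m. cnj (coeff k \<zeta>) * h \<zeta>)"
    by (rule homogeneous_moment_saturated[OF circle_homogeneous_cnj[OF coeff_homogeneous] N, symmetric])
  also have "\<dots> = 0" by (rule set_integral_null_set[OF null])
  finally have "(LINT \<zeta>|\<beta>. indicator ?V \<zeta> *\<^sub>R (cmod (coeff k \<zeta>))\<^sup>2) = 0" by simp
  then have 1: "AE \<zeta> in \<beta>. indicator ?V \<zeta> *\<^sub>R (cmod (coeff k \<zeta>))\<^sup>2 = 0"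
    by (subst (asm) integral_nonneg_eq_0_iff_AE[OF i]) auto
  have "bD_zeros (coeff k) \<in> null_sets \<beta>"
  proof -
    have "measure \<beta> (bD_zeros (coeff k)) = 0"
      by (rule boundary_coeff_zeros[OF u_continuous pluriharmonic k])
    moreover have "bD_zeros (coeff k) \<in> sets \<beta>"
      using closed_bD_zeros[OF ch] unfolding sets_\<beta> by (auto simp: sets_restrict_space bD_zeros_def intro!: image_eqI[of _ _ "bD_zeros (coeff k)"])
    ultimately show ?thesis
      using finite_measure.emeasure_eq_measure[OF finite_\<beta>] by (simp add: null_sets_def)
  qed
  then have 2: "AE \<zeta> in \<beta>. \<zeta> \<notin> bD_zeros (coeff k)" by (rule AE_not_in)
  have "AE \<zeta> in \<beta>. \<zeta> \<notin> ?V"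
    using 1 2 by eventually_elim (auto simp: bD_zeros_def)
  then have "?V \<in> null_sets \<beta>" using AE_iff_null_sets[OF V] by simp
  then show ?thesis using emeasure_\<nu>[OF N] N by (simp add: null_sets_def)
qed

lemma pseudo_image_quotient:
  assumes nz: "\<exists>E\<in>sets (borel_on bD). \<mu> E \<noteq> 0"
  shows "pseudo_image (borel_on bD) \<mu> torbit \<nu>"
  unfolding pseudo_image_def
proof (intro conjI allI impI iffI)
  show "torbit \<in> measurable (completion m) \<nu>"
    using measurable_completion[OF torbit_m] by (simp cong: measurable_cong_sets)
next
  fix N assume N: "N \<subseteq> space \<nu>" and "N \<in> null_sets (completion \<nu>)"
  then obtain N' where N': "N' \<in> null_sets \<nu>" "N \<subseteq> N'" unfolding null_sets_completion_iff2 by blast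
  have "torbit -` N \<inter> bD \<subseteq> torbit -` N' \<inter> bD" using N'(2) by blast
  then show "cnegligible (borel_on bD) \<mu> (torbit -` N \<inter> space (borel_on bD))"
    unfolding cnegligible_def null_sets_completion_iff2 space_borel_on by (rule bexI[OF _ saturated_null_imp[OF N'(1)]])
next
  fix N assume N: "N \<subseteq> space \<nu>" and "cnegligible (borel_on bD) \<mu> (torbit -` N \<inter> space (borel_on bD))"
  then have null: "torbit -` N \<inter> bD \<in> null_sets (completion m)" by (simp add: cnegligible_def)
  obtain N' where "N' \<in> sets Q" "N \<subseteq> N'" "torbit -` N' \<inter> bD \<in> null_sets m"
    using saturated_null_cover[OF _ null] N unfolding space_\<nu> by blast
  then show "N \<in> null_sets (completion \<nu>)"
    unfolding null_sets_completion_iff2 using saturated_null_conv[OF nz] by blast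
qed

end

section \<open>The theorem of F. and M. Riesz\<close>

text \<open>On the circle the product of \<alpha> and its conjugate is 1, which lowers both degrees
  by one, and the real part does not see the conjugation of a whole term.\<close>

lemma poly_Re_mult_cnj:
  fixes p q :: "complex poly"
  shows "\<exists>r. \<forall>\<alpha>\<in>sphere 0 1. Re (poly p \<alpha> * cnj (poly q \<alpha>)) = Re (poly r \<alpha>)"
proof (induction p arbitrary: q)
  case 0
  show ?case by (intro exI[of _ 0]) simp
next
  case (pCons a p)
  obtain b q' where q: "q = pCons b q'" by (cases q)
  from pCons.IH[of q'] obtain r where r: "\<forall>\<alpha>\<in>sphere 0 1. Re (poly p \<alpha> * cnj (poly q' \<alpha>)) = Re (poly r \<alpha>)" ..
  show ?case
  proof (intro exI ballI)
    fix \<alpha> :: complex assume \<alpha>: "\<alpha> \<in> sphere 0 1"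
    have 1: "\<alpha> * cnj \<alpha> = 1" using \<alpha> complex_norm_square[of \<alpha>] by simp
    have "poly (pCons a p) \<alpha> * cnj (poly q \<alpha>)
        = a * cnj (poly q \<alpha>) + cnj b * (\<alpha> * poly p \<alpha>) + (\<alpha> * cnj \<alpha>) * (poly p \<alpha> * cnj (poly q' \<alpha>))"
      by (simp add: q algebra_simps)
    then have "Re (poly (pCons a p) \<alpha> * cnj (poly q \<alpha>))
        = Re (a * cnj (poly q \<alpha>)) + Re (cnj b * (\<alpha> * poly p \<alpha>)) + Re (poly p \<alpha> * cnj (poly q' \<alpha>))"
      unfolding 1 by simp
    also have "Re (a * cnj (poly q \<alpha>)) = Re (cnj a * poly q \<alpha>)" by simp
    finally show "Re (poly (pCons a p) \<alpha> * cnj (poly q \<alpha>))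
        = Re (poly (smult (cnj a) q + smult (cnj b) (pCons 0 p) + r) \<alpha>)"
      using bspec[OF r \<alpha>] by (simp add: algebra_simps)
  qed
qed

text \<open>Products are the non-linear case, settled by 2 Re r Re s = Re (r s + r cnj s).
  Stone-Weierstrass thereby approximates by real parts of holomorphic polynomials.\<close>

lemma real_polynomial_circle:
  fixes p :: "complex \<Rightarrow> real"
  assumes "real_polynomial_function p"
  shows "\<exists>r. \<forall>\<alpha>\<in>sphere 0 1. p \<alpha> = Re (poly r \<alpha>)"
  using assms
proof induction
  case (linear f)
  interpret bounded_linear f by fact
  have "f \<alpha> = Re (poly [:0, Complex (f 1) (- f \<i>):] \<alpha>)" for \<alpha>
  proof -
    have "f \<alpha> = f (Re \<alpha> *\<^sub>R 1 + Im \<alpha> *\<^sub>R \<i>)"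
      by (rule arg_cong[of _ _ f]) (simp add: complex_eq_iff)
    also have "\<dots> = Re \<alpha> * f 1 + Im \<alpha> * f \<i>" by (simp only: add scaleR real_scaleR_def)
    finally show ?thesis by (simp add: mult.commute)
  qed
  then show ?case by blast
next
  case (const c)
  show ?case by (intro exI[of _ "[:complex_of_real c:]"]) simp
next
  case (add f g)
  then obtain r s where "\<forall>\<alpha>\<in>sphere 0 1. f \<alpha> = Re (poly r \<alpha>)" "\<forall>\<alpha>\<in>sphere 0 1. g \<alpha> = Re (poly s \<alpha>)" by blast
  then show ?case by (intro exI[of _ "r + s"]) simp
next
  case (mult f g)
  then obtain r s where rs: "\<forall>\<alpha>\<in>sphere 0 1. f \<alpha> = Re (poly r \<alpha>)" "\<forall>\<alpha>\<in>sphere 0 1. g \<alpha> = Re (poly s \<alpha>)" by blast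
  obtain t where t: "\<forall>\<alpha>\<in>sphere 0 1. Re (poly r \<alpha> * cnj (poly s \<alpha>)) = Re (poly t \<alpha>)"
    using poly_Re_mult_cnj[of r s] ..
  show ?case
  proof (intro exI[of _ "smult (1/2) (r * s + t)"] ballI)
    fix \<alpha> :: complex assume \<alpha>: "\<alpha> \<in> sphere 0 1"
    show "f \<alpha> * g \<alpha> = Re (poly (smult (1/2) (r * s + t)) \<alpha>)"
      using bspec[OF t \<alpha>] bspec[OF rs(1) \<alpha>] bspec[OF rs(2) \<alpha>] by simp
  qed
qed

lemma circle_integral_poly: "(LINT \<alpha>|circle_haar. poly p \<alpha>) = poly p 0"
proof -
  have i: "integrable circle_haar (\<lambda>\<alpha>. coeff p n * \<alpha> ^ n)" for n
    by (intro circle_integrable continuous_intros)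
  have "(LINT \<alpha>|circle_haar. poly p \<alpha>) = (\<Sum>n\<le>degree p. LINT \<alpha>|circle_haar. coeff p n * \<alpha> ^ n)"
    unfolding poly_altdef by (rule Bochner_Integration.integral_sum) (rule i)
  also have "\<dots> = (\<Sum>n\<le>degree p. coeff p n * 0 ^ n)"
  proof (rule sum.cong[OF refl])
    fix n
    show "(LINT \<alpha>|circle_haar. coeff p n * \<alpha> ^ n) = coeff p n * 0 ^ n"
      using circle_integral_hpow[of "int n"] by (simp add: power_0_left)
  qed
  finally show ?thesis by (simp add: poly_altdef)
qed

lemma circle_integral_Re_poly: "(LINT \<alpha>|circle_haar. Re (poly p \<alpha>)) = Re (poly p 0)"
  using integral_bounded_linear[OF bounded_linear_Re circle_integrable[of "poly p"]] circle_integral_poly[of p]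
  by (simp add: continuous_intros)

text \<open>The mean value of \<open>h\<^sup>2\<close> is the nonnegative number \<open>h(0)\<^sup>2\<close>.\<close>

lemma poly_mean_square:
  assumes "Im (poly h 0) = 0"
  shows "(LINT \<alpha>|circle_haar. (cmod (poly h \<alpha>))\<^sup>2) \<le> 2 * (LINT \<alpha>|circle_haar. (Re (poly h \<alpha>))\<^sup>2)"
proof -
  have eq: "(cmod (poly h \<alpha>))\<^sup>2 = 2 * (Re (poly h \<alpha>))\<^sup>2 - Re (poly (h * h) \<alpha>)" for \<alpha>
    unfolding cmod_power2 by (simp add: power2_eq_square)
  have i: "integrable circle_haar (\<lambda>\<alpha>. 2 * (Re (poly h \<alpha>))\<^sup>2)" "integrable circle_haar (\<lambda>\<alpha>. Re (poly (h * h) \<alpha>))"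
    by (intro circle_integrable continuous_intros)+
  have "(LINT \<alpha>|circle_haar. (cmod (poly h \<alpha>))\<^sup>2) = 2 * (LINT \<alpha>|circle_haar. (Re (poly h \<alpha>))\<^sup>2) - Re (poly (h * h) 0)"
    unfolding eq Bochner_Integration.integral_diff[OF i] circle_integral_Re_poly by simp
  moreover have "0 \<le> Re (poly (h * h) 0)" using assms by simp
  ultimately show ?thesis by linarith
qed

text \<open>Distance cut-offs converge boundedly to the indicator of \<open>K\<close>, whose
  integral is 0.\<close>

lemma circle_function_small:
  assumes K: "compact K" "K \<noteq> {}" "K \<in> null_sets circle_haar" and \<delta>: "\<delta> > 0"
  shows "\<exists>\<phi>. continuous_on UNIV \<phi> \<and> (\<forall>\<alpha>. 0 \<le> \<phi> \<alpha> \<and> \<phi> \<alpha> \<le> 1) \<and> (\<forall>\<alpha>\<in>K. \<phi> \<alpha> = (1::real)) \<and>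
    (LINT \<alpha>|circle_haar. \<phi> \<alpha>) < \<delta>"
proof -
  define \<phi> where "\<phi> = (\<lambda>(j::nat) \<alpha>::complex. max 0 (1 - real j * infdist \<alpha> K))"
  have c: "continuous_on S (\<phi> j)" for j S unfolding \<phi>_def by (intro continuous_intros)
  have bd: "0 \<le> \<phi> j \<alpha>" "\<phi> j \<alpha> \<le> 1" for j \<alpha> using infdist_nonneg[of \<alpha> K] by (simp_all add: \<phi>_def)
  have lim: "(\<lambda>j. \<phi> j \<alpha>) \<longlonglongrightarrow> indicator K \<alpha>" for \<alpha>
  proof (cases "\<alpha> \<in> K")
    case True
    then show ?thesis by (simp add: \<phi>_def)
  next
    case False
    then have d: "infdist \<alpha> K > 0"
      using K in_closed_iff_infdist_zero[OF compact_imp_closed[OF K(1)] K(2), of \<alpha>] infdist_nonneg[of \<alpha> K] by linarith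
    obtain n0 where n0: "1 / infdist \<alpha> K < real n0" using reals_Archimedean2 by blast
    have "\<phi> j \<alpha> = 0" if "j \<ge> n0" for j
    proof -
      have "1 / infdist \<alpha> K < real j" using n0 that by linarith
      then show ?thesis using d by (simp add: \<phi>_def divide_less_eq)
    qed
    then have "eventually (\<lambda>j. \<phi> j \<alpha> = 0) sequentially" by (auto simp: eventually_sequentially)
    then show ?thesis using False by (simp add: tendsto_eventually)
  qed
  have "(\<lambda>j. LINT \<alpha>|circle_haar. \<phi> j \<alpha>) \<longlonglongrightarrow> (LINT \<alpha>|circle_haar. indicator K \<alpha>)"
  proof (rule integral_dominated_convergence[where w="\<lambda>_. 1"])
    show "\<phi> j \<in> borel_measurable circle_haar" for j by (rule circle_continuous_measurable[OF c])
    show "(indicator K :: complex \<Rightarrow> real) \<in> borel_measurable circle_haar"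
      using null_setsD2[OF K(3)] by (rule borel_measurable_indicator)
    show "integrable circle_haar (\<lambda>_. 1 :: real)" by (rule circle_integrable) simp
  qed (use lim bd in simp_all)
  moreover have "(LINT \<alpha>|circle_haar. indicator K \<alpha>) = (0::real)"
    by (rule integral_eq_zero_AE) (use AE_not_in[OF K(3)] in \<open>auto elim!: eventually_mono\<close>)
  ultimately have "eventually (\<lambda>j. (LINT \<alpha>|circle_haar. \<phi> j \<alpha>) < \<delta>) sequentially"
    using \<delta> by (auto intro: order_tendstoD)
  then obtain j where "(LINT \<alpha>|circle_haar. \<phi> j \<alpha>) < \<delta>" by (auto simp: eventually_sequentially)
  moreover have "\<forall>\<alpha>\<in>K. \<phi> j \<alpha> = 1" by (simp add: \<phi>_def)
  ultimately show ?thesis using c bd by blast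
qed

text \<open>Stone-Weierstrass for \<phi> + \<delta> leaves the approximating real part between
  \<phi> and \<phi> + 2 \<delta>, so it is nonnegative and at least 1 on \<open>K\<close> before
  scaling by \<open>L\<close>; removing the imaginary constant makes \<open>poly_mean_square\<close>
  applicable.\<close>

lemma peak_polynomial:
  assumes K: "compact K" "K \<in> null_sets circle_haar" and L: "L > 0" and e: "e > 0"
  shows "\<exists>h. (\<forall>\<alpha>\<in>sphere 0 1. 0 \<le> Re (poly h \<alpha>)) \<and> (\<forall>\<alpha>\<in>K. L \<le> Re (poly h \<alpha>)) \<and>
    (LINT \<alpha>|circle_haar. (cmod (poly h \<alpha>))\<^sup>2) \<le> e \<and> cmod (poly h 0) \<le> e"
proof (cases "K = {}")
  case True
  then show ?thesis using e by (intro exI[of _ 0]) simp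
next
  case False
  \<comment> \<open>The value at 0 is at most 3 L \<delta>, and the mean square at most twice 9 L^2
    \<delta>; the minimum with 1 ensures that q is at most 3.\<close>
  define \<delta> where "\<delta> = min 1 (e / (18 * L\<^sup>2 + 3 * L))"
  have den: "18 * L\<^sup>2 + 3 * L > 0" using L by (intro add_nonneg_pos) auto
  have \<delta>: "\<delta> > 0" "\<delta> \<le> 1" using e den by (simp_all add: \<delta>_def)
  have "\<delta> \<le> e / (18 * L\<^sup>2 + 3 * L)" by (simp add: \<delta>_def)
  then have "\<delta> * (18 * L\<^sup>2 + 3 * L) \<le> e" unfolding pos_le_divide_eq[OF den] .
  moreover have "0 \<le> \<delta> * (18 * L\<^sup>2)" "0 \<le> \<delta> * (3 * L)" using \<delta> L by simp_all
  ultimately have e2: "18 * L\<^sup>2 * \<delta> \<le> e" "3 * L * \<delta> \<le> e" by (simp_all add: algebra_simps)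
  obtain \<phi> :: "complex \<Rightarrow> real" where \<phi>: "continuous_on UNIV \<phi>" "\<And>\<alpha>. 0 \<le> \<phi> \<alpha>" "\<And>\<alpha>. \<phi> \<alpha> \<le> 1"
    "\<And>\<alpha>. \<alpha> \<in> K \<Longrightarrow> \<phi> \<alpha> = 1" "(LINT \<alpha>|circle_haar. \<phi> \<alpha>) < \<delta>"
    using circle_function_small[OF K(1) False K(2) \<delta>(1)] by blast
  have "continuous_on (sphere 0 1) (\<lambda>\<alpha>. \<phi> \<alpha> + \<delta>)"
    by (intro continuous_intros continuous_on_subset[OF \<phi>(1)]) simp
  from Stone_Weierstrass_real_polynomial_function[OF compact_sphere this \<delta>(1)]
  obtain q where q: "real_polynomial_function q" "\<And>\<alpha>. \<alpha> \<in> sphere 0 1 \<Longrightarrow> \<bar>\<phi> \<alpha> + \<delta> - q \<alpha>\<bar> < \<delta>" by metis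
  obtain r where r: "\<And>\<alpha>. \<alpha> \<in> sphere 0 1 \<Longrightarrow> q \<alpha> = Re (poly r \<alpha>)" using real_polynomial_circle[OF q(1)] by blast
  define h where "h = smult (of_real L) (r - [:\<i> * of_real (Im (poly r 0)):])"
  have Reh: "Re (poly h \<alpha>) = L * q \<alpha>" if "\<alpha> \<in> sphere 0 1" for \<alpha> using r[OF that] by (simp add: h_def)
  have Imh: "Im (poly h 0) = 0" by (simp add: h_def)
  have qb: "\<phi> \<alpha> \<le> q \<alpha>" "q \<alpha> \<le> \<phi> \<alpha> + 2 * \<delta>" if "\<alpha> \<in> sphere 0 1" for \<alpha> using q(2)[OF that] by linarith+
  have K1: "K \<subseteq> sphere 0 1" using sets.sets_into_space[OF null_setsD2[OF K(2)]] by simp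
  have i\<phi>: "integrable circle_haar \<phi>" by (intro circle_integrable continuous_on_subset[OF \<phi>(1)]) simp
  have iq: "integrable circle_haar (\<lambda>\<alpha>. Re (poly h \<alpha>))" "integrable circle_haar (\<lambda>\<alpha>. (Re (poly h \<alpha>))\<^sup>2)"
    by (intro circle_integrable continuous_intros)+
  have i2: "integrable circle_haar (\<lambda>\<alpha>. c * (\<phi> \<alpha> + 2 * \<delta>))" for c using i\<phi> circle_integrable[of "\<lambda>_. 2 * \<delta>"] by simp
  have int2: "(LINT \<alpha>|circle_haar. c * (\<phi> \<alpha> + 2 * \<delta>)) \<le> c * (3 * \<delta>)" if "c \<ge> 0" for c
  proof -
    have "(LINT \<alpha>|circle_haar. c * (\<phi> \<alpha> + 2 * \<delta>)) = c * ((LINT \<alpha>|circle_haar. \<phi> \<alpha>) + 2 * \<delta>)"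
      using i\<phi> circle_integrable[of "\<lambda>_. 2 * \<delta>"] by simp
    also have "\<dots> \<le> c * (3 * \<delta>)" using \<phi>(5) that by (intro mult_left_mono) auto
    finally show ?thesis .
  qed
  have nonneg: "0 \<le> Re (poly h \<alpha>)" if "\<alpha> \<in> sphere 0 1" for \<alpha>
    unfolding Reh[OF that] using L order_trans[OF \<phi>(2) qb(1)[OF that]] by simp
  have "0 \<le> Re (poly h 0)"
    unfolding circle_integral_Re_poly[symmetric]
    by (rule Bochner_Integration.integral_nonneg) (use nonneg in simp)
  moreover have "Re (poly h 0) \<le> (LINT \<alpha>|circle_haar. L * (\<phi> \<alpha> + 2 * \<delta>))"
    unfolding circle_integral_Re_poly[symmetric]
    by (rule integral_mono[OF iq(1) i2]) (use Reh qb L in \<open>simp add: mult_left_mono\<close>)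
  ultimately have h0: "cmod (poly h 0) \<le> e"
  proof -
    assume *: "0 \<le> Re (poly h 0)" "Re (poly h 0) \<le> (LINT \<alpha>|circle_haar. L * (\<phi> \<alpha> + 2 * \<delta>))"
    have "(LINT \<alpha>|circle_haar. L * (\<phi> \<alpha> + 2 * \<delta>)) \<le> L * (3 * \<delta>)" using L by (intro int2) simp
    then have "Re (poly h 0) \<le> e" using *(2) e2(2) by (simp only: mult_ac)
    then show ?thesis using *(1) Imh by (simp add: cmod_def)
  qed
  have "(LINT \<alpha>|circle_haar. (Re (poly h \<alpha>))\<^sup>2) \<le> (LINT \<alpha>|circle_haar. 3 * L\<^sup>2 * (\<phi> \<alpha> + 2 * \<delta>))"
  proof (rule integral_mono[OF iq(2) i2])
    fix \<alpha> assume "\<alpha> \<in> space circle_haar"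
    then have \<alpha>: "\<alpha> \<in> sphere 0 1" by simp
    have "0 \<le> q \<alpha>" "q \<alpha> \<le> 3" using qb[OF \<alpha>] \<phi>(2,3)[of \<alpha>] \<delta>(2) by linarith+
    then have "q \<alpha> * q \<alpha> \<le> 3 * (\<phi> \<alpha> + 2 * \<delta>)" using qb[OF \<alpha>] by (intro mult_mono) auto
    then have "L\<^sup>2 * (q \<alpha> * q \<alpha>) \<le> L\<^sup>2 * (3 * (\<phi> \<alpha> + 2 * \<delta>))" by (rule mult_left_mono) simp
    then show "(Re (poly h \<alpha>))\<^sup>2 \<le> 3 * L\<^sup>2 * (\<phi> \<alpha> + 2 * \<delta>)"
      unfolding Reh[OF \<alpha>] power_mult_distrib by (simp add: power2_eq_square mult_ac)
  qed
  also have "\<dots> \<le> 9 * L\<^sup>2 * \<delta>" using int2[of "3 * L\<^sup>2"] by simp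
  finally have "(LINT \<alpha>|circle_haar. (cmod (poly h \<alpha>))\<^sup>2) \<le> e" using poly_mean_square[OF Imh] e2(1) by linarith
  moreover have "L \<le> Re (poly h \<alpha>)" if "\<alpha> \<in> K" for \<alpha>
  proof -
    have s: "\<alpha> \<in> sphere 0 1" using that K1 by blast
    show ?thesis unfolding Reh[OF s] using qb(1)[OF s] \<phi>(4)[OF that] L by simp
  qed
  ultimately show ?thesis using h0 nonneg by blast
qed

section \<open>Singular parts and peak functions\<close>

text \<open>Exhaustion by null sets whose \<open>N\<close>-measures approach the supremum. Their
  union carries the singular part of \<open>N\<close>, as in the Lebesgue decomposition.\<close>

lemma exists_maximal_null_set:
  assumes N: "finite_measure N" and sets: "sets N = sets M"
  shows "\<exists>A\<in>null_sets M. \<forall>E\<in>null_sets M. measure N (E - A) = 0"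
proof -
  interpret N: finite_measure N by fact
  define s where "s = (SUP E\<in>null_sets M. measure N E)"
  have bdd: "bdd_above (measure N ` null_sets M)"
    by (intro bdd_aboveI[of _ "measure N (space N)"]) (auto simp: N.bounded_measure)
  have le: "measure N E \<le> s" if "E \<in> null_sets M" for E unfolding s_def by (rule cSUP_upper[OF that bdd])
  have ne: "null_sets M \<noteq> {}" using null_sets.empty_sets[of M] by blast
  have "\<exists>E\<in>null_sets M. s - 1 / real (Suc n) < measure N E" for n
    using less_cSUP_iff[OF ne bdd, of "s - 1 / real (Suc n)"] by (simp add: s_def)
  then obtain E where E: "\<And>n. E n \<in> null_sets M" "\<And>n. s - 1 / real (Suc n) < measure N (E n)" by metis
  define A where "A = (\<Union>n. E n)"
  have A: "A \<in> null_sets M" unfolding A_def by (rule null_sets_UN) (rule E)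
  have AN: "A \<in> sets N" using null_setsD2[OF A] sets by simp
  have "s \<le> measure N A"
  proof (rule field_le_epsilon)
    fix e :: real assume "0 < e"
    then obtain n where n: "1 / real (Suc n) < e" using nat_approx_posE by blast
    have "measure N (E n) \<le> measure N A"
      by (rule N.finite_measure_mono[OF _ AN]) (auto simp: A_def)
    then show "s \<le> measure N A + e" using E(2)[of n] n by linarith
  qed
  have "measure N (F - A) = 0" if F: "F \<in> null_sets M" for F
  proof -
    have FN: "F \<in> sets N" using null_setsD2[OF F] sets by simp
    have "A \<union> F \<in> null_sets M" using A F by (rule null_sets.Un)
    then have "measure N (A \<union> F) \<le> measure N A" using order_trans[OF le \<open>s \<le> measure N A\<close>] by blast
    moreover have "measure N (A \<union> F) = measure N A + measure N (F - A)"
      using N.finite_measure_Union[of A "F - A"] AN FN by (simp add: Un_Diff_cancel)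
    ultimately show ?thesis using measure_nonneg[of N "F - A"] by linarith
  qed
  then show ?thesis using A by blast
qed

text \<open>Inner regularity for Borel measures on the whole space, applied to the image of
  \<open>N\<close> under the inclusion.\<close>

lemma compact_inner_approximation:
  fixes S :: "'a::{second_countable_topology, complete_space} set"
  assumes N: "finite_measure N" "sets N = sets (borel_on S)" and S: "closed S" and B: "B \<in> sets N" and e: "e > 0"
  shows "\<exists>K. compact K \<and> K \<subseteq> B \<and> measure N (B - K) < e"
proof (cases "measure N B < e")
  case True
  then show ?thesis by (intro exI[of _ "{}"]) simp
next
  case False
  interpret N: finite_measure N by fact
  have sp: "space N = S" using sets_eq_imp_space_eq[OF N(2)] by simp
  define M where "M = distr N borel (\<lambda>x. x)"
  have ident: "(\<lambda>x. x) \<in> measurable N borel"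
    unfolding measurable_cong_sets[OF N(2) refl] by (rule continuous_imp_borel_on) simp
  have eM: "emeasure M U = emeasure N (U \<inter> S)" if "U \<in> sets borel" for U
    unfolding M_def using that by (subst emeasure_distr[OF ident]) (simp_all add: sp)
  have Bb: "B \<in> sets borel" "B \<subseteq> S"
    using B sets.sets_into_space[OF B] S sp unfolding N(2) by (auto simp: sets_restrict_space)
  have fin: "emeasure M (space M) \<noteq> \<infinity>" by (simp add: M_def emeasure_distr[OF ident])
  have MB: "emeasure M B = ennreal (measure N B)"
    using eM[OF Bb(1)] Bb(2) by (simp add: Int_absorb2 N.emeasure_eq_measure)
  have "ennreal (measure N B - e) < emeasure M B" unfolding MB using False e by (intro ennreal_lessI) auto
  also have "emeasure M B = (SUP K\<in>{K. K \<subseteq> B \<and> compact K}. emeasure M K)"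
    by (rule inner_regular[OF _ fin Bb(1)]) (simp add: M_def)
  finally obtain K where K: "K \<subseteq> B" "compact K" "ennreal (measure N B - e) < emeasure M K"
    unfolding less_SUP_iff by blast
  have KN: "K \<in> sets N" using K(1,2) Bb(2) unfolding N(2)
    by (auto simp: sets_restrict_space intro!: image_eqI[of _ _ K] borel_compact)
  have "emeasure M K = ennreal (measure N K)"
    using eM[OF borel_compact[OF K(2)]] K(1) Bb(2) by (simp add: Int_absorb2 N.emeasure_eq_measure order_trans)
  then have "measure N B - e < measure N K" using K(3) False by (simp add: ennreal_less_iff)
  then have "measure N (B - K) < e" using N.finite_measure_Diff[OF B KN K(1)] by simp
  then show ?thesis using K by blast
qed

lemma unimodular_moment_poly:
  assumes N: "finite_measure N" and w: "w \<in> borel_measurable N" "\<And>x. x \<in> space N \<Longrightarrow> cmod (w x) \<le> B"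
    and e: "e \<in> borel_measurable N" "\<And>x. x \<in> space N \<Longrightarrow> cmod (e x) = 1"
    and zero: "\<And>n. (LINT x|N. e x ^ Suc n * w x) = 0"
  shows "(LINT x|N. poly p (e x) * w x) = poly p 0 * (LINT x|N. w x)"
proof -
  interpret N: finite_measure N by fact
  have i: "integrable N (\<lambda>x. e x ^ n * w x)" for n
    by (rule N.integrable_const_bound[of _ B])
      (use w e in \<open>auto intro!: AE_I2 borel_measurable_times borel_measurable_power simp: norm_mult norm_power\<close>)
  have m: "(LINT x|N. e x ^ n * w x) = 0 ^ n * (LINT x|N. w x)" for n
    using zero[of "n - 1"] by (cases n) simp_all
  have "(LINT x|N. poly p (e x) * w x) = (LINT x|N. (\<Sum>n\<le>degree p. coeff p n * (e x ^ n * w x)))"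
    unfolding poly_altdef sum_distrib_right by (simp only: mult.assoc)
  also have "\<dots> = (\<Sum>n\<le>degree p. LINT x|N. coeff p n * (e x ^ n * w x))"
    by (rule Bochner_Integration.integral_sum) (use i in simp)
  also have "\<dots> = (\<Sum>n\<le>degree p. coeff p n * 0 ^ n) * (LINT x|N. w x)"
    unfolding integral_mult_right_zero m sum_distrib_right by (simp only: mult.assoc)
  finally show ?thesis by (simp add: poly_altdef)
qed

text \<open>Integration against \<open>w\<close> acts on polynomials in \<open>e\<close> like
  evaluation at 0, up to the factor of the mean of \<open>w\<close>, and the exponential series
  preserves this. Division by a bound M of |p| makes the powers bounded by 1 and leaves the summable
  coefficients M^j / j!.\<close>

lemma unimodular_moment_exp_poly:
  assumes N: "finite_measure N" and w: "w \<in> borel_measurable N" "\<And>x. x \<in> space N \<Longrightarrow> cmod (w x) \<le> B"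
    and e: "e \<in> borel_measurable N" "\<And>x. x \<in> space N \<Longrightarrow> cmod (e x) = 1"
    and zero: "\<And>n. (LINT x|N. e x ^ Suc n * w x) = 0"
  shows "(LINT x|N. exp (poly p (e x)) * w x) = exp (poly p 0) * (LINT x|N. w x)"
proof -
  have "bounded (poly p ` sphere 0 1)"
    by (intro compact_imp_bounded compact_continuous_image continuous_intros compact_sphere)
  then obtain M where M: "M > 0" "\<And>\<alpha>. \<alpha> \<in> sphere 0 1 \<Longrightarrow> cmod (poly p \<alpha>) \<le> M"
    unfolding bounded_pos by blast
  define c where "c = (\<lambda>j. complex_of_real (M ^ j /\<^sub>R fact j))"
  define \<psi> where "\<psi> = (\<lambda>j x. (poly p (e x) / of_real M) ^ j * w x)"
  have c: "summable (\<lambda>j. norm (c j))"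
    using summable_exp_generic[of M] M(1) by (simp add: c_def norm_mult norm_power norm_inverse)
  have pm: "(\<lambda>x. poly p (e x)) \<in> borel_measurable N"
    by (rule measurable_compose[OF e(1) borel_measurable_continuous_onI]) (intro continuous_intros)
  have \<psi>: "\<psi> j \<in> borel_measurable N" for j
    unfolding \<psi>_def by (intro borel_measurable_times borel_measurable_power borel_measurable_divide pm w(1)) simp
  have \<psi>b: "cmod (\<psi> j x) \<le> B" if x: "x \<in> space N" for j x
  proof -
    have "cmod (poly p (e x) / of_real M) \<le> 1" using M(1) M(2)[of "e x"] e(2)[OF x] by (simp add: norm_divide)
    then have "cmod (poly p (e x) / of_real M) ^ j \<le> 1" by (simp add: power_le_one)
    then have "cmod (\<psi> j x) \<le> 1 * cmod (w x)" unfolding \<psi>_def norm_mult norm_power by (rule mult_right_mono) simp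
    then show ?thesis using w(2)[OF x] by simp
  qed
  have summand: "c j * \<psi> j x = poly p (e x) ^ j /\<^sub>R fact j * w x" for j x
    using M(1) by (simp add: c_def \<psi>_def power_divide scaleR_conv_of_real)
  have "exp (poly p (e x)) * w x = (\<Sum>j. c j * \<psi> j x)" for x
    unfolding summand exp_def by (rule suminf_mult2[OF summable_exp_generic])
  then have "(LINT x|N. exp (poly p (e x)) * w x) = (LINT x|N. (\<Sum>j. c j * \<psi> j x))" by simp
  also have "\<dots> = (\<Sum>j. c j * (LINT x|N. \<psi> j x))"
    by (rule integral_bounded_suminf(1)[OF N c \<psi> \<psi>b])
  also have "\<dots> = (\<Sum>j. poly p 0 ^ j /\<^sub>R fact j * (LINT x|N. w x))"
  proof (rule suminf_cong)
    fix j
    have "(LINT x|N. poly (p ^ j) (e x) * w x) = poly (p ^ j) 0 * (LINT x|N. w x)"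
      by (rule unimodular_moment_poly[OF N w e zero])
    moreover have "\<psi> j x = inverse (of_real M ^ j) * (poly (p ^ j) (e x) * w x)" for x
      by (simp add: \<psi>_def poly_power divide_inverse power_mult_distrib power_inverse)
    ultimately have "(LINT x|N. \<psi> j x) = inverse (of_real M ^ j) * (poly p 0 ^ j * (LINT x|N. w x))"
      by (simp only: integral_mult_right_zero poly_power)
    then show "c j * (LINT x|N. \<psi> j x) = poly p 0 ^ j /\<^sub>R fact j * (LINT x|N. w x)"
      using M(1) by (simp add: c_def scaleR_conv_of_real)
  qed
  also have "\<dots> = exp (poly p 0) * (LINT x|N. w x)"
    unfolding exp_def by (rule suminf_mult2[OF summable_exp_generic, symmetric])
  finally show ?thesis .
qed

text \<open>The series of the squares has finite integral, so it converges almost everywhere and its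
  terms tend to 0.\<close>

lemma summable_square_integrals_AE:
  fixes g :: "nat \<Rightarrow> complex \<Rightarrow> complex"
  assumes g: "\<And>n. continuous_on (sphere 0 1) (g n)"
    and le: "\<And>n. (LINT \<alpha>|circle_haar. (cmod (g n \<alpha>))\<^sup>2) \<le> (1/2) ^ n"
  shows "AE \<alpha> in circle_haar. (\<lambda>n. g n \<alpha>) \<longlonglongrightarrow> 0"
proof -
  have m: "(\<lambda>\<alpha>. (cmod (g n \<alpha>))\<^sup>2) \<in> borel_measurable circle_haar" for n
    by (intro circle_continuous_measurable continuous_intros g)
  have i: "integrable circle_haar (\<lambda>\<alpha>. (cmod (g n \<alpha>))\<^sup>2)" for n
    by (intro circle_integrable continuous_intros g)
  have "(\<integral>\<^sup>+\<alpha>. (\<Sum>n. ennreal ((cmod (g n \<alpha>))\<^sup>2)) \<partial>circle_haar) = (\<Sum>n. \<integral>\<^sup>+\<alpha>. ennreal ((cmod (g n \<alpha>))\<^sup>2) \<partial>circle_haar)"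
    by (rule nn_integral_suminf) (use m in measurable)
  also have "\<dots> = (\<Sum>n. ennreal (LINT \<alpha>|circle_haar. (cmod (g n \<alpha>))\<^sup>2))"
    by (intro suminf_cong nn_integral_eq_integral i AE_I2) simp
  also have "\<dots> \<le> (\<Sum>n. ennreal ((1/2) ^ n))"
    by (intro suminf_le ennreal_leI le) auto
  also have "\<dots> = ennreal (\<Sum>n. (1/2) ^ n)"
    by (rule suminf_ennreal2) (simp_all add: summable_geometric)
  finally have "(\<integral>\<^sup>+\<alpha>. (\<Sum>n. ennreal ((cmod (g n \<alpha>))\<^sup>2)) \<partial>circle_haar) \<noteq> \<infinity>"
    unfolding infinity_ennreal_def by (rule neq_top_trans[OF ennreal_neq_top])
  then have "AE \<alpha> in circle_haar. (\<Sum>n. ennreal ((cmod (g n \<alpha>))\<^sup>2)) \<noteq> \<infinity>"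
    by (intro nn_integral_PInf_AE) (use m in measurable)
  then show ?thesis
  proof eventually_elim
    case (elim \<alpha>)
    then have "summable (\<lambda>n. (cmod (g n \<alpha>))\<^sup>2)" by (intro summable_suminf_not_top) auto
    then have "(\<lambda>n. (cmod (g n \<alpha>))\<^sup>2) \<longlonglongrightarrow> 0" by (rule summable_LIMSEQ_zero)
    then have "(\<lambda>n. sqrt ((cmod (g n \<alpha>))\<^sup>2)) \<longlonglongrightarrow> sqrt 0" by (rule tendsto_real_sqrt)
    then show ?case by (simp add: tendsto_norm_zero_iff)
  qed
qed

text \<open>For peak polynomials h the functions exp (-h) have modulus at most 1. They tend to 0 on
  an exhaustion of \<open>A\<close> by compact sets, as Re h grows there, and to 1 where h tends to
  0, which is Haar-almost everywhere; maximality of \<open>A\<close> makes the exceptional set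
  negligible for \<open>V\<close> outside \<open>A\<close>.\<close>

lemma peak_sequence:
  assumes V: "finite_measure V" "sets V = sets circle_haar" and A: "A \<in> null_sets circle_haar"
    and max: "\<And>E. E \<in> null_sets circle_haar \<Longrightarrow> measure V (E - A) = 0"
  shows "\<exists>p. (\<forall>n. \<forall>\<alpha>\<in>sphere 0 1. cmod (exp (poly (p n) \<alpha>)) \<le> 1) \<and> (\<lambda>n. poly (p n) 0) \<longlonglongrightarrow> 0 \<and>
    (AE \<alpha> in V. (\<lambda>n::nat. exp (poly (p n) \<alpha>)) \<longlonglongrightarrow> (if \<alpha> \<in> A then 0 else 1))"
proof -
  interpret V: finite_measure V by fact
  have spV: "space V = sphere 0 1" using sets_eq_imp_space_eq[OF V(2)] by simp
  have AV: "A \<in> sets V" using null_setsD2[OF A] V(2) by simp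
  have Vs: "sets V = sets (borel_on (sphere 0 1))" using V(2) by simp
  have "\<exists>K. compact K \<and> K \<subseteq> A \<and> measure V (A - K) < 1 / real (Suc n)" for n
    by (rule compact_inner_approximation[OF V(1) Vs closed_sphere AV]) simp
  then obtain K where K: "\<And>n. compact (K n)" "\<And>n. K n \<subseteq> A" "\<And>n. measure V (A - K n) < 1 / real (Suc n)" by metis
  \<comment> \<open>Increasing unions, so that a point of one \<open>K i\<close> stays in all later
    \<open>J n\<close>, where Re h exceeds n.\<close>
  define J where "J = (\<lambda>n. \<Union>i\<le>n. K i)"
  have cJ: "compact (J n)" for n unfolding J_def by (intro compact_UN) (use K in auto)
  have Asp: "A \<subseteq> sphere 0 1" using sets.sets_into_space[OF AV] spV by simp
  have JA: "J n \<subseteq> A" for n using K(2) by (auto simp: J_def)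
  have Jm: "J n \<in> sets circle_haar" for n
    using borel_compact[OF cJ[of n]] order_trans[OF JA Asp] by (auto simp: sets_restrict_space intro!: image_eqI[of _ _ "J n"])
  have J0: "J n \<in> null_sets circle_haar" for n by (rule null_sets_subset[OF A Jm JA])
  have "\<exists>h. (\<forall>\<alpha>\<in>sphere 0 1. 0 \<le> Re (poly h \<alpha>)) \<and> (\<forall>\<alpha>\<in>J n. real (Suc n) \<le> Re (poly h \<alpha>)) \<and>
    (LINT \<alpha>|circle_haar. (cmod (poly h \<alpha>))\<^sup>2) \<le> (1/2) ^ n \<and> cmod (poly h 0) \<le> (1/2) ^ n" for n
    by (rule peak_polynomial[OF cJ J0]) simp_all
  then obtain h where h: "\<And>n \<alpha>. \<alpha> \<in> sphere 0 1 \<Longrightarrow> 0 \<le> Re (poly (h n) \<alpha>)"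
    "\<And>n \<alpha>. \<alpha> \<in> J n \<Longrightarrow> real (Suc n) \<le> Re (poly (h n) \<alpha>)"
    "\<And>n. (LINT \<alpha>|circle_haar. (cmod (poly (h n) \<alpha>))\<^sup>2) \<le> (1/2) ^ n" "\<And>n. cmod (poly (h n) 0) \<le> (1/2) ^ n"
    by metis
  have "AE \<alpha> in circle_haar. (\<lambda>n. poly (h n) \<alpha>) \<longlonglongrightarrow> 0"
    by (rule summable_square_integrals_AE) (use h(3) in \<open>auto intro!: continuous_intros\<close>)
  then obtain E where E: "E \<in> null_sets circle_haar" "\<And>\<alpha>. \<alpha> \<in> sphere 0 1 - E \<Longrightarrow> (\<lambda>n. poly (h n) \<alpha>) \<longlonglongrightarrow> 0"
    by (auto elim!: AE_E3)
  have EV: "E - A \<in> null_sets V"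
    using max[OF E(1)] null_setsD2[OF E(1)] AV V(2) by (auto simp: null_sets_def V.emeasure_eq_measure)
  have "A - (\<Union>i. K i) \<in> null_sets V"
  proof -
    have Km: "K i \<in> sets V" for i
      using borel_compact[OF K(1)[of i]] order_trans[OF K(2) Asp] unfolding Vs by (auto simp: sets_restrict_space intro!: image_eqI[of _ _ "K i"])
    have "measure V (A - (\<Union>i. K i)) \<le> 0"
    proof (rule field_le_epsilon)
      fix e :: real assume "0 < e"
      then obtain n where n: "1 / real (Suc n) < e" using nat_approx_posE by blast
      have "measure V (A - (\<Union>i. K i)) \<le> measure V (A - K n)"
        by (rule V.finite_measure_mono) (use AV Km in auto)
      then show "measure V (A - (\<Union>i. K i)) \<le> 0 + e" using K(3)[of n] n by linarith
    qed
    then have "measure V (A - (\<Union>i. K i)) = 0" using measure_nonneg by (rule antisym)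
    then show ?thesis using AV Km by (auto simp: null_sets_def V.emeasure_eq_measure)
  qed
  from AE_not_in[OF this] AE_not_in[OF EV]
  have "AE \<alpha> in V. (\<lambda>n::nat. exp (poly (- h n) \<alpha>)) \<longlonglongrightarrow> (if \<alpha> \<in> A then 0 else 1)"
    using AE_space
  proof eventually_elim
    case (elim \<alpha>)
    show ?case
    proof (cases "\<alpha> \<in> A")
      case True
      then obtain i where i: "\<alpha> \<in> K i" using elim(1) by blast
      have "(\<lambda>n. exp (poly (- h n) \<alpha>)) \<longlonglongrightarrow> 0"
      proof (rule Lim_null_comparison)
        show "eventually (\<lambda>n. norm (exp (poly (- h n) \<alpha>)) \<le> exp (- real (Suc n))) sequentially"
          unfolding eventually_sequentially
        proof (intro exI[of _ i] allI impI)
          fix n assume "i \<le> n"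
          then have "\<alpha> \<in> J n" using i by (auto simp: J_def)
          from h(2)[OF this] show "norm (exp (poly (- h n) \<alpha>)) \<le> exp (- real (Suc n))" by simp
        qed
        show "(\<lambda>n. exp (- real (Suc n))) \<longlonglongrightarrow> 0" by real_asymp
      qed
      then show ?thesis using True by simp
    next
      case False
      then have "(\<lambda>n. poly (h n) \<alpha>) \<longlonglongrightarrow> 0" using elim(2,3) spV by (intro E(2)) auto
      then have "(\<lambda>n. exp (- poly (h n) \<alpha>)) \<longlonglongrightarrow> exp (- 0)" by (intro tendsto_intros)
      then show ?thesis using False by simp
    qed
  qed
  moreover have "(\<lambda>n. poly (- h n) 0) \<longlonglongrightarrow> 0"
  proof (rule Lim_null_comparison)
    show "eventually (\<lambda>n. norm (poly (- h n) 0) \<le> (1/2) ^ n) sequentially" using h(4) by simp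
    show "(\<lambda>n. (1/2) ^ n :: real) \<longlonglongrightarrow> 0" by real_asymp
  qed
  moreover have "\<forall>n. \<forall>\<alpha>\<in>sphere 0 1. cmod (exp (poly (- h n) \<alpha>)) \<le> 1" using h(1) by simp
  ultimately show ?thesis by (intro exI[of _ "\<lambda>n. - h n"] conjI)
qed

text \<open>The peak functions tend to 1 at the origin, so in the limit the integral of
  \<open>w\<close> over the part outside \<open>A\<close> equals the full integral.\<close>

lemma F_and_M_Riesz_mean:
  assumes N: "finite_measure N" and w: "w \<in> borel_measurable N" "\<And>x. x \<in> space N \<Longrightarrow> cmod (w x) \<le> B"
    and e: "e \<in> measurable N circle_haar"
    and zero: "\<And>n. (LINT x|N. e x ^ Suc n * w x) = 0"
    and A: "A \<in> null_sets circle_haar"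
    and max: "\<And>E. E \<in> null_sets circle_haar \<Longrightarrow> measure (distr N circle_haar e) (E - A) = 0"
  shows "(LINT x|N. indicator A (e x) * w x) = 0"
proof -
  interpret N: finite_measure N by fact
  have eb: "e \<in> borel_measurable N"
    using measurable_compose[OF e circle_continuous_measurable[OF continuous_on_id]] by simp
  have e1: "cmod (e x) = 1" if "x \<in> space N" for x using measurable_space[OF e that] by simp
  obtain p where p: "\<And>n \<alpha>. \<alpha> \<in> sphere 0 1 \<Longrightarrow> cmod (exp (poly (p n) \<alpha>)) \<le> 1" "(\<lambda>n. poly (p n) 0) \<longlonglongrightarrow> 0"
    "AE \<alpha> in distr N circle_haar e. (\<lambda>n::nat. exp (poly (p n) \<alpha>)) \<longlonglongrightarrow> (if \<alpha> \<in> A then 0 else 1)"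
    using peak_sequence[OF N.finite_measure_distr[OF e] sets_distr A max] by blast
  have iw: "integrable N w" by (rule N.integrable_const_bound[of _ B]) (use w in \<open>auto intro!: AE_I2\<close>)
  have Am: "(\<lambda>x. indicator A (e x) :: complex) \<in> borel_measurable N"
    by (rule measurable_compose[OF e borel_measurable_indicator[OF null_setsD2[OF A]]])
  have iA: "integrable N (\<lambda>x. indicator A (e x) * w x)"
    by (rule integrable_bounded_mult[OF iw Am, of 1]) (simp add: indicator_def)
  have AE: "AE x in N. (\<lambda>n::nat. exp (poly (p n) (e x))) \<longlonglongrightarrow> (if e x \<in> A then 0 else 1)"
    by (rule AE_distrD[OF e p(3)])
  have pm: "(\<lambda>x. exp (poly (p n) (e x))) \<in> borel_measurable N" for n
    by (rule measurable_compose[OF eb borel_measurable_continuous_onI]) (intro continuous_intros)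
  have "(\<lambda>n. LINT x|N. exp (poly (p n) (e x)) * w x) \<longlonglongrightarrow> (LINT x|N. (1 - indicator A (e x)) * w x)"
  proof (rule integral_dominated_convergence[where w="\<lambda>_. B"])
    show "(\<lambda>x. (1 - indicator A (e x)) * w x) \<in> borel_measurable N"
      by (intro borel_measurable_times borel_measurable_diff Am w(1)) simp
    show "(\<lambda>x. exp (poly (p n) (e x)) * w x) \<in> borel_measurable N" for n
      by (intro borel_measurable_times pm w(1))
    show "integrable N (\<lambda>_. B)" by simp
    show "AE x in N. (\<lambda>n. exp (poly (p n) (e x)) * w x) \<longlonglongrightarrow> (1 - indicator A (e x)) * w x"
      using AE
    proof eventually_elim
      case (elim x)
      then show ?case using tendsto_mult[OF elim tendsto_const[of "w x"]] by (simp add: indicator_def split: if_splits)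
    qed
    show "AE x in N. norm (exp (poly (p n) (e x)) * w x) \<le> B" for n
    proof (rule AE_I2)
      fix x assume x: "x \<in> space N"
      have "cmod (exp (poly (p n) (e x))) * cmod (w x) \<le> 1 * cmod (w x)"
        by (rule mult_right_mono[OF p(1)]) (use e1[OF x] in simp_all)
      then show "norm (exp (poly (p n) (e x)) * w x) \<le> B" unfolding norm_mult using w(2)[OF x] by simp
    qed
  qed
  moreover have "(LINT x|N. exp (poly (p n) (e x)) * w x) = exp (poly (p n) 0) * (LINT x|N. w x)" for n
    by (rule unimodular_moment_exp_poly[OF N w eb e1 zero])
  moreover have "(\<lambda>n. exp (poly (p n) 0) * (LINT x|N. w x)) \<longlonglongrightarrow> exp 0 * (LINT x|N. w x)"
    by (intro tendsto_intros p(2))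
  ultimately have "(LINT x|N. (1 - indicator A (e x)) * w x) = (LINT x|N. w x)"
    using LIMSEQ_unique by fastforce
  then show ?thesis unfolding left_diff_distrib mult_1_left Bochner_Integration.integral_diff[OF iw iA] by simp
qed

text \<open>One maximal null set serves all degrees. The mean lemma for shifted densities kills the
  nonnegative moments of the part over \<open>A'\<close>; once these vanish, that part itself may be
  shifted downwards, degree by degree.\<close>

lemma F_and_M_Riesz:
  assumes N: "finite_measure N" and v: "v \<in> borel_measurable N" "\<And>x. x \<in> space N \<Longrightarrow> cmod (v x) \<le> B"
    and e: "e \<in> measurable N circle_haar"
    and zero: "\<And>n. (LINT x|N. e x ^ Suc n * v x) = 0"
    and A: "A \<in> null_sets circle_haar"
  shows "\<exists>A'\<in>null_sets circle_haar. A \<subseteq> A' \<and> (\<forall>k. (LINT x|N. hpow k (e x) * (indicator A' (e x) * v x)) = 0)"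
proof -
  interpret N: finite_measure N by fact
  obtain A0 where A0: "A0 \<in> null_sets circle_haar"
    "\<And>E. E \<in> null_sets circle_haar \<Longrightarrow> measure (distr N circle_haar e) (E - A0) = 0"
    using exists_maximal_null_set[OF N.finite_measure_distr[OF e] sets_distr] by blast
  define A' where "A' = A0 \<union> A"
  have A': "A' \<in> null_sets circle_haar" unfolding A'_def by (rule null_sets.Un[OF A0(1) A])
  have max: "measure (distr N circle_haar e) (E - A') = 0" if "E \<in> null_sets circle_haar" for E
  proof -
    interpret V: finite_measure "distr N circle_haar e" by (rule N.finite_measure_distr[OF e])
    have "measure (distr N circle_haar e) (E - A') \<le> measure (distr N circle_haar e) (E - A0)"
      by (rule V.finite_measure_mono) (use null_setsD2[OF that] null_setsD2[OF A0(1)] in \<open>auto simp: A'_def\<close>)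
    then show ?thesis using A0(2)[OF that] measure_nonneg by (metis antisym)
  qed
  have eb: "e \<in> borel_measurable N"
    using measurable_compose[OF e circle_continuous_measurable[OF continuous_on_id]] by simp
  have e1: "cmod (e x) = 1" if "x \<in> space N" for x using measurable_space[OF e that] by simp
  have hm: "(\<lambda>x. hpow k (e x)) \<in> borel_measurable N" for k by (rule measurable_compose[OF eb hpow_measurable])
  have hb: "cmod (hpow k (e x)) = 1" if "x \<in> space N" for k x using e1[OF that] by simp
  have Am: "(\<lambda>x. indicator A' (e x) :: complex) \<in> borel_measurable N"
    by (rule measurable_compose[OF e borel_measurable_indicator[OF null_setsD2[OF A']]])
  have hadd: "(LINT x|N. e x ^ Suc n * (hpow k (e x) * f x)) = (LINT x|N. hpow (int (Suc n) + k) (e x) * f x)"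
    for n k and f :: "_ \<Rightarrow> complex"
    by (intro LINT_cong) (simp only: hpow_add[OF e1] hpow_of_nat mult.assoc)
  have pos: "(LINT x|N. hpow (int m) (e x) * (indicator A' (e x) * v x)) = 0" for m
  proof -
    have "(LINT x|N. indicator A' (e x) * (hpow (int m) (e x) * v x)) = 0"
    proof (rule F_and_M_Riesz_mean[OF N _ _ e _ A' max])
      show "(\<lambda>x. hpow (int m) (e x) * v x) \<in> borel_measurable N" by (intro borel_measurable_times hm v(1))
      show "cmod (hpow (int m) (e x) * v x) \<le> B" if "x \<in> space N" for x
        unfolding norm_mult hb[OF that] using v(2)[OF that] by simp
      show "(LINT x|N. e x ^ Suc n * (hpow (int m) (e x) * v x)) = 0" for n
        unfolding hadd using zero[of "n + m"] by (simp only: of_nat_add[symmetric] hpow_of_nat add_Suc)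
    qed
    then show ?thesis by (simp only: mult.left_commute)
  qed
  \<comment> \<open>Strong induction, because the mean lemma has to be fed with all positive shifts
    of degree -m, some of which are still negative.\<close>
  have neg: "(LINT x|N. hpow (- int m) (e x) * (indicator A' (e x) * v x)) = 0" for m
  proof (induction m rule: less_induct)
    case (less m)
    have "(LINT x|N. indicator A' (e x) * (hpow (- int m) (e x) * (indicator A' (e x) * v x))) = 0"
    proof (rule F_and_M_Riesz_mean[OF N _ _ e _ A' max])
      show "(\<lambda>x. hpow (- int m) (e x) * (indicator A' (e x) * v x)) \<in> borel_measurable N"
        by (intro borel_measurable_times hm v(1) Am)
      show "cmod (hpow (- int m) (e x) * (indicator A' (e x) * v x)) \<le> max B 0" if "x \<in> space N" for x
        unfolding norm_mult hb[OF that] using v(2)[OF that] by (simp add: indicator_def le_max_iff_disj)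
      show "(LINT x|N. e x ^ Suc n * (hpow (- int m) (e x) * (indicator A' (e x) * v x))) = 0" for n
      proof (cases "m \<le> Suc n")
        case True
        then have "int (Suc n) + - int m = int (Suc n - m)" by simp
        then show ?thesis unfolding hadd by (simp only: pos)
      next
        case False
        then have "int (Suc n) + - int m = - int (m - Suc n)" "m - Suc n < m" by simp_all
        then show ?thesis unfolding hadd by (simp only: less.IH)
      qed
    qed
    moreover have "indicator A' (e x) * (hpow (- int m) (e x) * (indicator A' (e x) * v x))
      = hpow (- int m) (e x) * (indicator A' (e x) * v x)" for x by (simp add: indicator_def)
    ultimately show ?case by simp
  qed
  have "(LINT x|N. hpow k (e x) * (indicator A' (e x) * v x)) = 0" for k
    using pos[of "nat k"] neg[of "nat (- k)"] by (cases "0 \<le> k") simp_all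
  then show ?thesis using A' unfolding A'_def by blast
qed

section \<open>Disintegrations of pluriharmonic measures\<close>

text \<open>The fibre integrals are known to be measurable for the completion, while their
  comparison is available on sets of \<open>M\<close>; main parts of sets bridge the
  difference.\<close>

lemma AE_eq_completion_of_set_integrals:
  fixes F G :: "'a \<Rightarrow> 'b::{second_countable_topology, banach}"
  assumes M: "finite_measure M" and F: "integrable (completion M) F" and G: "integrable (completion M) G"
    and eq: "\<And>N. N \<in> sets M \<Longrightarrow> (LINT x:N|completion M. F x) = (LINT x:N|completion M. G x)"
  shows "AE x in M. F x = G x"
proof -
  have fin: "finite_measure (completion M)"
    by (rule finite_measureI) (use finite_measure.emeasure_finite[OF M] in simp)
  interpret finite_measure "completion M" by (rule fin)
  have main: "(LINT x:A|completion M. f x) = (LINT x:main_part M A|completion M. f x)"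
    if A: "A \<in> sets (completion M)" and f: "integrable (completion M) f" for A and f :: "'a \<Rightarrow> 'b"
  proof -
    obtain N where N: "N \<in> null_sets M" "null_part M A \<subseteq> N" using null_part[OF A] by blast
    have mA: "main_part M A \<in> sets (completion M)" using main_part_sets[OF A] by simp
    have "AE x in completion M. x \<notin> N" by (rule AE_completion[OF AE_not_in[OF N(1)]])
    then have "AE x in completion M. indicator A x *\<^sub>R f x = indicator (main_part M A) x *\<^sub>R f x"
    proof eventually_elim
      case (elim x)
      then have "x \<notin> null_part M A" using N(2) by blast
      then have "x \<in> A \<longleftrightarrow> x \<in> main_part M A" using main_part_null_part_Un[OF A] by blast
      then show ?case by (simp add: indicator_def)
    qed
    then show ?thesis
      unfolding set_lebesgue_integral_def
      by (intro integral_cong_AE borel_measurable_scaleR borel_measurable_indicator A mA borel_measurable_integrable[OF f])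
  qed
  have "AE x in completion M. F x = G x"
    by (rule density_unique_banach[OF F G]) (simp only: main F G eq main_part_sets)
  then show ?thesis unfolding AE_completion_iff .
qed

lemma cintegral_mult_left: "cintegral M \<mu> (\<lambda>x. c * f x) = c * cintegral M \<mu> f"
  unfolding cintegral_def by (simp add: mult.assoc)

locale disintegration_setting = pluriharmonic_setting D bD \<beta> C \<mu>
  for D bD :: "(complex^'n) set" and \<beta> :: "(complex^'n) measure" and C \<mu> +
  fixes \<kappa> :: "(complex^'n) set \<Rightarrow> (complex^'n) set \<Rightarrow> complex"
  assumes dis: "disintegration (borel_on bD) \<mu> torbit (quotient_measure bD \<beta>) \<kappa>"
begin

abbreviation fibre_integral :: "(complex^'n) set \<Rightarrow> (complex^'n \<Rightarrow> complex) \<Rightarrow> complex"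
  where "fibre_integral \<xi> \<equiv> cintegral (borel_on bD) (\<kappa> \<xi>)"
abbreviation m\<xi> :: "(complex^'n) set \<Rightarrow> (complex^'n) measure" where "m\<xi> \<xi> \<equiv> variation (borel_on bD) (\<kappa> \<xi>)"
abbreviation h\<xi> :: "(complex^'n) set \<Rightarrow> complex^'n \<Rightarrow> complex" where "h\<xi> \<xi> \<equiv> polar_density (borel_on bD) (\<kappa> \<xi>)"

lemma fibre_complex_measure: "\<xi> \<in> torbit ` bD \<Longrightarrow> complex_measure (borel_on bD) (\<kappa> \<xi>)"
  using dis unfolding disintegration_def space_\<nu> by blast

lemma fibre_concentrated: "AE \<xi> in \<nu>. concentrated_on (borel_on bD) (\<kappa> \<xi>) (torbit -` {\<xi>})"
  using dis unfolding disintegration_def by (elim conjE)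

lemma disintegrate:
  assumes "cintegrable (borel_on bD) \<mu> f"
  shows "integrable (completion \<nu>) (\<lambda>\<xi>. fibre_integral \<xi> f)"
    and "cintegral (borel_on bD) \<mu> f = (LINT \<xi>|completion \<nu>. fibre_integral \<xi> f)"
  using dis assms unfolding disintegration_def by blast+

lemma finite_\<nu>: "finite_measure \<nu>"
  unfolding quotient_measure_def by (rule finite_measure.finite_measure_distr[OF finite_\<beta> torbit_\<beta>])

text \<open>Any representative of an orbit gives the same value, and preimages of open sets are open
  by the definition of the quotient topology.\<close>

lemma invariant_factors:
  fixes g :: "complex^'n \<Rightarrow> complex"
  assumes g: "continuous_on bD g" and inv: "\<And>\<alpha> \<zeta>. cmod \<alpha> = 1 \<Longrightarrow> \<zeta> \<in> bD \<Longrightarrow> g (\<alpha> *s \<zeta>) = g \<zeta>"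
  shows "\<exists>G\<in>borel_measurable Q. \<forall>\<zeta>\<in>bD. G (torbit \<zeta>) = g \<zeta>"
proof -
  define G where "G = (\<lambda>\<xi>. g (SOME z. z \<in> \<xi>))"
  have G: "G (torbit \<zeta>) = g \<zeta>" if \<zeta>: "\<zeta> \<in> bD" for \<zeta>
  proof -
    have "(SOME z. z \<in> torbit \<zeta>) \<in> torbit \<zeta>" by (rule someI[of _ \<zeta>]) (rule torbit_self)
    then obtain \<alpha> where "cmod \<alpha> = 1" "(SOME z. z \<in> torbit \<zeta>) = \<alpha> *s \<zeta>"
      unfolding torbit_def by blast
    then show ?thesis using inv[OF _ \<zeta>] by (simp add: G_def)
  qed
  have "G \<in> borel_measurable Q"
  proof (rule borel_measurableI)
    fix S :: "complex set" assume S: "open S"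
    have "{\<zeta> \<in> bD. torbit \<zeta> \<in> G -` S \<inter> torbit ` bD} = bD \<inter> g -` S" using G by auto
    moreover have "openin (top_of_set bD) (bD \<inter> g -` S)" by (rule continuous_openin_preimage_gen[OF g S])
    ultimately have "G -` S \<inter> torbit ` bD \<in> quotient_open bD" unfolding quotient_open_def by simp
    then show "G -` S \<inter> space Q \<in> sets Q" unfolding sets_quotient_borel space_quotient_borel by (rule sigma_sets.Basic)
  qed
  then show ?thesis using G by blast
qed

text \<open>The indicator of a set of orbits is constant on each fibre and can be pulled out of the
  fibre integral, so both sides have equal integrals over all such sets. The right side is a
  function of the orbit because the product of \<phi> and c_k has degree 0.\<close>

lemma fibre_moment:
  assumes \<phi>: "circle_homogeneous bD (- k) \<phi>"
  shows "AE \<xi> in \<nu>. \<forall>\<zeta>\<in>bD. torbit \<zeta> = \<xi> \<longrightarrow> fibre_integral \<xi> \<phi> = \<phi> \<zeta> * coeff k \<zeta>"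
proof -
  have c\<phi>: "continuous_on bD \<phi>" using \<phi> by (simp add: circle_homogeneous_def)
  have cc: "continuous_on bD (coeff k)" using coeff_homogeneous by (simp add: circle_homogeneous_def)
  have \<phi>m: "\<phi> \<in> borel_measurable (borel_on bD)" by (rule continuous_imp_borel_on[OF c\<phi>])
  obtain B where B: "\<And>\<zeta>. \<zeta> \<in> bD \<Longrightarrow> cmod (\<phi> \<zeta>) \<le> B" using continuous_bD_bounded[OF c\<phi>] by blast
  have h0: "circle_homogeneous bD (- k + k) (\<lambda>\<zeta>. \<phi> \<zeta> * coeff k \<zeta>)"
    by (rule circle_homogeneous_mult[OF \<phi> coeff_homogeneous])
  obtain G where G: "G \<in> borel_measurable Q" "\<And>\<zeta>. \<zeta> \<in> bD \<Longrightarrow> G (torbit \<zeta>) = \<phi> \<zeta> * coeff k \<zeta>"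
    using invariant_factors[of "\<lambda>\<zeta>. \<phi> \<zeta> * coeff k \<zeta>"] h0 unfolding circle_homogeneous_def by auto
  have G\<nu>: "G \<in> borel_measurable \<nu>" unfolding measurable_cong_sets[OF sets_\<nu> refl] by (rule G(1))
  have iG: "integrable \<nu> G"
    unfolding quotient_measure_def
  proof (subst integrable_distr_eq[OF torbit_\<beta> G(1)])
    have "integrable \<beta> (\<lambda>\<zeta>. \<phi> \<zeta> * coeff k \<zeta>)" by (intro continuous_\<beta>_integrable continuous_intros c\<phi> cc)
    then show "integrable \<beta> (\<lambda>\<zeta>. G (torbit \<zeta>))"
      by (rule Bochner_Integration.integrable_cong[THEN iffD1, rotated 2]) (simp_all add: G(2) space_\<beta>)
  qed
  have iF: "integrable (completion \<nu>) (\<lambda>\<xi>. fibre_integral \<xi> \<phi>)"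
    by (rule disintegrate(1)[OF cintegrable_bounded[OF cm \<phi>m]]) (use B in simp)
  have eq: "(LINT \<xi>:N|completion \<nu>. fibre_integral \<xi> \<phi>) = (LINT \<xi>:N|completion \<nu>. G \<xi>)" if N\<nu>: "N \<in> sets \<nu>" for N
  proof -
    have N: "N \<in> sets Q" using N\<nu> by simp
    let ?V = "torbit -` N \<inter> bD"
    have V: "?V \<in> sets (borel_on bD)" by (rule saturated_sets[OF N])
    let ?f = "\<lambda>z. indicator ?V z * \<phi> z"
    have fm: "?f \<in> borel_measurable (borel_on bD)" by (intro borel_measurable_times \<phi>m borel_measurable_indicator V)
    have ci: "cintegrable (borel_on bD) \<mu> ?f"
      by (rule cintegrable_bounded[OF cm fm, of "max B 0"]) (use B in \<open>simp add: indicator_def le_max_iff_disj\<close>)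
    have Nc: "N \<in> sets (completion \<nu>)" using N\<nu> by simp
    have "AE \<xi> in completion \<nu>. indicator N \<xi> *\<^sub>R fibre_integral \<xi> \<phi> = fibre_integral \<xi> ?f"
    proof (rule AE_completion)
      show "AE \<xi> in \<nu>. indicator N \<xi> *\<^sub>R fibre_integral \<xi> \<phi> = fibre_integral \<xi> ?f"
        using fibre_concentrated AE_space
      proof eventually_elim
        case (elim \<xi>)
        have "fibre_integral \<xi> ?f = fibre_integral \<xi> (\<lambda>z. indicator N \<xi> * \<phi> z)"
        proof (rule cintegral_cong_concentrated[OF elim(1) fibre_complex_measure fm])
          show "\<xi> \<in> torbit ` bD" using elim(2) by simp
          show "(\<lambda>z. indicator N \<xi> * \<phi> z) \<in> borel_measurable (borel_on bD)" by (intro borel_measurable_times \<phi>m) simp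
        qed (auto simp: indicator_def)
        then show ?case unfolding cintegral_mult_left by (simp add: indicator_def)
      qed
    qed
    then have "(LINT \<xi>:N|completion \<nu>. fibre_integral \<xi> \<phi>) = (LINT \<xi>|completion \<nu>. fibre_integral \<xi> ?f)"
      unfolding set_lebesgue_integral_def
      by (intro integral_cong_AE borel_measurable_scaleR borel_measurable_indicator Nc
          borel_measurable_integrable[OF iF] borel_measurable_integrable[OF disintegrate(1)[OF ci]])
    also have "\<dots> = cintegral (borel_on bD) \<mu> ?f" by (rule disintegrate(2)[OF ci, symmetric])
    also have "\<dots> = (LINT z|m. ?f z * h z)" by (rule cintegral_polar[OF cm fm])
    also have "\<dots> = (LINT z:?V|m. \<phi> z * h z)"
      unfolding set_lebesgue_integral_def
      by (intro LINT_cong) (simp add: indicator_def)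
    also have "\<dots> = (LINT z:?V|\<beta>. \<phi> z * coeff k z)" by (rule homogeneous_moment_saturated[OF \<phi> N])
    also have "\<dots> = (LINT z|\<beta>. indicator N (torbit z) *\<^sub>R G (torbit z))"
      unfolding set_lebesgue_integral_def
      by (intro LINT_cong) (simp add: indicator_def space_\<beta> G(2))
    also have "\<dots> = (LINT \<xi>:N|\<nu>. G \<xi>)"
      unfolding quotient_measure_def set_lebesgue_integral_def
      by (rule integral_distr[OF torbit_\<beta>, symmetric])
        (intro borel_measurable_scaleR borel_measurable_indicator N G(1))
    also have "\<dots> = (LINT \<xi>:N|completion \<nu>. G \<xi>)"
      unfolding set_lebesgue_integral_def
      by (rule integral_completion[symmetric])
        (intro borel_measurable_scaleR borel_measurable_indicator N\<nu> G\<nu>)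
    finally show ?thesis .
  qed
  have "integrable (completion \<nu>) G" using integrable_completion[OF G\<nu>] iG by simp
  from AE_eq_completion_of_set_integrals[OF finite_\<nu> iF this eq]
  have "AE \<xi> in \<nu>. fibre_integral \<xi> \<phi> = G \<xi>" by blast
  then show ?thesis
  proof eventually_elim
    case (elim \<xi>)
    show ?case
    proof (intro ballI impI)
      fix \<zeta> assume "\<zeta> \<in> bD" "torbit \<zeta> = \<xi>"
      then show "fibre_integral \<xi> \<phi> = \<phi> \<zeta> * coeff k \<zeta>" using elim G(2)[of \<zeta>] by simp
    qed
  qed
qed

text \<open>Only countably many conditions, hence valid almost everywhere at once. On an orbit with
  \<open>\<zeta> $ j \<noteq> 0\<close> the powers of the j-th coordinate already determine all
  Fourier coefficients.\<close>

definition regular_fibre :: "(complex^'n) set \<Rightarrow> bool" where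
  "regular_fibre \<xi> \<longleftrightarrow> \<xi> \<in> torbit ` bD \<and> concentrated_on (borel_on bD) (\<kappa> \<xi>) \<xi> \<and>
     (\<forall>k j. \<forall>\<zeta>\<in>\<xi>. fibre_integral \<xi> (\<lambda>z. hpow (- k) (z $ j)) = hpow (- k) (\<zeta> $ j) * coeff k \<zeta>)"

lemma AE_regular_fibre: "AE \<xi> in \<nu>. regular_fibre \<xi>"
proof -
  have "AE \<xi> in \<nu>. \<forall>\<zeta>\<in>bD. torbit \<zeta> = \<xi> \<longrightarrow>
      fibre_integral \<xi> (\<lambda>z. hpow (- k) (z $ j)) = hpow (- k) (\<zeta> $ j) * coeff k \<zeta>" for k j
    by (rule fibre_moment) (auto simp: circle_homogeneous_def hpow_mult intro!: continuous_intros)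
  then have "AE \<xi> in \<nu>. \<forall>k. \<forall>j. \<forall>\<zeta>\<in>bD. torbit \<zeta> = \<xi> \<longrightarrow>
      fibre_integral \<xi> (\<lambda>z. hpow (- k) (z $ j)) = hpow (- k) (\<zeta> $ j) * coeff k \<zeta>"
    by (simp add: AE_all_countable AE_finite_all)
  then show ?thesis
    using fibre_concentrated AE_space
  proof eventually_elim
    case (elim \<xi>)
    have \<xi>: "\<xi> \<in> torbit ` bD" using elim(3) by simp
    then obtain \<zeta>0 where \<zeta>0: "\<zeta>0 \<in> bD" "\<xi> = torbit \<zeta>0" by blast
    have fib: "z \<in> bD \<and> torbit z = \<xi>" if "z \<in> \<xi>" for z
      using that torbit_subset_bD[OF \<zeta>0(1)] torbit_eq[of z \<zeta>0] \<zeta>0(2) by blast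
    have "bD - torbit -` {\<xi>} = bD - \<xi>"
      using fib torbit_self by blast
    then have "concentrated_on (borel_on bD) (\<kappa> \<xi>) \<xi>"
      using elim(2) unfolding concentrated_on_def space_borel_on by simp
    then show ?case unfolding regular_fibre_def using \<xi> elim(1) fib by blast
  qed
qed

end

context disintegration_setting
begin

lemma regular_fibreD:
  assumes \<xi>: "regular_fibre \<xi>" and \<zeta>: "\<zeta> \<in> \<xi>"
  shows "\<zeta> \<in> bD" "torbit \<zeta> = \<xi>" "\<xi> \<subseteq> bD" "\<xi> \<in> sets (borel_on bD)" "complex_measure (borel_on bD) (\<kappa> \<xi>)"
    "concentrated_on (borel_on bD) (\<kappa> \<xi>) \<xi>" "AE z in m\<xi> \<xi>. z \<in> \<xi>"
proof -
  obtain \<zeta>0 where \<zeta>0: "\<zeta>0 \<in> bD" "\<xi> = torbit \<zeta>0" using \<xi> unfolding regular_fibre_def by blast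
  show \<xi>b: "\<xi> \<subseteq> bD" using torbit_subset_bD[OF \<zeta>0(1)] \<zeta>0(2) by simp
  show "\<zeta> \<in> bD" using \<zeta> \<xi>b by blast
  show o: "torbit \<zeta> = \<xi>" using torbit_eq[of \<zeta> \<zeta>0] \<zeta> \<zeta>0(2) by simp
  show cm: "complex_measure (borel_on bD) (\<kappa> \<xi>)" using \<xi> fibre_complex_measure unfolding regular_fibre_def by blast
  show conc: "concentrated_on (borel_on bD) (\<kappa> \<xi>) \<xi>" using \<xi> unfolding regular_fibre_def by blast
  have "compact ((\<lambda>\<alpha>. \<alpha> *s \<zeta>) ` sphere 0 1)" by (intro compact_continuous_image continuous_intros compact_sphere)
  moreover have "(\<lambda>\<alpha>. \<alpha> *s \<zeta>) ` sphere 0 1 = \<xi>" unfolding o[symmetric] torbit_def by auto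
  ultimately have "\<xi> \<in> sets borel" by (simp add: borel_compact)
  then show \<xi>s: "\<xi> \<in> sets (borel_on bD)"
    using \<xi>b by (auto simp: sets_restrict_space intro!: image_eqI[of _ _ \<xi>])
  have "bD - \<xi> \<in> sets (m\<xi> \<xi>)"
    using sets.compl_sets[OF \<xi>s] by simp
  then have "bD - \<xi> \<in> null_sets (m\<xi> \<xi>)"
    using conc unfolding concentrated_on_def cnegligible_def space_borel_on by (simp add: null_sets_completion_iff)
  from AE_not_in[OF this] AE_space
  show "AE z in m\<xi> \<xi>. z \<in> \<xi>" by eventually_elim simp
qed

text \<open>The coordinate of a point on the orbit of \<open>\<zeta>\<close>, extended to \<open>bD\<close> as a unimodular function.\<close>

lemma fibre_coordinate:
  assumes \<xi>: "regular_fibre \<xi>" and \<zeta>: "\<zeta> \<in> \<xi>"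
  shows "\<exists>e\<in>measurable (borel_on bD) circle_haar. (\<forall>z\<in>\<xi>. z = e z *s \<zeta>) \<and>
    (\<forall>k. fibre_integral \<xi> (\<lambda>z. hpow (- k) (e z)) = coeff k \<zeta>)"
proof -
  note r = regular_fibreD[OF \<xi> \<zeta>]
  have "norm \<zeta> = 1" using r(1) bD_sphere by auto
  then have "\<zeta> \<noteq> 0" by auto
  then obtain j where j: "\<zeta> $ j \<noteq> 0" by (auto simp: vec_eq_iff)
  \<comment> \<open>Off the orbit the quotient may have any modulus; the default value 1 keeps
    \<open>e\<close> on the circle, and \<open>\<kappa> \<xi>\<close> does not charge these
    points.\<close>
  define e where "e = (\<lambda>z::complex^'n. if cmod (z $ j / \<zeta> $ j) = 1 then z $ j / \<zeta> $ j else 1)"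
  have q: "(\<lambda>z::complex^'n. z $ j / \<zeta> $ j) \<in> borel_measurable (borel_on bD)"
    by (rule continuous_imp_borel_on) (use j in \<open>auto intro!: continuous_intros\<close>)
  have "e \<in> borel_measurable (borel_on bD)"
    unfolding e_def
  proof (rule measurable_If[OF q])
    show "{x \<in> space (borel_on bD). cmod (x $ j / \<zeta> $ j) = 1} \<in> sets (borel_on bD)"
      using measurable_sets[OF measurable_compose[OF q borel_measurable_norm], of "{1}"]
      by (simp add: vimage_def Int_def conj_commute)
  qed simp
  then have e: "e \<in> measurable (borel_on bD) circle_haar"
    unfolding measurable_cong_sets[OF refl sets_circle_haar]
    by (rule measurable_restrict_space2[rotated]) (auto simp: e_def)
  have ez: "z = e z *s \<zeta>" if z: "z \<in> \<xi>" for z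
  proof -
    obtain \<alpha> where "cmod \<alpha> = 1" "z = \<alpha> *s \<zeta>" using z r(2) unfolding torbit_def by blast
    then show ?thesis using j by (simp add: e_def)
  qed
  have eb: "(\<lambda>z. hpow k (e z)) \<in> borel_measurable (borel_on bD)" for k
    by (rule measurable_compose[OF \<open>e \<in> borel_measurable (borel_on bD)\<close> hpow_measurable])
  have "fibre_integral \<xi> (\<lambda>z. hpow (- k) (e z)) = coeff k \<zeta>" for k
  proof -
    have "hpow (- k) (\<zeta> $ j) * fibre_integral \<xi> (\<lambda>z. hpow (- k) (e z))
        = fibre_integral \<xi> (\<lambda>z. hpow (- k) (\<zeta> $ j) * hpow (- k) (e z))"
      by (rule cintegral_mult_left[symmetric])
    also have "\<dots> = fibre_integral \<xi> (\<lambda>z. hpow (- k) (z $ j))"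
    proof (rule cintegral_cong_concentrated[OF r(6) r(5)])
      show "(\<lambda>z. hpow (- k) (\<zeta> $ j) * hpow (- k) (e z)) \<in> borel_measurable (borel_on bD)"
        by (intro borel_measurable_times eb) simp
      show "(\<lambda>z. hpow (- k) (z $ j)) \<in> borel_measurable (borel_on bD)"
        by (intro continuous_imp_borel_on continuous_intros)
      fix z assume "z \<in> \<xi>"
      then have "z $ j = (e z *s \<zeta>) $ j" using ez by simp
      then have "z $ j = e z * \<zeta> $ j" by simp
      then show "hpow (- k) (\<zeta> $ j) * hpow (- k) (e z) = hpow (- k) (z $ j)"
        by (simp add: hpow_mult mult.commute)
    qed
    also have "\<dots> = hpow (- k) (\<zeta> $ j) * coeff k \<zeta>" using \<xi> \<zeta> unfolding regular_fibre_def by blast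
    finally have "hpow (- k) (\<zeta> $ j) * fibre_integral \<xi> (\<lambda>z. hpow (- k) (e z)) = hpow (- k) (\<zeta> $ j) * coeff k \<zeta>" .
    moreover have "hpow (- k) (\<zeta> $ j) \<noteq> 0"
    proof
      assume "hpow (- k) (\<zeta> $ j) = 0"
      then have "cmod (\<zeta> $ j) ^ nat \<bar>- k\<bar> = 0" by (metis norm_hpow norm_zero)
      then show False using j by simp
    qed
    ultimately show ?thesis by simp
  qed
  then show ?thesis using e ez by blast
qed

section \<open>Poisson integrals on the fibres\<close>

lemma disc_kernel_measurable:
  assumes w: "cmod w < 1"
  shows "(\<lambda>\<alpha>. disc_kernel w \<alpha>) \<in> borel_measurable circle_haar"
    and "\<exists>B. \<forall>\<alpha>\<in>sphere 0 1. cmod (disc_kernel w \<alpha>) \<le> B"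
proof -
  have "continuous_on (sphere 0 1) (\<lambda>\<alpha>. disc_kernel w \<alpha>)"
    using w by (intro continuous_intros) auto
  from circle_continuous_measurable[OF this] compact_imp_bounded[OF compact_continuous_image[OF this compact_sphere]]
  show "(\<lambda>\<alpha>. disc_kernel w \<alpha>) \<in> borel_measurable circle_haar"
    and "\<exists>B. \<forall>\<alpha>\<in>sphere 0 1. cmod (disc_kernel w \<alpha>) \<le> B"
    unfolding bounded_iff by blast+
qed

text \<open>The fibre measure, read along the coordinate \<open>e\<close>, and the slice of
  \<open>u\<close> have the same Fourier coefficients; both sides are the sum of the same
  series.\<close>

lemma fibre_poisson:
  assumes \<xi>: "regular_fibre \<xi>" and \<zeta>: "\<zeta> \<in> \<xi>" and e: "e \<in> measurable (borel_on bD) circle_haar"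
    and mom: "\<And>k. fibre_integral \<xi> (\<lambda>z. hpow (- k) (e z)) = coeff k \<zeta>" and w: "cmod w < 1"
  shows "fibre_integral \<xi> (\<lambda>z. disc_kernel w (e z)) = u (w *s \<zeta>)"
proof -
  note r = regular_fibreD[OF \<xi> \<zeta>]
  let ?V = "m\<xi> \<xi>" and ?v = "h\<xi> \<xi>"
  have eb: "e \<in> borel_measurable (borel_on bD)"
    using measurable_compose[OF e circle_continuous_measurable[OF continuous_on_id]] by simp
  have e1: "cmod (e z) = 1" if "z \<in> bD" for z using measurable_space[OF e] that by simp
  have VM: "measurable ?V M = measurable (borel_on bD) M" for M :: "'z measure"
    by (rule measurable_cong_sets) simp_all
  have m: "(LINT z|?V. hpow (- k) (e z) * ?v z) = coeff k \<zeta>" for k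
    using mom[of k] cintegral_polar[OF r(5) measurable_compose[OF eb hpow_measurable], of "- k"] by simp
  have m': "(LINT z|?V. hpow (int (Suc n)) (e z) * ?v z) = coeff (- int (Suc n)) \<zeta>" for n
    using m[of "- int (Suc n)"] by (simp only: minus_minus)
  have "fibre_integral \<xi> (\<lambda>z. disc_kernel w (e z))
      = (LINT z|?V. disc_kernel w (e z) * ?v z)"
    by (rule cintegral_polar[OF r(5) measurable_compose[OF e disc_kernel_measurable(1)[OF w]]])
  also have "\<dots> = (\<Sum>n. w ^ n * coeff (int n) \<zeta>) + (\<Sum>n. cnj w ^ Suc n * coeff (- int (Suc n)) \<zeta>)"
    unfolding m[symmetric, of "int _"] m'[symmetric]
    by (rule poisson_kernel_integral[OF finite_measure_variation[OF r(5)] _ _ _ _ w, of _ 1])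
      (use norm_polar_density[OF r(5)] polar_density_measurable[OF r(5)] eb e1 in \<open>simp_all add: VM\<close>)
  also have "\<dots> = u (w *s \<zeta>)"
  proof -
    have "\<zeta> \<in> closure D" using r(1) bD_closure by blast
    from slice_coeffs(1)[OF pluriharmonic this] have "\<forall>w\<in>ball 0 1. u (w *s \<zeta>) = (\<Sum>n. coeff (int n) \<zeta> * w ^ n) + (\<Sum>n. coeff (- int (Suc n)) \<zeta> * cnj w ^ Suc n)"
      unfolding harmonic_coeffs_def by blast
    from bspec[OF this, of w] show ?thesis using w by (simp add: mult.commute)
  qed
  finally show ?thesis .
qed

text \<open>As \<zeta> is a unit vector, the distance between two points of its complex line is the
  distance between their coordinates; so the Euclidean kernel is the kernel of the disc.\<close>

lemma poisson_integral_on_fibre: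
  assumes \<xi>: "regular_fibre \<xi>" and z: "z \<in> disc_over \<xi>"
  shows "u z = fibre_integral \<xi> (\<lambda>\<zeta>. complex_of_real ((1 - (norm z)\<^sup>2) / (norm (\<zeta> - z))\<^sup>2))"
proof -
  obtain w \<zeta> where w: "z = w *s \<zeta>" "cmod w < 1" "\<zeta> \<in> \<xi>" using z unfolding disc_over_def by blast
  note r = regular_fibreD[OF \<xi> w(3)]
  have n1: "norm \<zeta> = 1" using r(1) bD_sphere by auto
  have nz: "norm z = cmod w" using n1 by (simp add: w(1) norm_scale_complex)
  obtain e where e: "e \<in> measurable (borel_on bD) circle_haar" "\<And>x. x \<in> \<xi> \<Longrightarrow> x = e x *s \<zeta>"
    "\<And>k. fibre_integral \<xi> (\<lambda>z. hpow (- k) (e z)) = coeff k \<zeta>"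
    using fibre_coordinate[OF \<xi> w(3)] by blast
  have "u z = fibre_integral \<xi> (\<lambda>x. disc_kernel w (e x))"
    unfolding w(1) by (rule fibre_poisson[OF \<xi> w(3) e(1,3) w(2), symmetric])
  also have "\<dots> = fibre_integral \<xi> (\<lambda>\<zeta>. complex_of_real ((1 - (norm z)\<^sup>2) / (norm (\<zeta> - z))\<^sup>2))"
  proof (rule cintegral_cong_concentrated[OF r(6) r(5) measurable_compose[OF e(1) disc_kernel_measurable(1)[OF w(2)]]])
    have "norm x \<noteq> norm z" if "x \<in> bD" for x using that bD_sphere nz w(2) by auto
    then have "x \<noteq> z" if "x \<in> bD" for x using that by blast
    then show "(\<lambda>\<zeta>. complex_of_real ((1 - (norm z)\<^sup>2) / (norm (\<zeta> - z))\<^sup>2)) \<in> borel_measurable (borel_on bD)"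
      by (intro continuous_imp_borel_on continuous_intros) auto
    fix x assume "x \<in> \<xi>"
    then have "x - z = (e x - w) *s \<zeta>" using e(2)[of x] w(1) by (simp add: vec_eq_iff algebra_simps)
    then have "norm (x - z) = cmod (e x - w)" by (simp only: norm_scale_complex n1 mult_1_right)
    then show "disc_kernel w (e x) = complex_of_real ((1 - (norm z)\<^sup>2) / (norm (x - z))\<^sup>2)"
      by (simp only: nz)
  qed
  finally show ?thesis .
qed

section \<open>Holomorphic measures\<close>

lemma slice_holomorphic:
  assumes hol: "mholomorphic_on u D" and \<zeta>: "\<zeta> \<in> bD"
  shows "(\<lambda>w. u (w *s \<zeta>)) holomorphic_on ball 0 1"
proof -
  have "(\<lambda>w. u (0 + w *s \<zeta>)) holomorphic_on {w. 0 + w *s \<zeta> \<in> D}" by (rule mholomorphic_on_line[OF hol])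
  from holomorphic_on_subset[OF this, of "ball 0 1"] show ?thesis
    using scale_bD[OF _ \<zeta>] by (simp add: subset_eq)
qed

text \<open>The slice also has an expansion in nonnegative degrees only; comparing the Fourier
  coefficients of both expansions at radius 1/2 identifies them.\<close>

lemma holomorphic_coeff_zero:
  assumes hol: "mholomorphic_on u D" and \<zeta>: "\<zeta> \<in> bD"
  shows "coeff (- int (Suc n)) \<zeta> = 0"
proof -
  obtain a where a: "\<forall>w\<in>ball 0 1. summable (\<lambda>n. norm (a n * w ^ n)) \<and> u (w *s \<zeta>) = (\<Sum>n. a n * w ^ n)"
    using holomorphic_power_series_0[OF slice_holomorphic[OF hol \<zeta>]] ..
  define c where "c = (\<lambda>k::int. if 0 \<le> k then a (nat k) else 0)"
  have "harmonic_coeffs (\<lambda>w. u (w *s \<zeta>)) 1 c"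
    unfolding harmonic_coeffs_def
  proof (intro conjI ballI holomorphic_on_imp_continuous_on[OF slice_holomorphic[OF hol \<zeta>]])
    fix w :: complex assume w: "w \<in> ball 0 1"
    note aw = bspec[OF a w]
    have c: "c (int n) = a n" "c (- int (Suc n)) = 0" for n by (simp_all add: c_def)
    show "summable (\<lambda>n. norm (c (int n) * w ^ n))" unfolding c by (rule conjunct1[OF aw])
    show "summable (\<lambda>n. norm (c (- int (Suc n)) * cnj w ^ Suc n))" unfolding c by simp
    show "u (w *s \<zeta>) = (\<Sum>n. c (int n) * w ^ n) + (\<Sum>n. c (- int (Suc n)) * cnj w ^ Suc n)"
      unfolding c by (simp add: conjunct2[OF aw])
  qed
  then have 1: "(LINT \<alpha>|circle_haar. u ((1/2 * \<alpha>) *s \<zeta>) * hpow (int (Suc n)) \<alpha>) = hpow (- int (Suc n)) (1/2) * c (- int (Suc n))"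
    using harmonic_coeffs_integral[of "\<lambda>w. u (w *s \<zeta>)" 1 c "1/2" "- int (Suc n)"] unfolding minus_minus by simp
  have "\<zeta> \<in> closure D" using \<zeta> bD_closure by blast
  from slice_coeffs(1)[OF pluriharmonic this]
  have 2: "(LINT \<alpha>|circle_haar. u ((1/2 * \<alpha>) *s \<zeta>) * hpow (int (Suc n)) \<alpha>) = hpow (- int (Suc n)) (1/2) * coeff (- int (Suc n)) \<zeta>"
    using harmonic_coeffs_integral[of "\<lambda>w. u (w *s \<zeta>)" 1 "\<lambda>k. coeff k \<zeta>" "1/2" "- int (Suc n)"] unfolding minus_minus by simp
  have "hpow (- int (Suc n)) (1/2) \<noteq> 0" using norm_hpow[of "- int (Suc n)" "1/2"] by auto
  moreover have "hpow (- int (Suc n)) (1/2) * coeff (- int (Suc n)) \<zeta> = 0"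
    using 1 2 by (simp add: c_def)
  ultimately show ?thesis by (simp only: mult_eq_0_iff) blast
qed

text \<open>The transported measure is the image of the fibre measure under \<open>e\<close>. Its
  density over the image of the variation is the polar density of the fibre measure, evaluated at
  \<alpha> \<zeta>, and \<open>cintegral_eq_density\<close> permits using it instead of the polar
  density of the transported measure.\<close>

lemma fibre_poisson_transport:
  assumes \<xi>: "regular_fibre \<xi>" and \<zeta>: "\<zeta> \<in> \<xi>" and w: "cmod w < 1"
  shows "disc_poisson (\<lambda>A. \<kappa> \<xi> ((\<lambda>\<alpha>. \<alpha> *s \<zeta>) ` A)) w = u (w *s \<zeta>)"
proof -
  note r = regular_fibreD[OF \<xi> \<zeta>]
  let ?V = "m\<xi> \<xi>" and ?v = "h\<xi> \<xi>"
  let ?T = "borel_on (sphere 0 1) :: complex measure"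
  let ?l = "\<lambda>A. \<kappa> \<xi> ((\<lambda>\<alpha>. \<alpha> *s \<zeta>) ` A)"
  obtain e where e: "e \<in> measurable (borel_on bD) circle_haar" "\<And>x. x \<in> \<xi> \<Longrightarrow> x = e x *s \<zeta>"
    "\<And>k. fibre_integral \<xi> (\<lambda>z. hpow (- k) (e z)) = coeff k \<zeta>"
    using fibre_coordinate[OF \<xi> \<zeta>] by blast
  have eT: "e \<in> measurable (borel_on bD) ?T" using e(1) unfolding measurable_cong_sets[OF refl sets_circle_haar] .
  have eV: "e \<in> measurable ?V ?T" using eT unfolding measurable_cong_sets[OF sets_variation refl] .
  have \<zeta>0: "\<zeta> \<noteq> 0" using r(1) bD_sphere by auto
  have inj: "\<alpha> = \<gamma>" if "\<alpha> *s \<zeta> = \<gamma> *s \<zeta>" for \<alpha> \<gamma> using that \<zeta>0 by simp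
  have scale: "\<alpha> *s \<zeta> \<in> \<xi>" if "cmod \<alpha> = 1" for \<alpha> using that r(2) unfolding torbit_def by blast
  have iv: "integrable ?V ?v" by (rule integrable_polar_density[OF r(5)])
  \<comment> \<open>The image of \<open>A\<close> lies in the orbit, whereas the preimage under
    \<open>e\<close> may also contain points off the orbit; the fibre measure vanishes
    there.\<close>
  have l: "?l A = \<kappa> \<xi> (e -` A \<inter> bD)" if A: "A \<in> sets ?T" for A
  proof -
    have As: "A \<subseteq> sphere 0 1" using sets.sets_into_space[OF A] by simp
    have eA: "e -` A \<inter> bD \<in> sets (borel_on bD)" using measurable_sets[OF eT A] by simp
    have "(\<lambda>\<alpha>. \<alpha> *s \<zeta>) ` A = (e -` A \<inter> bD) \<inter> \<xi>"
    proof (intro set_eqI iffI)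
      fix x assume "x \<in> (\<lambda>\<alpha>. \<alpha> *s \<zeta>) ` A"
      then obtain \<alpha> where \<alpha>: "\<alpha> \<in> A" "x = \<alpha> *s \<zeta>" by blast
      have x: "x \<in> \<xi>" using \<alpha> As scale by auto
      have "e x = \<alpha>" by (rule inj[OF trans[OF sym[OF e(2)[OF x]] \<alpha>(2)]])
      then show "x \<in> (e -` A \<inter> bD) \<inter> \<xi>" using \<alpha>(1) x r(3) by blast
    next
      fix x assume x: "x \<in> (e -` A \<inter> bD) \<inter> \<xi>"
      then have "x = e x *s \<zeta>" using e(2) by blast
      then show "x \<in> (\<lambda>\<alpha>. \<alpha> *s \<zeta>) ` A" using x by blast
    qed
    moreover have "\<kappa> \<xi> ((e -` A \<inter> bD) \<inter> \<xi> \<union> ((e -` A \<inter> bD) - \<xi>)) = \<kappa> \<xi> ((e -` A \<inter> bD) \<inter> \<xi>) + \<kappa> \<xi> ((e -` A \<inter> bD) - \<xi>)"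
      by (rule complex_measure_Un[OF r(5) sets.Int[OF eA r(4)] sets.Diff[OF eA r(4)]]) blast
    moreover have "\<kappa> \<xi> ((e -` A \<inter> bD) - \<xi>) = 0"
      by (rule complex_measure_concentrated[OF r(6) r(5) sets.Diff[OF eA r(4)]]) blast
    ultimately show ?thesis by (simp only: Int_Diff_Un add_0_right)
  qed
  have pol: "\<kappa> \<xi> (e -` A \<inter> bD) = (LINT x:(e -` A \<inter> space ?V)|?V. ?v x)" if A: "A \<in> sets ?T" for A
    using polar_density_integral[OF r(5) measurable_sets[OF eT A]] by simp
  have cm': "complex_measure ?T ?l"
  proof -
    have c: "complex_measure ?T (\<lambda>A. LINT x:(e -` A \<inter> space ?V)|?V. ?v x)"
      by (rule set_integral_complex_measure[OF iv eV])
    have q: "?l A = (LINT x:(e -` A \<inter> space ?V)|?V. ?v x)" if "A \<in> sets ?T" for A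
      using l[OF that] pol[OF that] by simp
    show ?thesis
      unfolding complex_measure_def
    proof (intro conjI allI impI)
      show "?l {} = 0" using complex_measure_empty[OF r(5)] by simp
      fix A :: "nat \<Rightarrow> complex set" assume A: "range A \<subseteq> sets ?T \<and> disjoint_family A"
      then have 1: "(\<lambda>i. LINT x:(e -` A i \<inter> space ?V)|?V. ?v x) sums (LINT x:(e -` (\<Union>i. A i) \<inter> space ?V)|?V. ?v x)"
        by (intro complex_measure_sums[OF c]) auto
      have Ai: "A i \<in> sets ?T" for i using A by blast
      have U: "(\<Union>i. A i) \<in> sets ?T" using Ai by blast
      show "(\<lambda>i. ?l (A i)) sums ?l (\<Union>i. A i)" using 1 by (simp only: q[OF Ai] q[OF U])
    qed
  qed
  define g where "g = (\<lambda>\<alpha>. ?v (\<alpha> *s \<zeta>))"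
  have sm: "(\<lambda>\<alpha>. \<alpha> *s \<zeta>) \<in> measurable ?T (borel_on bD)"
    by (rule measurable_restrict_space2)
      (use scale r(3) in \<open>auto intro!: continuous_imp_borel_on continuous_intros\<close>)
  have gm: "g \<in> borel_measurable ?T"
    unfolding g_def by (rule measurable_compose[OF sm polar_density_measurable[OF r(5)]])
  have ge: "AE x in ?V. g (e x) = ?v x"
    using r(7) by eventually_elim (simp add: g_def flip: e(2))
  have vV: "?v \<in> borel_measurable ?V" using iv by (rule borel_measurable_integrable)
  have geV: "(\<lambda>x. g (e x)) \<in> borel_measurable ?V" by (rule measurable_compose[OF eV gm])
  have ig: "integrable (distr ?V ?T e) g"
    unfolding integrable_distr_eq[OF eV gm]
    by (rule integrable_cong_AE[THEN iffD2, OF geV vV ge iv])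
  let ?K = "\<lambda>\<alpha>. disc_kernel w \<alpha>"
  have Km: "?K \<in> borel_measurable ?T"
    using disc_kernel_measurable(1)[OF w] unfolding measurable_cong_sets[OF sets_circle_haar refl] .
  obtain B where B: "\<forall>\<alpha>\<in>sphere 0 1. cmod (?K \<alpha>) \<le> B" using disc_kernel_measurable(2)[OF w] ..
  have "disc_poisson ?l w = (LINT \<alpha>|distr ?V ?T e. ?K \<alpha> * g \<alpha>)"
    unfolding disc_poisson_def
  proof (rule cintegral_eq_density[OF cm' sets_distr ig _ Km])
    show "cmod (?K \<alpha>) \<le> B" if "\<alpha> \<in> space ?T" for \<alpha> using bspec[OF B] that by simp
    fix E assume E: "E \<in> sets ?T"
    have "(LINT \<alpha>:E|distr ?V ?T e. g \<alpha>) = (LINT x|?V. indicator E (e x) *\<^sub>R g (e x))"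
      unfolding set_lebesgue_integral_def
      by (rule integral_distr[OF eV]) (intro borel_measurable_scaleR borel_measurable_indicator E gm)
    also have "\<dots> = (LINT x:(e -` E \<inter> space ?V)|?V. ?v x)"
      unfolding set_lebesgue_integral_def
    proof (rule integral_cong_AE)
      show "(\<lambda>x. indicator E (e x) *\<^sub>R g (e x)) \<in> borel_measurable ?V"
        by (intro borel_measurable_scaleR geV measurable_compose[OF eV borel_measurable_indicator[OF E]])
      show "(\<lambda>x. indicator (e -` E \<inter> space ?V) x *\<^sub>R ?v x) \<in> borel_measurable ?V"
        by (intro borel_measurable_scaleR vV borel_measurable_indicator measurable_sets[OF eV E])
      show "AE x in ?V. indicator E (e x) *\<^sub>R g (e x) = indicator (e -` E \<inter> space ?V) x *\<^sub>R ?v x"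
        using ge AE_space by eventually_elim (simp add: indicator_def)
    qed
    finally show "?l E = (LINT \<alpha>:E|distr ?V ?T e. g \<alpha>)" using l[OF E] pol[OF E] by simp
  qed
  also have "\<dots> = (LINT x|?V. ?K (e x) * g (e x))"
    by (rule integral_distr[OF eV]) (intro borel_measurable_times Km gm)
  also have "\<dots> = (LINT x|?V. ?K (e x) * ?v x)"
  proof (rule integral_cong_AE)
    show "AE x in ?V. ?K (e x) * g (e x) = ?K (e x) * ?v x" using ge by eventually_elim simp
  qed (intro borel_measurable_times geV vV measurable_compose[OF eV Km])+
  also have "\<dots> = fibre_integral \<xi> (\<lambda>z. ?K (e z))"
    by (rule cintegral_polar[OF r(5) measurable_compose[OF eT Km], symmetric])
  also have "\<dots> = u (w *s \<zeta>)" by (rule fibre_poisson[OF \<xi> \<zeta> e(1,3) w])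
  finally show ?thesis .
qed

lemma fibre_holomorphic:
  assumes hol: "mholomorphic_on u D" and \<xi>: "regular_fibre \<xi>"
  shows "fibre_holomorphic bD \<xi> (\<kappa> \<xi>)"
  unfolding fibre_holomorphic_def
proof (intro conjI ballI)
  show "concentrated_on (borel_on bD) (\<kappa> \<xi>) \<xi>" using \<xi> unfolding regular_fibre_def by blast
  fix \<zeta> assume \<zeta>: "\<zeta> \<in> \<xi>"
  show "disc_poisson (\<lambda>A. \<kappa> \<xi> ((\<lambda>\<alpha>. \<alpha> *s \<zeta>) ` A)) holomorphic_on ball 0 1"
    by (rule holomorphic_transform[OF slice_holomorphic[OF hol regular_fibreD(1)[OF \<xi> \<zeta>]]])
      (simp add: fibre_poisson_transport[OF \<xi> \<zeta>])
qed

text \<open>The moments of positive degree in \<open>e\<close> are the coefficients of negative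
  degree of \<open>u\<close>, which vanish. By F. and M. Riesz the part of the fibre measure over
  some null set of the circle containing the given one has no moments at all, so it is zero.\<close>

lemma fibre_absolutely_continuous:
  assumes hol: "mholomorphic_on u D" and \<xi>: "regular_fibre \<xi>" and \<zeta>: "\<zeta> \<in> \<xi>"
  shows "absolutely_continuous (orbit_haar bD \<zeta>) (m\<xi> \<xi>)"
  unfolding absolutely_continuous_def
proof
  note r = regular_fibreD[OF \<xi> \<zeta>]
  let ?V = "m\<xi> \<xi>" and ?v = "h\<xi> \<xi>"
  fix E assume E: "E \<in> null_sets (orbit_haar bD \<zeta>)"
  have Es: "E \<in> sets (borel_on bD)" using null_setsD2[OF E] by (simp add: orbit_haar_def)
  have scale: "\<alpha> *s \<zeta> \<in> \<xi>" if "cmod \<alpha> = 1" for \<alpha> using that r(2) unfolding torbit_def by blast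
  have sm: "(\<lambda>\<alpha>. \<alpha> *s \<zeta>) \<in> measurable circle_haar (borel_on bD)"
    by (rule measurable_restrict_space2)
      (use scale r(3) in \<open>auto intro!: circle_continuous_measurable continuous_intros\<close>)
  define A where "A = (\<lambda>\<alpha>. \<alpha> *s \<zeta>) -` E \<inter> space circle_haar"
  have A: "A \<in> null_sets circle_haar"
    using null_setsD1[OF E] measurable_sets[OF sm Es]
    unfolding A_def orbit_haar_def emeasure_distr[OF sm Es] by (simp add: null_sets_def)
  obtain e where e: "e \<in> measurable (borel_on bD) circle_haar" "\<And>x. x \<in> \<xi> \<Longrightarrow> x = e x *s \<zeta>"
    "\<And>k. fibre_integral \<xi> (\<lambda>z. hpow (- k) (e z)) = coeff k \<zeta>"
    using fibre_coordinate[OF \<xi> \<zeta>] by blast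
  have eb: "e \<in> borel_measurable (borel_on bD)"
    using measurable_compose[OF e(1) circle_continuous_measurable[OF continuous_on_id]] by simp
  have eV: "e \<in> measurable ?V circle_haar" using e(1) unfolding measurable_cong_sets[OF sets_variation refl] .
  have iv: "integrable ?V ?v" by (rule integrable_polar_density[OF r(5)])
  have vV: "?v \<in> borel_measurable ?V" using iv by (rule borel_measurable_integrable)
  have zero: "(LINT x|?V. e x ^ Suc n * ?v x) = 0" for n
  proof -
    have "(LINT x|?V. hpow (- (- int (Suc n))) (e x) * ?v x) = coeff (- int (Suc n)) \<zeta>"
      unfolding e(3)[symmetric] by (rule cintegral_polar[OF r(5) measurable_compose[OF eb hpow_measurable], symmetric])
    then show ?thesis unfolding minus_minus hpow_of_nat holomorphic_coeff_zero[OF hol r(1)] .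
  qed
  obtain A' where A': "A' \<in> null_sets circle_haar" "A \<subseteq> A'"
    "\<And>k. (LINT x|?V. hpow k (e x) * (indicator A' (e x) * ?v x)) = 0"
    using F_and_M_Riesz[OF finite_measure_variation[OF r(5)] vV _ eV zero A, of 1] norm_polar_density[OF r(5)] by auto
  let ?g = "\<lambda>x. indicator A' (e x) * ?v x"
  have ig: "integrable ?V ?g"
    by (rule integrable_bounded_mult[OF iv measurable_compose[OF eV borel_measurable_indicator[OF null_setsD2[OF A'(1)]]], of 1])
      (simp add: indicator_def)
  have gV: "?g \<in> borel_measurable ?V" using ig by (rule borel_measurable_integrable)
  \<comment> \<open>On the orbit a homogeneous function is \<open>\<phi> \<zeta>\<close> times a
    power of \<open>e\<close>, so the moments in \<open>e\<close> determine all homogeneous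
    moments.\<close>
  have hom: "(LINT x|?V. \<phi> x * ?g x) = 0" if \<phi>: "circle_homogeneous bD k \<phi>" for k \<phi>
  proof -
    have c\<phi>: "continuous_on bD \<phi>" and h\<phi>: "\<And>\<alpha>. cmod \<alpha> = 1 \<Longrightarrow> \<phi> (\<alpha> *s \<zeta>) = hpow k \<alpha> * \<phi> \<zeta>"
      using \<phi> r(1) unfolding circle_homogeneous_def by blast+
    have \<phi>V: "\<phi> \<in> borel_measurable ?V"
      using continuous_imp_borel_on[OF c\<phi>] unfolding measurable_cong_sets[OF sets_variation refl] .
    have hV: "(\<lambda>x. hpow k (e x)) \<in> borel_measurable ?V"
      using measurable_compose[OF eb hpow_measurable] unfolding measurable_cong_sets[OF sets_variation refl] .
    have "(LINT x|?V. \<phi> x * ?g x) = (LINT x|?V. \<phi> \<zeta> * (hpow k (e x) * ?g x))"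
    proof (rule integral_cong_AE)
      show "AE x in ?V. \<phi> x * ?g x = \<phi> \<zeta> * (hpow k (e x) * ?g x)"
        using r(7) AE_space
      proof eventually_elim
        case (elim x)
        have "cmod (e x) = 1" using measurable_space[OF eV elim(2)] by simp
        from h\<phi>[OF this] have "\<phi> x = hpow k (e x) * \<phi> \<zeta>" using e(2)[OF elim(1)] by simp
        then show ?case by (simp only: mult_ac)
      qed
    qed (intro borel_measurable_times \<phi>V hV gV borel_measurable_const)+
    also have "\<dots> = 0" unfolding integral_mult_right_zero A'(3) by simp
    finally show ?thesis .
  qed
  have "\<kappa> \<xi> F = 0" if F: "F \<in> sets (borel_on bD)" "F \<subseteq> E" for F
  proof -
    have FV: "F \<in> sets ?V" using F(1) by simp
    have "\<kappa> \<xi> F = (LINT x:F|?V. ?v x)" by (rule polar_density_integral[OF r(5) F(1)])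
    also have "\<dots> = (LINT x:F|?V. ?g x)"
      unfolding set_lebesgue_integral_def
    proof (rule integral_cong_AE)
      show "AE x in ?V. indicator F x *\<^sub>R ?v x = indicator F x *\<^sub>R ?g x"
        using r(7) AE_space
      proof eventually_elim
        case (elim x)
        have eA: "e x \<in> A'" if "x \<in> F"
        proof -
          have "e x *s \<zeta> \<in> E" using e(2)[OF elim(1)] that F(2) by auto
          then have "e x \<in> A" using measurable_space[OF eV elim(2)] by (simp add: A_def)
          then show ?thesis using A'(2) by blast
        qed
        show ?case by (cases "x \<in> F") (simp_all add: eA)
      qed
    qed (intro borel_measurable_scaleR borel_measurable_indicator FV vV gV)+
    also have "\<dots> = 0"
      by (rule homogeneous_moments_zero[OF compact_bD _ ig hom F(1)]) simp_all
    finally show ?thesis .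
  qed
  then have "emeasure ?V E = 0" using variation_null_iff[OF r(5) Es] by blast
  then show "E \<in> null_sets ?V" using Es by (simp add: null_sets_def)
qed

end

theorem theorem3p1:
  fixes D bD :: "(complex^'n) set"
    and \<beta> :: "(complex^'n) measure"
    and C :: "complex^'n \<Rightarrow> complex^'n \<Rightarrow> complex"
    and \<mu> :: "(complex^'n) set \<Rightarrow> complex"
  assumes "bounded_symmetric_domain D" and "convex D" and "circular D"
    and "silov_boundary D bD"
    and "\<forall>A\<in>linear_automorphisms D. unitary_matrix A"
    and "\<forall>\<zeta>\<in>bD. \<forall>\<zeta>'\<in>bD. \<exists>A\<in>linear_automorphisms D. A *v \<zeta> = \<zeta>'"
    and "bD \<subseteq> sphere 0 1"
    and "invariant_probability D bD \<beta>"
    and "cauchy_szego_kernel D \<beta> C"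
    and "pluriharmonic_measure D bD C \<mu>"
    and "\<exists>E\<in>sets (borel_on bD). \<mu> E \<noteq> 0"
  shows "pseudo_image (borel_on bD) \<mu> torbit (quotient_measure bD \<beta>) \<and>
    (\<forall>\<mu>\<xi>. disintegration (borel_on bD) \<mu> torbit (quotient_measure bD \<beta>) \<mu>\<xi> \<longrightarrow>
       (AE \<xi> in quotient_measure bD \<beta>. \<forall>z\<in>disc_over \<xi>.
          poisson_integral bD C \<mu> z =
          cintegral (borel_on bD) (\<mu>\<xi> \<xi>)
            (\<lambda>\<zeta>. complex_of_real ((1 - (norm z)\<^sup>2) / (norm (\<zeta> - z))\<^sup>2))) \<and>
       (holomorphic_measure D bD C \<mu> \<longrightarrow>
          (AE \<xi> in quotient_measure bD \<beta>.
             fibre_holomorphic bD \<xi> (\<mu>\<xi> \<xi>) \<and>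
             (\<forall>\<zeta>\<in>\<xi>. absolutely_continuous (orbit_haar bD \<zeta>) (variation (borel_on bD) (\<mu>\<xi> \<xi>))))))"
proof (intro conjI allI impI)
  have "symmetric_domain D bD \<beta> C"
    using assms(1-9) by (intro symmetric_domain.intro) blast+
  then interpret pluriharmonic_setting D bD \<beta> C \<mu>
    using assms(10) by (intro pluriharmonic_setting.intro pluriharmonic_setting_axioms.intro)
  show "pseudo_image (borel_on bD) \<mu> torbit (quotient_measure bD \<beta>)"
    by (rule pseudo_image_quotient[OF assms(11)])
  fix \<mu>\<xi> assume dis: "disintegration (borel_on bD) \<mu> torbit (quotient_measure bD \<beta>) \<mu>\<xi>"
  interpret disintegration_setting D bD \<beta> C \<mu> \<mu>\<xi>
    using dis by unfold_locales
  show "AE \<xi> in quotient_measure bD \<beta>. \<forall>z\<in>disc_over \<xi>. poisson_integral bD C \<mu> z =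
      cintegral (borel_on bD) (\<mu>\<xi> \<xi>) (\<lambda>\<zeta>. complex_of_real ((1 - (norm z)\<^sup>2) / (norm (\<zeta> - z))\<^sup>2))"
    using AE_regular_fibre by eventually_elim (intro ballI poisson_integral_on_fibre)
  assume "holomorphic_measure D bD C \<mu>"
  then have hol: "mholomorphic_on (poisson_integral bD C \<mu>) D" by (simp add: holomorphic_measure_def)
  show "AE \<xi> in quotient_measure bD \<beta>. fibre_holomorphic bD \<xi> (\<mu>\<xi> \<xi>) \<and>
      (\<forall>\<zeta>\<in>\<xi>. absolutely_continuous (orbit_haar bD \<zeta>) (variation (borel_on bD) (\<mu>\<xi> \<xi>)))"
    using AE_regular_fibre
    by eventually_elim (intro conjI ballI fibre_holomorphic[OF hol] fibre_absolutely_continuous[OF hol])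
qed

end
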